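(* Let $K$ be an algebraically closed field, $Q$ an arbitrary finite quiver, $L\ge1$, $\Lambda=KQ/\langle\text{all paths of length }L+1\rangle$ with Jacobson radical $J$, and let $\mathbf A$ be the transpose of the adjacency matrix of $Q$. Let $\mathbb S=(\mathbb S_0,\dots,\mathbb S_L)$ be a realizable semisimple sequence, and set $\mathbb S_{L+1}=0$. (a) If $K$ has infinite transcendence degree over its prime field and $G$ is a generic module for $\mathbf{Rep}\,\mathbb S$, then for $0\le m\le L$, $$\underline{\dim}\,\mathrm{soc}(J^{L-m}G)=\sup\Bigl\{\sum_{L-j\le l\le L}\bigl(\underline{\dim}\,\mathbb S_l-\underline{\dim}\,\mathbb S_{l+1}\cdot\mathbf A\bigr)\Bigm|0\le j\le m\Bigr\},$$ where the supremum is with respect to the componentwise partial order on $\mathbb Z^{|Q_0|}$. The generic socle $\mathbb S^*_0$ of the modules in $\mathbf{Rep}\,\mathbb S$ arises as the special case $m=L$; that is (for arbitrary algebraically closed $K$), $\underline{\dim}\,\mathbb S^*_0$ equals the right-hand side for $m=L$. (b) Let $(\mathbb S^*_0,\dots,\mathbb S^*_L)$ be the generic socle layering of the modules in $\mathbf{Rep}\,\mathbb S$. Generically, the quotients $M/\mathrm{soc}\,M$ for $M$ in $\mathbf{Rep}\,\mathbb S$ have radical layering $\mathbb S'=(\mathbb S_l/C_l)_{0\le l\le L-1}$ (extended by a last entry $0$), with the semisimple modules $C_l\subseteq \mathbb S_l$ defined in the context. Moreover, the generic socle layering of the modules in $\mathbf{Rep}\,\mathbb S'$ is $(\mathbb S^*_1,\dots,\mathbb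 S^*_L,0)$. (Hence the higher entries of the generic socle layering are obtained recursively from these facts together with (a).)
   Context: Modules are finitely generated left modules; isomorphic semisimple modules are identified (hence identified with their dimension vectors, which are row vectors in $\mathbb N_0^{|Q_0|}$), and the set of semisimple modules is a lattice under the componentwise order of dimension vectors, with $\inf$ and $\sup$ taken componentwise. The adjacency matrix $\mathbf B$ of $Q$ has $\mathbf B_{ij}$ = number of arrows $e_i\to e_j$; thus $\mathbf A_{ij}$ is the number of arrows $e_j\to e_i$. Products of paths are read from right to left. A semisimple sequence is a sequence $\mathbb S=(\mathbb S_0,\dots,\mathbb S_L)$ of semisimple modules, with $\underline{\dim}\,\mathbb S=\sum_l\underline{\dim}\,\mathbb S_l$. The radical layering of $M$ is $\mathbb S(M)=(J^lM/J^{l+1}M)_{0\le l\le L}$; the socle layering is $\mathbb S^*(M)=(\mathrm{soc}_lM/\mathrm{soc}_{l-1}M)_{0\le l\le L}$, $\mathrm{soc}_lM=\mathrm{ann}_M(J^{l+1})$, $\mathrm{soc}_{-1}M=0$. $\mathbb S$ is realizable if $\mathbb S=\mathbb S(M)$ for some $M$. For $\mathbf d=\underline{\dim}\,\mathbb S$, $\mathbf{Rep}_{\mathbf d}(\Lambda)$ is the affine variety of families of matrices $(x_\alpha)_{\alpha\in Q_1}$ defining $\Lambda$-modules $M_x$ with dimension vector $\mathbf d$, and $\mathbf{Rep}\,\mathbb S$ is its subvariety of points $x$ with $\mathbb S(M_x)=\mathbb S$ (known to be irreducible). A property holds generically for the modules in an irreducible subvariety if it holds on a dense open subset; the socle layering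 is generically constant, and its constant value is the generic socle layering (with entry $\mathbb S_0^*$ the generic socle). Generic module. Let $K_0$ be the prime field of $K$ and $\overline{K_0}$ its algebraic closure in $K$; assume $K$ has infinite transcendence degree over $K_0$. Each $\phi\in\mathrm{Gal}(K{:}\overline{K_0})$ acts on $KQ$ through coefficients, induces a ring automorphism of $\Lambda$, and hence, by twisting, a Morita self-equivalence of $\Lambda$-mod. A module property is $\mathrm{Gal}(K{:}\overline{K_0})$-stable if preserved by all these self-equivalences. A generic module for $\mathbf{Rep}\,\mathbb S$ is a module in $\mathbf{Rep}\,\mathbb S$ having all $\mathrm{Gal}(K{:}\overline{K_0})$-stable generic properties of the modules in $\mathbf{Rep}\,\mathbb S$. Known explicit description: let $P=\bigoplus_{1\le r\le t}\Lambda z_r$ be a projective cover of $\mathbb S_0$ with $z_r=e(r)z_r$, $e(r)\in Q_0$, $\Lambda z_r\cong\Lambda e(r)$. A skeleton with layering $\mathbb S$ is a set $\sigma$ of nonzero elements $pz_r$ ($p$ a path of length $\le L$ starting in $e(r)$), closed under initial subpaths, such that for each $l$ and $i$ the number of length-$l$ elements ending in $e_i$ is the multiplicity of $S_i$ in $\mathbb S_l$. A $\sigma$-critical path is a nonzero $\mathbf q=qz_s\notin\sigma$ all of whose proper initial subpaths lie in $\sigma$; $\sigma(\mathbf q)$ is the set of elements of $\sigma$ at least as long as $\mathbf q$ and ending in the same vertex. For any skeleton $\sigma$ with layering $\mathbb S$, the generic modules for $\mathbf{Rep}\,\mathbb S$ are, up to $\mathrm{Gal}(K{:}\overline{K_0})$-induced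 self-equivalences, the modules $P/\sum_{\mathbf q\ \sigma\text{-critical}}\Lambda\bigl(\mathbf q-\sum_{\mathbf p\in\sigma(\mathbf q)}x_{\mathbf q,\mathbf p}\mathbf p\bigr)$ with scalars $x_{\mathbf q,\mathbf p}$ algebraically independent over $K_0$. The modules $C_l$. For a semisimple module $T$ let $E_1(T)$ be the semisimple module with $\underline{\dim}\,E_1(T)=\underline{\dim}\,T\cdot\mathbf A$. Define semisimple modules $\mathbb S'_l\subseteq\mathbb S_l$ and $D_l$ recursively by $\mathbb S'_L=D_L=0$, and for $1\le j\le L$: $\mathbb S'_{L-j}=\inf\bigl(\mathbb S_{L-j},\,E_1(\mathbb S_{L-j+1})\oplus D_{L-j+1}\bigr)$, with $D_{L-j}$ determined by $\mathbb S'_{L-j}\oplus D_{L-j}=E_1(\mathbb S_{L-j+1})\oplus D_{L-j+1}$. Then $C_l$ is a direct complement of $\mathbb S'_l$ in $\mathbb S_l$, i.e. $\underline{\dim}\,C_l=\underline{\dim}\,\mathbb S_l-\underline{\dim}\,\mathbb S'_l$. (Equivalently, $C_l$ is the maximal semisimple direct summand of $J^lG$ for a generic module $G$ for $\mathbf{Rep}\,\mathbb S$. The entries $\mathbb S'_l$ of this recursion are not to be confused with the sequence $\mathbb S'$ in (b).) *)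

theory Defs
  imports
    "HOL-Library.Function_Algebras"
    "HOL-Library.Poly_Mapping"
    "HOL-Computational_Algebra.Polynomial"
    "HOL-Algebra.QuotRing"
    "HOL-Algebra.Ideal_Product"
    "HOL-Analysis.Abstract_Topology"
    "Graph_Theory.Arc_Walk"
begin

section \<open>Truncated path algebras\<close>

text \<open>
  A finite quiver is a \<^locale>\<open>fin_digraph\<close> (loops and multiple arrows allowed). A path is a pair
  \<open>(u, p)\<close> of its starting vertex and its list of arrows in the order of traversal; the
  starting vertex is needed to distinguish the trivial paths \<open>(u, [])\<close>.
\<close>

type_synonym ('v, 'e) path = "'v \<times> 'e list"

definition paths :: "('v, 'e) pre_digraph \<Rightarrow> ('v, 'e) path set" where
  "paths Q = {(u, p). \<exists>v. pre_digraph.awalk Q u p v}"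

definition path_elt :: "('v, 'e) path \<Rightarrow> ('v, 'e) path \<Rightarrow> 'k::field" where
  "path_elt w = (\<lambda>w'. if w' = w then 1 else 0)"

text \<open>
  Products are read from right to left: in \<open>f \<cdot> g\<close> the paths of \<open>g\<close> are traversed first.
\<close>

definition path_algebra :: "('v, 'e) pre_digraph \<Rightarrow> (('v, 'e) path \<Rightarrow> 'k::field) ring" where
  "path_algebra Q =
     \<lparr>carrier = {f. finite {w. f w \<noteq> 0} \<and> {w. f w \<noteq> 0} \<subseteq> paths Q},
      mult = (\<lambda>f g (u, p). \<Sum>n\<le>length p.
                f (pre_digraph.awlast Q u (take n p), drop n p) * g (u, take n p)),
      one = (\<lambda>(u, p). if u \<in> verts Q \<and> p = [] then 1 else 0),
      zero = (\<lambda>_. 0),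
      add = (\<lambda>f g w. f w + g w)\<rparr>"

definition trunc_ideal :: "('v, 'e) pre_digraph \<Rightarrow> nat \<Rightarrow> (('v, 'e) path \<Rightarrow> 'k::field) set" where
  "trunc_ideal Q L =
     Idl\<^bsub>path_algebra Q\<^esub> {path_elt w | w. w \<in> paths Q \<and> length (snd w) = L + 1}"

definition trunc_algebra ::
    "('v, 'e) pre_digraph \<Rightarrow> nat \<Rightarrow> (('v, 'e) path \<Rightarrow> 'k::field) set ring" where
  "trunc_algebra Q L = path_algebra Q Quot trunc_ideal Q L"

definition left_ideal :: "'a ring \<Rightarrow> 'a set \<Rightarrow> bool" where
  "left_ideal R I \<longleftrightarrow>
     additive_subgroup I R \<and> (\<forall>a\<in>carrier R. \<forall>x\<in>I. a \<otimes>\<^bsub>R\<^esub> x \<in> I)"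

definition maximal_left_ideal :: "'a ring \<Rightarrow> 'a set \<Rightarrow> bool" where
  "maximal_left_ideal R I \<longleftrightarrow>
     left_ideal R I \<and> I \<noteq> carrier R \<and>
     (\<forall>I'. left_ideal R I' \<and> I \<subseteq> I' \<longrightarrow> I' = I \<or> I' = carrier R)"

definition jacobson_radical :: "'a ring \<Rightarrow> 'a set" where
  "jacobson_radical R = carrier R \<inter> \<Inter>{I. maximal_left_ideal R I}"

primrec jacobson_power :: "'a ring \<Rightarrow> nat \<Rightarrow> 'a set" where
  "jacobson_power R 0 = carrier R"
| "jacobson_power R (Suc l) = ideal_prod R (jacobson_radical R) (jacobson_power R l)"


section \<open>Representations and their layerings\<close>

text \<open>
  Dimension vectors are functions on vertices vanishing outside \<^term>\<open>verts Q\<close>. The underlying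
  space of a module of dimension vector \<open>d\<close> is \<open>K\<^sup>d\<close>, with coordinates \<open>(i, r)\<close> for vertices
  \<open>i\<close> and \<open>r < d i\<close>; a family of matrices is a point \<open>x\<close> with coordinates
  \<open>(\<alpha>, r, c)\<close>, the entry of \<open>x\<^sub>\<alpha>\<close> in row \<open>r\<close> and column \<open>c\<close>. Coordinates outside the
  respective range are \<open>0\<close>.
\<close>

definition dim_vectors :: "('v, 'e) pre_digraph \<Rightarrow> ('v \<Rightarrow> nat) set" where
  "dim_vectors Q = {d. \<forall>i. i \<notin> verts Q \<longrightarrow> d i = 0}"

definition kspace :: "('v \<Rightarrow> nat) \<Rightarrow> ('v \<times> nat \<Rightarrow> 'k::field) set" where
  "kspace d = {m. \<forall>i r. d i \<le> r \<longrightarrow> m (i, r) = 0}"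

definition vscale :: "'k::field \<Rightarrow> ('b \<Rightarrow> 'k) \<Rightarrow> 'b \<Rightarrow> 'k" where
  "vscale c m = (\<lambda>z. c * m z)"

interpretation fvs: vector_space vscale
  by standard (auto simp: vscale_def fun_eq_iff algebra_simps)

type_synonym ('e, 'k) point = "'e \<times> nat \<times> nat \<Rightarrow> 'k"

definition rep_coords :: "('v, 'e) pre_digraph \<Rightarrow> ('v \<Rightarrow> nat) \<Rightarrow> ('e \<times> nat \<times> nat) set" where
  "rep_coords Q d = {(\<alpha>, r, c). \<alpha> \<in> arcs Q \<and> r < d (head Q \<alpha>) \<and> c < d (tail Q \<alpha>)}"

definition vertex_act :: "'v \<Rightarrow> ('v \<times> nat \<Rightarrow> 'k::field) \<Rightarrow> ('v \<times> nat \<Rightarrow> 'k)" where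
  "vertex_act i m = (\<lambda>(j, r). if j = i then m (j, r) else 0)"

definition arrow_act :: "('v, 'e) pre_digraph \<Rightarrow> ('v \<Rightarrow> nat) \<Rightarrow> ('e, 'k::field) point \<Rightarrow>
    'e \<Rightarrow> ('v \<times> nat \<Rightarrow> 'k) \<Rightarrow> ('v \<times> nat \<Rightarrow> 'k)" where
  "arrow_act Q d x \<alpha> m = (\<lambda>(j, r). if j = head Q \<alpha> \<and> r < d j
     then \<Sum>c<d (tail Q \<alpha>). x (\<alpha>, r, c) * m (tail Q \<alpha>, c) else 0)"

definition path_act :: "('v, 'e) pre_digraph \<Rightarrow> ('v \<Rightarrow> nat) \<Rightarrow> ('e, 'k::field) point \<Rightarrow>
    ('v, 'e) path \<Rightarrow> ('v \<times> nat \<Rightarrow> 'k) \<Rightarrow> ('v \<times> nat \<Rightarrow> 'k)" where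
  "path_act Q d x = (\<lambda>(u, p) m. fold (arrow_act Q d x) p (vertex_act u m))"

definition KQ_act :: "('v, 'e) pre_digraph \<Rightarrow> ('v \<Rightarrow> nat) \<Rightarrow> ('e, 'k::field) point \<Rightarrow>
    (('v, 'e) path \<Rightarrow> 'k) \<Rightarrow> ('v \<times> nat \<Rightarrow> 'k) \<Rightarrow> ('v \<times> nat \<Rightarrow> 'k)" where
  "KQ_act Q d x a m = (\<Sum>w\<in>{w. a w \<noteq> 0}. vscale (a w) (path_act Q d x w m))"

text \<open>\<open>Rep\<^sub>d(\<Lambda>)\<close>: the points for which the \<open>KQ\<close>-action on \<open>K\<^sup>d\<close> factors through \<open>\<Lambda>\<close>.\<close>

definition rep_variety ::
    "('v, 'e) pre_digraph \<Rightarrow> nat \<Rightarrow> ('v \<Rightarrow> nat) \<Rightarrow> ('e, 'k::field) point set" where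
  "rep_variety Q L d =
     {x. (\<forall>z. z \<notin> rep_coords Q d \<longrightarrow> x z = 0) \<and>
         (\<forall>a\<in>trunc_ideal Q L. \<forall>m\<in>kspace d. KQ_act Q d x a m = 0)}"

text \<open>
  The action of \<open>\<Lambda>\<close> on \<open>M\<^sub>x\<close>. An element \<open>\<lambda>\<close> of \<open>\<Lambda>\<close> is a coset; for
  \<open>x\<close> in \<open>Rep\<^sub>d(\<Lambda>)\<close> all its representatives act in the same way on \<open>K\<^sup>d\<close>.
\<close>

definition lact :: "('v, 'e) pre_digraph \<Rightarrow> ('v \<Rightarrow> nat) \<Rightarrow> ('e, 'k::field) point \<Rightarrow>
    (('v, 'e) path \<Rightarrow> 'k) set \<Rightarrow> ('v \<times> nat \<Rightarrow> 'k) \<Rightarrow> ('v \<times> nat \<Rightarrow> 'k)" where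
  "lact Q d x lam m = the_elem ((\<lambda>a. KQ_act Q d x a m) ` lam)"

text \<open>
  For \<open>J\<^sup>l M\<^sub>x\<close>, the \<open>K\<close>-span of the products is the additive subgroup they generate,
  since scalars can be absorbed into \<open>J\<^sup>l\<close>.
\<close>

definition rad_sub :: "('v, 'e) pre_digraph \<Rightarrow> nat \<Rightarrow> ('v \<Rightarrow> nat) \<Rightarrow> ('e, 'k::field) point \<Rightarrow>
    nat \<Rightarrow> ('v \<times> nat \<Rightarrow> 'k) set" where
  "rad_sub Q L d x l =
     fvs.span {lact Q d x lam m | lam m.
       lam \<in> jacobson_power (trunc_algebra Q L) l \<and> m \<in> kspace d}"

definition ann_sub :: "('v, 'e) pre_digraph \<Rightarrow> nat \<Rightarrow> ('v \<Rightarrow> nat) \<Rightarrow> ('e, 'k::field) point \<Rightarrow>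
    ('v \<times> nat \<Rightarrow> 'k) set \<Rightarrow> nat \<Rightarrow> ('v \<times> nat \<Rightarrow> 'k) set" where
  "ann_sub Q L d x N l =
     {n \<in> N. \<forall>lam\<in>jacobson_power (trunc_algebra Q L) l. lact Q d x lam n = 0}"

abbreviation socle :: "('v, 'e) pre_digraph \<Rightarrow> nat \<Rightarrow> ('v \<Rightarrow> nat) \<Rightarrow> ('e, 'k::field) point \<Rightarrow>
    ('v \<times> nat \<Rightarrow> 'k) set \<Rightarrow> ('v \<times> nat \<Rightarrow> 'k) set" where
  "socle Q L d x N \<equiv> ann_sub Q L d x N 1"

text \<open>The idempotent \<open>e\<^sub>i\<close> acts as \<^term>\<open>vertex_act i\<close>, so this is \<open>i \<mapsto> dim\<^sub>K (e\<^sub>i N)\<close>.\<close>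

definition dimvec :: "('v \<times> nat \<Rightarrow> 'k::field) set \<Rightarrow> 'v \<Rightarrow> nat" where
  "dimvec N i = fvs.dim (vertex_act i ` N)"

text \<open>
  Semisimple modules are identified with their dimension vectors, and a sequence
  \<open>(S\<^sub>0, \<dots>, S\<^sub>L)\<close> with the function vanishing beyond \<open>L\<close>. In the socle layering,
  \<open>soc\<^sub>l M\<close> is the annihilator of \<open>J\<^bsup>l+1\<^esup>\<close>; for \<open>l = 0\<close> the subtracted term is the
  annihilator of \<open>J\<^sup>0 = \<Lambda>\<close>, that is \<open>soc\<^bsub>-1\<^esub> M = 0\<close>.
\<close>

definition rad_layering :: "('v, 'e) pre_digraph \<Rightarrow> nat \<Rightarrow> ('v \<Rightarrow> nat) \<Rightarrow>
    ('e, 'k::field) point \<Rightarrow> nat \<Rightarrow> 'v \<Rightarrow> nat" where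
  "rad_layering Q L d x l i =
     dimvec (rad_sub Q L d x l) i - dimvec (rad_sub Q L d x (l + 1)) i"

definition soc_layering :: "('v, 'e) pre_digraph \<Rightarrow> nat \<Rightarrow> ('v \<Rightarrow> nat) \<Rightarrow>
    ('e, 'k::field) point \<Rightarrow> nat \<Rightarrow> 'v \<Rightarrow> nat" where
  "soc_layering Q L d x l i =
     dimvec (ann_sub Q L d x (kspace d) (l + 1)) i - dimvec (ann_sub Q L d x (kspace d) l) i"

definition semisimple_sequence :: "('v, 'e) pre_digraph \<Rightarrow> nat \<Rightarrow> (nat \<Rightarrow> 'v \<Rightarrow> nat) \<Rightarrow> bool" where
  "semisimple_sequence Q L S \<longleftrightarrow> (\<forall>l. S l \<in> dim_vectors Q) \<and> (\<forall>l>L. S l = (\<lambda>_. 0))"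

definition seq_dim :: "nat \<Rightarrow> (nat \<Rightarrow> 'v \<Rightarrow> nat) \<Rightarrow> 'v \<Rightarrow> nat" where
  "seq_dim L S i = (\<Sum>l\<le>L. S l i)"

definition realizable ::
    "'k::field itself \<Rightarrow> ('v, 'e) pre_digraph \<Rightarrow> nat \<Rightarrow> (nat \<Rightarrow> 'v \<Rightarrow> nat) \<Rightarrow> bool" where
  "realizable _ Q L S \<longleftrightarrow>
     (\<exists>d\<in>dim_vectors Q. \<exists>x\<in>rep_variety Q L d :: ('e, 'k) point set. rad_layering Q L d x = S)"

definition rep_layered ::
    "('v, 'e) pre_digraph \<Rightarrow> nat \<Rightarrow> (nat \<Rightarrow> 'v \<Rightarrow> nat) \<Rightarrow> ('e, 'k::field) point set" where
  "rep_layered Q L S =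
     {x \<in> rep_variety Q L (seq_dim L S). rad_layering Q L (seq_dim L S) x = S}"


section \<open>Homomorphisms and twists\<close>

text \<open>
  Homomorphisms from the twist of \<open>M\<^sub>x\<close> by a field automorphism \<open>\<phi>\<close> to \<open>M\<^sub>y\<close>. The automorphism
  acts on \<open>KQ\<close> through coefficients and on \<open>\<Lambda>\<close> by taking images of cosets; the twist is the
  additive group of \<open>M\<^sub>x\<close> on which \<open>\<lambda>\<close> acts as \<open>\<phi>(\<lambda>)\<close> does on \<open>M\<^sub>x\<close>.
\<close>

definition twisted_hom :: "('v, 'e) pre_digraph \<Rightarrow> nat \<Rightarrow> ('k::field \<Rightarrow> 'k) \<Rightarrow>
    ('v \<Rightarrow> nat) \<Rightarrow> ('e, 'k) point \<Rightarrow> ('v \<Rightarrow> nat) \<Rightarrow> ('e, 'k) point \<Rightarrow>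
    (('v \<times> nat \<Rightarrow> 'k) \<Rightarrow> ('v \<times> nat \<Rightarrow> 'k)) \<Rightarrow> bool" where
  "twisted_hom Q L \<phi> d x d' y f \<longleftrightarrow>
     (\<forall>m\<in>kspace d. f m \<in> kspace d') \<and>
     (\<forall>m\<in>kspace d. \<forall>n\<in>kspace d. f (m + n) = f m + f n) \<and>
     (\<forall>lam\<in>carrier (trunc_algebra Q L). \<forall>m\<in>kspace d.
        f (lact Q d x ((\<lambda>a. \<phi> \<circ> a) ` lam) m) = lact Q d' y lam (f m))"

abbreviation lam_hom :: "('v, 'e) pre_digraph \<Rightarrow> nat \<Rightarrow>
    ('v \<Rightarrow> nat) \<Rightarrow> ('e, 'k::field) point \<Rightarrow> ('v \<Rightarrow> nat) \<Rightarrow> ('e, 'k) point \<Rightarrow>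
    (('v \<times> nat \<Rightarrow> 'k) \<Rightarrow> ('v \<times> nat \<Rightarrow> 'k)) \<Rightarrow> bool" where
  "lam_hom Q L \<equiv> twisted_hom Q L id"

text \<open>
  \<open>M\<^sub>y\<close> is isomorphic to \<open>M\<^sub>x / N\<close>, expressed by an epimorphism with kernel \<open>N\<close>; every
  quotient of \<open>M\<^sub>x\<close> has such a model \<open>M\<^sub>y\<close>, unique up to isomorphism.
\<close>

definition is_quotient :: "('v, 'e) pre_digraph \<Rightarrow> nat \<Rightarrow> ('v \<Rightarrow> nat) \<Rightarrow> ('e, 'k::field) point \<Rightarrow>
    ('v \<times> nat \<Rightarrow> 'k) set \<Rightarrow> ('v \<Rightarrow> nat) \<Rightarrow> ('e, 'k) point \<Rightarrow> bool" where
  "is_quotient Q L d x N d' y \<longleftrightarrow>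
     (\<exists>f. lam_hom Q L d x d' y f \<and> f ` kspace d = kspace d' \<and> {m \<in> kspace d. f m = 0} = N)"

text \<open>\<open>M\<^sub>y\<close> is isomorphic to the twist of \<open>M\<^sub>x\<close> by \<open>\<phi>\<close>; for \<open>\<phi> = id\<close>, to \<open>M\<^sub>x\<close> itself.\<close>

definition twisted_iso :: "('v, 'e) pre_digraph \<Rightarrow> nat \<Rightarrow> ('k::field \<Rightarrow> 'k) \<Rightarrow>
    ('v \<Rightarrow> nat) \<Rightarrow> ('e, 'k) point \<Rightarrow> ('v \<Rightarrow> nat) \<Rightarrow> ('e, 'k) point \<Rightarrow> bool" where
  "twisted_iso Q L \<phi> d x d' y \<longleftrightarrow>
     (\<exists>f. twisted_hom Q L \<phi> d x d' y f \<and> bij_betw f (kspace d) (kspace d'))"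


section \<open>Zariski topology and genericity\<close>

text \<open>
  A polynomial in variables indexed by \<open>'c\<close> is a finitely supported function on monomials,
  that is, on finitely supported exponent functions.
\<close>

definition mpoly_eval :: "(('c \<Rightarrow>\<^sub>0 nat) \<Rightarrow>\<^sub>0 'k::field) \<Rightarrow> ('c \<Rightarrow> 'k) \<Rightarrow> 'k" where
  "mpoly_eval p x = (\<Sum>t\<in>Poly_Mapping.keys p. Poly_Mapping.lookup p t * (\<Prod>c\<in>Poly_Mapping.keys t. x c ^ Poly_Mapping.lookup t c))"

text \<open>
  The Zariski topology on the affine space with coordinates \<open>C\<close>, realized as the functions
  vanishing outside \<open>C\<close>, generated by the principal open sets.
\<close>

definition zariski :: "'c set \<Rightarrow> ('c \<Rightarrow> 'k::field) topology" where
  "zariski C = topology_generated_by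
     (range (\<lambda>p. {x. (\<forall>c. c \<notin> C \<longrightarrow> x c = 0) \<and> mpoly_eval p x \<noteq> 0}))"

definition rep_layered_top ::
    "('v, 'e) pre_digraph \<Rightarrow> nat \<Rightarrow> (nat \<Rightarrow> 'v \<Rightarrow> nat) \<Rightarrow> ('e, 'k::field) point topology" where
  "rep_layered_top Q L S =
     subtopology (zariski (rep_coords Q (seq_dim L S))) (rep_layered Q L S)"

definition generically :: "('v, 'e) pre_digraph \<Rightarrow> nat \<Rightarrow> (nat \<Rightarrow> 'v \<Rightarrow> nat) \<Rightarrow>
    (('e, 'k::field) point \<Rightarrow> bool) \<Rightarrow> bool" where
  "generically Q L S P \<longleftrightarrow>
     (\<exists>U. openin (rep_layered_top Q L S) U \<and>
          rep_layered_top Q L S closure_of U = rep_layered Q L S \<and> (\<forall>x\<in>U. P x))"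

definition generic_soc_layering ::
    "'k::field itself \<Rightarrow> ('v, 'e) pre_digraph \<Rightarrow> nat \<Rightarrow> (nat \<Rightarrow> 'v \<Rightarrow> nat) \<Rightarrow>
     (nat \<Rightarrow> 'v \<Rightarrow> nat) \<Rightarrow> bool" where
  "generic_soc_layering _ Q L S T \<longleftrightarrow>
     generically Q L S (\<lambda>x :: ('e, 'k) point. soc_layering Q L (seq_dim L S) x = T)"


section \<open>Generic modules\<close>

definition is_subfield :: "'k::field set \<Rightarrow> bool" where
  "is_subfield F \<longleftrightarrow> 0 \<in> F \<and> 1 \<in> F \<and>
     (\<forall>a\<in>F. \<forall>b\<in>F. a + b \<in> F \<and> a - b \<in> F \<and> a * b \<in> F) \<and> (\<forall>a\<in>F. inverse a \<in> F)"

definition prime_field :: "'k::field set" where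
  "prime_field = \<Inter>{F. is_subfield F}"

definition algebraic_closure_in :: "'k::field set \<Rightarrow> 'k set" where
  "algebraic_closure_in F = {a. \<exists>p. p \<noteq> 0 \<and> (\<forall>n. coeff p n \<in> F) \<and> poly p a = 0}"

text \<open>Here the elements of \<open>B\<close> themselves serve as the names of the variables.\<close>

definition alg_independent :: "'k::field set \<Rightarrow> 'k set \<Rightarrow> bool" where
  "alg_independent F B \<longleftrightarrow>
     (\<forall>p. (\<forall>t\<in>Poly_Mapping.keys p. Poly_Mapping.keys t \<subseteq> B) \<and> (\<forall>t. Poly_Mapping.lookup p t \<in> F) \<and> mpoly_eval p (\<lambda>b. b) = 0
        \<longrightarrow> p = 0)"

definition infinite_trdeg_over :: "'k::field set \<Rightarrow> bool" where
  "infinite_trdeg_over F \<longleftrightarrow> (\<exists>B. infinite B \<and> alg_independent F B)"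

definition galois_group :: "'k::field set \<Rightarrow> ('k \<Rightarrow> 'k) set" where
  "galois_group F =
     {\<phi>. bij \<phi> \<and> (\<forall>a b. \<phi> (a + b) = \<phi> a + \<phi> b) \<and> (\<forall>a b. \<phi> (a * b) = \<phi> a * \<phi> b) \<and>
         (\<forall>c\<in>F. \<phi> c = c)}"

text \<open>
  A property \<open>P d x\<close> of all modules \<open>M\<^sub>x\<close>, where \<open>d\<close> is a dimension vector and
  \<open>x\<close> a point of \<open>Rep\<^sub>d(\<Lambda>)\<close>; it has to be invariant under isomorphism.
\<close>

definition stable_under :: "('v, 'e) pre_digraph \<Rightarrow> nat \<Rightarrow> ('k::field \<Rightarrow> 'k) \<Rightarrow>
    (('v \<Rightarrow> nat) \<Rightarrow> ('e, 'k) point \<Rightarrow> bool) \<Rightarrow> bool" where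
  "stable_under Q L \<phi> P \<longleftrightarrow>
     (\<forall>d\<in>dim_vectors Q. \<forall>d'\<in>dim_vectors Q. \<forall>x\<in>rep_variety Q L d. \<forall>y\<in>rep_variety Q L d'.
        twisted_iso Q L \<phi> d x d' y \<and> P d x \<longrightarrow> P d' y)"

definition module_property :: "('v, 'e) pre_digraph \<Rightarrow> nat \<Rightarrow>
    (('v \<Rightarrow> nat) \<Rightarrow> ('e, 'k::field) point \<Rightarrow> bool) \<Rightarrow> bool" where
  "module_property Q L P \<longleftrightarrow> stable_under Q L id P"

definition galois_stable :: "('v, 'e) pre_digraph \<Rightarrow> nat \<Rightarrow>
    (('v \<Rightarrow> nat) \<Rightarrow> ('e, 'k::field) point \<Rightarrow> bool) \<Rightarrow> bool" where
  "galois_stable Q L P \<longleftrightarrow>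
     (\<forall>\<phi>\<in>galois_group (algebraic_closure_in prime_field). stable_under Q L \<phi> P)"

definition generic_module :: "('v, 'e) pre_digraph \<Rightarrow> nat \<Rightarrow> (nat \<Rightarrow> 'v \<Rightarrow> nat) \<Rightarrow>
    ('e, 'k::field) point \<Rightarrow> bool" where
  "generic_module Q L S x \<longleftrightarrow>
     x \<in> rep_layered Q L S \<and>
     (\<forall>P. module_property Q L P \<and> galois_stable Q L P \<and> generically Q L S (P (seq_dim L S))
        \<longrightarrow> P (seq_dim L S) x)"


section \<open>The combinatorial data\<close>

definition adjacency :: "('v, 'e) pre_digraph \<Rightarrow> 'v \<Rightarrow> 'v \<Rightarrow> nat" where
  "adjacency Q i j = card {\<alpha> \<in> arcs Q. tail Q \<alpha> = i \<and> head Q \<alpha> = j}"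

definition adjT :: "('v, 'e) pre_digraph \<Rightarrow> 'v \<Rightarrow> 'v \<Rightarrow> nat" where
  "adjT Q i j = adjacency Q j i"

definition E1 :: "('v, 'e) pre_digraph \<Rightarrow> ('v \<Rightarrow> nat) \<Rightarrow> 'v \<Rightarrow> nat" where
  "E1 Q T j = (\<Sum>i\<in>verts Q. T i * adjT Q i j)"

definition socle_sup :: "('v, 'e) pre_digraph \<Rightarrow> nat \<Rightarrow> (nat \<Rightarrow> 'v \<Rightarrow> nat) \<Rightarrow> nat \<Rightarrow> 'v \<Rightarrow> int" where
  "socle_sup Q L S m =
     Sup_fin ((\<lambda>j. \<lambda>i. \<Sum>l = L - j..L. int (S l i) - int (E1 Q (S (l + 1)) i)) ` {0..m})"

text \<open>
  The pair \<open>(S'\<^bsub>L-j\<^esub>, D\<^bsub>L-j\<^esub>)\<close>. The natural subtraction does not truncate, since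
  \<open>inf U V \<le> V\<close>.
\<close>

primrec SD_pair :: "('v, 'e) pre_digraph \<Rightarrow> nat \<Rightarrow> (nat \<Rightarrow> 'v \<Rightarrow> nat) \<Rightarrow> nat \<Rightarrow>
    ('v \<Rightarrow> nat) \<times> ('v \<Rightarrow> nat)" where
  "SD_pair Q L S 0 = (0, 0)"
| "SD_pair Q L S (Suc j) =
     (let V = E1 Q (S (L - j)) + snd (SD_pair Q L S j);
          S' = inf (S (L - Suc j)) V
      in (S', V - S'))"

definition C_mod :: "('v, 'e) pre_digraph \<Rightarrow> nat \<Rightarrow> (nat \<Rightarrow> 'v \<Rightarrow> nat) \<Rightarrow> nat \<Rightarrow> 'v \<Rightarrow> nat" where
  "C_mod Q L S l = S l - fst (SD_pair Q L S (L - l))"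

definition quot_seq :: "('v, 'e) pre_digraph \<Rightarrow> nat \<Rightarrow> (nat \<Rightarrow> 'v \<Rightarrow> nat) \<Rightarrow> nat \<Rightarrow> 'v \<Rightarrow> nat" where
  "quot_seq Q L S l = (if l < L then S l - C_mod Q L S l else 0)"

end

theory Submission
  imports Defs "Jordan_Normal_Form.Determinant"
begin

text \<open>
  Fix a basis of \<open>K\<^sup>d\<close> in which every basis vector carries a level, with \<open>S l i\<close> vectors of level \<open>l\<close> at the
  vertex \<open>i\<close>. A representation is adapted if each arrow maps a basis vector to a combination of vectors of
  strictly higher level. Adapted representations form a linear space, and \<open>Rep S\<close> meets this space in an open
  set (\<open>adapted_layered_open\<close>), because there the condition on the radical layering says that certain ranks
  are maximal. Conversely, a basis adapted to the radical filtration conjugates every point of \<open>Rep S\<close>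
  to an adapted one (\<open>adapted_form\<close>). Hence two points of \<open>Rep S\<close> can be joined by a polynomial curve, which makes
  \<open>Rep S\<close> irreducible (\<open>rep_layered_irreducible\<close>), and a property holds generically as soon as the nonvanishing
  of one polynomial function, which is not identically zero on \<open>Rep S\<close>, implies it. Curves are
  useful because over an infinite field finitely many nonzero polynomials in one variable have a common nonzero.

  For the socle of \<open>J\<^sup>lM\<close> at a vertex \<open>i\<close> one has to maximize the rank of the map from \<open>e\<^sub>iJ\<^sup>lM\<close> to the sum of the
  spaces at the ends of the arrows starting in \<open>i\<close>. Two bounds are available: this rank is at most the
  dimension of the target, which is counted by \<open>E\<^sub>1\<close>, and it grows by at most \<open>S l i\<close> when \<open>J\<^sup>l\<^sup>+\<^sup>1M\<close> is enlarged to
  \<open>J\<^sup>lM\<close>. Together they give the recursion for \<open>S'\<^sub>l\<close> as an upper bound (\<open>path_rank_le_matched\<close>). The bound is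
  attained: matching basis vectors with pairs (arrow, basis vector of higher level at its end) greedily,
  from the top level downwards, gives an adapted matrix of maximal rank, and a generic point of the line from it to
  an adapted point of \<open>Rep S\<close> lies in \<open>Rep S\<close> and still has maximal rank (\<open>greedy_point\<close>). Therefore the socle of
  \<open>J\<^sup>lM\<close> has generically the dimension vector of \<open>C\<^sub>l \<oplus> \<dots> \<oplus> C\<^sub>L\<close>; solving the recursion turns this into the supremum
  formula (\<open>socle_sup_C_mod\<close>). Since these dimensions are preserved by Galois twists, a generic module has them too.

  The dimension of the annihilator of \<open>J\<^sup>k\<close> is upper semicontinuous, so the socle layering is generically
  constant. For the quotient by the socle, the adapted basis is chosen such that its last vectors span the
  socle. Then passing to \<open>M / soc M\<close> means forgetting coordinates, and the radical layering of the quotient can be read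
  off. Forgetting coordinates shifts the socle layering, so it remains to find a point that is generic in
  \<open>Rep S\<close> and whose quotient is generic in \<open>Rep S'\<close> (\<open>generic_soc_layering_quotient\<close>). It lies on the line from an
  adapted point of \<open>Rep S\<close> in this form to an adapted point of \<open>Rep S'\<close>, extended by zero: the first condition
  holds generically near one end, the second near the other.
\<close>

section \<open>Linear algebra in function spaces\<close>

lemma vscale_apply: "vscale c m z = c * m z"
  by (simp add: vscale_def)

lemma sum_fun_apply: "(\<Sum>i\<in>I. f i) z = (\<Sum>i\<in>I. f i z)" for f :: "'i \<Rightarrow> 'b \<Rightarrow> 'k::field"
  by (induction I rule: infinite_finite_induct) auto

text \<open>Families instead of sets, because the members of a family that depends on a parameter may collide for
  some values of the parameter.\<close>

definition indep_on :: "'i set \<Rightarrow> ('i \<Rightarrow> 'b \<Rightarrow> 'k::field) \<Rightarrow> bool" where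
  "indep_on I v \<longleftrightarrow> (\<forall>c. (\<Sum>i\<in>I. vscale (c i) (v i)) = 0 \<longrightarrow> (\<forall>i\<in>I. c i = 0))"

text \<open>The ambient spaces of functions are infinite-dimensional, so dimensions and their monotonicity are
  meaningful only inside the span of a finite set.\<close>

definition fin_dim :: "('b \<Rightarrow> 'k::field) set \<Rightarrow> bool" where
  "fin_dim V \<longleftrightarrow> (\<exists>B. finite B \<and> V \<subseteq> fvs.span B)"

lemma indep_onD: "indep_on I v \<Longrightarrow> (\<Sum>i\<in>I. vscale (c i) (v i)) = 0 \<Longrightarrow> i \<in> I \<Longrightarrow> c i = 0"
  unfolding indep_on_def by blast

lemma indep_on_mono:
  assumes "indep_on I v" "J \<subseteq> I" "finite I"
  shows "indep_on J v"
  unfolding indep_on_def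
proof (intro allI impI ballI)
  fix c j assume s: "(\<Sum>i\<in>J. vscale (c i) (v i)) = 0" and j: "j \<in> J"
  let ?c = "\<lambda>i. if i \<in> J then c i else 0"
  have "(\<Sum>i\<in>I. vscale (?c i) (v i)) = (\<Sum>i\<in>J. vscale (?c i) (v i))"
    by (rule sum.mono_neutral_right) (use assms in auto)
  also have "\<dots> = 0" using s by (simp cong: sum.cong)
  finally have "?c j = 0" using indep_onD[OF assms(1), of ?c j] j assms(2) by blast
  then show "c j = 0" using j by simp
qed

lemma indep_on_inj_on:
  assumes "indep_on I v" "finite I"
  shows "inj_on v I"
proof (rule inj_onI, rule ccontr)
  fix a b assume ab: "a \<in> I" "b \<in> I" "v a = v b" "a \<noteq> b"
  let ?c = "\<lambda>i. if i = a then 1 else if i = b then -1 else (0::'c)"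
  have "(\<Sum>i\<in>I. vscale (?c i) (v i)) = (\<Sum>i\<in>{a,b}. vscale (?c i) (v i))"
    by (rule sum.mono_neutral_right) (use assms ab in auto)
  also have "\<dots> = 0" using ab by (auto simp: fun_eq_iff vscale_apply)
  finally have "?c a = 0" using indep_onD[OF assms(1), of ?c a] ab(1) by blast
  then show False by simp
qed

lemma independent_indep_on:
  assumes "finite B"
  shows "fvs.independent B \<longleftrightarrow> indep_on B (\<lambda>b. b)"
proof
  assume "fvs.independent B"
  then show "indep_on B (\<lambda>b. b)"
    unfolding indep_on_def fvs.independent_explicit_finite_subsets using assms by auto
next
  assume "indep_on B (\<lambda>b. b)"
  then show "fvs.independent B"
    by (intro fvs.independent_if_scalars_zero[OF assms]) (auto dest: indep_onD)
qed

lemma indep_on_image: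
  assumes "finite I"
  shows "indep_on I v \<longleftrightarrow> inj_on v I \<and> fvs.independent (v ` I)"
proof
  assume i: "indep_on I v"
  have inj: "inj_on v I" using indep_on_inj_on[OF i assms] .
  have "indep_on (v ` I) (\<lambda>b. b)" unfolding indep_on_def
  proof (intro allI impI ballI)
    fix c y assume "(\<Sum>x\<in>v ` I. vscale (c x) x) = 0" and y: "y \<in> v ` I"
    then have "(\<Sum>i\<in>I. vscale (c (v i)) (v i)) = 0"
      by (simp add: sum.reindex[OF inj])
    then show "c y = 0" using indep_onD[OF i, of "\<lambda>i. c (v i)"] y by blast
  qed
  then show "inj_on v I \<and> fvs.independent (v ` I)"
    using inj independent_indep_on[of "v ` I"] assms by auto
next
  assume a: "inj_on v I \<and> fvs.independent (v ` I)"
  then have b: "indep_on (v ` I) (\<lambda>b. b)" using independent_indep_on[of "v ` I"] assms by auto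
  show "indep_on I v" unfolding indep_on_def
  proof (intro allI impI ballI)
    fix c i assume s: "(\<Sum>i\<in>I. vscale (c i) (v i)) = 0" and i: "i \<in> I"
    let ?c = "\<lambda>x. c (the_inv_into I v x)"
    have "(\<Sum>x\<in>v ` I. vscale (?c x) x) = (\<Sum>i\<in>I. vscale (?c (v i)) (v i))"
      using a by (simp add: sum.reindex)
    also have "\<dots> = 0"
      unfolding s[symmetric] using a by (intro sum.cong) (auto simp: the_inv_into_f_f)
    finally have "?c (v i) = 0" using indep_onD[OF b, of ?c "v i"] i by blast
    then show "c i = 0" using a i by (simp add: the_inv_into_f_f)
  qed
qed

lemma span_family_iff:
  assumes "finite I"
  shows "m \<in> fvs.span (v ` I) \<longleftrightarrow> (\<exists>c. m = (\<Sum>i\<in>I. vscale (c i) (v i)))"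
proof
  assume "m \<in> fvs.span (v ` I)"
  then show "\<exists>c. m = (\<Sum>i\<in>I. vscale (c i) (v i))"
  proof (induction rule: fvs.span_induct_alt)
    case base
    show ?case by (rule exI[of _ "\<lambda>_. 0"]) simp
  next
    case (step a x y)
    then obtain i c where i: "i \<in> I" "x = v i" and c: "y = (\<Sum>i\<in>I. vscale (c i) (v i))" by blast
    show ?case
    proof (rule exI[of _ "\<lambda>j. c j + (if j = i then a else 0)"])
      show "vscale a x + y = (\<Sum>j\<in>I. vscale (c j + (if j = i then a else 0)) (v j))"
        unfolding fvs.scale_left_distrib sum.distrib c[symmetric] i
        by (simp add: if_distrib[of "\<lambda>t. vscale t _"] sum.delta[OF assms] i(1) add.commute cong: if_cong)
    qed
  qed
next
  assume "\<exists>c. m = (\<Sum>i\<in>I. vscale (c i) (v i))"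
  then show "m \<in> fvs.span (v ` I)"
    by (auto intro!: fvs.span_sum fvs.span_scale intro: fvs.span_base)
qed

lemma fin_dim_mono: "fin_dim W \<Longrightarrow> V \<subseteq> W \<Longrightarrow> fin_dim V"
  unfolding fin_dim_def by blast

lemma fin_dim_span: "finite B \<Longrightarrow> fin_dim (fvs.span B)"
  unfolding fin_dim_def by blast

lemma fin_dim_independent_finite:
  assumes "fin_dim V" "fvs.independent B" "B \<subseteq> V"
  shows "finite B"
  using assms fvs.independent_span_bound unfolding fin_dim_def by blast

lemma fin_dim_basis:
  assumes "fin_dim V"
  obtains B where "B \<subseteq> V" "finite B" "fvs.independent B" "V \<subseteq> fvs.span B" "card B = fvs.dim V"
  using fvs.basis_exists[of V] fin_dim_independent_finite[OF assms] by metis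

lemma fin_dim_extend_basis:
  assumes "fin_dim V" "B \<subseteq> V" "fvs.independent B"
  obtains B' where "B \<subseteq> B'" "B' \<subseteq> V" "finite B'" "fvs.independent B'" "V \<subseteq> fvs.span B'"
    "card B' = fvs.dim V"
proof -
  obtain B' where B': "B \<subseteq> B'" "B' \<subseteq> V" "fvs.independent B'" "V \<subseteq> fvs.span B'"
    using fvs.maximal_independent_subset_extend[OF assms(2,3)] by metis
  then have "finite B'" using fin_dim_independent_finite[OF assms(1)] by blast
  then show thesis using that B' fvs.basis_card_eq_dim by metis
qed

lemma dim_mono:
  assumes "fin_dim W" "V \<subseteq> W"
  shows "fvs.dim V \<le> fvs.dim W"
proof -
  obtain B where "finite B" "W \<subseteq> fvs.span B" "card B = fvs.dim W"
    using fin_dim_basis[OF assms(1)] by metis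
  then show ?thesis using fvs.dim_le_card[of V B] assms(2) by auto
qed

lemma subspace_eq_of_dim_le:
  assumes "fin_dim W" "fvs.subspace V" "V \<subseteq> W" "fvs.dim W \<le> fvs.dim V"
  shows "V = W"
proof (rule antisym)
  obtain B where B: "B \<subseteq> V" "finite B" "fvs.independent B" "V \<subseteq> fvs.span B" "card B = fvs.dim V"
    using fin_dim_basis[OF fin_dim_mono[OF assms(1,3)]] .
  obtain B' where B': "B \<subseteq> B'" "B' \<subseteq> W" "finite B'" "fvs.independent B'" "W \<subseteq> fvs.span B'"
    "card B' = fvs.dim W"
    using fin_dim_extend_basis[OF assms(1), of B] B assms(3) by blast
  have "card B' \<le> card B" using B B' assms by simp
  then have "B' = B" using B' card_seteq by blast
  then show "W \<subseteq> V" using B' B(1) fvs.span_minimal[OF B(1) assms(2)] by blast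
qed fact

lemma indep_on_card_le:
  assumes "indep_on I v" "finite I" "v ` I \<subseteq> V" "fin_dim V"
  shows "card I \<le> fvs.dim V"
proof -
  have i: "inj_on v I" "fvs.independent (v ` I)" using indep_on_image[OF assms(2)] assms(1) by auto
  obtain B where B: "v ` I \<subseteq> B" "finite B" "card B = fvs.dim V"
    by (rule fin_dim_extend_basis[OF assms(4,3) i(2)])
  show ?thesis using card_mono[OF B(2,1)] B(3) card_image[OF i(1)] by simp
qed

lemma dim_eq_card_family:
  assumes "indep_on I v" "finite I" "v ` I \<subseteq> V" "V \<subseteq> fvs.span (v ` I)"
  shows "fvs.dim V = card I"
proof -
  have "inj_on v I" "fvs.independent (v ` I)" using indep_on_image[OF assms(2)] assms(1) by auto
  then show ?thesis using fvs.dim_unique[OF assms(3,4)] by (simp add: card_image)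
qed

lemma indep_subfamily:
  assumes "finite I"
  obtains J where "J \<subseteq> I" "indep_on J v" "card J = fvs.dim (fvs.span (v ` I))"
proof -
  obtain B where B: "B \<subseteq> v ` I" "fvs.independent B" "v ` I \<subseteq> fvs.span B" "card B = fvs.dim (v ` I)"
    using fvs.basis_exists by blast
  obtain J where J: "J \<subseteq> I" "inj_on v J" "v ` J = B"
    using B(1) unfolding subset_image_inj by blast
  have "indep_on J v"
    unfolding indep_on_image[OF finite_subset[OF J(1) assms]] J(3) using J(2) B(2) by blast
  moreover have "card J = fvs.dim (fvs.span (v ` I))"
    unfolding fvs.dim_span B(4)[symmetric] J(3)[symmetric] by (rule card_image[OF J(2), symmetric])
  ultimately show thesis using that J(1) by blast
qed

text \<open>A field automorphism, and maps that are linear up to such a twist. Isomorphisms between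
  Galois twists are of this kind, so rank-nullity is needed in this generality.\<close>

definition field_auto :: "('k::field \<Rightarrow> 'k) \<Rightarrow> bool" where
  "field_auto \<theta> \<longleftrightarrow> bij \<theta> \<and> (\<forall>a b. \<theta> (a + b) = \<theta> a + \<theta> b) \<and> (\<forall>a b. \<theta> (a * b) = \<theta> a * \<theta> b)"

definition semilinear_on ::
    "('k::field \<Rightarrow> 'k) \<Rightarrow> ('b \<Rightarrow> 'k) set \<Rightarrow> (('b \<Rightarrow> 'k) \<Rightarrow> ('c \<Rightarrow> 'k)) \<Rightarrow> bool" where
  "semilinear_on \<theta> V f \<longleftrightarrow> field_auto \<theta> \<and>
     (\<forall>m\<in>V. \<forall>n\<in>V. f (m + n) = f m + f n) \<and> (\<forall>c. \<forall>m\<in>V. f (vscale c m) = vscale (\<theta> c) (f m))"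

lemma field_auto_id: "field_auto id" "field_auto (\<lambda>x. x)"
  by (auto simp: field_auto_def bij_def inj_def)

lemma field_auto_0: "field_auto \<theta> \<Longrightarrow> \<theta> 0 = 0"
  unfolding field_auto_def by (metis add_0_right add_cancel_right_right)

lemma field_auto_eq_0: "field_auto \<theta> \<Longrightarrow> \<theta> a = 0 \<longleftrightarrow> a = 0"
  using field_auto_0 unfolding field_auto_def bij_def by (metis injD)

lemma semilinear_on_0: "semilinear_on \<theta> V f \<Longrightarrow> fvs.subspace V \<Longrightarrow> f 0 = 0"
  unfolding semilinear_on_def using fvs.subspace_0 by (metis add_0_right add_cancel_right_right)

lemma semilinear_on_mono: "semilinear_on \<theta> V f \<Longrightarrow> W \<subseteq> V \<Longrightarrow> semilinear_on \<theta> W f"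
  unfolding semilinear_on_def by blast

lemma semilinear_on_add: "semilinear_on \<theta> V f \<Longrightarrow> m \<in> V \<Longrightarrow> n \<in> V \<Longrightarrow> f (m + n) = f m + f n"
  unfolding semilinear_on_def by blast

lemma semilinear_on_scale: "semilinear_on \<theta> V f \<Longrightarrow> m \<in> V \<Longrightarrow> f (vscale c m) = vscale (\<theta> c) (f m)"
  unfolding semilinear_on_def by blast

lemma semilinear_on_sum:
  assumes "semilinear_on \<theta> V f" "fvs.subspace V" "\<And>i. i \<in> I \<Longrightarrow> v i \<in> V"
  shows "f (\<Sum>i\<in>I. vscale (c i) (v i)) = (\<Sum>i\<in>I. vscale (\<theta> (c i)) (f (v i)))"
  using assms(3)
proof (induction I rule: infinite_finite_induct)
  case (insert x F)
  have 1: "(\<Sum>i\<in>F. vscale (c i) (v i)) \<in> V"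
    using insert.prems assms(2) by (auto intro!: fvs.subspace_sum fvs.subspace_scale)
  have 2: "vscale (c x) (v x) \<in> V" "v x \<in> V"
    using insert.prems assms(2) by (auto intro!: fvs.subspace_scale)
  have "f (\<Sum>i\<in>insert x F. vscale (c i) (v i)) = f (vscale (c x) (v x)) + f (\<Sum>i\<in>F. vscale (c i) (v i))"
    unfolding sum.insert[OF insert.hyps] by (rule semilinear_on_add[OF assms(1) 2(1) 1])
  also have "\<dots> = (\<Sum>i\<in>insert x F. vscale (\<theta> (c i)) (f (v i)))"
    using semilinear_on_scale[OF assms(1) 2(2)] insert.IH insert.prems
    unfolding sum.insert[OF insert.hyps] by auto
  finally show ?case .
next
  case empty
  show ?case unfolding sum.empty by (rule semilinear_on_0[OF assms(1,2)])
next
  case (infinite I)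
  show ?case unfolding sum.infinite[OF infinite.hyps] by (rule semilinear_on_0[OF assms(1,2)])
qed

lemma semilinear_on_subspace_vimage:
  assumes "semilinear_on \<theta> V f" "fvs.subspace V" "fvs.subspace W"
  shows "fvs.subspace {m\<in>V. f m \<in> W}"
proof (rule fvs.subspaceI)
  show "0 \<in> {m\<in>V. f m \<in> W}"
    unfolding mem_Collect_eq semilinear_on_0[OF assms(1,2)]
    using assms(2,3) by (blast intro: fvs.subspace_0)
  show "x + y \<in> {m\<in>V. f m \<in> W}" if xy: "x \<in> {m\<in>V. f m \<in> W}" "y \<in> {m\<in>V. f m \<in> W}" for x y
    using xy fvs.subspace_add[OF assms(2)] fvs.subspace_add[OF assms(3)]
    unfolding mem_Collect_eq by (simp only: semilinear_on_add[OF assms(1)] simp_thms)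
  show "vscale c x \<in> {m\<in>V. f m \<in> W}" if x: "x \<in> {m\<in>V. f m \<in> W}" for x c
    using x fvs.subspace_scale[OF assms(2)] fvs.subspace_scale[OF assms(3)]
    unfolding mem_Collect_eq by (simp only: semilinear_on_scale[OF assms(1)] simp_thms)
qed

lemma semilinear_on_subspace_image:
  assumes "semilinear_on \<theta> V f" "fvs.subspace V"
  shows "fvs.subspace (f ` V)"
proof (rule fvs.subspaceI)
  show "0 \<in> f ` V"
    using imageI[OF fvs.subspace_0[OF assms(2)], of f] unfolding semilinear_on_0[OF assms] .
  show "x + y \<in> f ` V" if xy: "x \<in> f ` V" "y \<in> f ` V" for x y
  proof -
    obtain a b where ab: "a \<in> V" "b \<in> V" and x: "x = f a" and y: "y = f b" using xy by (elim imageE)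
    show ?thesis unfolding x y semilinear_on_add[OF assms(1) ab, symmetric]
      using fvs.subspace_add[OF assms(2) ab] by (rule imageI)
  qed
  show "vscale c x \<in> f ` V" if x: "x \<in> f ` V" for x c
  proof -
    have "bij \<theta>" using assms(1) by (auto simp: semilinear_on_def field_auto_def)
    then obtain c' where c': "\<theta> c' = c" by (metis bij_pointE)
    obtain a where a: "a \<in> V" "x = f a" using x by (elim imageE)
    show ?thesis unfolding a(2) c'[symmetric] semilinear_on_scale[OF assms(1) a(1), symmetric]
      using fvs.subspace_scale[OF assms(2) a(1)] by (rule imageI)
  qed
qed

lemma semilinear_on_span:
  assumes "semilinear_on \<theta> V f" "fvs.subspace V" "A \<subseteq> V"
  shows "f ` fvs.span A = fvs.span (f ` A)"
proof
  have AV: "fvs.span A \<subseteq> V" using fvs.span_minimal[OF assms(3,2)] .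
  have "fvs.span A \<subseteq> {m\<in>V. f m \<in> fvs.span (f ` A)}"
    using assms(3) fvs.span_superset[of "f ` A"]
    by (intro fvs.span_minimal semilinear_on_subspace_vimage[OF assms(1,2)] fvs.subspace_span) blast
  then show "f ` fvs.span A \<subseteq> fvs.span (f ` A)" by auto
  show "fvs.span (f ` A) \<subseteq> f ` fvs.span A"
    using fvs.span_superset[of A]
    by (intro fvs.span_minimal semilinear_on_subspace_image[OF semilinear_on_mono[OF assms(1) AV]]
        fvs.subspace_span) blast
qed

lemma rank_nullity:
  assumes "semilinear_on \<theta> V f" "fvs.subspace V" "fin_dim V"
  shows "fvs.dim V = fvs.dim {m\<in>V. f m = 0} + fvs.dim (f ` V)"
proof -
  let ?K = "{m\<in>V. f m = 0}"
  have \<theta>: "field_auto \<theta>" and bij: "bij \<theta>" using assms(1) by (auto simp: semilinear_on_def field_auto_def)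
  obtain B where B: "B \<subseteq> ?K" "finite B" "fvs.independent B" "?K \<subseteq> fvs.span B" "card B = fvs.dim ?K"
    by (rule fin_dim_basis[OF fin_dim_mono[OF assms(3)], of ?K]) blast+
  obtain B' where B': "B \<subseteq> B'" "B' \<subseteq> V" "finite B'" "fvs.independent B'" "V \<subseteq> fvs.span B'"
    "card B' = fvs.dim V"
  proof (rule fin_dim_extend_basis[OF assms(3)])
    show "B \<subseteq> V" using B(1) by blast
  qed (rule B(3))
  let ?D = "B' - B"
  have ind: "indep_on ?D f" unfolding indep_on_def
  proof (intro allI impI ballI)
    fix c d assume s: "(\<Sum>b\<in>?D. vscale (c b) (f b)) = 0" and d: "d \<in> ?D"
    have "\<exists>a. \<theta> a = c b" for b using bij by (metis bij_pointE)
    then obtain c' where c': "\<theta> (c' b) = c b" for b by metis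
    let ?m = "\<Sum>b\<in>?D. vscale (c' b) b"
    have "?m \<in> V" using B' assms(2) by (auto intro!: fvs.subspace_sum fvs.subspace_scale)
    moreover have "f ?m = 0"
    proof -
      have "f ?m = (\<Sum>b\<in>?D. vscale (\<theta> (c' b)) (f b))"
        by (rule semilinear_on_sum[OF assms(1,2)]) (use B' in blast)
      then show ?thesis unfolding c' s .
    qed
    ultimately have "?m \<in> fvs.span B" using B(4) by blast
    then have "?m \<in> fvs.span ((\<lambda>b. b) ` B)" by (simp only: image_ident)
    then obtain e where e: "?m = (\<Sum>b\<in>B. vscale (e b) b)"
      unfolding span_family_iff[OF B(2)] by blast
    let ?c = "\<lambda>b. if b \<in> B then - e b else c' b"
    have "(\<Sum>b\<in>B'. vscale (?c b) b) = (\<Sum>b\<in>?D. vscale (?c b) b) + (\<Sum>b\<in>B. vscale (?c b) b)"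
      by (rule sum.subset_diff) (use B' in auto)
    also have "(\<Sum>b\<in>?D. vscale (?c b) b) = ?m" by (intro sum.cong) auto
    also have "(\<Sum>b\<in>B. vscale (?c b) b) = - (\<Sum>b\<in>B. vscale (e b) b)"
      unfolding sum_negf[symmetric] by (intro sum.cong) (simp_all add: fvs.scale_minus_left)
    finally have "(\<Sum>b\<in>B'. vscale (?c b) b) = 0" unfolding e by (simp only: right_minus)
    then have "?c d = 0"
      by (rule indep_onD[OF independent_indep_on[OF B'(3), THEN iffD1, OF B'(4)]]) (use d in blast)
    then show "c d = 0" using d c'[of d] field_auto_0[OF \<theta>] by simp
  qed
  have "f ` V \<subseteq> fvs.span (f ` ?D)"
  proof -
    have "f ` V \<subseteq> fvs.span (f ` B')"
      unfolding semilinear_on_span[OF assms(1,2) B'(2), symmetric] using B'(5) by (rule image_mono)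
    also have "\<dots> \<subseteq> fvs.span (f ` ?D)"
    proof (rule fvs.span_minimal)
      show "f ` B' \<subseteq> fvs.span (f ` ?D)"
      proof
        fix y assume "y \<in> f ` B'"
        then obtain b where b: "b \<in> B'" "y = f b" by (elim imageE)
        show "y \<in> fvs.span (f ` ?D)"
        proof (cases "b \<in> B")
          case True
          then have "f b = 0" using B(1) by blast
          then show ?thesis unfolding b(2) by (simp only: fvs.span_zero)
        next
          case False
          then show ?thesis unfolding b(2) using b(1) by (intro fvs.span_base imageI) blast
        qed
      qed
    qed (rule fvs.subspace_span)
    finally show ?thesis .
  qed
  moreover have "finite ?D" "f ` ?D \<subseteq> f ` V" using B' by auto
  ultimately have "fvs.dim (f ` V) = card ?D"
    using dim_eq_card_family[OF ind, of "f ` V"] by blast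
  moreover have "card B' = card B + card ?D"
    unfolding card_Diff_subset[OF B(2) B'(1)] using card_mono[OF B'(3,1)] by simp
  ultimately show ?thesis using B(5) B'(6) by simp
qed

lemma fin_dim_image:
  assumes "semilinear_on \<theta> V f" "fvs.subspace V" "fin_dim V"
  shows "fin_dim (f ` V)"
proof -
  obtain B where B: "B \<subseteq> V" "finite B" "V \<subseteq> fvs.span B" using fin_dim_basis[OF assms(3)] .
  have "f ` V \<subseteq> fvs.span (f ` B)" using semilinear_on_span[OF assms(1,2) B(1)] B(3) by blast
  then show ?thesis unfolding fin_dim_def using B(2) by blast
qed

section \<open>Polynomial functions\<close>

text \<open>For \<open>G\<close> the set of coordinates of an affine space these are the polynomial functions on it; for
  \<open>G = {\<lambda>t. t}\<close> they are the polynomials in the parameter of a curve. Allowing arbitrary generators makes it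
  trivial to pull back a polynomial condition to a curve.\<close>

inductive_set polyfuns :: "('a \<Rightarrow> 'k::field) set \<Rightarrow> ('a \<Rightarrow> 'k) set" for G where
  gen: "g \<in> G \<Longrightarrow> g \<in> polyfuns G"
| const: "(\<lambda>_. c) \<in> polyfuns G"
| add: "f \<in> polyfuns G \<Longrightarrow> g \<in> polyfuns G \<Longrightarrow> (\<lambda>x. f x + g x) \<in> polyfuns G"
| mult: "f \<in> polyfuns G \<Longrightarrow> g \<in> polyfuns G \<Longrightarrow> (\<lambda>x. f x * g x) \<in> polyfuns G"

lemma polyfuns_uminus: "f \<in> polyfuns G \<Longrightarrow> (\<lambda>x. - f x) \<in> polyfuns G"
  using polyfuns.mult[OF polyfuns.const[of "-1"], of f] by simp

lemma polyfuns_diff: "f \<in> polyfuns G \<Longrightarrow> g \<in> polyfuns G \<Longrightarrow> (\<lambda>x. f x - g x) \<in> polyfuns G"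
  using polyfuns.add[OF _ polyfuns_uminus, of f G g] by simp

lemma polyfuns_sum: "(\<And>i. i \<in> I \<Longrightarrow> f i \<in> polyfuns G) \<Longrightarrow> (\<lambda>x. \<Sum>i\<in>I. f i x) \<in> polyfuns G"
  by (induction I rule: infinite_finite_induct) (auto intro: polyfuns.intros)

lemma polyfuns_prod: "(\<And>i. i \<in> I \<Longrightarrow> f i \<in> polyfuns G) \<Longrightarrow> (\<lambda>x. \<Prod>i\<in>I. f i x) \<in> polyfuns G"
  by (induction I rule: infinite_finite_induct) (auto intro: polyfuns.intros)

lemma polyfuns_power: "f \<in> polyfuns G \<Longrightarrow> (\<lambda>x. f x ^ n) \<in> polyfuns G"
  by (induction n) (auto intro: polyfuns.intros)

lemmas polyfuns_closed = polyfuns.const polyfuns.add polyfuns.mult polyfuns_uminus polyfuns_diff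
  polyfuns_sum polyfuns_prod polyfuns_power

lemma polyfuns_compose:
  assumes "f \<in> polyfuns G" "\<And>g. g \<in> G \<Longrightarrow> (\<lambda>y. g (h y)) \<in> polyfuns G'"
  shows "(\<lambda>y. f (h y)) \<in> polyfuns G'"
  using assms(1) by induction (auto intro: polyfuns.intros assms(2))

lemma polyfuns_line_finite_zeros:
  assumes "f \<in> polyfuns {\<lambda>t. t}" "f t0 \<noteq> 0"
  shows "finite {t. f t = 0}"
proof -
  have "\<exists>p. f = poly p" using assms(1)
  proof induction
    case (gen g)
    then show ?case by (intro exI[of _ "[:0,1:]"]) auto
  next
    case (const c)
    then show ?case by (intro exI[of _ "[:c:]"]) auto
  next
    case (add f g)
    then obtain p q where "f = poly p" "g = poly q" by blast
    then show ?case by (intro exI[of _ "p + q"]) auto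
  next
    case (mult f g)
    then obtain p q where "f = poly p" "g = poly q" by blast
    then show ?case by (intro exI[of _ "p * q"]) auto
  qed
  then obtain p where p: "f = poly p" by blast
  moreover have "p \<noteq> 0" using assms(2) p by auto
  ultimately show ?thesis using poly_roots_finite[of p] by auto
qed

abbreviation coord_funs :: "(('c \<Rightarrow> 'k) \<Rightarrow> 'k::field) set" where
  "coord_funs \<equiv> range (\<lambda>c x. x c)"

lemma mpoly_eval_superset:
  assumes "finite T" "Poly_Mapping.keys p \<subseteq> T"
  shows "mpoly_eval p x = (\<Sum>t\<in>T. Poly_Mapping.lookup p t * (\<Prod>c\<in>Poly_Mapping.keys t. x c ^ Poly_Mapping.lookup t c))"
  unfolding mpoly_eval_def
  by (rule sum.mono_neutral_left) (use assms in \<open>auto simp: in_keys_iff\<close>)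

lemma mpoly_eval_add: "mpoly_eval (p + q) x = mpoly_eval p x + mpoly_eval q x"
proof -
  let ?T = "Poly_Mapping.keys p \<union> Poly_Mapping.keys q"
  have "Poly_Mapping.keys (p + q) \<subseteq> ?T" by (rule Poly_Mapping.keys_add)
  then show ?thesis
    using mpoly_eval_superset[of ?T "p + q" x] mpoly_eval_superset[of ?T p x] mpoly_eval_superset[of ?T q x]
    by (simp add: lookup_add distrib_right sum.distrib)
qed

lemma mpoly_eval_single:
  "mpoly_eval (Poly_Mapping.single t a) x = a * (\<Prod>c\<in>Poly_Mapping.keys t. x c ^ Poly_Mapping.lookup t c)"
  using mpoly_eval_superset[of "{t}" "Poly_Mapping.single t a" x] by simp

lemma monomial_add:
  "(\<Prod>c\<in>Poly_Mapping.keys (s + t). x c ^ Poly_Mapping.lookup (s + t) c) =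
   (\<Prod>c\<in>Poly_Mapping.keys s. x c ^ Poly_Mapping.lookup s c) *
   (\<Prod>c\<in>Poly_Mapping.keys t. x c ^ Poly_Mapping.lookup t c)" (is "?m (s + t) = _")
proof -
  let ?T = "Poly_Mapping.keys s \<union> Poly_Mapping.keys t"
  have *: "?m u = (\<Prod>c\<in>?T. x c ^ Poly_Mapping.lookup u c)" if "Poly_Mapping.keys u \<subseteq> ?T" for u
    by (rule prod.mono_neutral_left) (use that in \<open>auto simp: in_keys_iff\<close>)
  show ?thesis using *[of "s + t"] *[of s] *[of t] Poly_Mapping.keys_add[of s t]
    by (simp add: lookup_add power_add prod.distrib)
qed

lemma poly_mapping_sum_induct [case_names single sum]:
  assumes "\<And>k v. P (Poly_Mapping.single k v)" "\<And>f g. P f \<Longrightarrow> P g \<Longrightarrow> P (f + g)"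
  shows "P (p :: 'a \<Rightarrow>\<^sub>0 'b::comm_monoid_add)"
proof (induction p rule: update_induct)
  case const
  have "P (Poly_Mapping.single undefined 0)" by (rule assms(1))
  then show ?case by simp
next
  case (update f a b)
  then have "Poly_Mapping.update a b f = f + Poly_Mapping.single a b"
    by (intro poly_mapping_eqI) (auto simp: lookup_update lookup_add lookup_single in_keys_iff when_def)
  then show ?case using assms update by metis
qed

lemma mpoly_eval_mult: "mpoly_eval (p * q) x = mpoly_eval p x * mpoly_eval q x"
proof -
  have single: "mpoly_eval (Poly_Mapping.single t a * q) x = mpoly_eval (Poly_Mapping.single t a) x * mpoly_eval q x" for t a q
  proof (induction q rule: poly_mapping_sum_induct)
    case (single k v)
    then show ?case by (simp add: mult_single mpoly_eval_single monomial_add)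
  next
    case (sum f g)
    then show ?case by (simp add: distrib_left mpoly_eval_add)
  qed
  show ?thesis
    by (induction p rule: poly_mapping_sum_induct) (auto simp: single distrib_right mpoly_eval_add)
qed

lemma mpoly_eval_polyfuns: "mpoly_eval p \<in> polyfuns coord_funs"
  unfolding mpoly_eval_def by (intro polyfuns_closed polyfuns.gen) auto

lemma polyfuns_mpoly_eval:
  assumes "f \<in> polyfuns coord_funs"
  obtains p where "f = mpoly_eval p"
proof -
  have "\<exists>p. f = mpoly_eval p" using assms
  proof induction
    case (gen g)
    then obtain c where "g = (\<lambda>x. x c)" by blast
    then show ?case
      by (intro exI[of _ "Poly_Mapping.single (Poly_Mapping.single c 1) 1"]) (auto simp: mpoly_eval_single)
  next
    case (const c)
    then show ?case by (intro exI[of _ "Poly_Mapping.single 0 c"]) (auto simp: mpoly_eval_single)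
  next
    case (add f g)
    then obtain p q where "f = mpoly_eval p" "g = mpoly_eval q" by blast
    then show ?case by (intro exI[of _ "p + q"]) (auto simp: mpoly_eval_add)
  next
    case (mult f g)
    then obtain p q where "f = mpoly_eval p" "g = mpoly_eval q" by blast
    then show ?case by (intro exI[of _ "p * q"]) (auto simp: mpoly_eval_mult)
  qed
  then show thesis using that by blast
qed

text \<open>Linear independence is an open condition. The polynomial \<open>F\<close> comes from Gaussian elimination: a pivot
  coordinate of one vector is cleared from the others, without dividing, and \<open>F\<close> is the product of the pivots.\<close>

lemma indep_on_open:
  fixes w :: "'a \<Rightarrow> 'i \<Rightarrow> 'b \<Rightarrow> 'k::field"
  assumes "finite I" "\<And>i b. i \<in> I \<Longrightarrow> (\<lambda>x. w x i b) \<in> polyfuns G" "indep_on I (w x0)"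
  obtains F where "F \<in> polyfuns G" "F x0 \<noteq> 0" "\<And>x. F x \<noteq> 0 \<Longrightarrow> indep_on I (w x)"
proof -
  have "\<exists>F\<in>polyfuns G. F x0 \<noteq> 0 \<and> (\<forall>x. F x \<noteq> 0 \<longrightarrow> indep_on I (w x))"
    using assms
  proof (induction I arbitrary: w rule: finite_induct)
    case empty
    then show ?case by (intro bexI[of _ "\<lambda>_. 1"]) (auto simp: indep_on_def intro: polyfuns.intros)
  next
    case (insert a I)
    have "w x0 a \<noteq> 0"
    proof
      assume "w x0 a = 0"
      then have "(\<Sum>i\<in>insert a I. vscale (if i = a then 1 else 0) (w x0 i)) = 0"
        using insert.hyps by (auto simp: fun_eq_iff sum_fun_apply vscale_apply intro!: sum.neutral)
      then have "(if a = a then 1 else (0::'k)) = 0"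
        using indep_onD[OF insert.prems(2), of "\<lambda>i. if i = a then 1 else 0" a] by blast
      then show False by simp
    qed
    then obtain b where b: "w x0 a b \<noteq> 0" by (auto simp: fun_eq_iff)
    define w' where "w' x i = vscale (w x a b) (w x i) - vscale (w x i b) (w x a)" for x i
    have comb: "(\<Sum>i\<in>insert a I. vscale (if i = a then - (\<Sum>i\<in>I. c i * w x i b) else w x a b * c i) (w x i))
        = (\<Sum>i\<in>I. vscale (c i) (w' x i))" (is "?l = ?r") for c x
    proof
      fix z
      have "?l z = - (\<Sum>i\<in>I. c i * w x i b) * w x a z + (\<Sum>i\<in>I. w x a b * c i * w x i z)"
        using insert.hyps by (auto simp: sum_fun_apply vscale_apply intro!: sum.cong)
      also have "\<dots> = ?r z"
        by (simp add: sum_fun_apply vscale_apply w'_def algebra_simps sum_subtractf sum_distrib_left sum_distrib_right)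
      finally show "?l z = ?r z" .
    qed
    have "indep_on I (w' x0)" unfolding indep_on_def
    proof (intro allI impI ballI)
      fix c i assume s: "(\<Sum>i\<in>I. vscale (c i) (w' x0 i)) = 0" and i: "i \<in> I"
      have "(if i = a then - (\<Sum>i\<in>I. c i * w x0 i b) else w x0 a b * c i) = 0"
        by (rule indep_onD[OF insert.prems(2), OF trans[OF comb s]]) (use i in blast)
      then show "c i = 0" using i insert.hyps b by (auto split: if_splits)
    qed
    moreover have "(\<lambda>x. w' x i z) \<in> polyfuns G" if "i \<in> I" for i z
      unfolding w'_def using insert.prems(1) that by (auto simp: vscale_apply intro!: polyfuns_closed)
    ultimately obtain F where F: "F \<in> polyfuns G" "F x0 \<noteq> 0" "\<And>x. F x \<noteq> 0 \<Longrightarrow> indep_on I (w' x)"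
      using insert.IH by blast
    have "indep_on (insert a I) (w x)" if x: "F x * w x a b \<noteq> 0" for x
      unfolding indep_on_def
    proof (intro allI impI)
      fix c assume s: "(\<Sum>i\<in>insert a I. vscale (c i) (w x i)) = 0"
      have i': "indep_on I (w' x)" using F(3) x by auto
      have at: "c a * w x a z + (\<Sum>i\<in>I. c i * w x i z) = 0" for z
        using fun_cong[OF s, of z] insert.hyps by (simp add: sum_fun_apply vscale_apply)
      have "(\<Sum>i\<in>I. vscale (c i) (w' x i)) = 0"
      proof
        fix z
        have "(\<Sum>i\<in>I. vscale (c i) (w' x i)) z
            = w x a b * (\<Sum>i\<in>I. c i * w x i z) - (\<Sum>i\<in>I. c i * w x i b) * w x a z"
          by (simp add: sum_fun_apply vscale_apply w'_def algebra_simps sum_subtractf sum_distrib_left sum_distrib_right)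
        also have "\<dots> = w x a b * (- (c a * w x a z)) - (- (c a * w x a b)) * w x a z"
          unfolding add_eq_0_iff[THEN iffD1, OF at[of z]] add_eq_0_iff[THEN iffD1, OF at[of b]] by simp
        also have "\<dots> = 0" by simp
        finally show "(\<Sum>i\<in>I. vscale (c i) (w' x i)) z = 0 z" by simp
      qed
      then have cI: "c i = 0" if "i \<in> I" for i using indep_onD[OF i', of c i] that by blast
      then have "c a * w x a b = 0" using at[of b] by simp
      then show "\<forall>i\<in>insert a I. c i = 0" using cI x by auto
    qed
    then show ?case using F b insert.prems(1)[of a b]
      by (intro bexI[of _ "\<lambda>x. F x * w x a b"]) (auto intro: polyfuns.intros)
  qed
  then show thesis using that by blast
qed

text \<open>The adjugate \<open>k\<close> and the determinant \<open>\<delta>\<close> of a matrix with polynomial entries are again polynomial, which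
  is not true of its inverse.\<close>

lemma polyfuns_adjugate:
  fixes h :: "'a \<Rightarrow> nat \<Rightarrow> nat \<Rightarrow> 'k::field"
  assumes "\<And>r c. (\<lambda>x. h x r c) \<in> polyfuns G"
  obtains k \<delta> where "\<And>r c. (\<lambda>x. k x r c) \<in> polyfuns G" "\<delta> \<in> polyfuns G"
    "\<And>x r s. r < n \<Longrightarrow> s < n \<Longrightarrow> (\<Sum>c<n. h x r c * k x c s) = (if r = s then \<delta> x else 0)"
    "\<And>x r s. r < n \<Longrightarrow> s < n \<Longrightarrow> (\<Sum>c<n. k x r c * h x c s) = (if r = s then \<delta> x else 0)"
    "\<And>x g. (\<And>r s. r < n \<Longrightarrow> s < n \<Longrightarrow> (\<Sum>c<n. h x r c * g c s) = (if r = s then 1 else 0)) \<Longrightarrow> \<delta> x \<noteq> 0"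
proof -
  define A where "A x = mat n n (\<lambda>(r,c). h x r c)" for x
  have A: "A x \<in> carrier_mat n n" for x by (simp add: A_def)
  have A_entry: "(\<lambda>x. A x $$ (r,c)) \<in> polyfuns G" if "r < n" "c < n" for r c
    using that assms by (simp add: A_def)
  have det: "(\<lambda>x. det (B x)) \<in> polyfuns G"
    if B: "\<And>x. B x \<in> carrier_mat m m" and e: "\<And>r c. r < m \<Longrightarrow> c < m \<Longrightarrow> (\<lambda>x. B x $$ (r,c)) \<in> polyfuns G"
    for m and B :: "'a \<Rightarrow> 'k mat"
  proof -
    have "(\<lambda>x. det (B x)) = (\<lambda>x. \<Sum>p | p permutes {0..<m}. signof p * (\<Prod>i = 0..<m. B x $$ (i, p i)))"
      using B by (auto simp: det_def' fun_eq_iff)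
    moreover have "p i < m" if "p permutes {0..<m}" "i < m" for p i
      using permutes_in_image[OF that(1), of i] that(2) by simp
    ultimately show ?thesis by (auto intro!: polyfuns_closed e)
  qed
  define k where "k x r c = (if r < n \<and> c < n then adj_mat (A x) $$ (r,c) else 0)" for x r c
  have adj: "adj_mat (A x) \<in> carrier_mat n n" for x using adj_mat(1)[OF A] .
  show thesis
  proof (rule that[of k "\<lambda>x. det (A x)"])
    show "(\<lambda>x. det (A x)) \<in> polyfuns G" by (rule det[OF A]) (use A_entry in auto)
    show "(\<lambda>x. k x r c) \<in> polyfuns G" for r c
    proof (cases "r < n \<and> c < n")
      case True
      have "(\<lambda>x. k x r c) = (\<lambda>x. (-1) ^ (c + r) * det (mat_delete (A x) c r))"
        using True A by (auto simp: k_def adj_mat_def cofactor_def fun_eq_iff A_def)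
      moreover have "(\<lambda>x. det (mat_delete (A x) c r)) \<in> polyfuns G"
      proof (rule det[of _ "n - 1"])
        show "mat_delete (A x) c r \<in> carrier_mat (n - 1) (n - 1)" for x
          using A mat_delete_carrier by blast
        show "(\<lambda>x. mat_delete (A x) c r $$ (i, j)) \<in> polyfuns G" if "i < n - 1" "j < n - 1" for i j
          using that A_entry by (auto simp: mat_delete_def A_def)
      qed
      ultimately show ?thesis by (auto intro!: polyfuns_closed)
    next
      case False
      then have "(\<lambda>x. k x r c) = (\<lambda>_. 0)" by (auto simp: k_def)
      then show ?thesis by (auto intro: polyfuns_closed)
    qed
    show "(\<Sum>c<n. h x r c * k x c s) = (if r = s then det (A x) else 0)" if "r < n" "s < n" for x r s
    proof -
      have "(A x * adj_mat (A x)) $$ (r,s) = (\<Sum>c<n. h x r c * k x c s)"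
        using that adj[of x] by (auto simp: times_mat_def scalar_prod_def A_def k_def atLeast0LessThan intro!: sum.cong)
      then show ?thesis unfolding adj_mat(2)[OF A] using that by auto
    qed
    show "(\<Sum>c<n. k x r c * h x c s) = (if r = s then det (A x) else 0)" if "r < n" "s < n" for x r s
    proof -
      have "(adj_mat (A x) * A x) $$ (r,s) = (\<Sum>c<n. k x r c * h x c s)"
        using that adj[of x] by (auto simp: times_mat_def scalar_prod_def A_def k_def atLeast0LessThan intro!: sum.cong)
      then show ?thesis unfolding adj_mat(3)[OF A] using that by auto
    qed
    show "det (A x) \<noteq> 0"
      if "\<And>r s. r < n \<Longrightarrow> s < n \<Longrightarrow> (\<Sum>c<n. h x r c * g c s) = (if r = s then 1 else 0)" for x g
    proof -
      let ?g = "mat n n (\<lambda>(r,c). g r c)"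
      have "A x * ?g = 1\<^sub>m n"
        using that by (intro eq_matI) (auto simp: times_mat_def scalar_prod_def A_def atLeast0LessThan)
      then have "det (A x) * det ?g = 1" using det_mult[OF A, of ?g x] by (metis det_one mat_carrier)
      then show ?thesis by auto
    qed
  qed
qed

section \<open>The Jacobson radical of a truncated path algebra\<close>

locale quiver = fin_digraph Q for Q :: "('v, 'e) pre_digraph"
begin

lemma awlast_append: "awlast u (p @ q) = awlast (awlast u p) q"
  by (induction p arbitrary: u) auto

lemma path_iff: "(u, p) \<in> paths Q \<longleftrightarrow> awalk u p (awlast u p)"
  unfolding paths_def by auto

lemma path_append: "(u, p @ q) \<in> paths Q \<longleftrightarrow> (u, p) \<in> paths Q \<and> (awlast u p, q) \<in> paths Q"
  unfolding path_iff awlast_append by simp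

lemma path_Nil: "(u, []) \<in> paths Q \<longleftrightarrow> u \<in> verts Q"
  unfolding path_iff by (simp add: awalk_Nil_iff)

lemma path_take: "(u, p) \<in> paths Q \<Longrightarrow> (u, take n p) \<in> paths Q"
  using path_append[of u "take n p" "drop n p"] by simp

lemma path_drop: "(u, p) \<in> paths Q \<Longrightarrow> (awlast u (take n p), drop n p) \<in> paths Q"
  using path_append[of u "take n p" "drop n p"] by simp

lemma path_start: "(u, p) \<in> paths Q \<Longrightarrow> u \<in> verts Q"
  unfolding path_iff by auto

abbreviation KQ :: "(('v, 'e) path \<Rightarrow> 'k::field) ring" where
  "KQ \<equiv> path_algebra Q"

lemma KQ_carrier: "a \<in> carrier KQ \<longleftrightarrow> finite {w. a w \<noteq> 0} \<and> {w. a w \<noteq> 0} \<subseteq> paths Q"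
  by (simp add: path_algebra_def)

lemma KQ_add: "a \<oplus>\<^bsub>KQ\<^esub> b = a + b"
  by (simp add: path_algebra_def plus_fun_def)

lemma KQ_zero: "\<zero>\<^bsub>KQ\<^esub> = 0"
  by (simp add: path_algebra_def zero_fun_def)

lemma KQ_one: "\<one>\<^bsub>KQ\<^esub> (u, p) = (if u \<in> verts Q \<and> p = [] then 1 else 0)"
  by (simp add: path_algebra_def)

lemma KQ_mult: "(f \<otimes>\<^bsub>KQ\<^esub> g) (u, p) = (\<Sum>n\<le>length p. f (awlast u (take n p), drop n p) * g (u, take n p))"
  by (simp add: path_algebra_def)

lemma KQ_mult_support:
  assumes "(f \<otimes>\<^bsub>KQ\<^esub> g) (u, r) \<noteq> 0"
  obtains p q where "r = p @ q" "f (awlast u p, q) \<noteq> 0" "g (u, p) \<noteq> 0"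
proof -
  obtain n where "n \<le> length r" "f (awlast u (take n r), drop n r) * g (u, take n r) \<noteq> 0"
    using assms sum.not_neutral_contains_not_neutral unfolding KQ_mult by (metis (mono_tags, lifting) atMost_iff)
  then show thesis using that[of "take n r" "drop n r"] by auto
qed

lemma KQ_carrier_plus:
  assumes "a \<in> carrier KQ" "b \<in> carrier KQ" shows "a + b \<in> carrier KQ"
proof -
  have "{w. (a + b) w \<noteq> 0} \<subseteq> {w. a w \<noteq> 0} \<union> {w. b w \<noteq> 0}" by auto
  then show ?thesis using assms finite_subset unfolding KQ_carrier by (meson Un_least finite_UnI order_trans)
qed

lemma KQ_carrier_scale:
  assumes "a \<in> carrier KQ" shows "vscale c a \<in> carrier KQ"
proof -
  have "{w. vscale c a w \<noteq> 0} \<subseteq> {w. a w \<noteq> 0}" by (auto simp: vscale_apply)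
  then show ?thesis using assms finite_subset unfolding KQ_carrier by (meson order_trans)
qed

lemma KQ_carrier_mult:
  assumes "a \<in> carrier KQ" "b \<in> carrier KQ" shows "a \<otimes>\<^bsub>KQ\<^esub> b \<in> carrier KQ"
proof -
  let ?A = "{w. a w \<noteq> 0}" and ?B = "{w. b w \<noteq> 0}"
  have "w \<in> (\<lambda>(x, y). (fst y, snd y @ snd x)) ` (?A \<times> ?B) \<and> w \<in> paths Q"
    if w: "(a \<otimes>\<^bsub>KQ\<^esub> b) w \<noteq> 0" for w
  proof -
    obtain u r where ur: "w = (u, r)" by (cases w)
    obtain p q where pq: "r = p @ q" "a (awlast u p, q) \<noteq> 0" "b (u, p) \<noteq> 0"
      using w unfolding ur by (rule KQ_mult_support)
    have "(awlast u p, q) \<in> paths Q" "(u, p) \<in> paths Q"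
      using assms pq unfolding KQ_carrier by blast+
    then have "w \<in> paths Q" unfolding ur pq(1) path_append by blast
    moreover have "w \<in> (\<lambda>(x, y). (fst y, snd y @ snd x)) ` (?A \<times> ?B)"
      by (rule image_eqI[of _ _ "((awlast u p, q), (u, p))"]) (use pq ur in auto)
    ultimately show ?thesis by blast
  qed
  then have "{w. (a \<otimes>\<^bsub>KQ\<^esub> b) w \<noteq> 0} \<subseteq> (\<lambda>(x, y). (fst y, snd y @ snd x)) ` (?A \<times> ?B)"
    "{w. (a \<otimes>\<^bsub>KQ\<^esub> b) w \<noteq> 0} \<subseteq> paths Q" by blast+
  moreover have "finite ((\<lambda>(x, y). (fst y, snd y @ snd x)) ` (?A \<times> ?B))"
    using assms unfolding KQ_carrier by blast
  ultimately show ?thesis unfolding KQ_carrier using finite_subset by blast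
qed

lemma KQ_zero_carrier: "0 \<in> carrier KQ"
  by (simp add: KQ_carrier)

lemma KQ_one_carrier: "\<one>\<^bsub>KQ\<^esub> \<in> carrier KQ"
proof -
  have "{w. \<one>\<^bsub>KQ\<^esub> w \<noteq> (0::'k::field)} \<subseteq> (\<lambda>u. (u, [])) ` verts Q"
  proof
    fix w assume w: "w \<in> {w. \<one>\<^bsub>KQ\<^esub> w \<noteq> (0::'k)}"
    obtain u r where ur: "w = (u, r)" by (cases w)
    show "w \<in> (\<lambda>u. (u, [])) ` verts Q" using w by (auto simp: ur KQ_one split: if_splits)
  qed
  moreover have "(\<lambda>u. (u, [])) ` verts Q \<subseteq> paths Q" by (auto simp: path_Nil)
  moreover have "finite ((\<lambda>u. (u, [])) ` verts Q)" by simp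
  ultimately show ?thesis unfolding KQ_carrier using finite_subset by blast
qed

lemma KQ_mult_assoc: "(f \<otimes>\<^bsub>KQ\<^esub> g) \<otimes>\<^bsub>KQ\<^esub> h = f \<otimes>\<^bsub>KQ\<^esub> (g \<otimes>\<^bsub>KQ\<^esub> h)"
proof
  fix w :: "('v, 'e) path"
  obtain u p where w: "w = (u, p)" by (cases w)
  let ?N = "length p"
  define F where "F n m = f (awlast u (take (n + m) p), drop (n + m) p) *
    (g (awlast u (take n p), take m (drop n p)) * h (u, take n p))" for n m
  have "((f \<otimes>\<^bsub>KQ\<^esub> g) \<otimes>\<^bsub>KQ\<^esub> h) (u, p) = (\<Sum>n\<le>?N. \<Sum>m\<le>?N - n. F n m)"
    unfolding KQ_mult sum_distrib_right
    by (intro sum.cong) (auto simp: F_def take_add awlast_append add.commute mult.assoc)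
  also have "\<dots> = (\<Sum>(n, m)\<in>{(i, j). i + j \<le> ?N}. F n m)"
    by (subst sum.Sigma) (auto intro!: sum.cong)
  also have "\<dots> = (\<Sum>k\<le>?N. \<Sum>n\<le>k. F n (k - n))"
    by (rule sum.triangle_reindex_eq)
  also have "\<dots> = (f \<otimes>\<^bsub>KQ\<^esub> (g \<otimes>\<^bsub>KQ\<^esub> h)) (u, p)"
    unfolding KQ_mult
  proof (rule sum.cong[OF refl])
    fix k assume "k \<in> {..?N}"
    then have l: "length (take k p) = k" by simp
    show "(\<Sum>n\<le>k. F n (k - n)) = f (awlast u (take k p), drop k p) *
      (\<Sum>n\<le>length (take k p). g (awlast u (take n (take k p)), drop n (take k p)) * h (u, take n (take k p)))"
      unfolding l sum_distrib_left by (intro sum.cong) (auto simp: F_def drop_take min_def)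
  qed
  finally show "((f \<otimes>\<^bsub>KQ\<^esub> g) \<otimes>\<^bsub>KQ\<^esub> h) w = (f \<otimes>\<^bsub>KQ\<^esub> (g \<otimes>\<^bsub>KQ\<^esub> h)) w" by (simp only: w)
qed

lemma KQ_one_mult:
  assumes "f \<in> carrier KQ"
  shows "\<one>\<^bsub>KQ\<^esub> \<otimes>\<^bsub>KQ\<^esub> f = f"
proof
  fix w :: "('v, 'e) path"
  obtain u p where w: "w = (u, p)" by (cases w)
  have *: "f (u, p) = 0" if "awlast u p \<notin> verts Q" for p
  proof (rule ccontr)
    assume "f (u, p) \<noteq> 0"
    then have "(u, p) \<in> paths Q" using assms unfolding KQ_carrier by blast
    then show False using that awalk_last_in_verts unfolding path_iff by blast
  qed
  have "(\<one>\<^bsub>KQ\<^esub> \<otimes>\<^bsub>KQ\<^esub> f) (u, p) = (\<Sum>n\<le>length p. if n = length p then f (u, p) else 0)"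
    unfolding KQ_mult KQ_one using * by (intro sum.cong) auto
  also have "\<dots> = f (u, p)" by simp
  finally show "(\<one>\<^bsub>KQ\<^esub> \<otimes>\<^bsub>KQ\<^esub> f) w = f w" by (simp only: w)
qed

lemma KQ_mult_one:
  assumes "f \<in> carrier KQ"
  shows "f \<otimes>\<^bsub>KQ\<^esub> \<one>\<^bsub>KQ\<^esub> = f"
proof
  fix w :: "('v, 'e) path"
  obtain u p where w: "w = (u, p)" by (cases w)
  have *: "f (u, p) = 0" if "u \<notin> verts Q"
    using assms that path_start unfolding KQ_carrier by blast
  have "(f \<otimes>\<^bsub>KQ\<^esub> \<one>\<^bsub>KQ\<^esub>) (u, p) = (\<Sum>n\<le>length p. if n = 0 then f (u, p) else 0)"
    unfolding KQ_mult KQ_one using * by (intro sum.cong) auto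
  also have "\<dots> = f (u, p)" by simp
  finally show "(f \<otimes>\<^bsub>KQ\<^esub> \<one>\<^bsub>KQ\<^esub>) w = f w" by (simp only: w)
qed

lemma KQ_ring: "ring KQ"
proof (rule ringI)
  show "abelian_group KQ"
  proof (rule abelian_groupI)
    show "\<exists>y\<in>carrier KQ. y \<oplus>\<^bsub>KQ\<^esub> x = \<zero>\<^bsub>KQ\<^esub>" if "x \<in> carrier KQ" for x
    proof (rule bexI)
      show "vscale (- 1) x \<oplus>\<^bsub>KQ\<^esub> x = \<zero>\<^bsub>KQ\<^esub>"
        by (auto simp: KQ_add KQ_zero vscale_apply fun_eq_iff)
    qed (rule KQ_carrier_scale[OF that])
  qed (auto simp: KQ_add KQ_zero KQ_carrier_plus KQ_zero_carrier add.assoc add.commute)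
  show "monoid KQ"
    by (rule monoidI) (auto simp: KQ_carrier_mult KQ_one_carrier KQ_mult_assoc KQ_one_mult KQ_mult_one)
  show "(x \<oplus>\<^bsub>KQ\<^esub> y) \<otimes>\<^bsub>KQ\<^esub> z = x \<otimes>\<^bsub>KQ\<^esub> z \<oplus>\<^bsub>KQ\<^esub> y \<otimes>\<^bsub>KQ\<^esub> z" for x y z
    by (auto simp: KQ_add KQ_mult fun_eq_iff distrib_right sum.distrib)
  show "z \<otimes>\<^bsub>KQ\<^esub> (x \<oplus>\<^bsub>KQ\<^esub> y) = z \<otimes>\<^bsub>KQ\<^esub> x \<oplus>\<^bsub>KQ\<^esub> z \<otimes>\<^bsub>KQ\<^esub> y" for x y z
    by (auto simp: KQ_add KQ_mult fun_eq_iff distrib_left sum.distrib)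
qed

lemma KQ_scale_mult: "vscale c f \<otimes>\<^bsub>KQ\<^esub> g = vscale c (f \<otimes>\<^bsub>KQ\<^esub> g)"
  by (auto simp: KQ_mult fun_eq_iff vscale_apply sum_distrib_left mult.assoc)

lemma KQ_path_elt: "w \<in> paths Q \<Longrightarrow> path_elt w \<in> carrier KQ"
  by (simp add: KQ_carrier path_elt_def)

lemma KQ_path_mult:
  assumes "(u, p @ q) \<in> paths Q"
  shows "path_elt (awlast u p, q) \<otimes>\<^bsub>KQ\<^esub> path_elt (u, p) = path_elt (u, p @ q)"
proof
  fix w :: "('v, 'e) path"
  obtain u' r where w: "w = (u', r)" by (cases w)
  have "(path_elt (awlast u p, q) \<otimes>\<^bsub>KQ\<^esub> path_elt (u, p)) (u', r) =
     (\<Sum>n\<le>length r. if n = length p then (if (u', r) = (u, p @ q) then 1 else 0) else 0)"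
    unfolding KQ_mult
  proof (rule sum.cong[OF refl])
    fix n assume n: "n \<in> {..length r}"
    show "path_elt (awlast u p, q) (awlast u' (take n r), drop n r) * path_elt (u, p) (u', take n r) =
      (if n = length p then (if (u', r) = (u, p @ q) then 1 else 0) else 0)"
    proof (cases "n = length p \<and> r = p @ q")
      case True
      then have "take n r = p" "drop n r = q" by auto
      then show ?thesis using True by (simp add: path_elt_def)
    next
      case False
      have "take n r \<noteq> p \<or> drop n r \<noteq> q"
      proof (rule ccontr)
        assume "\<not> ?thesis"
        then have "p = take n r" "q = drop n r" by simp_all
        then have "n = length p" "r = p @ q" using n by (simp_all only: length_take append_take_drop_id atMost_iff min_absorb2)
        then show False using False by blast
      qed
      then have "(awlast u' (take n r), drop n r) \<noteq> (awlast u p, q) \<or> (u', take n r) \<noteq> (u, p)" by blast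
      then show ?thesis using False unfolding path_elt_def by (simp only: if_False if_True mult_zero_left mult_zero_right prod.inject simp_thms split: if_split) blast
    qed
  qed
  also have "\<dots> = path_elt (u, p @ q) (u', r)"
    by (auto simp: path_elt_def)
  finally show "(path_elt (awlast u p, q) \<otimes>\<^bsub>KQ\<^esub> path_elt (u, p)) w = path_elt (u, p @ q) w" by (simp only: w)
qed

text \<open>An additive property of elements supported on \<open>W\<close> has to be checked on multiples of paths only.\<close>

lemma KQ_support_induct [consumes 2, case_names zero plus path]:
  assumes "a \<in> carrier KQ" "{w. a w \<noteq> 0} \<subseteq> W" and "P 0" "\<And>f g. P f \<Longrightarrow> P g \<Longrightarrow> P (f + g)"
    and path: "\<And>c w. w \<in> W \<Longrightarrow> w \<in> paths Q \<Longrightarrow> P (vscale c (path_elt w))"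
  shows "P a"
proof -
  have *: "P (\<Sum>w\<in>X. vscale (a w) (path_elt w))" if "finite X" "X \<subseteq> {w. a w \<noteq> 0}" for X
    using that
  proof (induction X rule: finite_induct)
    case (insert w X)
    then have "w \<in> W" "w \<in> paths Q" "X \<subseteq> {w. a w \<noteq> 0}" using assms unfolding KQ_carrier by blast+
    then show ?case unfolding sum.insert[OF insert.hyps] by (intro assms(4) path insert.IH)
  qed (use assms(3) in simp)
  have fin: "finite {w. a w \<noteq> 0}" using assms(1) by (simp add: KQ_carrier)
  have eq: "(\<Sum>w\<in>{w. a w \<noteq> 0}. vscale (a w) (path_elt w)) = a"
  proof
    fix v
    have "(\<Sum>w\<in>{w. a w \<noteq> 0}. vscale (a w) (path_elt w)) v = (\<Sum>w\<in>{w. a w \<noteq> 0}. if w = v then a v else 0)"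
      unfolding sum_fun_apply vscale_apply path_elt_def by (intro sum.cong) auto
    then show "(\<Sum>w\<in>{w. a w \<noteq> 0}. vscale (a w) (path_elt w)) v = a v"
      using fin by (simp add: sum.delta)
  qed
  show ?thesis using *[OF fin order_refl] unfolding eq .
qed

text \<open>The powers of the arrow ideal.\<close>

definition long_elts :: "nat \<Rightarrow> (('v, 'e) path \<Rightarrow> 'k::field) set" where
  "long_elts n = {a \<in> carrier KQ. \<forall>w. a w \<noteq> 0 \<longrightarrow> n \<le> length (snd w)}"

lemma long_elts_carrier: "a \<in> long_elts n \<Longrightarrow> a \<in> carrier KQ"
  by (simp add: long_elts_def)

lemma long_elts_mult:
  assumes "a \<in> long_elts m" "b \<in> long_elts n"
  shows "a \<otimes>\<^bsub>KQ\<^esub> b \<in> long_elts (m + n)"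
  unfolding long_elts_def
proof (intro CollectI conjI allI impI)
  show "a \<otimes>\<^bsub>KQ\<^esub> b \<in> carrier KQ" using assms KQ_carrier_mult by (auto simp: long_elts_def)
  fix w assume w: "(a \<otimes>\<^bsub>KQ\<^esub> b) w \<noteq> 0"
  obtain u r where ur: "w = (u, r)" by (cases w)
  obtain p q where pq: "r = p @ q" "a (awlast u p, q) \<noteq> 0" "b (u, p) \<noteq> 0"
    using w unfolding ur by (rule KQ_mult_support)
  have "m \<le> length q" "n \<le> length p" using assms pq unfolding long_elts_def by fastforce+
  then show "m + n \<le> length (snd w)" by (simp add: ur pq(1))
qed

lemma long_elts_plus:
  assumes "a \<in> long_elts n" "b \<in> long_elts n"
  shows "a + b \<in> long_elts n"
  unfolding long_elts_def
proof (intro CollectI conjI allI impI)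
  show "a + b \<in> carrier KQ" using assms KQ_carrier_plus by (auto simp: long_elts_def)
  fix w assume "(a + b) w \<noteq> 0"
  then have "a w \<noteq> 0 \<or> b w \<noteq> 0" by auto
  then show "n \<le> length (snd w)" using assms unfolding long_elts_def by blast
qed

lemma long_elts_scale: "a \<in> long_elts n \<Longrightarrow> vscale c a \<in> long_elts n"
  using KQ_carrier_scale by (auto simp: long_elts_def vscale_apply)

lemma long_elts_0: "0 \<in> long_elts n" "long_elts 0 = carrier KQ"
  using KQ_zero_carrier by (auto simp: long_elts_def)

lemma long_elts_path: "w \<in> paths Q \<Longrightarrow> n \<le> length (snd w) \<Longrightarrow> path_elt w \<in> long_elts n"
  using KQ_path_elt[of w] unfolding long_elts_def by (auto simp: path_elt_def split: if_splits)

lemma long_elts_ideal: "ideal (long_elts n) (KQ :: (('v, 'e) path \<Rightarrow> 'k::field) ring)"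
proof (rule idealI[OF KQ_ring])
  interpret KQ: ring "KQ :: (('v, 'e) path \<Rightarrow> 'k) ring" by (rule KQ_ring)
  have "\<ominus>\<^bsub>KQ\<^esub> a = vscale (- 1) a" if "a \<in> carrier KQ" for a :: "('v, 'e) path \<Rightarrow> 'k"
    using that KQ_carrier_scale[OF that] 
    by (intro KQ.minus_equality) (auto simp: KQ_add KQ_zero vscale_apply fun_eq_iff simp del: fvs.scale_minus_left)
  then have "a_inv KQ a \<in> long_elts n" if "a \<in> long_elts n" for a :: "('v, 'e) path \<Rightarrow> 'k"
    using that long_elts_scale long_elts_carrier by metis
  then show "subgroup (long_elts n) (add_monoid (KQ :: (('v, 'e) path \<Rightarrow> 'k) ring))"
    using long_elts_plus long_elts_0 long_elts_carrier
    by (intro subgroup.intro) (auto simp: KQ_add KQ_zero a_inv_def)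
  show "x \<otimes>\<^bsub>KQ\<^esub> a \<in> long_elts n" "a \<otimes>\<^bsub>KQ\<^esub> x \<in> long_elts n"
    if "a \<in> long_elts n" "x \<in> carrier KQ" for a x :: "('v, 'e) path \<Rightarrow> 'k"
    using long_elts_mult[of x 0 a n] long_elts_mult[of a n x 0] that by (auto simp: long_elts_0)
qed

lemma trunc_ideal_eq: "trunc_ideal Q L = (long_elts (L + 1) :: (('v, 'e) path \<Rightarrow> 'k::field) set)"
proof
  let ?G = "{path_elt w | w. w \<in> paths Q \<and> length (snd w) = L + 1} :: (('v, 'e) path \<Rightarrow> 'k) set"
  interpret KQ: ring "KQ :: (('v, 'e) path \<Rightarrow> 'k) ring" by (rule KQ_ring)
  have G: "?G \<subseteq> carrier KQ" using KQ_path_elt by auto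
  have "?G \<subseteq> long_elts (L + 1)" using long_elts_path by fastforce
  then show "trunc_ideal Q L \<subseteq> (long_elts (L + 1) :: (('v, 'e) path \<Rightarrow> 'k) set)"
    unfolding trunc_ideal_def using KQ.genideal_minimal[OF long_elts_ideal] by blast
  interpret I: ideal "trunc_ideal Q L :: (('v, 'e) path \<Rightarrow> 'k) set" KQ
    unfolding trunc_ideal_def by (rule KQ.genideal_ideal[OF G])
  show "long_elts (L + 1) \<subseteq> (trunc_ideal Q L :: (('v, 'e) path \<Rightarrow> 'k) set)"
  proof
    fix a :: "('v, 'e) path \<Rightarrow> 'k" assume a: "a \<in> long_elts (L + 1)"
    have "a \<in> carrier KQ" "{w. a w \<noteq> 0} \<subseteq> {w. L + 1 \<le> length (snd w)}"
      using a by (auto simp: long_elts_def)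
    then show "a \<in> trunc_ideal Q L"
    proof (induction a rule: KQ_support_induct)
      case zero
      show ?case using I.zero_closed by (simp only: KQ_zero)
    next
      case (plus f g)
      then show ?case using I.a_closed by (simp only: KQ_add)
    next
      case (path c w)
      obtain u p where w: "w = (u, p)" by (cases w)
      let ?p = "take (L + 1) p" and ?q = "drop (L + 1) p"
      have wp: "(u, ?p @ ?q) \<in> paths Q" using path w by simp
      have "(path_elt (u, ?p) :: ('v, 'e) path \<Rightarrow> 'k) \<in> trunc_ideal Q L"
        unfolding trunc_ideal_def
      proof (rule subsetD[OF KQ.genideal_self[OF G]])
        have "(u, ?p) \<in> paths Q" "length (snd (u, ?p)) = L + 1" using path w path_take by auto
        then show "path_elt (u, ?p) \<in> ?G" by blast
      qed
      then have "vscale c (path_elt (awlast u ?p, ?q)) \<otimes>\<^bsub>KQ\<^esub> path_elt (u, ?p) \<in> trunc_ideal Q L"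
        using wp unfolding path_append by (intro I.I_l_closed KQ_carrier_scale KQ_path_elt) blast+
      then show ?case unfolding KQ_scale_mult KQ_path_mult[OF wp] by (simp add: w)
    qed
  qed
qed

end

text \<open>If \<open>1 = m + y\<close> with \<open>y\<close> nilpotent, then \<open>m\<close> is a unit. This puts the nilpotent arrow ideal into every
  maximal left ideal.\<close>

lemma left_ideal_nilpotent_complement:
  fixes R :: "'a ring" (structure)
  assumes "ring R" "left_ideal R M" "m \<in> M" "y \<in> carrier R" "m \<oplus> y = \<one>" "y [^] (n::nat) = \<zero>"
  shows "M = carrier R"
proof -
  interpret ring R by fact
  interpret M: additive_subgroup M R using assms(2) by (simp add: left_ideal_def)
  have l: "a \<otimes> x \<in> M" if "a \<in> carrier R" "x \<in> M" for a x
    using assms(2) that by (simp add: left_ideal_def)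
  have m: "m \<in> carrier R" using M.a_subset assms(3) by blast
  have "\<exists>m'\<in>M. m' \<oplus> y [^] k = \<one>" for k :: nat
  proof (induction k)
    case 0
    show ?case using M.zero_closed by (intro bexI[of _ \<zero>]) auto
  next
    case (Suc k)
    then obtain m' where m': "m' \<in> M" "m' \<oplus> y [^] k = \<one>" by blast
    have c: "m' \<in> carrier R" using M.a_subset m' by blast
    have "y [^] k = y [^] k \<otimes> (m \<oplus> y)" using assms(4,5) by simp
    also have "\<dots> = y [^] k \<otimes> m \<oplus> y [^] Suc k" using assms(4) m by (simp add: r_distr)
    finally have "\<one> = (m' \<oplus> y [^] k \<otimes> m) \<oplus> y [^] Suc k"
      using m' c m assms(4) by (simp add: a_assoc)
    then show ?case using m' l[of "y [^] k" m] assms(3,4) M.a_closed by (metis nat_pow_closed)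
  qed
  then obtain m' where m': "m' \<in> M" "m' \<oplus> y [^] n = \<one>" by blast
  then have "\<one> \<in> M" using assms(6) M.a_subset by auto
  then have "carrier R \<subseteq> M" using l[of _ \<one>] by fastforce
  then show ?thesis using M.a_subset by blast
qed

context quiver
begin

abbreviation coset :: "nat \<Rightarrow> (('v, 'e) path \<Rightarrow> 'k::field) \<Rightarrow> (('v, 'e) path \<Rightarrow> 'k) set" where
  "coset L a \<equiv> trunc_ideal Q L +>\<^bsub>KQ\<^esub> a"

lemma trunc_ideal_ideal: "ideal (trunc_ideal Q L) KQ"
  unfolding trunc_ideal_eq by (rule long_elts_ideal)

lemma trunc_ring: "ring (trunc_algebra Q L)"
  unfolding trunc_algebra_def by (rule ideal.quotient_is_ring[OF trunc_ideal_ideal])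

lemma coset_hom: "coset L \<in> Ring.ring_hom KQ (trunc_algebra Q L)"
  unfolding trunc_algebra_def by (rule ideal.rcos_ring_hom[OF trunc_ideal_ideal])

lemma coset_mult:
  "a \<in> carrier KQ \<Longrightarrow> b \<in> carrier KQ \<Longrightarrow> coset L a \<otimes>\<^bsub>trunc_algebra Q L\<^esub> coset L b = coset L (a \<otimes>\<^bsub>KQ\<^esub> b)"
  using Ring.ring_hom_mult[OF coset_hom] by (rule sym)

lemma coset_add:
  "a \<in> carrier KQ \<Longrightarrow> b \<in> carrier KQ \<Longrightarrow> coset L a \<oplus>\<^bsub>trunc_algebra Q L\<^esub> coset L b = coset L (a + b)"
  by (rule Ring.ring_hom_add[OF coset_hom, unfolded KQ_add, symmetric])

lemma coset_one: "coset L \<one>\<^bsub>KQ\<^esub> = \<one>\<^bsub>trunc_algebra Q L\<^esub>"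
  by (rule Ring.ring_hom_one[OF coset_hom])

lemma trunc_carrier: "carrier (trunc_algebra Q L) = coset L ` carrier KQ"
  by (auto simp: trunc_algebra_def FactRing_def A_RCOSETS_def')

lemma mem_coset: "b \<in> coset L a \<longleftrightarrow> b - a \<in> trunc_ideal Q L"
  unfolding a_r_coset_def' KQ_add by (auto intro: bexI[of _ "b - a"])

lemma coset_eqD:
  assumes "coset L a = coset L b"
  shows "a - b \<in> trunc_ideal Q L"
proof -
  have "a \<in> coset L a" unfolding mem_coset using long_elts_0 by (simp add: trunc_ideal_eq)
  then show ?thesis unfolding assms mem_coset .
qed

lemma coset_zero:
  assumes "a \<in> trunc_ideal Q L"
  shows "coset L a = \<zero>\<^bsub>trunc_algebra Q L\<^esub>"
proof -
  interpret I: ideal "trunc_ideal Q L" KQ by (rule trunc_ideal_ideal)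
  have "coset L a = trunc_ideal Q L" by (rule I.a_rcos_const[OF assms])
  then show ?thesis by (simp add: trunc_algebra_def FactRing_def)
qed

lemma trunc_zero: "\<zero>\<^bsub>trunc_algebra Q L\<^esub> = coset L 0"
  by (rule coset_zero[symmetric]) (simp only: trunc_ideal_eq long_elts_0)

lemma KQ_carrier_uminus: "a \<in> carrier KQ \<Longrightarrow> - a \<in> carrier KQ"
  by (simp add: KQ_carrier)

lemma coset_image_left_ideal:
  fixes M :: "(('v, 'e) path \<Rightarrow> 'k::field) set"
  assumes M: "M \<subseteq> carrier KQ" "0 \<in> M" "\<And>a b. a \<in> M \<Longrightarrow> b \<in> M \<Longrightarrow> a + b \<in> M"
    "\<And>a b. a \<in> carrier KQ \<Longrightarrow> b \<in> M \<Longrightarrow> a \<otimes>\<^bsub>KQ\<^esub> b \<in> M" "\<And>a. a \<in> M \<Longrightarrow> - a \<in> M"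
  shows "left_ideal (trunc_algebra Q L) (coset L ` M)"
proof -
  interpret R: ring "trunc_algebra Q L :: (('v, 'e) path \<Rightarrow> 'k) set ring" by (rule trunc_ring)
  have sub: "coset L ` M \<subseteq> carrier (trunc_algebra Q L)" using M(1) by (auto simp: trunc_carrier)
  have inv: "\<ominus>\<^bsub>trunc_algebra Q L\<^esub> coset L a = coset L (- a)" if a: "a \<in> M" for a
  proof (rule R.minus_equality)
    have c: "a \<in> carrier KQ" "- a \<in> carrier KQ" using a M(1) KQ_carrier_uminus by auto
    show "coset L (- a) \<oplus>\<^bsub>trunc_algebra Q L\<^esub> coset L a = \<zero>\<^bsub>trunc_algebra Q L\<^esub>"
      unfolding coset_add[OF c(2,1)] trunc_zero by (simp only: left_minus)
    show "coset L a \<in> carrier (trunc_algebra Q L)" "coset L (- a) \<in> carrier (trunc_algebra Q L)"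
      unfolding trunc_carrier using c by (blast intro: imageI)+
  qed
  have "subgroup (coset L ` M) (add_monoid (trunc_algebra Q L))"
  proof (rule subgroup.intro)
    show "coset L ` M \<subseteq> carrier (add_monoid (trunc_algebra Q L))" using sub by simp
    show "x \<otimes>\<^bsub>add_monoid (trunc_algebra Q L)\<^esub> y \<in> coset L ` M"
      if xy: "x \<in> coset L ` M" "y \<in> coset L ` M" for x y
    proof -
      obtain a b where ab: "a \<in> M" "x = coset L a" "b \<in> M" "y = coset L b" using xy by (elim imageE)
      have "x \<oplus>\<^bsub>trunc_algebra Q L\<^esub> y = coset L (a + b)"
        unfolding ab by (rule coset_add) (use ab M(1) in blast)+
      then show ?thesis using M(3)[OF ab(1,3)] by simp
    qed
    show "\<one>\<^bsub>add_monoid (trunc_algebra Q L)\<^esub> \<in> coset L ` M"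
      using M(2) by (simp add: trunc_zero)
    show "inv\<^bsub>add_monoid (trunc_algebra Q L)\<^esub> x \<in> coset L ` M" if x: "x \<in> coset L ` M" for x
    proof -
      obtain a where a: "a \<in> M" "x = coset L a" using x by (elim imageE)
      have "inv\<^bsub>add_monoid (trunc_algebra Q L)\<^esub> x = coset L (- a)"
        unfolding a(2) using inv[OF a(1)] by (simp add: a_inv_def)
      then show ?thesis using M(5)[OF a(1)] by blast
    qed
  qed
  moreover have "x \<otimes>\<^bsub>trunc_algebra Q L\<^esub> y \<in> coset L ` M"
    if xy: "x \<in> carrier (trunc_algebra Q L)" "y \<in> coset L ` M" for x y
  proof -
    obtain a b where ab: "a \<in> carrier KQ" "x = coset L a" "b \<in> M" "y = coset L b"
      using xy unfolding trunc_carrier by (elim imageE)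
    have "x \<otimes>\<^bsub>trunc_algebra Q L\<^esub> y = coset L (a \<otimes>\<^bsub>KQ\<^esub> b)"
      unfolding ab by (rule coset_mult) (use ab M(1) in blast)+
    then show ?thesis using M(4)[OF ab(1,3)] by simp
  qed
  ultimately show ?thesis unfolding left_ideal_def additive_subgroup_def by blast
qed

text \<open>The elements without the trivial path at \<open>i\<close> form a left ideal of codimension one.\<close>

lemma vertex_maximal_left_ideal:
  assumes "i \<in> verts Q"
  shows "maximal_left_ideal (trunc_algebra Q L)
    (coset L ` {a \<in> carrier KQ. a (i, []) = (0::'k::field)})" (is "maximal_left_ideal ?R (coset L ` ?M)")
proof -
  interpret R: ring ?R by (rule trunc_ring)
  have li: "left_ideal ?R (coset L ` ?M)"
    by (rule coset_image_left_ideal)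
      (auto simp: KQ_zero_carrier KQ_carrier_plus KQ_carrier_mult KQ_mult KQ_carrier_uminus)
  have trunc0: "a (i, []) = 0" if "a \<in> trunc_ideal Q L" for a :: "('v, 'e) path \<Rightarrow> 'k"
    using that unfolding trunc_ideal_eq long_elts_def by fastforce
  have "coset L \<one>\<^bsub>KQ\<^esub> \<notin> coset L ` ?M"
  proof
    assume "coset L \<one>\<^bsub>KQ\<^esub> \<in> coset L ` ?M"
    then obtain a :: "('v, 'e) path \<Rightarrow> 'k" where a: "a (i, []) = 0" "coset L \<one>\<^bsub>KQ\<^esub> = coset L a" by (elim imageE) blast
    have "(\<one>\<^bsub>KQ\<^esub> - a) (i, []) = 0" using trunc0[OF coset_eqD[OF a(2)]] .
    then show False using a(1) assms by (simp add: KQ_one)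
  qed
  then have ne: "coset L ` ?M \<noteq> carrier ?R" using KQ_one_carrier unfolding trunc_carrier by blast
  have "I' = coset L ` ?M \<or> I' = carrier ?R" if I': "left_ideal ?R I'" "coset L ` ?M \<subseteq> I'" for I'
  proof (rule ccontr)
    assume not: "\<not> ?thesis"
    interpret I': additive_subgroup I' ?R using I'(1) by (simp add: left_ideal_def)
    have mult: "a \<otimes>\<^bsub>?R\<^esub> x \<in> I'" if "a \<in> carrier ?R" "x \<in> I'" for a x
      using I'(1) that by (simp add: left_ideal_def)
    obtain x where x: "x \<in> I'" "x \<notin> coset L ` ?M" using I'(2) not by blast
    obtain b where b: "b \<in> carrier KQ" "x = coset L b" using x(1) I'.a_subset unfolding trunc_carrier by blast
    then have c: "b (i, []) \<noteq> 0" using x(2) by blast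
    let ?e = "vscale (1 / b (i, [])) \<one>\<^bsub>KQ\<^esub> :: ('v, 'e) path \<Rightarrow> 'k"
    have e: "?e \<in> carrier KQ" by (intro KQ_carrier_scale KQ_one_carrier)
    have eb: "?e \<otimes>\<^bsub>KQ\<^esub> b = vscale (1 / b (i, [])) b" unfolding KQ_scale_mult KQ_one_mult[OF b(1)] ..
    let ?r = "\<one>\<^bsub>KQ\<^esub> + - (?e \<otimes>\<^bsub>KQ\<^esub> b)"
    have rc: "?r \<in> carrier KQ" using KQ_carrier_mult[OF e b(1)]
      by (intro KQ_carrier_plus KQ_carrier_uminus KQ_one_carrier)
    have "?r (i, []) = 0" unfolding eb using c assms by (simp add: KQ_one vscale_apply)
    then have r: "?r \<in> ?M" using rc by blast
    have "coset L ?e \<otimes>\<^bsub>?R\<^esub> coset L b \<in> I'" using mult e x(1) b(2) unfolding trunc_carrier by blast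
    then have "coset L (?e \<otimes>\<^bsub>KQ\<^esub> b) \<in> I'" unfolding coset_mult[OF e b(1)] .
    moreover have "coset L ?r \<in> I'" using r I'(2) by blast
    ultimately have "coset L ?r \<oplus>\<^bsub>?R\<^esub> coset L (?e \<otimes>\<^bsub>KQ\<^esub> b) \<in> I'" by (rule I'.a_closed[rotated])
    moreover have "?r + ?e \<otimes>\<^bsub>KQ\<^esub> b = \<one>\<^bsub>KQ\<^esub>" by (simp only: add.assoc left_minus add_0_right)
    ultimately have "\<one>\<^bsub>?R\<^esub> \<in> I'"
      unfolding coset_add[OF rc KQ_carrier_mult[OF e b(1)]] by (simp only: coset_one)
    then have "carrier ?R \<subseteq> I'" using mult[of _ "\<one>\<^bsub>?R\<^esub>"] by (metis R.r_one subsetI)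
    then show False using not I'.a_subset by blast
  qed
  then show ?thesis unfolding maximal_left_ideal_def using li ne by blast
qed

text \<open>The maximal left ideals that belong to the vertices intersect in the arrow ideal; conversely, this ideal is
  nilpotent and therefore contained in all maximal left ideals.\<close>

lemma trunc_radical:
  "jacobson_radical (trunc_algebra Q L :: (('v, 'e) path \<Rightarrow> 'k::field) set ring) = coset L ` long_elts 1"
proof
  let ?R = "trunc_algebra Q L :: (('v, 'e) path \<Rightarrow> 'k) set ring"
  interpret R: ring ?R by (rule trunc_ring)
  show "jacobson_radical ?R \<subseteq> coset L ` long_elts 1"
  proof
    fix x assume x: "x \<in> jacobson_radical ?R"
    obtain a where a: "a \<in> carrier KQ" "x = coset L a"
      using x unfolding jacobson_radical_def trunc_carrier by blast
    have "a (i, []) = 0" if i: "i \<in> verts Q" for i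
    proof -
      have "x \<in> coset L ` {a \<in> carrier KQ. a (i, []) = 0}"
        using x vertex_maximal_left_ideal[OF i] unfolding jacobson_radical_def by blast
      then obtain b where b: "b (i, []) = 0" "coset L a = coset L b" using a(2) by blast
      have "(a - b) (i, []) = 0"
        using coset_eqD[OF b(2)] unfolding trunc_ideal_eq long_elts_def by fastforce
      then show ?thesis using b(1) by simp
    qed
    moreover have "fst w \<in> verts Q" if "a w \<noteq> 0" for w
      using a(1) that path_start[of "fst w" "snd w"] unfolding KQ_carrier by auto
    ultimately have "a \<in> long_elts 1" using a(1) unfolding long_elts_def
      by (auto simp: Suc_le_eq) (metis fst_conv)
    then show "x \<in> coset L ` long_elts 1" using a(2) by blast
  qed
  show "coset L ` long_elts 1 \<subseteq> jacobson_radical ?R"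
    unfolding jacobson_radical_def
  proof (intro subsetI IntI InterI)
    fix x assume x: "x \<in> coset L ` (long_elts 1 :: (('v, 'e) path \<Rightarrow> 'k) set)"
    show xc: "x \<in> carrier ?R" using x long_elts_carrier unfolding trunc_carrier by blast
    fix M assume "M \<in> {I. maximal_left_ideal ?R I}"
    then have M: "left_ideal ?R M" "M \<noteq> carrier ?R"
      "\<And>N. left_ideal ?R N \<Longrightarrow> M \<subseteq> N \<Longrightarrow> N = M \<or> N = carrier ?R"
      unfolding maximal_left_ideal_def by blast+
    interpret M: additive_subgroup M ?R using M(1) by (simp add: left_ideal_def)
    have mult: "a \<otimes>\<^bsub>?R\<^esub> m \<in> M" if "a \<in> carrier ?R" "m \<in> M" for a m
      using M(1) that by (simp add: left_ideal_def)
    show "x \<in> M"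
    proof (rule ccontr)
      assume xM: "x \<notin> M"
      let ?N = "{m \<oplus>\<^bsub>?R\<^esub> r \<otimes>\<^bsub>?R\<^esub> x | m r. m \<in> M \<and> r \<in> carrier ?R}"
      have N: "left_ideal ?R ?N" unfolding left_ideal_def
      proof (intro conjI ballI)
        show "additive_subgroup ?N ?R"
        proof (rule additive_subgroupI, rule subgroup.intro)
          show "?N \<subseteq> carrier (add_monoid ?R)" using M.a_subset xc by auto
          show "\<one>\<^bsub>add_monoid ?R\<^esub> \<in> ?N"
          proof -
            have "\<zero>\<^bsub>?R\<^esub> = \<zero>\<^bsub>?R\<^esub> \<oplus>\<^bsub>?R\<^esub> \<zero>\<^bsub>?R\<^esub> \<otimes>\<^bsub>?R\<^esub> x" using xc by simp
            then show ?thesis using M.zero_closed R.zero_closed by (simp only: monoid.simps) blast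
          qed
          show "y \<otimes>\<^bsub>add_monoid ?R\<^esub> z \<in> ?N" if yz: "y \<in> ?N" "z \<in> ?N" for y z
          proof -
            obtain m r m' r' where *: "m \<in> M" "r \<in> carrier ?R" "m' \<in> M" "r' \<in> carrier ?R"
              "y = m \<oplus>\<^bsub>?R\<^esub> r \<otimes>\<^bsub>?R\<^esub> x" "z = m' \<oplus>\<^bsub>?R\<^esub> r' \<otimes>\<^bsub>?R\<^esub> x" using yz by blast
            have c: "m \<in> carrier ?R" "m' \<in> carrier ?R" using * M.a_subset by blast+
            have "y \<oplus>\<^bsub>?R\<^esub> z = (m \<oplus>\<^bsub>?R\<^esub> m') \<oplus>\<^bsub>?R\<^esub> (r \<oplus>\<^bsub>?R\<^esub> r') \<otimes>\<^bsub>?R\<^esub> x"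
              unfolding * using * c xc by (simp add: R.l_distr R.a_ac)
            moreover have "m \<oplus>\<^bsub>?R\<^esub> m' \<in> M" "r \<oplus>\<^bsub>?R\<^esub> r' \<in> carrier ?R" using * M.a_closed by auto
            ultimately show ?thesis by auto
          qed
          show "inv\<^bsub>add_monoid ?R\<^esub> y \<in> ?N" if y: "y \<in> ?N" for y
          proof -
            obtain m r where *: "m \<in> M" "r \<in> carrier ?R" "y = m \<oplus>\<^bsub>?R\<^esub> r \<otimes>\<^bsub>?R\<^esub> x" using y by blast
            have c: "m \<in> carrier ?R" using * M.a_subset by blast
            have "\<ominus>\<^bsub>?R\<^esub> y = (\<ominus>\<^bsub>?R\<^esub> m) \<oplus>\<^bsub>?R\<^esub> (\<ominus>\<^bsub>?R\<^esub> r) \<otimes>\<^bsub>?R\<^esub> x"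
              unfolding * using * c xc by (simp add: R.l_minus R.minus_add R.a_comm)
            moreover have "\<ominus>\<^bsub>?R\<^esub> m \<in> M" "\<ominus>\<^bsub>?R\<^esub> r \<in> carrier ?R" using * M.a_inv_closed by auto
            ultimately show ?thesis unfolding a_inv_def by auto
          qed
        qed
        show "a \<otimes>\<^bsub>?R\<^esub> y \<in> ?N" if a: "a \<in> carrier ?R" and y: "y \<in> ?N" for a y
        proof -
          obtain m r where *: "m \<in> M" "r \<in> carrier ?R" "y = m \<oplus>\<^bsub>?R\<^esub> r \<otimes>\<^bsub>?R\<^esub> x" using y by blast
          have c: "m \<in> carrier ?R" using * M.a_subset by blast
          have "a \<otimes>\<^bsub>?R\<^esub> y = (a \<otimes>\<^bsub>?R\<^esub> m) \<oplus>\<^bsub>?R\<^esub> (a \<otimes>\<^bsub>?R\<^esub> r) \<otimes>\<^bsub>?R\<^esub> x"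
            unfolding * using * c xc a by (simp add: R.r_distr R.m_assoc)
          moreover have "a \<otimes>\<^bsub>?R\<^esub> m \<in> M" "a \<otimes>\<^bsub>?R\<^esub> r \<in> carrier ?R" using * mult a by auto
          ultimately show ?thesis by blast
        qed
      qed
      have "M \<subseteq> ?N"
      proof
        fix m assume m: "m \<in> M"
        then have "m = m \<oplus>\<^bsub>?R\<^esub> \<zero>\<^bsub>?R\<^esub> \<otimes>\<^bsub>?R\<^esub> x" using xc M.a_subset by auto
        then show "m \<in> ?N" using m R.zero_closed by blast
      qed
      moreover have "x \<in> ?N"
      proof -
        have "x = \<zero>\<^bsub>?R\<^esub> \<oplus>\<^bsub>?R\<^esub> \<one>\<^bsub>?R\<^esub> \<otimes>\<^bsub>?R\<^esub> x" using xc by simp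
        then show ?thesis using M.zero_closed R.one_closed by blast
      qed
      ultimately have "?N = carrier ?R" using M(3)[OF N] xM by blast
      then have "\<one>\<^bsub>?R\<^esub> \<in> ?N" using R.one_closed by blast
      then obtain m r where mr: "m \<in> M" "r \<in> carrier ?R" "\<one>\<^bsub>?R\<^esub> = m \<oplus>\<^bsub>?R\<^esub> r \<otimes>\<^bsub>?R\<^esub> x" by blast
      obtain a b where ab: "a \<in> carrier KQ" "r = coset L a" "b \<in> long_elts 1" "x = coset L b"
        using mr(2) x unfolding trunc_carrier by blast
      let ?y = "a \<otimes>\<^bsub>KQ\<^esub> b"
      have y: "?y \<in> long_elts 1" using long_elts_mult[of a 0 b 1] ab by (simp add: long_elts_0)
      have rx: "r \<otimes>\<^bsub>?R\<^esub> x = coset L ?y" unfolding ab by (rule coset_mult[OF ab(1) long_elts_carrier[OF ab(3)]])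
      have "coset L ?y [^]\<^bsub>?R\<^esub> k \<in> coset L ` long_elts k" for k :: nat
      proof (induction k)
        case 0
        show ?case using imageI[OF KQ_one_carrier, of "coset L"]
          by (simp only: R.nat_pow_0 coset_one[symmetric] long_elts_0)
      next
        case (Suc k)
        then obtain z where z: "z \<in> long_elts k" "coset L ?y [^]\<^bsub>?R\<^esub> k = coset L z" by blast
        have "coset L ?y [^]\<^bsub>?R\<^esub> Suc k = coset L (z \<otimes>\<^bsub>KQ\<^esub> ?y)"
          using z(2) coset_mult[OF long_elts_carrier[OF z(1)] long_elts_carrier[OF y], of L] by simp
        then show ?case using long_elts_mult[OF z(1) y] by auto
      qed
      then obtain z where "z \<in> long_elts (L + 1)" "coset L ?y [^]\<^bsub>?R\<^esub> (L + 1) = coset L z" by blast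
      then have "coset L ?y [^]\<^bsub>?R\<^esub> (L + 1) = \<zero>\<^bsub>?R\<^esub>" using coset_zero unfolding trunc_ideal_eq by metis
      then have "M = carrier ?R"
        using R.m_closed[OF mr(2) xc] mr(3)[symmetric] unfolding rx[symmetric]
        by (intro left_ideal_nilpotent_complement[OF trunc_ring M(1) mr(1)])
      then show False using M(2) by blast
    qed
  qed
qed

text \<open>Every path of length \<open>l + 1\<close> is the product of an arrow and a path of length \<open>l\<close>.\<close>

lemma trunc_jacobson_power:
  "jacobson_power (trunc_algebra Q L :: (('v, 'e) path \<Rightarrow> 'k::field) set ring) l = coset L ` long_elts l"
proof (induction l)
  case 0
  show ?case by (simp add: trunc_carrier long_elts_0)
next
  case (Suc l)
  let ?R = "trunc_algebra Q L :: (('v, 'e) path \<Rightarrow> 'k::field) set ring"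
  let ?P = "ideal_prod ?R (coset L ` long_elts 1) (coset L ` long_elts l)"
  have "x \<in> coset L ` (long_elts (Suc l) :: (('v, 'e) path \<Rightarrow> 'k) set)" if "x \<in> ?P" for x
    using that
  proof induction
    case (prod i j)
    then obtain a b where ab: "a \<in> long_elts 1" "b \<in> long_elts l" "i = coset L a" "j = coset L b" by blast
    have "i \<otimes>\<^bsub>?R\<^esub> j = coset L (a \<otimes>\<^bsub>KQ\<^esub> b)"
      unfolding ab by (rule coset_mult[OF long_elts_carrier[OF ab(1)] long_elts_carrier[OF ab(2)]])
    then show ?case using long_elts_mult[OF ab(1,2)] by auto
  next
    case (sum s1 s2)
    then obtain a b where ab: "a \<in> long_elts (Suc l)" "b \<in> long_elts (Suc l)" "s1 = coset L a" "s2 = coset L b" by blast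
    have "s1 \<oplus>\<^bsub>?R\<^esub> s2 = coset L (a + b)"
      unfolding ab by (rule coset_add[OF long_elts_carrier[OF ab(1)] long_elts_carrier[OF ab(2)]])
    then show ?case using long_elts_plus[OF ab(1,2)] by auto
  qed
  moreover have "coset L a \<in> ?P" if a: "a \<in> long_elts (Suc l)" for a :: "('v, 'e) path \<Rightarrow> 'k"
  proof -
    have "a \<in> carrier KQ" "{w. a w \<noteq> 0} \<subseteq> {w. Suc l \<le> length (snd w)}"
      using a by (auto simp: long_elts_def)
    then have "a \<in> carrier KQ \<and> coset L a \<in> ?P"
    proof (induction a rule: KQ_support_induct)
      case zero
      have "0 \<otimes>\<^bsub>KQ\<^esub> 0 = (0 :: ('v, 'e) path \<Rightarrow> 'k)" by (auto simp: KQ_mult fun_eq_iff)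
      then have "coset L (0 :: ('v, 'e) path \<Rightarrow> 'k) = coset L 0 \<otimes>\<^bsub>?R\<^esub> coset L 0"
        by (simp only: coset_mult[OF KQ_zero_carrier KQ_zero_carrier])
      also have "\<dots> \<in> ?P" by (intro ideal_prod.prod imageI long_elts_0)
      finally show ?case using KQ_zero_carrier by blast
    next
      case (plus f g)
      then show ?case using ideal_prod.sum[of "coset L f" ?R _ _ "coset L g"] coset_add KQ_carrier_plus
        by metis
    next
      case (path c w)
      obtain u p where w: "w = (u, p)" by (cases w)
      let ?p = "take l p" and ?q = "drop l p"
      have wp: "(u, ?p @ ?q) \<in> paths Q" using path w by simp
      have 1: "vscale c (path_elt (awlast u ?p, ?q)) \<in> long_elts 1"
        using wp path w unfolding path_append by (intro long_elts_scale long_elts_path) auto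
      have 2: "path_elt (u, ?p) \<in> long_elts l"
        using wp path w unfolding path_append by (intro long_elts_path) auto
      have "vscale c (path_elt (awlast u ?p, ?q)) \<otimes>\<^bsub>KQ\<^esub> path_elt (u, ?p) = vscale c (path_elt w)"
        unfolding KQ_scale_mult KQ_path_mult[OF wp] by (simp add: w)
      then have "coset L (vscale c (path_elt w)) =
          coset L (vscale c (path_elt (awlast u ?p, ?q))) \<otimes>\<^bsub>?R\<^esub> coset L (path_elt (u, ?p))"
        using coset_mult[OF long_elts_carrier[OF 1] long_elts_carrier[OF 2], of L] by simp
      also have "\<dots> \<in> ?P" by (intro ideal_prod.prod imageI 1 2)
      finally show ?case using KQ_carrier_scale[OF KQ_path_elt[OF path(2)]] by blast
    qed
    then show ?thesis by blast
  qed
  ultimately show ?case unfolding jacobson_power.simps trunc_radical Suc by blast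
qed

end

section \<open>Radical and annihilator filtrations in terms of paths\<close>

definition std_vec :: "'b \<Rightarrow> 'b \<Rightarrow> 'k::field" where
  "std_vec z = (\<lambda>z'. if z' = z then 1 else 0)"

lemma kspace_subspace: "fvs.subspace (kspace d)"
  by (auto simp: fvs.subspace_def kspace_def vscale_apply)

lemma kspaceD: "m \<in> kspace d \<Longrightarrow> d i \<le> r \<Longrightarrow> m (i, r) = 0"
  by (auto simp: kspace_def)

lemma vertex_act_apply: "vertex_act i m (j, r) = (if j = i then m (j, r) else 0)"
  by (simp add: vertex_act_def)

lemma vertex_act_add: "vertex_act i (m + n) = vertex_act i m + vertex_act i n"
  by (auto simp: fun_eq_iff vertex_act_apply)

lemma vertex_act_scale: "vertex_act i (vscale c m) = vscale c (vertex_act i m)"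
  by (auto simp: fun_eq_iff vertex_act_apply vscale_apply)

lemma vertex_act_0: "vertex_act i 0 = 0"
  by (auto simp: fun_eq_iff vertex_act_apply)

lemma vertex_act_vertex_act: "vertex_act i (vertex_act j m) = (if i = j then vertex_act i m else 0)"
  by (auto simp: fun_eq_iff vertex_act_apply)

lemma vertex_act_idem: "vertex_act i (vertex_act i m) = vertex_act i m"
  by (simp add: vertex_act_vertex_act)

lemma vertex_act_kspace: "m \<in> kspace d \<Longrightarrow> vertex_act i m \<in> kspace d"
  by (auto simp: kspace_def vertex_act_apply)

lemma vertex_act_semilinear: "semilinear_on id V (vertex_act i)"
  unfolding semilinear_on_def using field_auto_id by (simp add: vertex_act_add vertex_act_scale)

text \<open>A subspace of \<open>K\<^sup>d\<close> that is the direct sum of its components at the vertices.\<close>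

definition graded_sub :: "('v \<Rightarrow> nat) \<Rightarrow> ('v \<times> nat \<Rightarrow> 'k::field) set \<Rightarrow> bool" where
  "graded_sub d N \<longleftrightarrow> fvs.subspace N \<and> N \<subseteq> kspace d \<and> (\<forall>i. \<forall>m\<in>N. vertex_act i m \<in> N)"

lemma graded_sub_component:
  "graded_sub d N \<Longrightarrow> vertex_act i ` N = {m \<in> N. vertex_act i m = m}"
  unfolding graded_sub_def by (force simp: vertex_act_idem)

lemma graded_sub_component_subspace:
  assumes "graded_sub d N" shows "fvs.subspace (vertex_act i ` N)"
  using assms by (intro semilinear_on_subspace_image[OF vertex_act_semilinear]) (simp add: graded_sub_def)

lemma graded_sub_kspace: "graded_sub d (kspace d)"
  by (auto simp: graded_sub_def kspace_subspace vertex_act_kspace)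

lemma graded_sub_inter: "graded_sub d N \<Longrightarrow> graded_sub d N' \<Longrightarrow> graded_sub d (N \<inter> N')"
  by (auto simp: graded_sub_def fvs.subspace_inter)

lemma component_expansion:
  fixes m :: "'v \<times> nat \<Rightarrow> 'k::field"
  assumes m: "m \<in> kspace d"
  shows "vertex_act i m = (\<Sum>r<d i. vscale (m (i, r)) (std_vec (i, r)))"
proof
  fix z :: "'v \<times> nat"
  obtain j r where z: "z = (j, r)" by (cases z)
  have "(\<Sum>r'<d i. m (i, r') * std_vec (i, r') (j, r)) = (\<Sum>r'<d i. if r' = r then (if j = i then m (j, r) else 0) else 0)"
    by (intro sum.cong) (auto simp: std_vec_def)
  also have "\<dots> = (if j = i then m (j, r) else 0)" using kspaceD[OF m, of i r] by auto
  finally show "vertex_act i m z = (\<Sum>r<d i. vscale (m (i, r)) (std_vec (i, r))) z"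
    by (simp add: z sum_fun_apply vscale_apply vertex_act_apply)
qed

lemma kspace_component:
  "(vertex_act i ` kspace d :: ('v \<times> nat \<Rightarrow> 'k::field) set) = fvs.span ((\<lambda>r. std_vec (i, r)) ` {..<d i})" (is "?A = ?B")
proof
  show "?A \<subseteq> ?B"
  proof (rule image_subsetI)
    fix m :: "'v \<times> nat \<Rightarrow> 'k" assume m: "m \<in> kspace d"
    have "vertex_act i m = (\<Sum>r<d i. vscale (m (i, r)) (std_vec (i, r)))"
      by (rule component_expansion[OF m])
    then show "vertex_act i m \<in> ?B"
      unfolding span_family_iff[OF finite_lessThan] by (intro exI[of _ "\<lambda>r. m (i, r)"])
  qed
  have "std_vec (i, r) \<in> ?A" if r: "r < d i" for r
  proof (rule image_eqI)
    show "std_vec (i, r) = vertex_act i (std_vec (i, r) :: 'v \<times> nat \<Rightarrow> 'k)"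
      by (auto simp: fun_eq_iff vertex_act_apply std_vec_def)
    show "(std_vec (i, r) :: 'v \<times> nat \<Rightarrow> 'k) \<in> kspace d" using r by (auto simp: kspace_def std_vec_def)
  qed
  then show "?B \<subseteq> ?A"
    by (intro fvs.span_minimal graded_sub_component_subspace[OF graded_sub_kspace]) blast
qed

lemma indep_on_std_vec: "finite A \<Longrightarrow> inj_on g A \<Longrightarrow> indep_on A (\<lambda>r. std_vec (g r) :: 'b \<Rightarrow> 'k::field)"
  unfolding indep_on_def
proof (intro allI impI ballI)
  fix c :: "'a \<Rightarrow> 'k" and s
  assume A: "finite A" "inj_on g A" and 0: "(\<Sum>r\<in>A. vscale (c r) (std_vec (g r))) = 0" and s: "s \<in> A"
  have "0 = (\<Sum>r\<in>A. vscale (c r) (std_vec (g r))) (g s)" unfolding 0 by simp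
  also have "\<dots> = (\<Sum>r\<in>A. if r = s then c s else 0)"
    unfolding sum_fun_apply vscale_apply std_vec_def
    by (intro sum.cong) (use A(2) s in \<open>auto dest: inj_onD\<close>)
  also have "\<dots> = c s" using A(1) s by simp
  finally show "c s = 0" by simp
qed

lemma fin_dim_component: "fin_dim (vertex_act i ` kspace d)"
  unfolding kspace_component by (rule fin_dim_span) simp

lemma graded_sub_fin_dim: "graded_sub d N \<Longrightarrow> fin_dim (vertex_act i ` N)"
  by (rule fin_dim_mono[OF fin_dim_component[of i d]]) (auto simp: graded_sub_def)

lemma dimvec_kspace: "dimvec (kspace d :: ('v \<times> nat \<Rightarrow> 'k::field) set) i = d i"
  unfolding dimvec_def kspace_component
proof (subst dim_eq_card_family[OF _ _ _ order_refl])
  show "indep_on {..<d i} (\<lambda>r. std_vec (i, r) :: 'v \<times> nat \<Rightarrow> 'k)"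
    by (rule indep_on_std_vec) (auto simp: inj_on_def)
qed (auto intro: fvs.span_base)

lemma dimvec_mono: "graded_sub d N' \<Longrightarrow> N \<subseteq> N' \<Longrightarrow> dimvec N i \<le> dimvec N' i"
  unfolding dimvec_def by (rule dim_mono[OF graded_sub_fin_dim]) auto

lemma dimvec_0: "dimvec {0} i = 0"
  unfolding dimvec_def using fvs.dim_le_card[of "{0}" "{}"] by (simp add: vertex_act_0)

lemma graded_sub_sum_components:
  fixes m :: "'v \<times> nat \<Rightarrow> 'k::field"
  assumes "m \<in> kspace d" "finite V" "\<forall>i. i \<notin> V \<longrightarrow> d i = 0"
  shows "m = (\<Sum>i\<in>V. vertex_act i m)"
proof
  fix z :: "'v \<times> nat"
  obtain j r where z: "z = (j, r)" by (cases z)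
  have "(\<Sum>i\<in>V. vertex_act i m (j, r)) = (\<Sum>i\<in>V. if i = j then m (j, r) else 0)"
    by (intro sum.cong) (auto simp: vertex_act_apply)
  also have "\<dots> = m (j, r)" using assms kspaceD[OF assms(1), of j r] by (auto simp: sum.delta)
  finally show "m z = (\<Sum>i\<in>V. vertex_act i m) z" by (simp add: z sum_fun_apply)
qed

lemma graded_sub_subsetI:
  assumes "graded_sub d N" "fvs.subspace N'" "finite V" "\<forall>i. i \<notin> V \<longrightarrow> d i = 0"
    "\<And>i. i \<in> V \<Longrightarrow> vertex_act i ` N \<subseteq> N'"
  shows "N \<subseteq> N'"
proof
  fix m assume m: "m \<in> N"
  then have "m = (\<Sum>i\<in>V. vertex_act i m)"
    using assms graded_sub_sum_components unfolding graded_sub_def by blast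
  also have "\<dots> \<in> N'" using m assms by (intro fvs.subspace_sum) auto
  finally show "m \<in> N'" .
qed

lemma arrow_act_add: "arrow_act Q d x \<alpha> (m + n) = arrow_act Q d x \<alpha> m + arrow_act Q d x \<alpha> n"
  by (auto simp: fun_eq_iff arrow_act_def distrib_left sum.distrib)

lemma arrow_act_scale: "arrow_act Q d x \<alpha> (vscale c m) = vscale c (arrow_act Q d x \<alpha> m)"
  by (auto simp: fun_eq_iff arrow_act_def vscale_apply sum_distrib_left mult.left_commute)

lemma arrow_act_0: "arrow_act Q d x \<alpha> 0 = 0"
  by (auto simp: fun_eq_iff arrow_act_def)

lemma arrow_act_semilinear: "semilinear_on id V (arrow_act Q d x \<alpha>)"
  unfolding semilinear_on_def using field_auto_id by (simp add: arrow_act_add arrow_act_scale)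

lemma arrow_act_kspace: "arrow_act Q d x \<alpha> m \<in> kspace d"
  by (auto simp: kspace_def arrow_act_def)

lemma arrow_act_tail: "arrow_act Q d x \<alpha> (vertex_act j m) = (if j = tail Q \<alpha> then arrow_act Q d x \<alpha> m else 0)"
  by (auto simp: fun_eq_iff arrow_act_def vertex_act_apply)

lemma arrow_act_head: "vertex_act j (arrow_act Q d x \<alpha> m) = (if j = head Q \<alpha> then arrow_act Q d x \<alpha> m else 0)"
  by (auto simp: fun_eq_iff arrow_act_def vertex_act_apply)

lemma fold_arrow_act_add: "fold (arrow_act Q d x) p (m + n) = fold (arrow_act Q d x) p m + fold (arrow_act Q d x) p n"
  by (induction p arbitrary: m n) (simp_all only: fold_simps arrow_act_add)

lemma fold_arrow_act_scale: "fold (arrow_act Q d x) p (vscale c m) = vscale c (fold (arrow_act Q d x) p m)"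
  by (induction p arbitrary: m) (simp_all only: fold_simps arrow_act_scale)

lemma path_act_semilinear: "semilinear_on id V (path_act Q d x w)"
  unfolding semilinear_on_def path_act_def using field_auto_id
  by (cases w) (simp add: fold_arrow_act_add fold_arrow_act_scale vertex_act_add vertex_act_scale)

lemma path_act_add: "path_act Q d x w (m + n) = path_act Q d x w m + path_act Q d x w n"
  by (rule semilinear_on_add[OF path_act_semilinear[of UNIV]]) auto

lemma path_act_scale: "path_act Q d x w (vscale c m) = vscale c (path_act Q d x w m)"
  using semilinear_on_scale[OF path_act_semilinear[of UNIV], of m Q d x w c] by simp

lemma path_act_0: "path_act Q d x w 0 = 0"
  by (rule semilinear_on_0[OF path_act_semilinear[of UNIV]]) auto

lemma fold_arrow_act_kspace: "m \<in> kspace d \<Longrightarrow> fold (arrow_act Q d x) p m \<in> kspace d"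
  by (induction p arbitrary: m) (auto simp: arrow_act_kspace)

lemma path_act_kspace: "m \<in> kspace d \<Longrightarrow> path_act Q d x w m \<in> kspace d"
  by (cases w) (simp add: path_act_def fold_arrow_act_kspace vertex_act_kspace)

lemma path_act_Nil: "path_act Q d x (u, []) m = vertex_act u m"
  by (simp add: path_act_def)

lemma path_act_arrow: "path_act Q d x (tail Q \<alpha>, [\<alpha>]) m = arrow_act Q d x \<alpha> m"
  by (simp add: path_act_def arrow_act_tail)

lemma path_act_snoc: "path_act Q d x (u, p @ [\<alpha>]) m = arrow_act Q d x \<alpha> (path_act Q d x (u, p) m)"
  by (simp add: path_act_def)

context quiver
begin

lemma path_act_end:
  "vertex_act j (path_act Q d x (u, p) m) = (if j = awlast u p then path_act Q d x (u, p) m else 0)"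
proof (cases p rule: rev_cases)
  case Nil
  then show ?thesis by (simp add: path_act_Nil vertex_act_vertex_act)
next
  case (snoc p' \<alpha>)
  then show ?thesis by (simp add: path_act_snoc arrow_act_head awlast_append)
qed

lemma path_act_append: "path_act Q d x (u, p @ q) m = path_act Q d x (awlast u p, q) (path_act Q d x (u, p) m)"
proof -
  have "path_act Q d x (awlast u p, q) (path_act Q d x (u, p) m) =
      fold (arrow_act Q d x) q (vertex_act (awlast u p) (path_act Q d x (u, p) m))"
    by (simp only: path_act_def prod.case)
  also have "\<dots> = path_act Q d x (u, p @ q) m"
    unfolding path_act_end by (simp add: path_act_def)
  finally show ?thesis by (rule sym)
qed

lemma path_act_start: "path_act Q d x (u, p) (vertex_act j m) = (if j = u then path_act Q d x (u, p) m else 0)"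
proof -
  have "path_act Q d x (u, p) (vertex_act j m) = fold (arrow_act Q d x) p (vertex_act u (vertex_act j m))"
    by (simp only: path_act_def prod.case)
  also have "\<dots> = (if j = u then path_act Q d x (u, p) m else 0)"
    using fold_arrow_act_scale[of Q d x p 0 0] unfolding vertex_act_vertex_act
    by (simp add: path_act_def)
  finally show ?thesis .
qed

lemma finite_paths_length: "finite {w \<in> paths Q. length (snd w) = l}"
proof (rule finite_subset)
  show "{w \<in> paths Q. length (snd w) = l} \<subseteq> verts Q \<times> {p. set p \<subseteq> arcs Q \<and> length p = l}"
    by (auto simp: path_iff awalk_def)
  show "finite (verts Q \<times> {p. set p \<subseteq> arcs Q \<and> length p = l})"
    using finite_lists_length_eq[OF finite_arcs] by simp
qed

lemma KQ_act_superset: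
  assumes "finite W" "{w. a w \<noteq> 0} \<subseteq> W"
  shows "KQ_act Q d x a m = (\<Sum>w\<in>W. vscale (a w) (path_act Q d x w m))"
  unfolding KQ_act_def by (rule sum.mono_neutral_left) (use assms in \<open>auto simp: fun_eq_iff vscale_apply\<close>)

lemma KQ_act_add:
  assumes "a \<in> carrier KQ" "b \<in> carrier KQ"
  shows "KQ_act Q d x (a + b) m = KQ_act Q d x a m + KQ_act Q d x b m"
proof -
  let ?W = "{w. a w \<noteq> 0} \<union> {w. b w \<noteq> 0}"
  have W: "finite ?W" "{w. a w \<noteq> 0} \<subseteq> ?W" "{w. b w \<noteq> 0} \<subseteq> ?W" "{w. (a + b) w \<noteq> 0} \<subseteq> ?W"
    using assms by (auto simp: KQ_carrier)
  show ?thesis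
    unfolding KQ_act_superset[OF W(1,2)] KQ_act_superset[OF W(1,3)] KQ_act_superset[OF W(1,4)]
      sum.distrib[symmetric]
    by (intro sum.cong) (auto simp: fun_eq_iff vscale_apply distrib_right)
qed

lemma KQ_act_scale_path:
  fixes m :: "'v \<times> nat \<Rightarrow> 'k::field"
  shows "KQ_act Q d x (vscale c (path_elt w)) m = vscale c (path_act Q d x w m)"
proof -
  have "KQ_act Q d x (vscale c (path_elt w)) m =
      (\<Sum>v\<in>{w}. vscale (vscale c (path_elt w) v) (path_act Q d x v m))"
    by (rule KQ_act_superset) (auto simp: path_elt_def vscale_apply split: if_splits)
  then show ?thesis by (simp add: path_elt_def vscale_apply)
qed

lemma KQ_act_path: "KQ_act Q d x (path_elt w) m = path_act Q d x w m"
  using KQ_act_scale_path[of d x 1 w m] by simp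

lemma path_act_long_0:
  assumes "\<And>w m. w \<in> paths Q \<Longrightarrow> length (snd w) = n \<Longrightarrow> m \<in> M \<Longrightarrow> path_act Q d x w m = 0"
    and "(u, p) \<in> paths Q" "n \<le> length p" "m \<in> M"
  shows "path_act Q d x (u, p) m = 0"
proof -
  have "path_act Q d x (u, p) m = path_act Q d x (awlast u (take n p), drop n p) (path_act Q d x (u, take n p) m)"
    using path_act_append[of d x u "take n p" "drop n p" m] by (simp only: append_take_drop_id)
  also have "path_act Q d x (u, take n p) m = 0" using assms path_take by (intro assms(1)) auto
  finally show ?thesis by (simp only: path_act_0)
qed

lemma rep_variety_iff:
  fixes x :: "('e, 'k::field) point"
  shows "x \<in> rep_variety Q L d \<longleftrightarrow> (\<forall>z. z \<notin> rep_coords Q d \<longrightarrow> x z = 0) \<and>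
    (\<forall>w\<in>paths Q. length (snd w) = L + 1 \<longrightarrow> (\<forall>m\<in>kspace d. path_act Q d x w m = 0))"
    (is "_ \<longleftrightarrow> ?A \<and> ?B")
proof -
  have "(\<forall>a\<in>trunc_ideal Q L. \<forall>m\<in>kspace d. KQ_act Q d x a m = 0) \<longleftrightarrow> ?B" (is "?C \<longleftrightarrow> ?B")
  proof
    assume C: ?C
    show ?B
    proof (intro ballI impI)
      fix w and m :: "'v \<times> nat \<Rightarrow> 'k" assume w: "w \<in> paths Q" "length (snd w) = L + 1" and m: "m \<in> kspace d"
      have "(path_elt w :: _ \<Rightarrow> 'k) \<in> trunc_ideal Q L" unfolding trunc_ideal_eq using w by (intro long_elts_path) auto
      then have "KQ_act Q d x (path_elt w) m = 0" using C m by blast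
      then show "path_act Q d x w m = 0" by (simp only: KQ_act_path)
    qed
  next
    assume B: ?B
    show ?C
    proof (intro ballI)
      fix a :: "('v, 'e) path \<Rightarrow> 'k" and m :: "'v \<times> nat \<Rightarrow> 'k"
      assume a: "a \<in> trunc_ideal Q L" and m: "m \<in> kspace d"
      have "path_act Q d x w m = 0" if w: "a w \<noteq> 0" for w
      proof -
        obtain u p where up: "w = (u, p)" by (cases w)
        have "L + 1 \<le> length p" "(u, p) \<in> paths Q"
          using a w unfolding trunc_ideal_eq long_elts_def KQ_carrier up by fastforce+
        then show ?thesis unfolding up using B m by (intro path_act_long_0[of "L + 1" "kspace d"]) auto
      qed
      then show "KQ_act Q d x a m = 0" unfolding KQ_act_def
        by (intro sum.neutral) (simp add: fvs.scale_zero_right)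
    qed
  qed
  then show ?thesis unfolding rep_variety_def by blast
qed

lemma lact_subset_coset:
  assumes "x \<in> rep_variety Q L d" "a \<in> carrier KQ" "m \<in> kspace d" "B \<subseteq> coset L a" "B \<noteq> {}"
  shows "lact Q d x B m = KQ_act Q d x a m"
proof -
  have "KQ_act Q d x b m = KQ_act Q d x a m" if b: "b \<in> B" for b
  proof -
    have i: "b - a \<in> trunc_ideal Q L" using subsetD[OF assms(4) b] unfolding mem_coset .
    then have "b - a \<in> carrier KQ" unfolding trunc_ideal_eq by (rule long_elts_carrier)
    then have "KQ_act Q d x (b - a + a) m = KQ_act Q d x (b - a) m + KQ_act Q d x a m"
      using assms(2) by (rule KQ_act_add)
    also have "KQ_act Q d x (b - a) m = 0" using assms(1,3) i unfolding rep_variety_def by blast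
    finally show ?thesis by (simp only: diff_add_cancel add_0_left)
  qed
  then have "(\<lambda>a. KQ_act Q d x a m) ` B = (\<lambda>_. KQ_act Q d x a m) ` B" by (rule image_cong[OF refl])
  then have "(\<lambda>a. KQ_act Q d x a m) ` B = {KQ_act Q d x a m}"
    unfolding image_constant_conv using assms(5) by simp
  then show ?thesis unfolding lact_def by (simp only: the_elem_eq)
qed

lemma mem_coset_long: "b \<in> coset L a \<longleftrightarrow> b - a \<in> long_elts (L + 1)"
  unfolding mem_coset unfolding trunc_ideal_eq ..

lemma coset_self: "a \<in> coset L a"
  unfolding mem_coset unfolding diff_self trunc_ideal_eq by (rule long_elts_0)

lemma lact_coset:
  assumes "x \<in> rep_variety Q L d" "a \<in> carrier KQ" "m \<in> kspace d"
  shows "lact Q d x (coset L a) m = KQ_act Q d x a m"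
proof (rule lact_subset_coset[OF assms order_refl])
  show "coset L a \<noteq> {}" using ex_in_conv[of "coset L a"] exI[of "\<lambda>b. b \<in> coset L a", OF coset_self] by (simp only: simp_thms)
qed

text \<open>From here on, the algebra enters only through the actions of the paths.\<close>

lemma rad_sub_paths:
  fixes x :: "('e, 'k::field) point"
  assumes x: "x \<in> rep_variety Q L d"
  shows "rad_sub Q L d x l =
    fvs.span {path_act Q d x w m | w m. w \<in> paths Q \<and> length (snd w) = l \<and> m \<in> kspace d}"
    (is "_ = fvs.span ?P")
proof -
  let ?G = "{lact Q d x lam m | lam m. lam \<in> jacobson_power (trunc_algebra Q L) l \<and> m \<in> kspace d}"
  have "?G \<subseteq> fvs.span ?P"
  proof
    fix n assume "n \<in> ?G"
    then obtain a :: "('v, 'e) path \<Rightarrow> 'k" and m where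
      a: "a \<in> long_elts l" and m: "m \<in> kspace d" and n: "n = lact Q d x (coset L a) m"
      unfolding trunc_jacobson_power by blast
    have "path_act Q d x w m \<in> fvs.span ?P" if w: "a w \<noteq> 0" for w
    proof -
      obtain u p where up: "w = (u, p)" by (cases w)
      have l: "l \<le> length p" and P: "(u, p) \<in> paths Q"
        using a w unfolding long_elts_def KQ_carrier up by fastforce+
      let ?k = "length p - l"
      have "path_act Q d x w m = path_act Q d x (awlast u (take ?k p), drop ?k p) (path_act Q d x (u, take ?k p) m)"
        unfolding up using path_act_append[of d x u "take ?k p" "drop ?k p" m] by (simp only: append_take_drop_id)
      moreover have "(awlast u (take ?k p), drop ?k p) \<in> paths Q" "length (snd (awlast u (take ?k p), drop ?k p)) = l"
        using path_drop[OF P] l by auto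
      moreover have "path_act Q d x (u, take ?k p) m \<in> kspace d" by (rule path_act_kspace[OF m])
      ultimately show ?thesis by (intro fvs.span_base) blast
    qed
    then have "KQ_act Q d x a m \<in> fvs.span ?P" unfolding KQ_act_def
      by (intro fvs.span_sum fvs.span_scale) blast
    then show "n \<in> fvs.span ?P" unfolding n lact_coset[OF x long_elts_carrier[OF a] m] .
  qed
  moreover have "?P \<subseteq> ?G"
  proof
    fix n assume "n \<in> ?P"
    then obtain w m where w: "w \<in> paths Q" "length (snd w) = l" and m: "m \<in> kspace d" and n: "n = path_act Q d x w m"
      by blast
    have p: "path_elt w \<in> long_elts l" using w by (intro long_elts_path) auto
    have "n = lact Q d x (coset L (path_elt w)) m"
      unfolding lact_coset[OF x long_elts_carrier[OF p] m] n KQ_act_path ..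
    moreover have "coset L (path_elt w) \<in> jacobson_power (trunc_algebra Q L) l"
      unfolding trunc_jacobson_power using p by (rule imageI)
    ultimately show "n \<in> ?G" using m by blast
  qed
  ultimately show ?thesis unfolding rad_sub_def
    by (intro antisym fvs.span_minimal fvs.subspace_span fvs.span_mono)
qed

lemma ann_sub_paths:
  fixes x :: "('e, 'k::field) point"
  assumes x: "x \<in> rep_variety Q L d" and N: "N \<subseteq> kspace d"
  shows "ann_sub Q L d x N l = {n \<in> N. \<forall>w\<in>paths Q. length (snd w) = l \<longrightarrow> path_act Q d x w n = 0}"
proof -
  have "(\<forall>lam\<in>jacobson_power (trunc_algebra Q L) l. lact Q d x lam n = 0) \<longleftrightarrow>
    (\<forall>w\<in>paths Q. length (snd w) = l \<longrightarrow> path_act Q d x w n = 0)" (is "?A \<longleftrightarrow> ?B") if n: "n \<in> N" for n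
  proof
    have m: "n \<in> kspace d" using n N by blast
    show ?B if A: ?A
    proof (intro ballI impI)
      fix w assume w: "w \<in> paths Q" "length (snd w) = l"
      have p: "(path_elt w :: _ \<Rightarrow> 'k) \<in> long_elts l" using w by (intro long_elts_path) auto
      have "lact Q d x (coset L (path_elt w)) n = 0"
        using A imageI[OF p, of "coset L"] unfolding trunc_jacobson_power by blast
      then show "path_act Q d x w n = 0" unfolding lact_coset[OF x long_elts_carrier[OF p] m] KQ_act_path .
    qed
    show ?A if B: ?B
    proof
      fix lam assume "lam \<in> jacobson_power (trunc_algebra Q L :: (('v, 'e) path \<Rightarrow> 'k) set ring) l"
      then obtain a :: "('v, 'e) path \<Rightarrow> 'k" where a: "a \<in> long_elts l" "lam = coset L a"
        unfolding trunc_jacobson_power by blast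
      have "path_act Q d x w n = 0" if w: "a w \<noteq> 0" for w
      proof -
        obtain u p where up: "w = (u, p)" by (cases w)
        have "l \<le> length p" "(u, p) \<in> paths Q"
          using a w unfolding long_elts_def KQ_carrier up by fastforce+
        then show ?thesis unfolding up using B by (intro path_act_long_0[of l "{n}"]) auto
      qed
      then have "KQ_act Q d x a n = 0" unfolding KQ_act_def
        by (intro sum.neutral) (simp add: fvs.scale_zero_right)
      then show "lact Q d x lam n = 0" unfolding a(2) lact_coset[OF x long_elts_carrier[OF a(1)] m] .
    qed
  qed
  then show ?thesis unfolding ann_sub_def by blast
qed


lemma dim_vectorsD: "d \<in> dim_vectors Q \<Longrightarrow> \<forall>i. i \<notin> verts Q \<longrightarrow> d i = 0"
  by (simp add: dim_vectors_def)

lemma arc_path: "\<alpha> \<in> arcs Q \<Longrightarrow> (tail Q \<alpha>, [\<alpha>]) \<in> paths Q"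
  by (simp add: path_iff awalk_def)

lemma path_snoc: "(u, p @ [\<alpha>]) \<in> paths Q \<longleftrightarrow> (u, p) \<in> paths Q \<and> \<alpha> \<in> arcs Q \<and> awlast u p = tail Q \<alpha>"
  unfolding path_append by (auto simp: path_iff awalk_def dest: awlast_if_cas)

lemma rad_sub_subspace: "fvs.subspace (rad_sub Q L d x l)"
  unfolding rad_sub_def by (rule fvs.subspace_span)

lemma rad_sub_path:
  assumes "x \<in> rep_variety Q L d" "w \<in> paths Q" "length (snd w) = l" "m \<in> kspace d"
  shows "path_act Q d x w m \<in> rad_sub Q L d x l"
  unfolding rad_sub_paths[OF assms(1)] using assms by (intro fvs.span_base) blast

lemma rad_sub_leastI:
  assumes "x \<in> rep_variety Q L d" "fvs.subspace W"
    "\<And>u p m. (u, p) \<in> paths Q \<Longrightarrow> length p = l \<Longrightarrow> m \<in> kspace d \<Longrightarrow> path_act Q d x (u, p) m \<in> W"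
  shows "rad_sub Q L d x l \<subseteq> W"
  unfolding rad_sub_paths[OF assms(1)] using assms(3) by (intro fvs.span_minimal assms(2)) auto

lemma linear_vimage_subspace: "semilinear_on id UNIV f \<Longrightarrow> fvs.subspace W \<Longrightarrow> fvs.subspace {m. f m \<in> W}"
  using semilinear_on_subspace_vimage[of id UNIV f W] by simp

lemma graded_sub_rad_sub:
  fixes x :: "('e, 'k::field) point"
  assumes x: "x \<in> rep_variety Q L d"
  shows "graded_sub d (rad_sub Q L d x l)"
  unfolding graded_sub_def
proof (intro conjI allI ballI)
  show "rad_sub Q L d x l \<subseteq> kspace d"
    by (rule rad_sub_leastI[OF x kspace_subspace]) (rule path_act_kspace)
  show "vertex_act i m \<in> rad_sub Q L d x l" if m: "m \<in> rad_sub Q L d x l" for i m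
  proof -
    have "rad_sub Q L d x l \<subseteq> {m. vertex_act i m \<in> rad_sub Q L d x l}"
    proof (rule rad_sub_leastI[OF x linear_vimage_subspace[OF vertex_act_semilinear rad_sub_subspace]])
      fix u p and n :: "'v \<times> nat \<Rightarrow> 'k" assume "(u, p) \<in> paths Q" "length p = l" "n \<in> kspace d"
      then have "path_act Q d x (u, p) n \<in> rad_sub Q L d x l" by (intro rad_sub_path[OF x]) auto
      then show "path_act Q d x (u, p) n \<in> {m. vertex_act i m \<in> rad_sub Q L d x l}"
        by (auto simp: path_act_end intro: fvs.subspace_0[OF rad_sub_subspace])
    qed
    then show ?thesis using m by blast
  qed
qed (rule rad_sub_subspace)

lemma rad_sub_kspace: "x \<in> rep_variety Q L d \<Longrightarrow> rad_sub Q L d x l \<subseteq> kspace d"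
  using graded_sub_rad_sub[of x L d l] unfolding graded_sub_def by blast

lemma rad_sub_0:
  assumes "x \<in> rep_variety Q L d" "d \<in> dim_vectors Q"
  shows "rad_sub Q L d x 0 = kspace d"
proof
  show "kspace d \<subseteq> rad_sub Q L d x 0"
  proof (rule graded_sub_subsetI[OF graded_sub_kspace rad_sub_subspace finite_verts dim_vectorsD[OF assms(2)]])
    fix i assume i: "i \<in> verts Q"
    show "vertex_act i ` kspace d \<subseteq> rad_sub Q L d x 0"
      using rad_sub_path[OF assms(1), of "(i, [])" 0] i by (auto simp: path_Nil path_act_Nil)
  qed
qed (rule rad_sub_kspace[OF assms(1)])

lemma rad_sub_arrow:
  fixes x :: "('e, 'k::field) point"
  assumes x: "x \<in> rep_variety Q L d" and \<alpha>: "\<alpha> \<in> arcs Q" and m: "m \<in> rad_sub Q L d x l"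
  shows "arrow_act Q d x \<alpha> m \<in> rad_sub Q L d x (Suc l)"
proof -
  have "rad_sub Q L d x l \<subseteq> {m. arrow_act Q d x \<alpha> m \<in> rad_sub Q L d x (Suc l)}"
  proof (rule rad_sub_leastI[OF x linear_vimage_subspace[OF arrow_act_semilinear rad_sub_subspace]])
    fix u p and n :: "'v \<times> nat \<Rightarrow> 'k" assume p: "(u, p) \<in> paths Q" "length p = l" and n: "n \<in> kspace d"
    have "arrow_act Q d x \<alpha> (path_act Q d x (u, p) n) \<in> rad_sub Q L d x (Suc l)"
    proof (cases "awlast u p = tail Q \<alpha>")
      case True
      then have "(u, p @ [\<alpha>]) \<in> paths Q" using p \<alpha> by (simp add: path_snoc)
      then show ?thesis unfolding path_act_snoc[symmetric] using p n by (intro rad_sub_path[OF x]) auto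
    next
      case False
      have "arrow_act Q d x \<alpha> (path_act Q d x (u, p) n) =
          arrow_act Q d x \<alpha> (vertex_act (tail Q \<alpha>) (path_act Q d x (u, p) n))"
        by (simp only: arrow_act_tail simp_thms if_True)
      also have "\<dots> = 0" using False by (simp add: path_act_end arrow_act_0)
      finally show ?thesis using fvs.subspace_0[OF rad_sub_subspace] by (simp only:)
    qed
    then show "path_act Q d x (u, p) n \<in> {m. arrow_act Q d x \<alpha> m \<in> rad_sub Q L d x (Suc l)}" by blast
  qed
  then show ?thesis using m by blast
qed

lemma rad_sub_antimono:
  fixes x :: "('e, 'k::field) point"
  assumes x: "x \<in> rep_variety Q L d" and "k \<le> l"
  shows "rad_sub Q L d x l \<subseteq> rad_sub Q L d x k"
proof (rule rad_sub_leastI[OF x rad_sub_subspace])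
  fix u p and m :: "'v \<times> nat \<Rightarrow> 'k" assume p: "(u, p) \<in> paths Q" "length p = l" and m: "m \<in> kspace d"
  let ?n = "l - k"
  have "path_act Q d x (u, p) m = path_act Q d x (awlast u (take ?n p), drop ?n p) (path_act Q d x (u, take ?n p) m)"
    using path_act_append[of d x u "take ?n p" "drop ?n p" m] by (simp only: append_take_drop_id)
  also have "\<dots> \<in> rad_sub Q L d x k"
    using assms(2) p path_drop[OF p(1)] by (intro rad_sub_path[OF x] path_act_kspace m) auto
  finally show "path_act Q d x (u, p) m \<in> rad_sub Q L d x k" .
qed

lemma rad_sub_end:
  fixes x :: "('e, 'k::field) point"
  assumes x: "x \<in> rep_variety Q L d" and "L < l"
  shows "rad_sub Q L d x l = {0}"
proof
  show "rad_sub Q L d x l \<subseteq> {0}"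
  proof (rule rad_sub_leastI[OF x fvs.subspace_single_0])
    fix u p and m :: "'v \<times> nat \<Rightarrow> 'k" assume p: "(u, p) \<in> paths Q" "length p = l" and m: "m \<in> kspace d"
    have "path_act Q d x (u, p) m = 0"
      using x[unfolded rep_variety_iff] p m assms(2) by (intro path_act_long_0[of "L + 1" "kspace d"]) auto
    then show "path_act Q d x (u, p) m \<in> {0}" by simp
  qed
qed (use fvs.subspace_0[OF rad_sub_subspace] in blast)

lemma graded_sub_ann_sub:
  assumes x: "x \<in> rep_variety Q L d" and N: "graded_sub d N"
  shows "graded_sub d (ann_sub Q L d x N l)"
proof -
  have sub: "N \<subseteq> kspace d" using N by (simp add: graded_sub_def)
  note eq = ann_sub_paths[OF x sub]
  show ?thesis unfolding graded_sub_def
  proof (intro conjI allI ballI)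
    show "fvs.subspace (ann_sub Q L d x N l)" unfolding eq
      using N by (auto simp: graded_sub_def fvs.subspace_def path_act_0 path_act_add path_act_scale)
    show "ann_sub Q L d x N l \<subseteq> kspace d" unfolding eq using sub by blast
    show "vertex_act i m \<in> ann_sub Q L d x N l" if "m \<in> ann_sub Q L d x N l" for i m
      using that N unfolding eq by (auto simp: graded_sub_def path_act_start)
  qed
qed

lemma ann_sub_inter:
  assumes x: "x \<in> rep_variety Q L d" and N: "N \<subseteq> kspace d"
  shows "ann_sub Q L d x N l = N \<inter> ann_sub Q L d x (kspace d) l"
  unfolding ann_sub_paths[OF x N] ann_sub_paths[OF x order_refl] using N by blast

lemma ann_sub_mono:
  assumes x: "x \<in> rep_variety Q L d" and N: "N \<subseteq> kspace d" and "k \<le> l"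
  shows "ann_sub Q L d x N k \<subseteq> ann_sub Q L d x N l"
  unfolding ann_sub_paths[OF x N]
proof (intro subsetI CollectI conjI ballI impI)
  fix n w assume n: "n \<in> {n \<in> N. \<forall>w\<in>paths Q. length (snd w) = k \<longrightarrow> path_act Q d x w n = 0}"
    and w: "w \<in> paths Q" "length (snd w) = l"
  obtain u p where up: "w = (u, p)" by (cases w)
  show "path_act Q d x w n = 0" unfolding up
    using n w assms(3) up by (intro path_act_long_0[of k "{n}"]) auto
qed blast

lemma ann_sub_end:
  assumes x: "x \<in> rep_variety Q L d" and N: "N \<subseteq> kspace d" and "L < l"
  shows "ann_sub Q L d x N l = N"
proof -
  have "ann_sub Q L d x N (L + 1) = N"
    unfolding ann_sub_paths[OF x N] using x[unfolded rep_variety_iff] N by blast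
  then show ?thesis using ann_sub_mono[OF x N, of "L + 1" l] assms(3)
    unfolding ann_sub_paths[OF x N, of l] by auto
qed

lemma ann_sub_0:
  assumes x: "x \<in> rep_variety Q L d" and N: "graded_sub d N" and d: "d \<in> dim_vectors Q"
  shows "ann_sub Q L d x N 0 = {0}"
proof
  have sub: "N \<subseteq> kspace d" using N by (simp add: graded_sub_def)
  show "ann_sub Q L d x N 0 \<subseteq> {0}"
  proof
    fix n assume n: "n \<in> ann_sub Q L d x N 0"
    have "n = (\<Sum>i\<in>verts Q. vertex_act i n)"
      using n sub graded_sub_sum_components[OF _ finite_verts dim_vectorsD[OF d]]
      unfolding ann_sub_paths[OF x sub] by blast
    also have "\<dots> = 0"
    proof (rule sum.neutral, intro ballI)
      fix i assume "i \<in> verts Q"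
      then have "path_act Q d x (i, []) n = 0"
        using n unfolding ann_sub_paths[OF x sub] by (auto simp: path_Nil)
      then show "vertex_act i n = 0" unfolding path_act_Nil .
    qed
    finally show "n \<in> {0}" by simp
  qed
  have "fvs.subspace (ann_sub Q L d x N 0)" using graded_sub_ann_sub[OF x N] by (simp add: graded_sub_def)
  then show "{0} \<subseteq> ann_sub Q L d x N 0" using fvs.subspace_0 by blast
qed

lemma socle_arrows:
  assumes x: "x \<in> rep_variety Q L d" and N: "N \<subseteq> kspace d"
  shows "socle Q L d x N = {n \<in> N. \<forall>\<alpha>\<in>arcs Q. arrow_act Q d x \<alpha> n = 0}"
proof -
  have "(\<forall>w\<in>paths Q. length (snd w) = 1 \<longrightarrow> path_act Q d x w n = 0) \<longleftrightarrow> (\<forall>\<alpha>\<in>arcs Q. arrow_act Q d x \<alpha> n = 0)" for n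
  proof
    assume a: "\<forall>w\<in>paths Q. length (snd w) = 1 \<longrightarrow> path_act Q d x w n = 0"
    show "\<forall>\<alpha>\<in>arcs Q. arrow_act Q d x \<alpha> n = 0"
      using a arc_path unfolding path_act_arrow[symmetric] by fastforce
  next
    assume a: "\<forall>\<alpha>\<in>arcs Q. arrow_act Q d x \<alpha> n = 0"
    show "\<forall>w\<in>paths Q. length (snd w) = 1 \<longrightarrow> path_act Q d x w n = 0"
    proof (intro ballI impI)
      fix w assume w: "w \<in> paths Q" "length (snd w) = 1"
      obtain u p where up: "w = (u, p)" by (cases w)
      then obtain \<alpha> where p: "p = [\<alpha>]" using w(2) by (auto simp: length_Suc_conv)
      then have "u = tail Q \<alpha>" "\<alpha> \<in> arcs Q" using w(1) up by (auto simp: path_iff awalk_def)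
      then show "path_act Q d x w n = 0" using a unfolding up p by (simp only: path_act_arrow)
    qed
  qed
  then show ?thesis unfolding ann_sub_paths[OF x N] by blast
qed

end

section \<open>Morphisms up to scalars and field automorphisms\<close>

text \<open>Three kinds of maps occur below: homomorphisms, isomorphisms onto a Galois twist, and the
  conjugation by an adjugate matrix, which commutes with each arrow only up to a scalar.
  All of them are compatible with the radical and annihilator filtrations.\<close>

definition scaled_map :: "('v, 'e) pre_digraph \<Rightarrow> ('k::field \<Rightarrow> 'k) \<Rightarrow> ('e \<Rightarrow> 'k) \<Rightarrow> ('v \<Rightarrow> nat) \<Rightarrow> ('e, 'k) point \<Rightarrow>
    ('v \<Rightarrow> nat) \<Rightarrow> ('e, 'k) point \<Rightarrow> (('v \<times> nat \<Rightarrow> 'k) \<Rightarrow> ('v \<times> nat \<Rightarrow> 'k)) \<Rightarrow> bool" where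
  "scaled_map Q \<theta> s d x d' y f \<longleftrightarrow>
     semilinear_on \<theta> (kspace d) f \<and> f ` kspace d \<subseteq> kspace d' \<and>
     (\<forall>i. \<forall>m\<in>kspace d. f (vertex_act i m) = vertex_act i (f m)) \<and>
     (\<forall>\<alpha>\<in>arcs Q. s \<alpha> \<noteq> 0 \<and>
       (\<forall>m\<in>kspace d. arrow_act Q d' y \<alpha> (f m) = vscale (s \<alpha>) (f (arrow_act Q d x \<alpha> m))))"

context quiver
begin

lemma scaled_map_path:
  assumes f: "scaled_map Q \<theta> s d x d' y f" and p: "(u, p) \<in> paths Q"
  shows "\<exists>c. c \<noteq> 0 \<and> (\<forall>m\<in>kspace d. path_act Q d' y (u, p) (f m) = vscale c (f (path_act Q d x (u, p) m)))"
  using p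
proof (induction p rule: rev_induct)
  case Nil
  show ?case
    using f unfolding scaled_map_def path_act_Nil by (intro exI[of _ 1]) simp
next
  case (snoc \<alpha> p)
  then obtain c where c: "c \<noteq> 0"
    "\<And>m. m \<in> kspace d \<Longrightarrow> path_act Q d' y (u, p) (f m) = vscale c (f (path_act Q d x (u, p) m))"
    unfolding path_snoc by blast
  have \<alpha>: "\<alpha> \<in> arcs Q" using snoc.prems unfolding path_snoc by blast
  have "path_act Q d' y (u, p @ [\<alpha>]) (f m) = vscale (c * s \<alpha>) (f (path_act Q d x (u, p @ [\<alpha>]) m))"
    if m: "m \<in> kspace d" for m
  proof -
    have "arrow_act Q d' y \<alpha> (f (path_act Q d x (u, p) m)) = vscale (s \<alpha>) (f (arrow_act Q d x \<alpha> (path_act Q d x (u, p) m)))"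
      using f \<alpha> path_act_kspace[OF m] unfolding scaled_map_def by blast
    then show ?thesis
      unfolding path_act_snoc c(2)[OF m] arrow_act_scale by (simp only: fvs.scale_scale)
  qed
  moreover have "c * s \<alpha> \<noteq> 0" using c(1) f \<alpha> by (auto simp: scaled_map_def)
  ultimately show ?case by blast
qed

lemma scaled_map_rad_sub:
  fixes x y :: "('e, 'k::field) point"
  assumes f: "scaled_map Q \<theta> s d x d' y f" and x: "x \<in> rep_variety Q L d" and y: "y \<in> rep_variety Q L d'"
    and surj: "f ` kspace d = kspace d'"
  shows "f ` rad_sub Q L d x l = rad_sub Q L d' y l"
proof -
  let ?X = "{path_act Q d x w m | w m. w \<in> paths Q \<and> length (snd w) = l \<and> m \<in> kspace d}"
  have sl: "semilinear_on \<theta> (kspace d) f" using f by (simp add: scaled_map_def)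
  have X: "?X \<subseteq> kspace d" using path_act_kspace by blast
  have "f ` rad_sub Q L d x l = fvs.span (f ` ?X)"
    unfolding rad_sub_paths[OF x] by (rule semilinear_on_span[OF sl kspace_subspace X])
  also have "\<dots> = rad_sub Q L d' y l"
  proof
    show "fvs.span (f ` ?X) \<subseteq> rad_sub Q L d' y l"
    proof (rule fvs.span_minimal[OF _ rad_sub_subspace], rule image_subsetI)
      fix n assume "n \<in> ?X"
      then obtain u p m where up: "(u, p) \<in> paths Q" "length p = l" and m: "m \<in> kspace d"
        and n: "n = path_act Q d x (u, p) m" by auto
      obtain c where c: "c \<noteq> 0" "path_act Q d' y (u, p) (f m) = vscale c (f (path_act Q d x (u, p) m))"
        using scaled_map_path[OF f up(1)] m by blast
      have "path_act Q d' y (u, p) (f m) \<in> rad_sub Q L d' y l"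
        using up m surj by (intro rad_sub_path[OF y]) auto
      then have "vscale (1 / c) (vscale c (f n)) \<in> rad_sub Q L d' y l"
        unfolding c(2) n by (rule fvs.subspace_scale[OF rad_sub_subspace])
      then show "f n \<in> rad_sub Q L d' y l" using c(1) by simp
    qed
    show "rad_sub Q L d' y l \<subseteq> fvs.span (f ` ?X)"
    proof (rule rad_sub_leastI[OF y fvs.subspace_span])
      fix u p and m' :: "'v \<times> nat \<Rightarrow> 'k" assume up: "(u, p) \<in> paths Q" "length p = l" and "m' \<in> kspace d'"
      then obtain m where m: "m \<in> kspace d" "m' = f m" using surj by blast
      obtain c where c: "path_act Q d' y (u, p) (f m) = vscale c (f (path_act Q d x (u, p) m))"
        using scaled_map_path[OF f up(1)] m by blast
      have "path_act Q d x (u, p) m \<in> ?X" using up m(1) by fastforce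
      then show "path_act Q d' y (u, p) m' \<in> fvs.span (f ` ?X)"
        unfolding m(2) c by (intro fvs.span_scale fvs.span_base imageI)
    qed
  qed
  finally show ?thesis .
qed

lemma scaled_map_ann_sub:
  fixes x y :: "('e, 'k::field) point"
  assumes f: "scaled_map Q \<theta> s d x d' y f" and x: "x \<in> rep_variety Q L d" and y: "y \<in> rep_variety Q L d'"
    and inj: "inj_on f (kspace d)" and N: "N \<subseteq> kspace d"
  shows "f ` ann_sub Q L d x N l = ann_sub Q L d' y (f ` N) l"
proof -
  have fN: "f ` N \<subseteq> kspace d'" using f N by (auto simp: scaled_map_def)
  have f0: "f 0 = 0" using f semilinear_on_0[OF _ kspace_subspace] unfolding scaled_map_def by blast
  have "path_act Q d' y w (f n) = 0 \<longleftrightarrow> path_act Q d x w n = 0" if w: "w \<in> paths Q" and n: "n \<in> N" for w n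
  proof -
    obtain u p where up: "w = (u, p)" by (cases w)
    have nk: "n \<in> kspace d" using n N by blast
    obtain c where c: "c \<noteq> 0" "path_act Q d' y (u, p) (f n) = vscale c (f (path_act Q d x (u, p) n))"
      using scaled_map_path[OF f] w nk unfolding up by blast
    have "f (path_act Q d x (u, p) n) = 0 \<longleftrightarrow> path_act Q d x (u, p) n = 0"
      using inj_on_eq_iff[OF inj path_act_kspace[OF nk] fvs.subspace_0[OF kspace_subspace]] f0 by simp
    then show ?thesis unfolding up c(2) using c(1) by (simp only: fvs.scale_eq_0_iff simp_thms)
  qed
  then show ?thesis unfolding ann_sub_paths[OF x N] ann_sub_paths[OF y fN] by blast
qed

lemma scaled_map_dimvec:
  fixes x y :: "('e, 'k::field) point"
  assumes f: "scaled_map Q \<theta> s d x d' y f" and N: "graded_sub d N"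
  shows "dimvec N i = dimvec {n\<in>N. f n = 0} i + dimvec (f ` N) i"
proof -
  have sub: "N \<subseteq> kspace d" using N by (simp add: graded_sub_def)
  have comm: "f (vertex_act i m) = vertex_act i (f m)" if "m \<in> kspace d" for m i
    using f that by (simp add: scaled_map_def)
  have Ni: "vertex_act i ` N \<subseteq> N" using N by (auto simp: graded_sub_def)
  have sl: "semilinear_on \<theta> (vertex_act i ` N) f"
  proof (rule semilinear_on_mono)
    show "semilinear_on \<theta> (kspace d) f" using f unfolding scaled_map_def by blast
  qed (rule order_trans[OF Ni sub])
  have "{m \<in> vertex_act i ` N. f m = 0} = vertex_act i ` {n\<in>N. f n = 0}"
  proof
    show "{m \<in> vertex_act i ` N. f m = 0} \<subseteq> vertex_act i ` {n\<in>N. f n = 0}"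
      unfolding graded_sub_component[OF N]
    proof
      fix m assume "m \<in> {m \<in> {m \<in> N. vertex_act i m = m}. f m = 0}"
      then have m: "m \<in> {n\<in>N. f n = 0}" "vertex_act i m = m" by blast+
      show "m \<in> vertex_act i ` {n\<in>N. f n = 0}" using imageI[OF m(1), of "vertex_act i"] unfolding m(2) .
    qed
    show "vertex_act i ` {n\<in>N. f n = 0} \<subseteq> {m \<in> vertex_act i ` N. f m = 0}"
    proof (rule image_subsetI)
      fix n assume n: "n \<in> {n\<in>N. f n = 0}"
      then have "f (vertex_act i n) = 0" using comm[of n i] sub by (auto simp: vertex_act_0)
      then show "vertex_act i n \<in> {m \<in> vertex_act i ` N. f m = 0}" using n by blast
    qed
  qed
  moreover have "f ` vertex_act i ` N = vertex_act i ` f ` N"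
    unfolding image_image by (rule image_cong[OF refl comm]) (rule subsetD[OF sub])
  ultimately show ?thesis unfolding dimvec_def
    using rank_nullity[OF sl graded_sub_component_subspace[OF N] graded_sub_fin_dim[OF N]] by (simp only:)
qed

lemma scaled_map_dimvec_inj:
  fixes x y :: "('e, 'k::field) point"
  assumes f: "scaled_map Q \<theta> s d x d' y f" and N: "graded_sub d N" and inj: "inj_on f (kspace d)"
  shows "dimvec (f ` N) i = dimvec N i"
proof -
  have f0: "f 0 = 0" using f semilinear_on_0[OF _ kspace_subspace] unfolding scaled_map_def by blast
  have N': "0 \<in> N" "N \<subseteq> kspace d" using N fvs.subspace_0 by (auto simp: graded_sub_def)
  have "n = 0" if "n \<in> N" "f n = 0" for n
    using inj_onD[OF inj _ subsetD[OF N'(2) that(1)] subsetD[OF N'(2) N'(1)]] that(2) f0 by simp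
  then have "{n\<in>N. f n = 0} = {0}" using N'(1) f0 by blast
  then show ?thesis using scaled_map_dimvec[OF f N, of i] by (simp add: dimvec_0)
qed

lemma scaled_map_rep_variety:
  fixes x y :: "('e, 'k::field) point"
  assumes f: "scaled_map Q \<theta> s d x d' y f" and x: "x \<in> rep_variety Q L d"
    and surj: "f ` kspace d = kspace d'" and y: "\<And>z. z \<notin> rep_coords Q d' \<Longrightarrow> y z = 0"
  shows "y \<in> rep_variety Q L d'"
  unfolding rep_variety_iff
proof (intro conjI ballI allI impI)
  fix w and m' :: "'v \<times> nat \<Rightarrow> 'k" assume w: "w \<in> paths Q" "length (snd w) = L + 1" and "m' \<in> kspace d'"
  then obtain m where m: "m \<in> kspace d" "m' = f m" using surj by blast
  have f0: "f 0 = 0" using f semilinear_on_0[OF _ kspace_subspace] unfolding scaled_map_def by blast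
  obtain u p where up: "w = (u, p)" by (cases w)
  obtain c where c: "path_act Q d' y (u, p) (f m) = vscale c (f (path_act Q d x (u, p) m))"
    using scaled_map_path[OF f] w m unfolding up by blast
  have "path_act Q d x (u, p) m = 0" using x[unfolded rep_variety_iff] w m up by blast
  then show "path_act Q d' y w m' = 0" unfolding up m(2) c by (simp only: f0 fvs.scale_zero_right)
qed (rule y)

lemma not_emptyI: "a \<in> A \<Longrightarrow> A \<noteq> {}"
  by blast

lemma scaled_map_invariants:
  assumes f: "scaled_map Q \<theta> s d x d' y f" and x: "x \<in> rep_variety Q L d" and y: "y \<in> rep_variety Q L d'"
    and bij: "bij_betw f (kspace d) (kspace d')"
  shows "rad_layering Q L d' y = rad_layering Q L d x"
    and "soc_layering Q L d' y = soc_layering Q L d x"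
    and "dimvec (socle Q L d' y (rad_sub Q L d' y l)) i = dimvec (socle Q L d x (rad_sub Q L d x l)) i"
    and "dimvec (ann_sub Q L d' y (kspace d') l) i = dimvec (ann_sub Q L d x (kspace d) l) i"
    and "d' = d"
proof -
  have inj: "inj_on f (kspace d)" and surj: "f ` kspace d = kspace d'" using bij by (auto simp: bij_betw_def)
  have rad: "f ` rad_sub Q L d x l = rad_sub Q L d' y l" for l by (rule scaled_map_rad_sub[OF f x y surj])
  have ann: "dimvec (ann_sub Q L d' y (f ` N) l) i = dimvec (ann_sub Q L d x N l) i" if N: "graded_sub d N" for N l i
  proof -
    have sub: "N \<subseteq> kspace d" using N by (simp add: graded_sub_def)
    show ?thesis
      unfolding scaled_map_ann_sub[OF f x y inj sub, symmetric]
      by (intro scaled_map_dimvec_inj[OF f _ inj] graded_sub_ann_sub[OF x N])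
  qed
  have "dimvec (rad_sub Q L d' y l) i = dimvec (rad_sub Q L d x l) i" for l i
    unfolding rad[symmetric] by (rule scaled_map_dimvec_inj[OF f graded_sub_rad_sub[OF x] inj])
  then show "rad_layering Q L d' y = rad_layering Q L d x" by (simp add: rad_layering_def fun_eq_iff)
  show *: "dimvec (ann_sub Q L d' y (kspace d') l) i = dimvec (ann_sub Q L d x (kspace d) l) i" for l i
    using ann[OF graded_sub_kspace] unfolding surj .
  then show "soc_layering Q L d' y = soc_layering Q L d x" by (simp add: soc_layering_def fun_eq_iff)
  show "dimvec (socle Q L d' y (rad_sub Q L d' y l)) i = dimvec (socle Q L d x (rad_sub Q L d x l)) i"
    unfolding rad[symmetric] by (rule ann[OF graded_sub_rad_sub[OF x]])
  have "d' i = d i" for i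
    using scaled_map_dimvec_inj[OF f graded_sub_kspace inj, of i] unfolding surj dimvec_kspace .
  then show "d' = d" by blast
qed

lemma scaled_map_lam_hom:
  fixes x y :: "('e, 'k::field) point"
  assumes f: "scaled_map Q id (\<lambda>_. 1) d x d' y f" and x: "x \<in> rep_variety Q L d" and y: "y \<in> rep_variety Q L d'"
  shows "lam_hom Q L d x d' y f"
  unfolding twisted_hom_def
proof (intro conjI ballI)
  show fm: "f m \<in> kspace d'" if "m \<in> kspace d" for m using f that by (auto simp: scaled_map_def)
  have sl: "semilinear_on id (kspace d) f" using f by (simp add: scaled_map_def)
  show "f (m + n) = f m + f n" if "m \<in> kspace d" "n \<in> kspace d" for m n
    by (rule semilinear_on_add[OF sl that])
  fix lam :: "(('v, 'e) path \<Rightarrow> 'k) set" and m :: "'v \<times> nat \<Rightarrow> 'k" assume "lam \<in> carrier (trunc_algebra Q L)" and m: "m \<in> kspace d"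
  then obtain a :: "('v, 'e) path \<Rightarrow> 'k" where a: "a \<in> carrier KQ" "lam = coset L a"
    unfolding trunc_carrier by (elim imageE)
  have eq: "f (path_act Q d x w m) = path_act Q d' y w (f m)" if w: "w \<in> paths Q" for w
  proof -
    obtain u p where up: "w = (u, p)" by (cases w)
    show ?thesis using w unfolding up
    proof (induction p rule: rev_induct)
      case Nil
      then show ?case using f m unfolding path_act_Nil by (simp add: scaled_map_def)
    next
      case (snoc \<alpha> p)
      have "arrow_act Q d' y \<alpha> (f (path_act Q d x (u, p) m)) = vscale 1 (f (arrow_act Q d x \<alpha> (path_act Q d x (u, p) m)))"
        using f snoc.prems path_act_kspace[OF m] unfolding scaled_map_def path_snoc by blast
      then show ?case using snoc unfolding path_act_snoc path_snoc by simp
    qed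
  qed
  have supp: "{w. a w \<noteq> 0} \<subseteq> paths Q" using a by (simp add: KQ_carrier)
  have "f (lact Q d x ((\<lambda>a. id \<circ> a) ` lam) m) = f (KQ_act Q d x a m)"
    unfolding a(2) using lact_coset[OF x a(1) m] by simp
  also have "\<dots> = (\<Sum>w\<in>{w. a w \<noteq> 0}. vscale (a w) (f (path_act Q d x w m)))"
  proof -
    have "f (\<Sum>w\<in>{w. a w \<noteq> 0}. vscale (a w) (path_act Q d x w m)) =
        (\<Sum>w\<in>{w. a w \<noteq> 0}. vscale (id (a w)) (f (path_act Q d x w m)))"
      by (rule semilinear_on_sum[OF sl kspace_subspace]) (rule path_act_kspace[OF m])
    then show ?thesis unfolding KQ_act_def id_apply .
  qed
  also have "\<dots> = KQ_act Q d' y a (f m)"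
    unfolding KQ_act_def using eq supp by (intro sum.cong) auto
  also have "\<dots> = lact Q d' y lam (f m)" unfolding a(2) by (rule lact_coset[OF y a(1) fm[OF m], symmetric])
  finally show "f (lact Q d x ((\<lambda>a. id \<circ> a) ` lam) m) = lact Q d' y lam (f m)" .
qed

text \<open>In the twisted module a scalar \<open>c\<close> acts as \<open>\<phi> c\<close> does in the original one, so a homomorphism from the twist
  is semilinear with respect to the inverse of \<open>\<phi>\<close>.\<close>

lemma twisted_hom_scaled_map:
  fixes \<phi> :: "'k::field \<Rightarrow> 'k"
  assumes f: "twisted_hom Q L \<phi> d x d' y f" and \<phi>: "field_auto \<phi>"
    and x: "x \<in> rep_variety Q L d" and y: "y \<in> rep_variety Q L d'"
    and d: "d \<in> dim_vectors Q" "d' \<in> dim_vectors Q"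
  shows "scaled_map Q (inv_into UNIV \<phi>) (\<lambda>_. 1) d x d' y f"
proof -
  have fk: "f m \<in> kspace d'" if "m \<in> kspace d" for m using f that by (simp add: twisted_hom_def)
  have add: "f (m + n) = f m + f n" if "m \<in> kspace d" "n \<in> kspace d" for m n
    using f that by (simp add: twisted_hom_def)
  have bij: "bij \<phi>" and pa: "\<And>a b. \<phi> (a + b) = \<phi> a + \<phi> b" and pm: "\<And>a b. \<phi> (a * b) = \<phi> a * \<phi> b"
    using \<phi> by (auto simp: field_auto_def)
  have p0: "\<phi> 0 = 0" by (rule field_auto_0[OF \<phi>])
  have p1: "\<phi> 1 = 1"
  proof -
    have "\<phi> 1 * \<phi> 1 = \<phi> 1 * 1" using pm[of 1 1] by simp
    moreover have "\<phi> 1 \<noteq> 0" using field_auto_eq_0[OF \<phi>, of 1] by simp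
    ultimately show ?thesis by (metis mult_cancel_left)
  qed
  have pd: "\<phi> (a - b) = \<phi> a - \<phi> b" for a b using pa[of "a - b" b] by (simp add: algebra_simps)
  have key: "f (vscale (\<phi> c) (path_act Q d x w m)) = vscale c (path_act Q d' y w (f m))"
    if w: "w \<in> paths Q" and m: "m \<in> kspace d" for c w m
  proof -
    let ?a = "vscale c (path_elt w)" and ?b = "vscale (\<phi> c) (path_elt w) :: ('v, 'e) path \<Rightarrow> 'k"
    have a: "?a \<in> carrier KQ" "?b \<in> carrier KQ" using w by (auto intro: KQ_carrier_scale KQ_path_elt)
    have ab: "\<phi> \<circ> ?a = ?b" by (auto simp: fun_eq_iff vscale_apply path_elt_def p0)
    have "(\<lambda>a. \<phi> \<circ> a) ` coset L ?a \<subseteq> coset L ?b"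
    proof (rule image_subsetI)
      fix e assume "e \<in> coset L ?a"
      then have e: "e - ?a \<in> long_elts (L + 1)" unfolding mem_coset_long .
      have "(\<phi> \<circ> e) - ?b = \<phi> \<circ> (e - ?a)" unfolding ab[symmetric] by (auto simp: fun_eq_iff pd)
      moreover have "(\<phi> \<circ> (e - ?a)) w = 0 \<longleftrightarrow> (e - ?a) w = 0" for w
        unfolding o_apply by (rule field_auto_eq_0[OF \<phi>])
      ultimately have "(\<phi> \<circ> e) - ?b \<in> long_elts (L + 1)"
        using e unfolding long_elts_def KQ_carrier by (simp only: mem_Collect_eq simp_thms) blast
      then show "\<phi> \<circ> e \<in> coset L ?b" unfolding mem_coset_long .
    qed
    then have 1: "lact Q d x ((\<lambda>a. \<phi> \<circ> a) ` coset L ?a) m = KQ_act Q d x ?b m"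
    proof (rule lact_subset_coset[OF x a(2) m])
      show "(\<lambda>a. \<phi> \<circ> a) ` coset L ?a \<noteq> {}" using imageI[OF coset_self, of "\<lambda>a. \<phi> \<circ> a" ?a L] by (rule not_emptyI)
    qed
    have "f (lact Q d x ((\<lambda>a. \<phi> \<circ> a) ` coset L ?a) m) = lact Q d' y (coset L ?a) (f m)"
    proof -
      have "coset L ?a \<in> carrier (trunc_algebra Q L)" unfolding trunc_carrier using a(1) by (rule imageI)
      then show ?thesis using f m unfolding twisted_hom_def by blast
    qed
    then show ?thesis
      unfolding 1 lact_coset[OF y a(1) fk[OF m]] KQ_act_scale_path .
  qed
  have key1: "f (path_act Q d x w m) = path_act Q d' y w (f m)" if "w \<in> paths Q" "m \<in> kspace d" for w m
    using key[OF that, of 1] by (simp add: p1)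
  have f0: "f 0 = 0" using add[OF fvs.subspace_0[OF kspace_subspace] fvs.subspace_0[OF kspace_subspace]]
    by (metis add_0_right add_cancel_right_right)
  have fsum: "f (\<Sum>i\<in>V. g i) = (\<Sum>i\<in>V. f (g i))" if "finite V" "\<And>i. i \<in> V \<Longrightarrow> g i \<in> kspace d" for V :: "'v set" and g
    using that
  proof (induction V rule: finite_induct)
    case empty
    show ?case unfolding sum.empty by (rule f0)
  next
    case (insert i V)
    have "f (g i + (\<Sum>i\<in>V. g i)) = f (g i) + f (\<Sum>i\<in>V. g i)"
      using insert.prems by (intro add fvs.subspace_sum[OF kspace_subspace]) auto
    also have "f (\<Sum>i\<in>V. g i) = (\<Sum>i\<in>V. f (g i))" using insert.prems by (intro insert.IH) auto
    finally show ?case unfolding sum.insert[OF insert.hyps] .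
  qed
  have scale: "f (vscale (\<phi> c) m) = vscale c (f m)" if m: "m \<in> kspace d" for c m
  proof -
    have "vscale (\<phi> c) m = (\<Sum>i\<in>verts Q. vertex_act i (vscale (\<phi> c) m))"
      by (rule graded_sub_sum_components[OF fvs.subspace_scale[OF kspace_subspace m] finite_verts dim_vectorsD[OF d(1)]])
    also have "\<dots> = (\<Sum>i\<in>verts Q. vscale (\<phi> c) (path_act Q d x (i, []) m))"
      by (simp only: vertex_act_scale path_act_Nil)
    finally have "f (vscale (\<phi> c) m) = f (\<Sum>i\<in>verts Q. vscale (\<phi> c) (path_act Q d x (i, []) m))"
      by (rule arg_cong)
    also have "\<dots> = (\<Sum>i\<in>verts Q. f (vscale (\<phi> c) (path_act Q d x (i, []) m)))"
      by (rule fsum[OF finite_verts]) (rule fvs.subspace_scale[OF kspace_subspace path_act_kspace[OF m]])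
    also have "\<dots> = (\<Sum>i\<in>verts Q. vscale c (vertex_act i (f m)))"
    proof (rule sum.cong[OF refl])
      fix i assume "i \<in> verts Q"
      then have "(i, []) \<in> paths Q" by (simp add: path_Nil)
      from key[OF this m, of c]
      show "f (vscale (\<phi> c) (path_act Q d x (i, []) m)) = vscale c (vertex_act i (f m))"
        unfolding path_act_Nil .
    qed
    also have "\<dots> = (\<Sum>i\<in>verts Q. vertex_act i (vscale c (f m)))"
      by (simp only: vertex_act_scale)
    also have "\<dots> = vscale c (f m)"
      by (rule graded_sub_sum_components[OF fvs.subspace_scale[OF kspace_subspace fk[OF m]] finite_verts dim_vectorsD[OF d(2)], symmetric])
    finally show ?thesis .
  qed
  have inv: "field_auto (inv_into UNIV \<phi>)"
    unfolding field_auto_def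
  proof (intro conjI allI)
    show "bij (inv_into UNIV \<phi>)" using bij by (rule bij_betw_inv_into[where A = UNIV and B = UNIV])
    have s: "\<phi> (inv_into UNIV \<phi> a) = a" for a using bij by (simp add: bij_is_surj surj_f_inv_f)
    have i: "inv_into UNIV \<phi> (\<phi> a) = a" for a using bij by (simp add: bij_is_inj inv_f_f)
    show "inv_into UNIV \<phi> (a + b) = inv_into UNIV \<phi> a + inv_into UNIV \<phi> b" "inv_into UNIV \<phi> (a * b) = inv_into UNIV \<phi> a * inv_into UNIV \<phi> b" for a b
      using i[of "inv_into UNIV \<phi> a + inv_into UNIV \<phi> b"] i[of "inv_into UNIV \<phi> a * inv_into UNIV \<phi> b"] by (simp_all add: pa pm s)
  qed
  show ?thesis unfolding scaled_map_def semilinear_on_def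
  proof (intro conjI ballI allI)
    show "f (vscale c m) = vscale (inv_into UNIV \<phi> c) (f m)" if "m \<in> kspace d" for c m
    proof -
      have "\<phi> (inv_into UNIV \<phi> c) = c" using bij by (simp add: bij_is_surj surj_f_inv_f)
      then show ?thesis using scale[OF that, of "inv_into UNIV \<phi> c"] by (simp only:)
    qed
    show "f (vertex_act i m) = vertex_act i (f m)" if m: "m \<in> kspace d" for i m
    proof (cases "i \<in> verts Q")
      case True
      then have "(i, []) \<in> paths Q" by (simp add: path_Nil)
      from key1[OF this m] show ?thesis unfolding path_act_Nil .
    next
      case False
      have "vertex_act i n = 0" if "n \<in> kspace e" "e \<in> dim_vectors Q" for n :: "'v \<times> nat \<Rightarrow> 'k" and e :: "'v \<Rightarrow> nat"
        using that False by (auto simp: fun_eq_iff vertex_act_apply kspace_def dim_vectors_def)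
      from this[OF m d(1)] this[OF fk[OF m] d(2)] show ?thesis using f0 by (simp only:)
    qed
    show "arrow_act Q d' y \<alpha> (f m) = vscale 1 (f (arrow_act Q d x \<alpha> m))" if "\<alpha> \<in> arcs Q" "m \<in> kspace d" for \<alpha> m
      using key1[OF arc_path[OF that(1)] that(2)] by (simp add: path_act_arrow)
  qed (use add fk inv in auto)
qed

end

section \<open>Dense open subsets\<close>

lemma topspace_zariski: "topspace (zariski C) = {x :: 'c \<Rightarrow> 'k::field. \<forall>c. c \<notin> C \<longrightarrow> x c = 0}"
proof -
  have one: "mpoly_eval 1 x = (1::'k)" for x :: "'c \<Rightarrow> 'k"
    using mpoly_eval_single[of 0 1 x] by simp
  show ?thesis unfolding zariski_def topology_generated_by_topspace
    using one by (fastforce intro: exI[of _ 1])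
qed

lemma openin_zariski_basic:
  fixes U :: "('c \<Rightarrow> 'k::field) set"
  assumes "openin (zariski C) U" "x \<in> U"
  shows "\<exists>F\<in>polyfuns coord_funs. F x \<noteq> 0 \<and> {y. (\<forall>c. c \<notin> C \<longrightarrow> y c = 0) \<and> F y \<noteq> 0} \<subseteq> U"
proof -
  have "generate_topology_on (range (\<lambda>p. {x. (\<forall>c. c \<notin> C \<longrightarrow> x c = 0) \<and> mpoly_eval p x \<noteq> 0})) U"
    using assms(1) unfolding zariski_def by (simp add: openin_topology_generated_by_iff)
  then show ?thesis using assms(2)
  proof (induction arbitrary: x)
    case Empty
    then show ?case by blast
  next
    case (Int a b)
    obtain F where F: "F \<in> polyfuns coord_funs" "F x \<noteq> 0" "{y. (\<forall>c. c \<notin> C \<longrightarrow> y c = 0) \<and> F y \<noteq> 0} \<subseteq> a"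
      using Int.IH(1)[of x] Int.prems by blast
    obtain H where H: "H \<in> polyfuns coord_funs" "H x \<noteq> 0" "{y. (\<forall>c. c \<notin> C \<longrightarrow> y c = 0) \<and> H y \<noteq> 0} \<subseteq> b"
      using Int.IH(2)[of x] Int.prems by blast
    show ?case
    proof (intro bexI[of _ "\<lambda>y. F y * H y"] conjI)
      show "(\<lambda>y. F y * H y) \<in> polyfuns coord_funs" using F H by (intro polyfuns.mult)
      show "F x * H x \<noteq> 0" using F H by simp
      show "{y. (\<forall>c. c \<notin> C \<longrightarrow> y c = 0) \<and> F y * H y \<noteq> 0} \<subseteq> a \<inter> b"
        using F(3) H(3) by auto
    qed
  next
    case (UN K)
    then obtain k where k: "k \<in> K" "x \<in> k" by blast
    from UN.IH[OF k] show ?case using k(1) by (meson Union_upper order_trans)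
  next
    case (Basis s)
    then obtain p where s: "s = {x. (\<forall>c. c \<notin> C \<longrightarrow> x c = 0) \<and> mpoly_eval p x \<noteq> 0}" by blast
    then show ?case using Basis.prems by (intro bexI[of _ "mpoly_eval p"] mpoly_eval_polyfuns) auto
  qed
qed

lemma openin_zariski_polyfun:
  assumes "F \<in> polyfuns coord_funs"
  shows "openin (zariski C) {y. (\<forall>c. c \<notin> C \<longrightarrow> y c = 0) \<and> F y \<noteq> 0}"
proof -
  obtain p where "F = mpoly_eval p" by (rule polyfuns_mpoly_eval[OF assms])
  then show ?thesis unfolding zariski_def by (auto intro: topology_generated_by_Basis)
qed

text \<open>Irreducibility of \<open>X\<close> in the Zariski topology, in terms of principal open sets.\<close>

definition poly_irreducible :: "('c \<Rightarrow> 'k::field) set \<Rightarrow> bool" where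
  "poly_irreducible X \<longleftrightarrow> X \<noteq> {} \<and> (\<forall>F\<in>polyfuns coord_funs. \<forall>G\<in>polyfuns coord_funs.
     (\<exists>x\<in>X. F x \<noteq> 0) \<longrightarrow> (\<exists>x\<in>X. G x \<noteq> 0) \<longrightarrow> (\<exists>x\<in>X. F x \<noteq> 0 \<and> G x \<noteq> 0))"

definition poly_generic :: "('c \<Rightarrow> 'k::field) set \<Rightarrow> (('c \<Rightarrow> 'k) \<Rightarrow> bool) \<Rightarrow> bool" where
  "poly_generic X P \<longleftrightarrow> (\<exists>F\<in>polyfuns coord_funs. (\<exists>x\<in>X. F x \<noteq> 0) \<and> (\<forall>x\<in>X. F x \<noteq> 0 \<longrightarrow> P x))"

lemma poly_generic_mono: "poly_generic X P \<Longrightarrow> (\<And>x. x \<in> X \<Longrightarrow> P x \<Longrightarrow> P' x) \<Longrightarrow> poly_generic X P'"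
  unfolding poly_generic_def by blast

lemma poly_generic_ex: "poly_generic X P \<Longrightarrow> \<exists>x\<in>X. P x"
  unfolding poly_generic_def by blast

lemma poly_generic_conj:
  assumes "poly_irreducible X" "poly_generic X P" "poly_generic X P'"
  shows "poly_generic X (\<lambda>x. P x \<and> P' x)"
proof -
  obtain F where F: "F \<in> polyfuns coord_funs" "\<exists>x\<in>X. F x \<noteq> 0" "\<forall>x\<in>X. F x \<noteq> 0 \<longrightarrow> P x"
    using assms(2) unfolding poly_generic_def by blast
  obtain G where G: "G \<in> polyfuns coord_funs" "\<exists>x\<in>X. G x \<noteq> 0" "\<forall>x\<in>X. G x \<noteq> 0 \<longrightarrow> P' x"
    using assms(3) unfolding poly_generic_def by blast
  have "\<exists>x\<in>X. F x \<noteq> 0 \<and> G x \<noteq> 0" using assms(1) F G unfolding poly_irreducible_def by blast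
  then show ?thesis unfolding poly_generic_def using F G
    by (intro bexI[of _ "\<lambda>x. F x * G x"] polyfuns.mult) auto
qed

lemma poly_generic_ball:
  assumes X: "poly_irreducible X" and "finite A" "\<And>a. a \<in> A \<Longrightarrow> poly_generic X (P a)"
  shows "poly_generic X (\<lambda>x. \<forall>a\<in>A. P a x)"
  using assms(2,3)
proof (induction A rule: finite_induct)
  case empty
  have "X \<noteq> {}" using X by (simp add: poly_irreducible_def)
  then show ?case unfolding poly_generic_def by (intro bexI[of _ "\<lambda>_. 1"] polyfuns.const) auto
next
  case (insert a A)
  have "poly_generic X (\<lambda>x. P a x \<and> (\<forall>a\<in>A. P a x))"
    using insert by (intro poly_generic_conj[OF X]) auto
  then show ?case by (rule poly_generic_mono) auto
qed

text \<open>In an irreducible space every nonempty open set is dense, and a dense open set contains a nonempty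
  principal one.\<close>

lemma generically_iff_poly_generic:
  fixes P :: "('e, 'k::field) point \<Rightarrow> bool" and Q :: "('v, 'e) pre_digraph"
  assumes X: "poly_irreducible (rep_layered Q L S :: ('e, 'k) point set)"
  shows "generically Q L S P \<longleftrightarrow> poly_generic (rep_layered Q L S) P"
proof -
  let ?X = "rep_layered Q L S :: ('e, 'k) point set" and ?C = "rep_coords Q (seq_dim L S)"
  let ?T = "rep_layered_top Q L S :: ('e, 'k) point topology"
  have off: "x c = 0" if "x \<in> ?X" "c \<notin> ?C" for x c
    using that unfolding rep_layered_def rep_variety_def by blast
  have sub: "?X \<subseteq> topspace (zariski ?C)" using off by (auto simp: topspace_zariski)
  then have top: "topspace ?T = ?X" unfolding rep_layered_top_def by auto
  have basic: "\<exists>F\<in>polyfuns coord_funs. F x \<noteq> 0 \<and> {y\<in>?X. F y \<noteq> 0} \<subseteq> U" if Ux: "openin ?T U" "x \<in> U" for U x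
  proof -
    obtain W where W: "openin (zariski ?C) W" "U = W \<inter> ?X"
      using Ux(1) unfolding rep_layered_top_def openin_subtopology by blast
    obtain F where F: "F \<in> polyfuns coord_funs" "F x \<noteq> 0" "{y. (\<forall>c. c \<notin> ?C \<longrightarrow> y c = 0) \<and> F y \<noteq> 0} \<subseteq> W"
      using openin_zariski_basic[OF W(1), of x] Ux(2) W(2) by blast
    then show ?thesis using W(2) off by blast
  qed
  show ?thesis
  proof
    assume "generically Q L S P"
    then obtain U where U: "openin ?T U" "?T closure_of U = ?X" "\<forall>x\<in>U. P x"
      unfolding generically_def by blast
    have "U \<noteq> {}" using U(2) X by (auto simp: poly_irreducible_def)
    then obtain x where x: "x \<in> U" by blast
    obtain F where F: "F \<in> polyfuns coord_funs" "F x \<noteq> 0" "{y\<in>?X. F y \<noteq> 0} \<subseteq> U"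
      using basic[OF U(1) x] by blast
    have "x \<in> ?X" using openin_subset[OF U(1)] x top by blast
    then show "poly_generic ?X P" unfolding poly_generic_def using F U(3) by blast
  next
    assume "poly_generic ?X P"
    then obtain F where F: "F \<in> polyfuns coord_funs" "\<exists>x\<in>?X. F x \<noteq> 0" "\<forall>x\<in>?X. F x \<noteq> 0 \<longrightarrow> P x"
      unfolding poly_generic_def by blast
    let ?U = "{x\<in>?X. F x \<noteq> 0}"
    have "?U = {y. (\<forall>c. c \<notin> ?C \<longrightarrow> y c = 0) \<and> F y \<noteq> 0} \<inter> ?X" using off by auto
    then have "openin ?T ?U"
      unfolding rep_layered_top_def openin_subtopology using openin_zariski_polyfun[OF F(1)] by blast
    moreover have "?T closure_of ?U = ?X"
    proof
      show "?T closure_of ?U \<subseteq> ?X" using closure_of_subset_topspace[of ?T] top by blast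
      show "?X \<subseteq> ?T closure_of ?U"
      proof
        fix x assume x: "x \<in> ?X"
        show "x \<in> ?T closure_of ?U"
          unfolding in_closure_of
        proof (intro conjI allI impI)
          show "x \<in> topspace ?T" using x top by blast
          fix W assume W: "x \<in> W \<and> openin ?T W"
          then obtain G where G: "G \<in> polyfuns coord_funs" "G x \<noteq> 0" "{y\<in>?X. G y \<noteq> 0} \<subseteq> W"
            using basic[of W x] by blast
          then obtain y where "y \<in> ?X" "F y \<noteq> 0" "G y \<noteq> 0"
            using X F x unfolding poly_irreducible_def by blast
          then show "\<exists>y. y \<in> ?U \<and> y \<in> W" using G by blast
        qed
      qed
    qed
    ultimately show "generically Q L S P" unfolding generically_def using F(3) by blast
  qed
qed

section \<open>Semicontinuity\<close>

text \<open>All path actions of a fixed length, as one linear map. Its kernel is an annihilator, and its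
  image has a spanning family whose coordinates are polynomials in the representation.\<close>

definition path_eval :: "('v, 'e) pre_digraph \<Rightarrow> ('v \<Rightarrow> nat) \<Rightarrow> ('e, 'k::field) point \<Rightarrow> nat \<Rightarrow>
    ('v \<times> nat \<Rightarrow> 'k) \<Rightarrow> (('v, 'e) path \<times> 'v \<times> nat \<Rightarrow> 'k)" where
  "path_eval Q d x k n = (\<lambda>(w, z). if w \<in> paths Q \<and> length (snd w) = k then path_act Q d x w n z else 0)"

definition path_family :: "('v, 'e) pre_digraph \<Rightarrow> ('v \<Rightarrow> nat) \<Rightarrow> nat \<Rightarrow> 'v \<Rightarrow> (('v, 'e) path \<times> nat) set" where
  "path_family Q d l i = {(w, c). w \<in> paths Q \<and> length (snd w) = l \<and>
     pre_digraph.awlast Q (fst w) (snd w) = i \<and> c < d (fst w)}"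

lemma path_eval_semilinear: "semilinear_on id V (path_eval Q d x k)"
  unfolding semilinear_on_def using field_auto_id
  by (auto simp: path_eval_def path_act_add path_act_scale fun_eq_iff vscale_apply)

lemma arrow_act_polyfuns:
  assumes "\<And>z. (\<lambda>t. x t z) \<in> polyfuns G" "\<And>z. (\<lambda>t. m t z) \<in> polyfuns G"
  shows "(\<lambda>t. arrow_act Q d (x t) \<alpha> (m t) z) \<in> polyfuns G"
proof -
  obtain j r where z: "z = (j, r)" by (cases z)
  show ?thesis
  proof (cases "j = head Q \<alpha> \<and> r < d j")
    case True
    then show ?thesis unfolding z arrow_act_def using assms by (auto intro!: polyfuns_closed)
  next
    case False
    then have "(\<lambda>t. arrow_act Q d (x t) \<alpha> (m t) z) = (\<lambda>_. 0)" by (auto simp: z arrow_act_def)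
    then show ?thesis by (simp only: polyfuns.const)
  qed
qed

lemma path_act_polyfuns:
  assumes "\<And>z. (\<lambda>t. x t z) \<in> polyfuns G" "\<And>z. (\<lambda>t. m t z) \<in> polyfuns G"
  shows "(\<lambda>t. path_act Q d (x t) (u, p) (m t) z) \<in> polyfuns G"
proof (induction p arbitrary: z rule: rev_induct)
  case Nil
  obtain j r where z: "z = (j, r)" by (cases z)
  show ?case unfolding path_act_Nil z vertex_act_apply using assms(2) polyfuns.const
    by (cases "j = u") (simp_all only: if_True if_False simp_thms)
next
  case (snoc \<alpha> p)
  show ?case unfolding path_act_snoc by (rule arrow_act_polyfuns[OF assms(1) snoc.IH])
qed

context quiver
begin

lemma finite_path_family: "finite (path_family Q d l i)"
proof (rule finite_subset)
  show "path_family Q d l i \<subseteq> (SIGMA w : {w \<in> paths Q. length (snd w) = l}. {..<d (fst w)})"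
    by (auto simp: path_family_def)
  show "finite (SIGMA w : {w \<in> paths Q. length (snd w) = l}. {..<d (fst w)})"
    using finite_paths_length by blast
qed

lemma rad_sub_component_span:
  fixes x :: "('e, 'k::field) point"
  assumes x: "x \<in> rep_variety Q L d"
  shows "vertex_act i ` rad_sub Q L d x l =
    fvs.span ((\<lambda>(w, c). path_act Q d x w (std_vec (fst w, c))) ` path_family Q d l i)" (is "?A = fvs.span ?B")
proof
  have "rad_sub Q L d x l \<subseteq> {m. vertex_act i m \<in> fvs.span ?B}"
  proof (rule rad_sub_leastI[OF x linear_vimage_subspace[OF vertex_act_semilinear fvs.subspace_span]])
    fix u p and m :: "'v \<times> nat \<Rightarrow> 'k"
    assume p: "(u, p) \<in> paths Q" "length p = l" and m: "m \<in> kspace d"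
    show "path_act Q d x (u, p) m \<in> {m. vertex_act i m \<in> fvs.span ?B}"
    proof (cases "i = awlast u p")
      case False
      then show ?thesis using fvs.span_zero by (simp add: path_act_end)
    next
      case True
      have "vertex_act u m \<in> fvs.span ((\<lambda>r. std_vec (u, r)) ` {..<d u})"
        using m unfolding kspace_component[symmetric] by (rule imageI)
      then have "path_act Q d x (u, p) (vertex_act u m) \<in> path_act Q d x (u, p) ` fvs.span ((\<lambda>r. std_vec (u, r)) ` {..<d u})"
        by (rule imageI)
      also have "\<dots> = fvs.span (path_act Q d x (u, p) ` (\<lambda>r. std_vec (u, r)) ` {..<d u})"
        by (rule semilinear_on_span[OF path_act_semilinear[of UNIV]]) auto
      also have "\<dots> \<subseteq> fvs.span ?B"
      proof (rule fvs.span_mono, rule image_subsetI)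
        fix n :: "'v \<times> nat \<Rightarrow> 'k" assume "n \<in> (\<lambda>r. std_vec (u, r)) ` {..<d u}"
        then obtain r where r: "r < d u" "n = std_vec (u, r)" by auto
        show "path_act Q d x (u, p) n \<in> ?B"
          by (rule image_eqI[of _ _ "((u, p), r)"]) (use p r True in \<open>auto simp: path_family_def\<close>)
      qed
      finally show ?thesis using True by (simp add: path_act_start path_act_end)
    qed
  qed
  then show "?A \<subseteq> fvs.span ?B" by blast
  show "fvs.span ?B \<subseteq> ?A"
  proof (rule fvs.span_minimal[OF _ graded_sub_component_subspace[OF graded_sub_rad_sub[OF x]]], rule image_subsetI)
    fix q assume "q \<in> path_family Q d l i"
    then obtain u p c where q: "q = ((u, p), c)" "(u, p) \<in> paths Q" "length p = l" "awlast u p = i" "c < d u"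
      by (auto simp: path_family_def)
    have "path_act Q d x (u, p) (std_vec (u, c)) \<in> rad_sub Q L d x l"
      using q by (intro rad_sub_path[OF x]) (auto simp: kspace_def std_vec_def)
    then have "vertex_act i (path_act Q d x (u, p) (std_vec (u, c))) \<in> ?A" by (rule imageI)
    then show "(case q of (w, c) \<Rightarrow> path_act Q d x w (std_vec (fst w, c))) \<in> ?A"
      using q by (simp add: path_act_end)
  qed
qed

definition path_rank :: "nat \<Rightarrow> ('v \<Rightarrow> nat) \<Rightarrow> ('e, 'k::field) point \<Rightarrow> nat \<Rightarrow> nat \<Rightarrow> 'v \<Rightarrow> nat" where
  "path_rank L d x l k i = fvs.dim (path_eval Q d x k ` vertex_act i ` rad_sub Q L d x l)"

lemma path_eval_eq_0: "path_eval Q d x k n = 0 \<longleftrightarrow> (\<forall>w\<in>paths Q. length (snd w) = k \<longrightarrow> path_act Q d x w n = 0)"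
proof
  assume 0: "path_eval Q d x k n = 0"
  show "\<forall>w\<in>paths Q. length (snd w) = k \<longrightarrow> path_act Q d x w n = 0"
  proof (intro ballI impI ext)
    fix w z assume "w \<in> paths Q" "length (snd w) = k"
    then show "path_act Q d x w n z = 0 z" using fun_cong[OF 0, of "(w, z)"] by (simp add: path_eval_def)
  qed
next
  assume "\<forall>w\<in>paths Q. length (snd w) = k \<longrightarrow> path_act Q d x w n = 0"
  then show "path_eval Q d x k n = 0" by (auto simp: path_eval_def fun_eq_iff)
qed

lemma path_rank_nullity:
  fixes x :: "('e, 'k::field) point"
  assumes x: "x \<in> rep_variety Q L d"
  shows "dimvec (rad_sub Q L d x l) i =
    dimvec (ann_sub Q L d x (rad_sub Q L d x l) k) i + path_rank L d x l k i"
proof -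
  let ?R = "rad_sub Q L d x l" and ?V = "vertex_act i ` rad_sub Q L d x l"
  note gr = graded_sub_rad_sub[OF x, of l]
  note ga = graded_sub_ann_sub[OF x gr, of k]
  have "{m \<in> ?V. path_eval Q d x k m = 0} = vertex_act i ` ann_sub Q L d x ?R k"
    unfolding graded_sub_component[OF gr] graded_sub_component[OF ga]
    unfolding ann_sub_paths[OF x rad_sub_kspace[OF x]] path_eval_eq_0 by blast
  moreover have "fvs.dim ?V = fvs.dim {m \<in> ?V. path_eval Q d x k m = 0} + fvs.dim (path_eval Q d x k ` ?V)"
    by (rule rank_nullity[OF path_eval_semilinear graded_sub_component_subspace[OF gr] graded_sub_fin_dim[OF gr]])
  ultimately show ?thesis unfolding dimvec_def path_rank_def by (simp only:)
qed

text \<open>The rank is lower semicontinuous: a subfamily of the spanning family that is independent at \<open>t0\<close> stays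
  independent nearby.\<close>

lemma path_rank_open:
  fixes x :: "'a \<Rightarrow> ('e, 'k::field) point"
  assumes x: "\<And>z. (\<lambda>t. x t z) \<in> polyfuns G" and x0: "x t0 \<in> rep_variety Q L d"
  shows "\<exists>F\<in>polyfuns G. F t0 \<noteq> 0 \<and>
    (\<forall>t. F t \<noteq> 0 \<longrightarrow> x t \<in> rep_variety Q L d \<longrightarrow> path_rank L d (x t0) l k i \<le> path_rank L d (x t) l k i)"
proof -
  let ?I = "path_family Q d l i"
  define v where "v t = (\<lambda>(w, c). path_eval Q d (x t) k (path_act Q d (x t) w (std_vec (fst w, c))))" for t
  have span: "path_eval Q d (x t) k ` vertex_act i ` rad_sub Q L d (x t) l = fvs.span (v t ` ?I)"
    if "x t \<in> rep_variety Q L d" for t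
  proof -
    have "path_eval Q d (x t) k ` vertex_act i ` rad_sub Q L d (x t) l =
        fvs.span (path_eval Q d (x t) k ` (\<lambda>(w, c). path_act Q d (x t) w (std_vec (fst w, c))) ` ?I)"
      unfolding rad_sub_component_span[OF that]
      by (rule semilinear_on_span[OF path_eval_semilinear[of UNIV]]) auto
    also have "path_eval Q d (x t) k ` (\<lambda>(w, c). path_act Q d (x t) w (std_vec (fst w, c))) ` ?I = v t ` ?I"
      unfolding image_image v_def by (rule image_cong) auto
    finally show ?thesis .
  qed
  obtain J where J: "J \<subseteq> ?I" "indep_on J (v t0)" "card J = fvs.dim (fvs.span (v t0 ` ?I))"
    by (rule indep_subfamily[OF finite_path_family])
  have fin: "finite J" using J(1) finite_path_family finite_subset by blast
  have pf: "(\<lambda>t. v t q b) \<in> polyfuns G" for q b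
  proof -
    obtain u p c where q: "q = ((u, p), c)" by (metis surj_pair)
    obtain u' p' z where b: "b = ((u', p'), z)" by (metis surj_pair)
    have "(\<lambda>t. path_act Q d (x t) (u', p') (path_act Q d (x t) (u, p) (std_vec (u, c))) z) \<in> polyfuns G"
      by (intro path_act_polyfuns x polyfuns.const)
    then show ?thesis unfolding v_def q b path_eval_def using polyfuns.const
      by (cases "(u', p') \<in> paths Q \<and> length p' = k") auto
  qed
  obtain F where F: "F \<in> polyfuns G" "F t0 \<noteq> 0" "\<And>t. F t \<noteq> 0 \<Longrightarrow> indep_on J (v t)"
    by (rule indep_on_open[OF fin pf J(2)]) blast
  have "path_rank L d (x t0) l k i \<le> path_rank L d (x t) l k i"
    if t: "F t \<noteq> 0" "x t \<in> rep_variety Q L d" for t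
  proof -
    have "path_rank L d (x t0) l k i = card J" unfolding path_rank_def span[OF x0] J(3) ..
    also have "\<dots> \<le> path_rank L d (x t) l k i" unfolding path_rank_def span[OF t(2)]
    proof (rule indep_on_card_le[OF F(3)[OF t(1)] fin])
      show "v t ` J \<subseteq> fvs.span (v t ` ?I)" using image_mono[OF J(1), of "v t"] fvs.span_superset by (rule order_trans)
      show "fin_dim (fvs.span (v t ` ?I))" using finite_path_family by (intro fin_dim_span finite_imageI)
    qed
    finally show ?thesis .
  qed
  then show ?thesis using F by blast
qed

lemma path_rank_0:
  assumes x: "x \<in> rep_variety Q L d" and d: "d \<in> dim_vectors Q"
  shows "path_rank L d x l 0 i = dimvec (rad_sub Q L d x l) i"
  using path_rank_nullity[OF x, of l i 0] unfolding ann_sub_0[OF x graded_sub_rad_sub[OF x] d] dimvec_0 by simp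

lemma dimvec_rad_sub:
  assumes x: "x \<in> rep_layered Q L S" and S: "semisimple_sequence Q L S"
  shows "dimvec (rad_sub Q L (seq_dim L S) x l) i = (\<Sum>k=l..L. S k i)"
proof -
  let ?d = "seq_dim L S"
  have xv: "x \<in> rep_variety Q L ?d" and lay: "rad_layering Q L ?d x = S" using x by (auto simp: rep_layered_def)
  let ?D = "\<lambda>l. dimvec (rad_sub Q L ?d x l) i"
  have step: "?D l = S l i + ?D (l + 1)" for l
  proof -
    have "?D (l + 1) \<le> ?D l"
      by (intro dimvec_mono[OF graded_sub_rad_sub[OF xv]] rad_sub_antimono[OF xv]) simp
    moreover have "S l i = ?D l - ?D (l + 1)"
      unfolding rad_layering_def[of Q L ?d x l i, symmetric] lay ..
    ultimately show ?thesis by simp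
  qed
  have end0: "?D l = 0" if "L < l" for l unfolding rad_sub_end[OF xv that] by (rule dimvec_0)
  show ?thesis
  proof (cases "l \<le> L")
    case False
    then show ?thesis using end0[of l] by simp
  next
    case True
    then show ?thesis
    proof (induction l rule: inc_induct)
      case base
      show ?case using step[of L] end0[of "L + 1"] by simp
    next
      case (step n)
      have "?D n = S n i + ?D (Suc n)" using \<open>\<And>l. ?D l = S l i + ?D (l + 1)\<close>[of n] by simp
      then show ?case using step by (simp add: sum.atLeast_Suc_atMost)
    qed
  qed
qed

lemma seq_dim_dim_vectors: "semisimple_sequence Q L S \<Longrightarrow> seq_dim L S \<in> dim_vectors Q"
  by (auto simp: semisimple_sequence_def dim_vectors_def seq_dim_def)

end

section \<open>Coordinates adapted to the radical filtration\<close>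

definition coord_sub :: "('v \<Rightarrow> nat) \<Rightarrow> ('v \<Rightarrow> nat \<Rightarrow> bool) \<Rightarrow> ('v \<times> nat \<Rightarrow> 'k::field) set" where
  "coord_sub d A = {m \<in> kspace d. \<forall>i r. \<not> A i r \<longrightarrow> m (i, r) = 0}"

lemma graded_sub_coord_sub: "graded_sub d (coord_sub d A)"
  by (auto simp: graded_sub_def coord_sub_def fvs.subspace_def kspace_def vscale_apply vertex_act_apply)

lemma coord_sub_component:
  "(vertex_act i ` coord_sub d A :: ('v \<times> nat \<Rightarrow> 'k::field) set) =
    fvs.span ((\<lambda>r. std_vec (i, r)) ` {r. r < d i \<and> A i r})" (is "?A = fvs.span ?B")
proof
  have fin: "finite {r. r < d i \<and> A i r}" by simp
  show "?A \<subseteq> fvs.span ?B"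
  proof (rule image_subsetI)
    fix m :: "'v \<times> nat \<Rightarrow> 'k" assume m: "m \<in> coord_sub d A"
    have "vertex_act i m = (\<Sum>r\<in>{r. r < d i \<and> A i r}. vscale (m (i, r)) (std_vec (i, r)))"
    proof
      fix z :: "'v \<times> nat"
      obtain j r where z: "z = (j, r)" by (cases z)
      have "(\<Sum>r'\<in>{r. r < d i \<and> A i r}. m (i, r') * std_vec (i, r') (j, r)) =
          (\<Sum>r'\<in>{r. r < d i \<and> A i r}. if r' = r then (if j = i then m (j, r) else 0) else 0)"
        by (intro sum.cong) (auto simp: std_vec_def)
      also have "\<dots> = (if j = i then m (j, r) else 0)"
        using m unfolding sum.delta[OF fin] coord_sub_def kspace_def by auto
      finally show "vertex_act i m z = (\<Sum>r\<in>{r. r < d i \<and> A i r}. vscale (m (i, r)) (std_vec (i, r))) z"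
        by (simp add: z sum_fun_apply vscale_apply vertex_act_apply)
    qed
    then show "vertex_act i m \<in> fvs.span ?B"
      unfolding span_family_iff[OF fin] by (intro exI[of _ "\<lambda>r. m (i, r)"])
  qed
  have "std_vec (i, r) \<in> ?A" if r: "r < d i \<and> A i r" for r
  proof (rule image_eqI)
    show "std_vec (i, r) = vertex_act i (std_vec (i, r) :: 'v \<times> nat \<Rightarrow> 'k)"
      by (auto simp: fun_eq_iff vertex_act_apply std_vec_def)
    show "(std_vec (i, r) :: 'v \<times> nat \<Rightarrow> 'k) \<in> coord_sub d A" using r by (auto simp: coord_sub_def kspace_def std_vec_def)
  qed
  then show "fvs.span ?B \<subseteq> ?A"
    by (intro fvs.span_minimal graded_sub_component_subspace[OF graded_sub_coord_sub]) blast
qed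

lemma dimvec_coord_sub:
  "dimvec (coord_sub d A :: ('v \<times> nat \<Rightarrow> 'k::field) set) i = card {r. r < d i \<and> A i r}"
  unfolding dimvec_def coord_sub_component
proof (subst dim_eq_card_family[OF _ _ _ order_refl])
  show "indep_on {r. r < d i \<and> A i r} (\<lambda>r. std_vec (i, r) :: 'v \<times> nat \<Rightarrow> 'k)"
    by (rule indep_on_std_vec) (auto simp: inj_on_def)
qed (auto intro: fvs.span_base)

text \<open>The level of a coordinate is meant to be the largest \<open>l\<close> such that the corresponding basis vector lies in \<open>J\<^sup>lM\<close>.\<close>

definition levels :: "(nat \<Rightarrow> 'v \<Rightarrow> nat) \<Rightarrow> ('v \<Rightarrow> nat) \<Rightarrow> ('v \<Rightarrow> nat \<Rightarrow> nat) \<Rightarrow> bool" where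
  "levels S d lev \<longleftrightarrow> (\<forall>i l. card {r. r < d i \<and> lev i r = l} = S l i)"

lemma levels_le:
  assumes "levels S d lev" "semisimple_sequence Q L S" "r < d i"
  shows "lev i r \<le> L"
proof (rule ccontr)
  assume "\<not> lev i r \<le> L"
  then have "S (lev i r) i = 0" using assms(2) by (auto simp: semisimple_sequence_def)
  then have "card {r'. r' < d i \<and> lev i r' = lev i r} = 0" using assms(1) by (simp add: levels_def)
  then have "{r'. r' < d i \<and> lev i r' = lev i r} = {}" by simp
  then show False using assms(3) by blast
qed

lemma card_levels_ge:
  assumes "levels S d lev" "semisimple_sequence Q L S"
  shows "card {r. r < d i \<and> l \<le> lev i r} = (\<Sum>k=l..L. S k i)"
proof -
  have "{r. r < d i \<and> l \<le> lev i r} = (\<Union>k\<in>{l..L}. {r. r < d i \<and> lev i r = k})"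
    using levels_le[OF assms] by auto
  then have "card {r. r < d i \<and> l \<le> lev i r} = (\<Sum>k=l..L. card {r. r < d i \<and> lev i r = k})"
    by (simp only:) (rule card_UN_disjoint, auto)
  then show ?thesis using assms(1) by (simp add: levels_def)
qed

lemma levels_seq_dim:
  assumes "levels S d lev" "semisimple_sequence Q L S"
  shows "seq_dim L S = d"
proof
  fix i
  have "{r. r < d i \<and> 0 \<le> lev i r} = {..<d i}" by auto
  then show "seq_dim L S i = d i"
    using card_levels_ge[OF assms, of i 0] by (simp add: seq_dim_def atLeast0AtMost)
qed

lemma ex_levels_nat:
  fixes s :: "nat \<Rightarrow> nat"
  shows "\<exists>f. \<forall>l. card {r. r < (\<Sum>l<n. s l) \<and> f r = l} = (if l < n then s l else 0)"
proof (induction n)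
  case 0
  then show ?case by simp
next
  case (Suc n)
  then obtain f where f: "\<And>l. card {r. r < (\<Sum>l<n. s l) \<and> f r = l} = (if l < n then s l else 0)" by blast
  let ?m = "\<Sum>l<n. s l" and ?g = "\<lambda>r. if r < (\<Sum>l<n. s l) then f r else n"
  have "card {r. r < (\<Sum>l<Suc n. s l) \<and> ?g r = l} = (if l < Suc n then s l else 0)" for l
  proof (cases "l = n")
    case True
    have "card {r. r < ?m \<and> f r = n} = 0" using f[of n] by simp
    then have "{r. r < ?m \<and> f r = n} = {}" by simp
    then have "{r. r < (\<Sum>l<Suc n. s l) \<and> ?g r = l} = {?m..<?m + s n}" using True by auto
    then show ?thesis using True by simp
  next
    case False
    then have "{r. r < (\<Sum>l<Suc n. s l) \<and> ?g r = l} = {r. r < ?m \<and> f r = l}" by auto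
    then show ?thesis using False f[of l] by auto
  qed
  then show ?case by (intro exI[of _ ?g] allI)
qed

lemma levels_concat:
  fixes s c f g :: "nat \<Rightarrow> nat" and m n :: nat
  assumes "\<And>l. card {r. r < m \<and> f r = l} = s l" "\<And>l. card {r. r < n \<and> g r = l} = c l"
  shows "card {r. r < m + n \<and> (if r < m then f r else g (r - m)) = l} = s l + c l"
    and "card {r. r < m \<and> (if r < m then f r else g (r - m)) = l} = s l"
proof -
  have "{r. r < m \<and> (if r < m then f r else g (r - m)) = l} = {r. r < m \<and> f r = l}" by auto
  then show "card {r. r < m \<and> (if r < m then f r else g (r - m)) = l} = s l" using assms(1) by simp
  have "{r. r < m + n \<and> (if r < m then f r else g (r - m)) = l} =
      {r. r < m \<and> f r = l} \<union> (\<lambda>r. r + m) ` {r. r < n \<and> g r = l}" (is "?X = ?Y \<union> ?Z")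
  proof
    show "?X \<subseteq> ?Y \<union> ?Z"
    proof
      fix r assume r: "r \<in> ?X"
      show "r \<in> ?Y \<union> ?Z"
      proof (cases "r < m")
        case False
        then have "r - m \<in> {r. r < n \<and> g r = l}" using r by auto
        then have "r - m + m \<in> ?Z" by (rule imageI)
        then show ?thesis using False by simp
      qed (use r in simp)
    qed
    show "?Y \<union> ?Z \<subseteq> ?X" by auto
  qed
  moreover have "?Y \<inter> ?Z = {}" by auto
  moreover have "finite ?Y" "finite ?Z" by auto
  moreover have "card ?Z = c l" unfolding assms(2)[symmetric] by (rule card_image) (auto simp: inj_on_def)
  ultimately show "card ?X = s l + c l" using assms(1)[of l] by (simp add: card_Un_disjoint)
qed

text \<open>If \<open>S'\<close> is the layering of a quotient, the first coordinates at each vertex are those that survive in it.\<close>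

lemma ex_levels:
  assumes S: "semisimple_sequence Q L S" and le: "\<And>l i. S' l i \<le> S l i"
  shows "\<exists>lev. levels S (seq_dim L S) lev \<and> levels S' (seq_dim L S') lev"
proof -
  have 0: "S l i = 0" "S' l i = 0" if "L < l" for l i
    using S that le[of l i] by (auto simp: semisimple_sequence_def)
  have sum: "(\<Sum>l\<le>L. s l) = (\<Sum>l<Suc L. s l)" for s :: "nat \<Rightarrow> nat" by (simp add: lessThan_Suc_atMost)
  have "\<exists>f. (\<forall>l. card {r. r < seq_dim L S i \<and> f r = l} = S l i) \<and>
      (\<forall>l. card {r. r < seq_dim L S' i \<and> f r = l} = S' l i)" for i
  proof -
    let ?d' = "seq_dim L S' i"
    let ?c = "\<lambda>l. S l i - S' l i"
    obtain f where f: "\<And>l. card {r. r < (\<Sum>l<Suc L. S' l i) \<and> f r = l} = (if l < Suc L then S' l i else 0)"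
      using ex_levels_nat[where n = "Suc L" and s = "\<lambda>l. S' l i"] by (elim exE) blast
    obtain g where g: "\<And>l. card {r. r < (\<Sum>l<Suc L. ?c l) \<and> g r = l} = (if l < Suc L then ?c l else 0)"
      using ex_levels_nat[where n = "Suc L" and s = ?c] by (elim exE) blast
    let ?c' = "\<Sum>l<Suc L. ?c l"
    have d: "seq_dim L S i = ?d' + ?c'"
    proof -
      have "seq_dim L S i = (\<Sum>l<Suc L. S' l i + ?c l)"
        unfolding seq_dim_def sum by (rule sum.cong[OF refl]) (simp add: le)
      then show ?thesis unfolding sum.distrib by (simp only: seq_dim_def sum)
    qed
    have f': "card {r. r < ?d' \<and> f r = l} = S' l i" for l
      using f[of l] 0(2)[of l i] by (simp add: seq_dim_def sum del: sum.lessThan_Suc)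
    have g': "card {r. r < ?c' \<and> g r = l} = ?c l" for l using g[of l] 0[of l i] by (simp del: sum.lessThan_Suc)
    show ?thesis
    proof (intro exI[of _ "\<lambda>r. if r < ?d' then f r else g (r - ?d')"] conjI allI)
      show "card {r. r < seq_dim L S i \<and> (if r < ?d' then f r else g (r - ?d')) = l} = S l i" for l
        unfolding d levels_concat(1)[OF f' g'] using le[of l i] by simp
    qed (rule levels_concat(2)[OF f' g'])
  qed
  then have "\<forall>i. \<exists>f. (\<forall>l. card {r. r < seq_dim L S i \<and> f r = l} = S l i) \<and>
      (\<forall>l. card {r. r < seq_dim L S' i \<and> f r = l} = S' l i)" by (rule allI)
  from choice[OF this] show ?thesis unfolding levels_def by blast
qed

text \<open>Each arrow strictly raises the level. This is a linear condition on the matrices, so lines between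
  adapted points consist of adapted points.\<close>

definition adapted :: "('v, 'e) pre_digraph \<Rightarrow> ('v \<Rightarrow> nat) \<Rightarrow> ('v \<Rightarrow> nat \<Rightarrow> nat) \<Rightarrow> ('e, 'k::field) point \<Rightarrow> bool" where
  "adapted Q d lev x \<longleftrightarrow> (\<forall>z. z \<notin> rep_coords Q d \<longrightarrow> x z = 0) \<and>
     (\<forall>\<alpha> r c. x (\<alpha>, r, c) \<noteq> 0 \<longrightarrow> lev (tail Q \<alpha>) c < lev (head Q \<alpha>) r)"

abbreviation level_sub :: "('v \<Rightarrow> nat) \<Rightarrow> ('v \<Rightarrow> nat \<Rightarrow> nat) \<Rightarrow> nat \<Rightarrow> ('v \<times> nat \<Rightarrow> 'k::field) set" where
  "level_sub d lev l \<equiv> coord_sub d (\<lambda>i r. l \<le> lev i r)"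

lemma adapted_arrow:
  assumes x: "adapted Q d lev x" and m: "m \<in> level_sub d lev l"
  shows "arrow_act Q d x \<alpha> m \<in> level_sub d lev (Suc l)"
  unfolding coord_sub_def
proof (intro CollectI conjI allI impI)
  fix i r assume r: "\<not> Suc l \<le> lev i r"
  have "x (\<alpha>, r, c) * m (tail Q \<alpha>, c) = 0" if "i = head Q \<alpha>" for c
  proof (cases "x (\<alpha>, r, c) = 0")
    case False
    then have "lev (tail Q \<alpha>) c < lev i r" using x that by (auto simp: adapted_def)
    then have "\<not> l \<le> lev (tail Q \<alpha>) c" using r by simp
    then have "m (tail Q \<alpha>, c) = 0" using m by (auto simp: coord_sub_def)
    then show ?thesis by simp
  qed simp
  then show "arrow_act Q d x \<alpha> m (i, r) = 0" unfolding arrow_act_def by (auto intro: sum.neutral)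
qed (rule arrow_act_kspace)

context quiver
begin

lemma adapted_path:
  assumes x: "adapted Q d lev x" and m: "m \<in> kspace d"
  shows "path_act Q d x (u, p) m \<in> level_sub d lev (length p)"
proof (induction p rule: rev_induct)
  case Nil
  show ?case unfolding path_act_Nil using vertex_act_kspace[OF m] by (auto simp: coord_sub_def)
next
  case (snoc \<alpha> p)
  show ?case unfolding path_act_snoc length_append_singleton by (rule adapted_arrow[OF x snoc])
qed

lemma level_sub_end:
  fixes d :: "'v \<Rightarrow> nat"
  assumes "\<And>i r. r < d i \<Longrightarrow> lev i r \<le> L" "L < l"
  shows "level_sub d lev l = ({0} :: ('v \<times> nat \<Rightarrow> 'k::field) set)"
proof -
  have z: "m (i, r) = 0" if m: "m \<in> level_sub d lev l" for m :: "'v \<times> nat \<Rightarrow> 'k" and i r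
  proof (cases "r < d i")
    case True
    then have "\<not> l \<le> lev i r" using assms(1)[of r i] assms(2) by simp
    then show ?thesis using m unfolding coord_sub_def by blast
  next
    case False
    then show ?thesis using m unfolding coord_sub_def kspace_def by auto
  qed
  show ?thesis
  proof (rule antisym; rule subsetI)
    fix m :: "'v \<times> nat \<Rightarrow> 'k" assume "m \<in> level_sub d lev l"
    then have "m w = 0 w" for w using z[of m "fst w" "snd w"] by simp
    then have "m = 0" by (rule ext)
    then show "m \<in> {0}" by (simp only: singleton_iff)
  next
    fix m :: "'v \<times> nat \<Rightarrow> 'k" assume "m \<in> {0}"
    then have m: "m = 0" by (rule singletonD)
    have "fvs.subspace (level_sub d lev l :: ('v \<times> nat \<Rightarrow> 'k) set)"
      using graded_sub_coord_sub unfolding graded_sub_def by blast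
    then show "m \<in> level_sub d lev l" unfolding m by (rule fvs.subspace_0)
  qed
qed

lemma adapted_rep_variety:
  fixes x :: "('e, 'k::field) point"
  assumes x: "adapted Q d lev x" and lev: "\<And>i r. r < d i \<Longrightarrow> lev i r \<le> L"
  shows "x \<in> rep_variety Q L d"
  unfolding rep_variety_iff
proof (intro conjI ballI impI allI)
  fix w :: "('v, 'e) path" and m :: "'v \<times> nat \<Rightarrow> 'k" assume w: "length (snd w) = L + 1" and m: "m \<in> kspace d"
  obtain u p where up: "w = (u, p)" by (cases w)
  have e: "level_sub d lev (L + 1) = ({0} :: ('v \<times> nat \<Rightarrow> 'k) set)" by (rule level_sub_end[OF lev]) simp_all
  have l: "length p = L + 1" using w up by simp
  have "path_act Q d x (u, p) m \<in> level_sub d lev (length p)" by (rule adapted_path[OF x m])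
  then have "path_act Q d x (u, p) m = 0" unfolding l e by (rule singletonD)
  then show "path_act Q d x w m = 0" unfolding up .
qed (use x in \<open>unfold adapted_def, blast\<close>)

lemma adapted_rad_sub:
  assumes x: "adapted Q d lev x" and lev: "\<And>i r. r < d i \<Longrightarrow> lev i r \<le> L"
  shows "rad_sub Q L d x l \<subseteq> level_sub d lev l"
proof (rule rad_sub_leastI[OF adapted_rep_variety[OF assms]])
  show "fvs.subspace (level_sub d lev l)" using graded_sub_coord_sub unfolding graded_sub_def by blast
qed (use adapted_path[OF x] in auto)

lemma graded_sub_eqI:
  assumes N: "graded_sub d N" and N': "graded_sub d N'" and sub: "N \<subseteq> N'" and d: "d \<in> dim_vectors Q"
    and dim: "\<And>i. i \<in> verts Q \<Longrightarrow> dimvec N' i \<le> dimvec N i"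
  shows "N = N'"
proof (rule antisym[OF sub])
  show "N' \<subseteq> N"
  proof (rule graded_sub_subsetI[OF N' _ finite_verts dim_vectorsD[OF d]])
    show "fvs.subspace N" using N by (simp add: graded_sub_def)
    fix i assume i: "i \<in> verts Q"
    have "vertex_act i ` N = vertex_act i ` N'"
      using dim[OF i] unfolding dimvec_def
      by (intro subspace_eq_of_dim_le graded_sub_fin_dim[OF N'] graded_sub_component_subspace[OF N] image_mono sub)
    moreover have "vertex_act i ` N \<subseteq> N" using N by (auto simp: graded_sub_def)
    ultimately show "vertex_act i ` N' \<subseteq> N" by (simp only:)
  qed
qed

text \<open>The radical power is always contained in the span of the higher levels; in \<open>Rep S\<close> the dimensions agree.\<close>

lemma adapted_layered_rad_sub:
  fixes x :: "('e, 'k::field) point"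
  assumes x: "adapted Q d lev x" "x \<in> rep_layered Q L S" and lev: "levels S d lev"
    and S: "semisimple_sequence Q L S"
  shows "rad_sub Q L d x l = level_sub d lev l"
proof -
  note d = levels_seq_dim[OF lev S]
  have xv: "x \<in> rep_variety Q L d" using x(2) d by (auto simp: rep_layered_def)
  have le: "lev i r \<le> L" if "r < d i" for i r using levels_le[where d = d, OF lev S that] .
  show ?thesis
  proof (rule graded_sub_eqI[OF graded_sub_rad_sub[OF xv] graded_sub_coord_sub adapted_rad_sub[OF x(1) le]])
    show "d \<in> dim_vectors Q" using seq_dim_dim_vectors[OF S] d by simp
    show "dimvec (level_sub d lev l :: ('v \<times> nat \<Rightarrow> 'k) set) i \<le> dimvec (rad_sub Q L d x l) i" for i
      using dimvec_rad_sub[OF x(2) S, of l i] unfolding d dimvec_coord_sub card_levels_ge[OF lev S] by simp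
  qed
qed

lemma adapted_layeredI:
  fixes x :: "('e, 'k::field) point"
  assumes x: "adapted Q d lev x" and lev: "levels S d lev" and S: "semisimple_sequence Q L S"
    and dim: "\<And>l i. l \<le> L \<Longrightarrow> i \<in> verts Q \<Longrightarrow> card {r. r < d i \<and> l \<le> lev i r} \<le> dimvec (rad_sub Q L d x l) i"
  shows "x \<in> rep_layered Q L S"
proof -
  note d = levels_seq_dim[OF lev S]
  have dv: "d \<in> dim_vectors Q" using seq_dim_dim_vectors[OF S] d by simp
  have le: "lev i r \<le> L" if "r < d i" for i r using levels_le[where d = d, OF lev S that] .
  have xv: "x \<in> rep_variety Q L d" by (rule adapted_rep_variety[OF x le])
  have eq: "rad_sub Q L d x l = level_sub d lev l" for l
  proof (cases "l \<le> L")
    case True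
    show ?thesis
    proof (rule graded_sub_eqI[OF graded_sub_rad_sub[OF xv] graded_sub_coord_sub adapted_rad_sub[OF x le] dv])
      show "dimvec (level_sub d lev l :: ('v \<times> nat \<Rightarrow> 'k) set) i \<le> dimvec (rad_sub Q L d x l) i" if "i \<in> verts Q" for i
        unfolding dimvec_coord_sub by (rule dim[OF True that])
    qed
  next
    case False
    have "level_sub d lev l = ({0} :: ('v \<times> nat \<Rightarrow> 'k) set)" by (rule level_sub_end[OF le]) (use False in simp_all)
    moreover have "rad_sub Q L d x l = {0}" by (rule rad_sub_end[OF xv]) (use False in simp)
    ultimately show ?thesis by (simp only:)
  qed
  have "rad_layering Q L d x l i = S l i" for l i
  proof -
    have "{r. r < d i \<and> l \<le> lev i r} = {r. r < d i \<and> lev i r = l} \<union> {r. r < d i \<and> l + 1 \<le> lev i r}" by auto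
    then have "card {r. r < d i \<and> l \<le> lev i r} = S l i + card {r. r < d i \<and> l + 1 \<le> lev i r}"
      using lev by (simp only:) (subst card_Un_disjoint, auto simp: levels_def)
    then show ?thesis unfolding rad_layering_def eq dimvec_coord_sub by simp
  qed
  then show ?thesis unfolding rep_layered_def d using xv by (auto simp: fun_eq_iff)
qed

lemma polyfuns_finite_ball:
  assumes "finite A" "\<And>a. a \<in> A \<Longrightarrow> \<exists>F\<in>polyfuns G. F t0 \<noteq> 0 \<and> (\<forall>t. F t \<noteq> 0 \<longrightarrow> P a t)"
  shows "\<exists>F\<in>polyfuns G. F t0 \<noteq> 0 \<and> (\<forall>t. F t \<noteq> 0 \<longrightarrow> (\<forall>a\<in>A. P a t))"
proof -
  obtain F where F: "\<And>a. a \<in> A \<Longrightarrow> F a \<in> polyfuns G \<and> F a t0 \<noteq> 0 \<and> (\<forall>t. F a t \<noteq> 0 \<longrightarrow> P a t)"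
    using assms(2) by metis
  show ?thesis
    by (rule bexI[of _ "\<lambda>t. \<Prod>a\<in>A. F a t"]) (use F assms(1) in \<open>auto intro!: polyfuns_prod\<close>)
qed

text \<open>For an adapted point, membership in \<open>Rep S\<close> means that the dimensions of the radical powers have their
  maximal values, and these dimensions are ranks.\<close>

lemma adapted_layered_open:
  fixes x :: "'a \<Rightarrow> ('e, 'k::field) point"
  assumes x: "\<And>z. (\<lambda>t. x t z) \<in> polyfuns G" and ad: "\<And>t. adapted Q d lev (x t)"
    and x0: "x t0 \<in> rep_layered Q L S" and lev: "levels S d lev" and S: "semisimple_sequence Q L S"
  shows "\<exists>F\<in>polyfuns G. F t0 \<noteq> 0 \<and> (\<forall>t. F t \<noteq> 0 \<longrightarrow> x t \<in> rep_layered Q L S)"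
proof -
  note d = levels_seq_dim[OF lev S]
  have dv: "d \<in> dim_vectors Q" using seq_dim_dim_vectors[OF S] d by simp
  have le: "lev i r \<le> L" if "r < d i" for i r using levels_le[where d = d, OF lev S that] .
  have xv: "x t \<in> rep_variety Q L d" for t by (rule adapted_rep_variety[OF ad le])
  have "\<exists>F\<in>polyfuns G. F t0 \<noteq> 0 \<and> (\<forall>t. F t \<noteq> 0 \<longrightarrow>
      (\<forall>q\<in>{..L} \<times> verts Q. path_rank L d (x t0) (fst q) 0 (snd q) \<le> path_rank L d (x t) (fst q) 0 (snd q)))"
  proof (rule polyfuns_finite_ball)
    show "\<exists>F\<in>polyfuns G. F t0 \<noteq> 0 \<and> (\<forall>t. F t \<noteq> 0 \<longrightarrow>
      path_rank L d (x t0) (fst q) 0 (snd q) \<le> path_rank L d (x t) (fst q) 0 (snd q))" for q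
      using path_rank_open[of x G t0 L d "fst q" 0 "snd q", OF x xv] xv by blast
  qed simp
  then obtain F where F: "F \<in> polyfuns G" "F t0 \<noteq> 0" "\<And>t l i. F t \<noteq> 0 \<Longrightarrow> l \<le> L \<Longrightarrow> i \<in> verts Q \<Longrightarrow>
      path_rank L d (x t0) l 0 i \<le> path_rank L d (x t) l 0 i" by fastforce
  have "x t \<in> rep_layered Q L S" if t: "F t \<noteq> 0" for t
  proof (rule adapted_layeredI[OF ad lev S])
    fix l i assume "l \<le> L" "i \<in> verts Q"
    then have "dimvec (rad_sub Q L d (x t0) l) i \<le> dimvec (rad_sub Q L d (x t) l) i"
      using F(3)[OF t] unfolding path_rank_0[OF xv dv] by blast
    then show "card {r. r < d i \<and> l \<le> lev i r} \<le> dimvec (rad_sub Q L d (x t) l) i"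
      unfolding adapted_layered_rad_sub[OF ad x0 lev S] dimvec_coord_sub .
  qed
  then show ?thesis using F by blast
qed

end

section \<open>Bases adapted to a filtration\<close>

lemma extend_family:
  assumes b: "indep_on I b" "finite I" "b ` I \<subseteq> V" and V: "fin_dim V"
    and J: "finite J" "I \<inter> J = {}" "card I + card J = fvs.dim V"
  shows "\<exists>b'. (\<forall>i\<in>I. b' i = b i) \<and> indep_on (I \<union> J) b' \<and> b' ` J \<subseteq> V"
proof -
  have i: "inj_on b I" "fvs.independent (b ` I)" using indep_on_image[OF b(2)] b(1) by auto
  obtain B where B: "b ` I \<subseteq> B" "B \<subseteq> V" "finite B" "fvs.independent B" "card B = fvs.dim V"
    by (rule fin_dim_extend_basis[OF V b(3) i(2)])
  have "card (B - b ` I) = card J"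
    using B(3,5) J(3) card_Diff_subset[OF _ B(1)] b(2) card_image[OF i(1)] by simp
  then obtain h where h: "bij_betw h J (B - b ` I)"
    using finite_same_card_bij[of J "B - b ` I"] J(1) B(3) by auto
  let ?b = "\<lambda>i. if i \<in> J then h i else b i"
  have eqI: "?b i = b i" if "i \<in> I" for i using that J(2) by auto
  have imI: "?b ` I = b ` I" using eqI by (intro image_cong) auto
  have imJ: "?b ` J = B - b ` I" using h by (auto simp: bij_betw_def)
  have "inj_on ?b I" using i(1) eqI inj_on_cong[of I ?b b] by blast
  moreover have "inj_on ?b J" using h inj_on_cong[of J ?b h] by (auto simp: bij_betw_def)
  moreover have "?b ` (I - J) \<inter> ?b ` (J - I) = {}" using imI imJ by blast
  ultimately have "inj_on ?b (I \<union> J)" unfolding inj_on_Un by blast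
  moreover have "?b ` (I \<union> J) = B" unfolding image_Un imI imJ using B(1) by blast
  ultimately have "indep_on (I \<union> J) ?b"
    unfolding indep_on_image[OF finite_UnI[OF b(2) J(1)]] using B(4) by (simp only: simp_thms)
  moreover have "?b ` J \<subseteq> V" unfolding imJ using B(2) by blast
  ultimately show ?thesis using eqI by (intro exI[of _ ?b]) blast
qed

lemma indep_on_spans:
  assumes "indep_on I b" "finite I" "b ` I \<subseteq> V" "fvs.subspace V" "fin_dim V" "card I = fvs.dim V"
  shows "fvs.span (b ` I) = V"
proof (rule subspace_eq_of_dim_le[OF assms(5) fvs.subspace_span])
  show "fvs.span (b ` I) \<subseteq> V" by (rule fvs.span_minimal[OF assms(3,4)])
  have "fvs.dim (fvs.span (b ` I)) = card I"
    by (rule dim_eq_card_family[OF assms(1,2) _ order_refl]) (rule fvs.span_superset)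
  then show "fvs.dim V \<le> fvs.dim (fvs.span (b ` I))" using assms(6) by simp
qed

text \<open>The family is built from the smallest term of the filtration upwards. At each step, vectors of \<open>N\<close> are added
  first; they stay independent of the earlier ones because those among the earlier ones that lie in \<open>N\<close> already
  span \<open>N \<inter> F\<^sub>l\<^sub>+\<^sub>1\<close>. The coordinates \<open>r \<ge> n'\<close> are the ones reserved for \<open>N\<close>.\<close>

lemma adapted_basis:
  fixes F :: "nat \<Rightarrow> ('b \<Rightarrow> 'k::field) set" and n n' :: nat
  assumes F: "\<And>l. fvs.subspace (F l)" "\<And>l. F (Suc l) \<subseteq> F l" "fin_dim (F 0)" "F M = {0}"
    and N: "fvs.subspace N"
    and dimF: "\<And>l. card {r. r < n \<and> l \<le> lev r} = fvs.dim (F l)"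
    and dimN: "\<And>l. card {r. r < n \<and> n' \<le> r \<and> l \<le> lev r} = fvs.dim (N \<inter> F l)"
  shows "\<exists>b. indep_on {r. r < n \<and> 0 \<le> lev r} b \<and>
    (\<forall>r. r < n \<and> 0 \<le> lev r \<longrightarrow> b r \<in> F (lev r) \<and> (n' \<le> r \<longrightarrow> b r \<in> N))"
proof -
  have mono: "F l \<subseteq> F k" if "k \<le> l" for k l by (rule lift_Suc_antimono_le[of F, OF F(2) that])
  have fd: "fin_dim (F l)" for l by (rule fin_dim_mono[OF F(3) mono]) simp
  show ?thesis
  proof (rule inc_induct[of 0 M])
    have "fvs.dim ({0} :: ('b \<Rightarrow> 'k) set) = 0" using fvs.dim_le_card[of "{0}" "{}"] by simp
    then have "card {r. r < n \<and> M \<le> lev r} = 0" unfolding dimF F(4) .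
    then have "{r. r < n \<and> M \<le> lev r} = {}" by simp
    then show "\<exists>b. indep_on {r. r < n \<and> M \<le> lev r} b \<and>
      (\<forall>r. r < n \<and> M \<le> lev r \<longrightarrow> b r \<in> F (lev r) \<and> (n' \<le> r \<longrightarrow> b r \<in> N))"
      by (auto simp: indep_on_def)
  next
    fix l assume "\<exists>b. indep_on {r. r < n \<and> Suc l \<le> lev r} b \<and>
      (\<forall>r. r < n \<and> Suc l \<le> lev r \<longrightarrow> b r \<in> F (lev r) \<and> (n' \<le> r \<longrightarrow> b r \<in> N))"
    then obtain b where b: "indep_on {r. r < n \<and> Suc l \<le> lev r} b"
      "\<And>r. r < n \<Longrightarrow> Suc l \<le> lev r \<Longrightarrow> b r \<in> F (lev r)"
      "\<And>r. r < n \<Longrightarrow> Suc l \<le> lev r \<Longrightarrow> n' \<le> r \<Longrightarrow> b r \<in> N" by blast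
    define R where "R = {r. r < n \<and> Suc l \<le> lev r}"
    define I where "I = {r. r < n \<and> n' \<le> r \<and> Suc l \<le> lev r}"
    define J where "J = {r. r < n \<and> n' \<le> r \<and> lev r = l}"
    define J2 where "J2 = {r. r < n \<and> \<not> n' \<le> r \<and> lev r = l}"
    have fin: "finite R" "finite I" "finite J" "finite J2" by (auto simp: R_def I_def J_def J2_def)
    have IR: "I \<subseteq> R" by (auto simp: R_def I_def)
    have IJ: "I \<inter> J = {}" "R \<inter> J = {}" "(R \<union> J) \<inter> J2 = {}" by (auto simp: R_def I_def J_def J2_def)
    have IuJ: "I \<union> J = {r. r < n \<and> n' \<le> r \<and> l \<le> lev r}" by (auto simp: I_def J_def)
    have all: "R \<union> J \<union> J2 = {r. r < n \<and> l \<le> lev r}" by (auto simp: R_def J_def J2_def)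
    have bR: "indep_on R b" using b(1) by (simp add: R_def)
    have bRF: "b ` R \<subseteq> F (Suc l)" using b(2) mono by (fastforce simp: R_def)
    have bI: "indep_on I b" by (rule indep_on_mono[OF bR IR fin(1)])
    have bIN: "b ` I \<subseteq> N \<inter> F (Suc l)" using b(3) bRF IR by (auto simp: I_def)
    have NF: "fvs.subspace (N \<inter> F k)" "fin_dim (N \<inter> F k)" for k
      using fvs.subspace_inter[OF N F(1)] fin_dim_mono[OF fd, of "N \<inter> F k" k] by auto
    have spanI: "fvs.span (b ` I) = N \<inter> F (Suc l)"
      by (rule indep_on_spans[OF bI fin(2) bIN NF]) (use dimN[of "Suc l"] in \<open>simp add: I_def\<close>)
    have "\<exists>b1. (\<forall>i\<in>I. b1 i = b i) \<and> indep_on (I \<union> J) b1 \<and> b1 ` J \<subseteq> N \<inter> F l"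
    proof (rule extend_family[OF bI fin(2) _ NF(2) fin(3) IJ(1)])
      show "b ` I \<subseteq> N \<inter> F l" using bIN F(2)[of l] by blast
      show "card I + card J = fvs.dim (N \<inter> F l)"
        unfolding dimN[symmetric] IuJ[symmetric] by (rule card_Un_disjoint[OF fin(2,3) IJ(1), symmetric])
    qed
    then obtain b1 where b1: "\<And>i. i \<in> I \<Longrightarrow> b1 i = b i" "indep_on (I \<union> J) b1" "b1 ` J \<subseteq> N \<inter> F l" by blast
    let ?b2 = "\<lambda>r. if r \<in> J then b1 r else b r"
    have b2: "indep_on (R \<union> J) ?b2" unfolding indep_on_def
    proof (rule allI, rule impI)
      fix c assume s: "(\<Sum>r\<in>R \<union> J. vscale (c r) (?b2 r)) = 0"
      have R2: "(\<Sum>r\<in>R. vscale (c r) (?b2 r)) = (\<Sum>r\<in>R. vscale (c r) (b r))"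
        by (rule sum.cong[OF refl]) (use IJ(2) in auto)
      have J2: "(\<Sum>r\<in>J. vscale (c r) (?b2 r)) = (\<Sum>r\<in>J. vscale (c r) (b1 r))"
        by (rule sum.cong[OF refl]) auto
      have s': "(\<Sum>r\<in>R. vscale (c r) (b r)) + (\<Sum>r\<in>J. vscale (c r) (b1 r)) = 0"
        using s unfolding sum.union_disjoint[OF fin(1,3) IJ(2)] R2 J2 .
      let ?v = "\<Sum>r\<in>J. vscale (c r) (b1 r)"
      have "?v \<in> N" using b1(3) by (intro fvs.subspace_sum[OF N] fvs.subspace_scale[OF N]) auto
      moreover have "?v \<in> F (Suc l)"
      proof -
        have "(\<Sum>r\<in>R. vscale (c r) (b r)) \<in> F (Suc l)"
          using bRF by (intro fvs.subspace_sum[OF F(1)] fvs.subspace_scale[OF F(1)]) auto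
        then have "- (\<Sum>r\<in>R. vscale (c r) (b r)) \<in> F (Suc l)" by (rule fvs.subspace_neg[OF F(1)])
        moreover have "?v = - (\<Sum>r\<in>R. vscale (c r) (b r))" using s' by (simp only: add_eq_0_iff)
        ultimately show ?thesis by (simp only:)
      qed
      ultimately have "?v \<in> fvs.span (b ` I)" unfolding spanI by blast
      then obtain e where e: "?v = (\<Sum>r\<in>I. vscale (e r) (b r))" unfolding span_family_iff[OF fin(2)] by blast
      let ?c = "\<lambda>r. if r \<in> J then c r else - e r"
      have "(\<Sum>r\<in>I \<union> J. vscale (?c r) (b1 r)) = (\<Sum>r\<in>I. vscale (?c r) (b1 r)) + (\<Sum>r\<in>J. vscale (?c r) (b1 r))"
        by (rule sum.union_disjoint[OF fin(2,3) IJ(1)])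
      also have "(\<Sum>r\<in>I. vscale (?c r) (b1 r)) = - (\<Sum>r\<in>I. vscale (e r) (b r))"
        unfolding sum_negf[symmetric] by (rule sum.cong[OF refl]) (use IJ(1) b1(1) in auto)
      also have "(\<Sum>r\<in>J. vscale (?c r) (b1 r)) = ?v" by (rule sum.cong[OF refl]) auto
      also have "- (\<Sum>r\<in>I. vscale (e r) (b r)) + ?v = 0" unfolding e by (simp only: left_minus)
      finally have s2: "(\<Sum>r\<in>I \<union> J. vscale (?c r) (b1 r)) = 0" .
      have cJ: "c r = 0" if r: "r \<in> J" for r
      proof -
        have "?c r = 0" by (rule indep_onD[OF b1(2) s2]) (use r in blast)
        then show ?thesis using r by simp
      qed
      then have "?v = 0" by (intro sum.neutral) (simp add: fvs.scale_zero_left)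
      then have s3: "(\<Sum>r\<in>R. vscale (c r) (b r)) = 0" using s' by (simp only: add_0_right)
      have "c r = 0" if "r \<in> R" for r by (rule indep_onD[OF bR s3 that])
      then show "\<forall>r\<in>R \<union> J. c r = 0" using cJ by blast
    qed
    have b2F: "?b2 ` (R \<union> J) \<subseteq> F l" using bRF b1(3) F(2)[of l] by auto
    have "\<exists>b3. (\<forall>i\<in>R \<union> J. b3 i = ?b2 i) \<and> indep_on (R \<union> J \<union> J2) b3 \<and> b3 ` J2 \<subseteq> F l"
    proof (rule extend_family[OF b2 finite_UnI[OF fin(1,3)] b2F fd fin(4) IJ(3)])
      show "card (R \<union> J) + card J2 = fvs.dim (F l)"
        unfolding dimF[symmetric] all[symmetric]
        by (rule card_Un_disjoint[OF finite_UnI[OF fin(1,3)] fin(4) IJ(3), symmetric])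
    qed
    then obtain b3 where b3: "\<And>i. i \<in> R \<union> J \<Longrightarrow> b3 i = ?b2 i" "indep_on (R \<union> J \<union> J2) b3" "b3 ` J2 \<subseteq> F l" by blast
    have "b3 r \<in> F (lev r) \<and> (n' \<le> r \<longrightarrow> b3 r \<in> N)" if r: "r < n" "l \<le> lev r" for r
    proof -
      have "r \<in> R \<union> J \<union> J2" unfolding all using r by blast
      then consider "r \<in> R" | "r \<in> J" | "r \<in> J2" by blast
      then show ?thesis
      proof cases
        case 1
        then have "r \<notin> J" using IJ(2) by blast
        then have "b3 r = b r" using b3(1)[of r] 1 by simp
        then show ?thesis using b(2,3)[of r] 1 by (simp add: R_def)
      next
        case 2
        then have "b3 r = b1 r" using b3(1)[of r] by simp
        moreover have "b1 r \<in> N \<inter> F l" using b1(3) 2 by blast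
        ultimately show ?thesis using 2 by (simp add: J_def)
      next
        case 3
        then have "b3 r \<in> F l" using b3(3) by blast
        then show ?thesis using 3 by (simp add: J2_def)
      qed
    qed
    then show "\<exists>b. indep_on {r. r < n \<and> l \<le> lev r} b \<and>
      (\<forall>r. r < n \<and> l \<le> lev r \<longrightarrow> b r \<in> F (lev r) \<and> (n' \<le> r \<longrightarrow> b r \<in> N))"
      using b3(2) unfolding all by blast
  qed simp
qed

section \<open>Conjugation\<close>

text \<open>The action on \<open>K\<^sup>d\<close> of one matrix at each vertex.\<close>

definition gmap :: "('v \<Rightarrow> nat) \<Rightarrow> ('v \<Rightarrow> nat \<Rightarrow> nat \<Rightarrow> 'k::field) \<Rightarrow> ('v \<times> nat \<Rightarrow> 'k) \<Rightarrow> ('v \<times> nat \<Rightarrow> 'k)" where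
  "gmap d h m = (\<lambda>(j, r). if r < d j then \<Sum>c<d j. h j r c * m (j, c) else 0)"

text \<open>Conjugation of \<open>u\<close> by \<open>h\<close>, with \<open>k\<close> in the place of the inverse. Along a curve \<open>k\<close> has to be the
  adjugate; therefore \<open>h\<close> and \<open>k\<close> are assumed to be inverse to each other only up to a scalar \<open>\<delta> i\<close> at each
  vertex.\<close>

definition conj_pt :: "('v, 'e) pre_digraph \<Rightarrow> ('v \<Rightarrow> nat) \<Rightarrow> ('v \<Rightarrow> nat \<Rightarrow> nat \<Rightarrow> 'k::field) \<Rightarrow>
    ('e, 'k) point \<Rightarrow> ('v \<Rightarrow> nat \<Rightarrow> nat \<Rightarrow> 'k) \<Rightarrow> ('e, 'k) point" where
  "conj_pt Q d h u k = (\<lambda>(\<alpha>, r, c). if (\<alpha>, r, c) \<in> rep_coords Q d then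
     \<Sum>r'<d (head Q \<alpha>). \<Sum>c'<d (tail Q \<alpha>). h (head Q \<alpha>) r r' * u (\<alpha>, r', c') * k (tail Q \<alpha>) c' c else 0)"

definition mat_prod_scalar :: "('v \<Rightarrow> nat) \<Rightarrow> ('v \<Rightarrow> nat \<Rightarrow> nat \<Rightarrow> 'k::field) \<Rightarrow>
    ('v \<Rightarrow> nat \<Rightarrow> nat \<Rightarrow> 'k) \<Rightarrow> ('v \<Rightarrow> 'k) \<Rightarrow> bool" where
  "mat_prod_scalar d k h \<delta> \<longleftrightarrow> (\<forall>i r s. r < d i \<longrightarrow> s < d i \<longrightarrow>
     (\<Sum>c<d i. k i r c * h i c s) = (if r = s then \<delta> i else 0))"

lemma gmap_semilinear: "semilinear_on id V (gmap d h)"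
  unfolding semilinear_on_def using field_auto_id
  by (auto simp: gmap_def fun_eq_iff vscale_apply distrib_left sum.distrib sum_distrib_left mult.left_commute)

lemma gmap_kspace: "gmap d h m \<in> kspace d"
  by (auto simp: gmap_def kspace_def)

lemma gmap_vertex: "gmap d h (vertex_act i m) = vertex_act i (gmap d h m)"
  by (auto simp: gmap_def fun_eq_iff vertex_act_apply)

lemma gmap_gmap:
  assumes "mat_prod_scalar d k h \<delta>"
  shows "gmap d k (gmap d h m) (j, r) = (if r < d j then \<delta> j * m (j, r) else 0)"
proof (cases "r < d j")
  case True
  have "gmap d k (gmap d h m) (j, r) = (\<Sum>c<d j. \<Sum>s<d j. k j r c * h j c s * m (j, s))"
    using True by (simp add: gmap_def sum_distrib_left mult.assoc)
  also have "\<dots> = (\<Sum>s<d j. \<Sum>c<d j. k j r c * h j c s * m (j, s))" by (rule sum.swap)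
  also have "\<dots> = (\<Sum>s<d j. (if r = s then \<delta> j else 0) * m (j, s))"
    unfolding sum_distrib_right[symmetric] using assms True
    by (intro sum.cong refl) (simp add: mat_prod_scalar_def)
  also have "\<dots> = (\<Sum>s<d j. if s = r then \<delta> j * m (j, r) else 0)" by (intro sum.cong) auto
  also have "\<dots> = \<delta> j * m (j, r)" using True by simp
  finally show ?thesis using True by simp
qed (simp add: gmap_def)

lemma conj_arrow:
  assumes "mat_prod_scalar d k h \<delta>" "\<alpha> \<in> arcs Q"
  shows "arrow_act Q d (conj_pt Q d h u k) \<alpha> (gmap d h m) = vscale (\<delta> (tail Q \<alpha>)) (gmap d h (arrow_act Q d u \<alpha> m))"
proof
  fix z :: "'a \<times> nat"
  obtain j r where z: "z = (j, r)" by (cases z)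
  let ?t = "tail Q \<alpha>" and ?h = "head Q \<alpha>"
  show "arrow_act Q d (conj_pt Q d h u k) \<alpha> (gmap d h m) z = vscale (\<delta> ?t) (gmap d h (arrow_act Q d u \<alpha> m)) z"
  proof (cases "j = ?h \<and> r < d j")
    case False
    then consider "j \<noteq> ?h" | "\<not> r < d j" by blast
    then show ?thesis
    proof cases
      case 1
      then show ?thesis by (simp add: z arrow_act_def gmap_def vscale_apply)
    next
      case 2
      then show ?thesis by (simp add: z arrow_act_def gmap_def vscale_apply)
    qed
  next
    case True
    then have jh: "j = ?h" and r: "r < d ?h" by auto
    let ?M = "gmap d h m"
    have "arrow_act Q d (conj_pt Q d h u k) \<alpha> ?M (?h, r) =
      (\<Sum>c<d ?t. (\<Sum>r'<d ?h. \<Sum>c'<d ?t. h ?h r r' * u (\<alpha>, r', c') * k ?t c' c) * ?M (?t, c))"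
      using r assms(2) unfolding arrow_act_def conj_pt_def
      by (auto simp: rep_coords_def intro!: sum.cong)
    also have "\<dots> = (\<Sum>c<d ?t. \<Sum>r'<d ?h. \<Sum>c'<d ?t. h ?h r r' * (u (\<alpha>, r', c') * (k ?t c' c * ?M (?t, c))))"
      by (simp add: sum_distrib_right mult.assoc)
    also have "\<dots> = (\<Sum>r'<d ?h. \<Sum>c<d ?t. \<Sum>c'<d ?t. h ?h r r' * (u (\<alpha>, r', c') * (k ?t c' c * ?M (?t, c))))"
      by (rule sum.swap)
    also have "\<dots> = (\<Sum>r'<d ?h. \<Sum>c'<d ?t. \<Sum>c<d ?t. h ?h r r' * (u (\<alpha>, r', c') * (k ?t c' c * ?M (?t, c))))"
      by (intro sum.cong refl sum.swap)
    also have "\<dots> = (\<Sum>r'<d ?h. \<Sum>c'<d ?t. h ?h r r' * (u (\<alpha>, r', c') * gmap d k ?M (?t, c')))"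
      by (intro sum.cong refl) (simp add: gmap_def[of d k] sum_distrib_left)
    also have "\<dots> = (\<Sum>r'<d ?h. \<Sum>c'<d ?t. h ?h r r' * (u (\<alpha>, r', c') * (\<delta> ?t * m (?t, c'))))"
      by (intro sum.cong refl) (simp add: gmap_gmap[OF assms(1)])
    also have "\<dots> = \<delta> ?t * (\<Sum>r'<d ?h. h ?h r r' * (\<Sum>c'<d ?t. u (\<alpha>, r', c') * m (?t, c')))"
      unfolding sum_distrib_left by (intro sum.cong refl) (simp add: mult.left_commute)
    also have "\<dots> = vscale (\<delta> ?t) (gmap d h (arrow_act Q d u \<alpha> m)) (?h, r)"
      using r by (simp add: gmap_def vscale_apply arrow_act_def)
    finally show ?thesis by (simp only: z jh)
  qed
qed

lemma gmap_bij:
  assumes "mat_prod_scalar d k h \<delta>" "mat_prod_scalar d h k \<delta>" "\<And>i. \<delta> i \<noteq> 0"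
  shows "bij_betw (gmap d h) (kspace d) (kspace d)"
proof (rule bij_betw_byWitness[where f' = "\<lambda>n (j, r). gmap d k n (j, r) / \<delta> j"])
  show "\<forall>m\<in>kspace d. (\<lambda>(j, r). gmap d k (gmap d h m) (j, r) / \<delta> j) = m"
    using assms(3) by (auto simp: gmap_gmap[OF assms(1)] fun_eq_iff kspace_def)
  show "\<forall>n\<in>kspace d. gmap d h (\<lambda>(j, r). gmap d k n (j, r) / \<delta> j) = n"
  proof
    fix n :: "'a \<times> nat \<Rightarrow> 'b" assume n: "n \<in> kspace d"
    have "gmap d h (\<lambda>(j, r). gmap d k n (j, r) / \<delta> j) (j, r) = n (j, r)" for j r
    proof -
      have "gmap d h (\<lambda>(j, r). gmap d k n (j, r) / \<delta> j) (j, r) = gmap d h (gmap d k n) (j, r) / \<delta> j"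
        by (simp add: gmap_def[of d h] sum_divide_distrib)
      then show ?thesis using assms(3) n by (auto simp: gmap_gmap[OF assms(2)] kspace_def)
    qed
    then have "gmap d h (\<lambda>(j, r). gmap d k n (j, r) / \<delta> j) z = n z" for z by (cases z) (simp only:)
    then show "gmap d h (\<lambda>(j, r). gmap d k n (j, r) / \<delta> j) = n" by (rule ext)
  qed
  show "gmap d h ` kspace d \<subseteq> kspace d" using gmap_kspace by blast
  show "(\<lambda>n (j, r). gmap d k n (j, r) / \<delta> j) ` kspace d \<subseteq> kspace d"
    by (auto simp: gmap_def kspace_def)
qed

lemma conj_scaled_map:
  assumes "mat_prod_scalar d k h \<delta>" "\<And>i. \<delta> i \<noteq> 0"
  shows "scaled_map Q id (\<lambda>\<alpha>. \<delta> (tail Q \<alpha>)) d u d (conj_pt Q d h u k) (gmap d h)"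
  unfolding scaled_map_def
proof (intro conjI ballI allI)
  show "semilinear_on id (kspace d) (gmap d h)" by (rule gmap_semilinear)
  show "gmap d h ` kspace d \<subseteq> kspace d" by (rule image_subsetI) (rule gmap_kspace)
qed (rule gmap_vertex, rule assms(2), rule conj_arrow[OF assms(1)])

lemma arrow_act_std:
  "(\<alpha>, r, c) \<in> rep_coords Q d \<Longrightarrow> arrow_act Q d x \<alpha> (std_vec (tail Q \<alpha>, c)) (head Q \<alpha>, r) = x (\<alpha>, r, c)"
proof -
  assume "(\<alpha>, r, c) \<in> rep_coords Q d"
  then have rc: "r < d (head Q \<alpha>)" "c < d (tail Q \<alpha>)" by (auto simp: rep_coords_def)
  have "(\<Sum>c'<d (tail Q \<alpha>). x (\<alpha>, r, c') * std_vec (tail Q \<alpha>, c) (tail Q \<alpha>, c')) =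
      (\<Sum>c'<d (tail Q \<alpha>). if c' = c then x (\<alpha>, r, c) else 0)"
    by (intro sum.cong) (auto simp: std_vec_def)
  then show ?thesis using rc by (simp add: arrow_act_def)
qed

lemma std_vec_kspace: "c < d i \<Longrightarrow> std_vec (i, c) \<in> kspace d"
  by (auto simp: kspace_def std_vec_def)

lemma point_eqI:
  fixes x y :: "('e, 'k::field) point"
  assumes "\<And>z. z \<notin> rep_coords Q d \<Longrightarrow> x z = 0" "\<And>z. z \<notin> rep_coords Q d \<Longrightarrow> y z = 0"
    and "\<And>\<alpha> m. \<alpha> \<in> arcs Q \<Longrightarrow> m \<in> kspace d \<Longrightarrow> arrow_act Q d x \<alpha> m = arrow_act Q d y \<alpha> m"
  shows "x = y"
proof
  fix z :: "'e \<times> nat \<times> nat"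
  obtain \<alpha> r c where z: "z = (\<alpha>, r, c)" by (metis surj_pair)
  show "x z = y z"
  proof (cases "z \<in> rep_coords Q d")
    case True
    then have rc: "(\<alpha>, r, c) \<in> rep_coords Q d" using z by simp
    then have "arrow_act Q d x \<alpha> (std_vec (tail Q \<alpha>, c)) = arrow_act Q d y \<alpha> (std_vec (tail Q \<alpha>, c))"
      by (intro assms(3) std_vec_kspace) (auto simp: rep_coords_def)
    then have "arrow_act Q d x \<alpha> (std_vec (tail Q \<alpha>, c)) (head Q \<alpha>, r) = arrow_act Q d y \<alpha> (std_vec (tail Q \<alpha>, c)) (head Q \<alpha>, r)"
      by (rule fun_cong)
    then show ?thesis unfolding arrow_act_std[OF rc] z .
  next
    case False
    then show ?thesis using assms(1,2) by simp
  qed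
qed

lemma conj_pt_off: "z \<notin> rep_coords Q d \<Longrightarrow> conj_pt Q d h u k z = 0"
  by (cases z) (simp add: conj_pt_def)

lemma gmap_inverse:
  assumes "mat_prod_scalar d k h (\<lambda>_. 1)" "m \<in> kspace d"
  shows "gmap d k (gmap d h m) = m"
  using assms(2) by (auto simp: fun_eq_iff gmap_gmap[OF assms(1)] kspace_def)

lemma conj_conj:
  fixes x :: "('e, 'k::field) point" and Q :: "('v, 'e) pre_digraph"
  assumes "mat_prod_scalar d h g (\<lambda>_. 1)" "mat_prod_scalar d g h (\<lambda>_. 1)"
    and x: "\<And>z. z \<notin> rep_coords Q d \<Longrightarrow> x z = 0"
  shows "conj_pt Q d h (conj_pt Q d g x h) g = x"
proof (rule point_eqI[OF conj_pt_off x])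
  fix \<alpha> and m :: "'v \<times> nat \<Rightarrow> 'k" assume \<alpha>: "\<alpha> \<in> arcs Q" and m: "m \<in> kspace d"
  let ?u = "conj_pt Q d g x h"
  have "arrow_act Q d (conj_pt Q d h ?u g) \<alpha> (gmap d h (gmap d g m)) = gmap d h (arrow_act Q d ?u \<alpha> (gmap d g m))"
    using conj_arrow[OF assms(2) \<alpha>, of ?u "gmap d g m"] by simp
  also have "\<dots> = gmap d h (gmap d g (arrow_act Q d x \<alpha> m))"
    using conj_arrow[OF assms(1) \<alpha>, of x m] by simp
  finally show "arrow_act Q d (conj_pt Q d h ?u g) \<alpha> m = arrow_act Q d x \<alpha> m"
    unfolding gmap_inverse[OF assms(1) m] gmap_inverse[OF assms(1) arrow_act_kspace] .
qed

context quiver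
begin

text \<open>A basis adapted to the radical filtration brings a point of \<open>Rep S\<close> into adapted form. If moreover
  \<open>N\<close> is a submodule annihilated by the arrows, such a basis can be chosen with \<open>N\<close> spanned by its last vectors; then
  the new matrices vanish on the last coordinates. The condition on cardinalities says that the last coordinates
  carry the levels that the induced filtration of \<open>N\<close> requires. The columns of \<open>h\<close> are the basis vectors.\<close>

lemma adapted_form:
  fixes x :: "('e, 'k::field) point"
  assumes x: "x \<in> rep_layered Q L S" and S: "semisimple_sequence Q L S" and lev: "levels S d lev"
    and N: "graded_sub d N" and arr: "\<And>\<alpha> n. \<alpha> \<in> arcs Q \<Longrightarrow> n \<in> N \<Longrightarrow> arrow_act Q d x \<alpha> n = 0"
    and dimN: "\<And>i l. card {r. r < d i \<and> d' i \<le> r \<and> l \<le> lev i r} = dimvec (N \<inter> rad_sub Q L d x l) i"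
  shows "\<exists>u g h. mat_prod_scalar d g h (\<lambda>_. 1) \<and> mat_prod_scalar d h g (\<lambda>_. 1) \<and>
    u = conj_pt Q d g x h \<and> x = conj_pt Q d h u g \<and> adapted Q d lev u \<and> u \<in> rep_layered Q L S \<and>
    (\<forall>\<alpha> r c. d' (tail Q \<alpha>) \<le> c \<longrightarrow> u (\<alpha>, r, c) = 0) \<and>
    gmap d g ` N = coord_sub d (\<lambda>i r. d' i \<le> r)"
proof -
  note d = levels_seq_dim[OF lev S]
  have dv: "d \<in> dim_vectors Q" using seq_dim_dim_vectors[OF S] d by simp
  have xv: "x \<in> rep_variety Q L d" and layx: "rad_layering Q L d x = S" using x d by (auto simp: rep_layered_def)
  have le: "lev i r \<le> L" if "r < d i" for i r using levels_le[where d = d, OF lev S that] .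
  note gr = graded_sub_rad_sub[OF xv]
  let ?F = "\<lambda>i l. vertex_act i ` rad_sub Q L d x l"
  have NF: "vertex_act i ` N \<inter> ?F i l = vertex_act i ` (N \<inter> rad_sub Q L d x l)" for i l
    unfolding graded_sub_component[OF N] graded_sub_component[OF gr] graded_sub_component[OF graded_sub_inter[OF N gr]]
    by blast
  have dimF: "card {r. r < d i \<and> l \<le> lev i r} = fvs.dim (?F i l)" for i l
    using dimvec_rad_sub[OF x S, of l i] unfolding card_levels_ge[OF lev S] d dimvec_def by simp
  have F0: "?F i (L + 1) = {0}" for i
    unfolding rad_sub_end[OF xv less_add_one] by (simp add: vertex_act_0)
  have ex: "\<exists>b. indep_on {r. r < d i \<and> 0 \<le> lev i r} b \<and>
    (\<forall>r. r < d i \<and> 0 \<le> lev i r \<longrightarrow> b r \<in> ?F i (lev i r) \<and> (d' i \<le> r \<longrightarrow> b r \<in> vertex_act i ` N))" for i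
  proof (rule adapted_basis[where F = "?F i" and M = "L + 1" and N = "vertex_act i ` N"])
    show "fvs.subspace (?F i l)" for l by (rule graded_sub_component_subspace[OF gr])
    show "?F i (Suc l) \<subseteq> ?F i l" for l by (rule image_mono[OF rad_sub_antimono[OF xv]]) simp
    show "fin_dim (?F i 0)" by (rule graded_sub_fin_dim[OF gr])
    show "?F i (L + 1) = {0}" by (rule F0)
    show "fvs.subspace (vertex_act i ` N)" by (rule graded_sub_component_subspace[OF N])
    show "card {r. r < d i \<and> l \<le> lev i r} = fvs.dim (?F i l)" for l by (rule dimF)
    show "card {r. r < d i \<and> d' i \<le> r \<and> l \<le> lev i r} = fvs.dim (vertex_act i ` N \<inter> ?F i l)" for l
      unfolding NF dimN dimvec_def ..
  qed
  have "\<exists>b. \<forall>i. indep_on {r. r < d i \<and> 0 \<le> lev i r} (b i) \<and>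
    (\<forall>r. r < d i \<and> 0 \<le> lev i r \<longrightarrow> b i r \<in> ?F i (lev i r) \<and> (d' i \<le> r \<longrightarrow> b i r \<in> vertex_act i ` N))"
    by (rule choice[OF allI[OF ex]])
  then obtain b where b00: "\<forall>i. indep_on {r. r < d i \<and> 0 \<le> lev i r} (b i) \<and>
    (\<forall>r. r < d i \<and> 0 \<le> lev i r \<longrightarrow> b i r \<in> ?F i (lev i r) \<and> (d' i \<le> r \<longrightarrow> b i r \<in> vertex_act i ` N))"
    by (rule exE)
  note b0 = b00[THEN spec]
  have b: "indep_on {..<d i} (b i)" for i
  proof -
    have "{r. r < d i \<and> 0 \<le> lev i r} = {..<d i}" by auto
    then show ?thesis using b0[of i] by simp
  qed
  have bF: "b i r \<in> ?F i (lev i r)" if "r < d i" for i r using b0[of i] that by blast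
  have bN: "b i r \<in> vertex_act i ` N" if "r < d i" "d' i \<le> r" for i r using b0[of i] that by blast
  have Fanti: "?F i l \<subseteq> ?F i k" if "k \<le> l" for i k l by (rule image_mono[OF rad_sub_antimono[OF xv that]])
  have bR: "b i r \<in> ?F i l" if "r < d i" "l \<le> lev i r" for i r l using bF[OF that(1)] Fanti[OF that(2)] by blast
  have bK: "b i r \<in> kspace d" "vertex_act i (b i r) = b i r" if "r < d i" for i r
    using bF[OF that] unfolding graded_sub_component[OF gr] using rad_sub_kspace[OF xv] by blast+
  have spanF: "fvs.span (b i ` {r. r < d i \<and> l \<le> lev i r}) = ?F i l" for i l
  proof (rule indep_on_spans[OF _ _ _ graded_sub_component_subspace[OF gr] graded_sub_fin_dim[OF gr] dimF])
    show "indep_on {r. r < d i \<and> l \<le> lev i r} (b i)" by (rule indep_on_mono[OF b[of i]]) auto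
    show "b i ` {r. r < d i \<and> l \<le> lev i r} \<subseteq> ?F i l" using bR by blast
  qed simp
  have spanN: "fvs.span (b i ` {r. r < d i \<and> d' i \<le> r}) = vertex_act i ` N" for i
  proof (rule indep_on_spans[OF _ _ _ graded_sub_component_subspace[OF N] graded_sub_fin_dim[OF N]])
    show "indep_on {r. r < d i \<and> d' i \<le> r} (b i)" by (rule indep_on_mono[OF b[of i]]) auto
    show "b i ` {r. r < d i \<and> d' i \<le> r} \<subseteq> vertex_act i ` N" using bN by blast
    have "N \<inter> kspace d = N" using N by (auto simp: graded_sub_def)
    then show "card {r. r < d i \<and> d' i \<le> r} = fvs.dim (vertex_act i ` N)"
      using dimN[of i 0] unfolding rad_sub_0[OF xv dv] by (simp add: dimvec_def)
  qed simp
  have spanK: "vertex_act i ` kspace d = fvs.span (b i ` {..<d i})" for i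
  proof -
    have "{r. r < d i \<and> 0 \<le> lev i r} = {..<d i}" by auto
    then show ?thesis using spanF[of i 0] unfolding rad_sub_0[OF xv dv] by simp
  qed
  define h where "h i r c = b i c (i, r)" for i r c
  have "\<exists>g. std_vec (i, s) = (\<Sum>c<d i. vscale (g c) (b i c))" if "s < d i" for i s
  proof -
    have "(std_vec (i, s) :: 'v \<times> nat \<Rightarrow> 'k) = vertex_act i (std_vec (i, s))"
      by (auto simp: fun_eq_iff vertex_act_apply std_vec_def)
    moreover have "(std_vec (i, s) :: 'v \<times> nat \<Rightarrow> 'k) \<in> kspace d" by (rule std_vec_kspace, rule that)
    ultimately have "(std_vec (i, s) :: 'v \<times> nat \<Rightarrow> 'k) \<in> vertex_act i ` kspace d" by (rule image_eqI)
    then show ?thesis unfolding spanK span_family_iff[OF finite_lessThan] .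
  qed
  then have "\<forall>q. \<exists>g. snd q < d (fst q) \<longrightarrow> std_vec q = (\<Sum>c<d (fst q). vscale (g c) (b (fst q) c))"
    by (metis prod.collapse)
  from choice[OF this] obtain g0 where g0:
    "\<And>q. snd q < d (fst q) \<Longrightarrow> std_vec q = (\<Sum>c<d (fst q). vscale (g0 q c) (b (fst q) c))" by blast
  define g where "g i c s = g0 (i, s) c" for i c s
  have g: "std_vec (i, s) = (\<Sum>c<d i. vscale (g i c s) (b i c))" if "s < d i" for i s
    using g0[of "(i, s)"] that by (simp only: g_def fst_conv snd_conv)
  have hg: "mat_prod_scalar d h g (\<lambda>_. 1)" unfolding mat_prod_scalar_def
  proof (intro allI impI)
    fix i r s assume rs: "r < d i" "s < d i"
    have "(\<Sum>c<d i. h i r c * g i c s) = (\<Sum>c<d i. vscale (g i c s) (b i c)) (i, r)"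
      by (simp add: sum_fun_apply vscale_apply h_def mult.commute)
    also have "\<dots> = std_vec (i, s) (i, r)" unfolding g[OF rs(2), symmetric] ..
    finally show "(\<Sum>c<d i. h i r c * g i c s) = (if r = s then 1 else 0)" by (simp add: std_vec_def)
  qed
  have gh: "mat_prod_scalar d g h (\<lambda>_. 1)" unfolding mat_prod_scalar_def
  proof (intro allI impI)
    fix i r s assume rs: "r < d i" "s < d i"
    let ?e = "\<lambda>r. (\<Sum>c<d i. g i r c * h i c s) - (if r = s then 1 else 0)"
    have "(\<Sum>r<d i. vscale (?e r) (b i r)) = 0"
    proof
      fix z
      have "(\<Sum>r<d i. vscale (?e r) (b i r)) z =
          (\<Sum>r<d i. (\<Sum>c<d i. g i r c * h i c s * b i r z)) - (\<Sum>r<d i. if r = s then b i s z else 0)"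
        unfolding sum_fun_apply sum_subtractf[symmetric] vscale_apply left_diff_distrib sum_distrib_right
        by (intro sum.cong) auto
      also have "(\<Sum>r<d i. (\<Sum>c<d i. g i r c * h i c s * b i r z)) = (\<Sum>c<d i. \<Sum>r<d i. g i r c * h i c s * b i r z)"
        by (rule sum.swap)
      also have "\<dots> = (\<Sum>c<d i. h i c s * std_vec (i, c) z)"
      proof (rule sum.cong[OF refl])
        fix c assume "c \<in> {..<d i}"
        then have "c < d i" by simp
        have "h i c s * std_vec (i, c) z = (\<Sum>r<d i. h i c s * (g i r c * b i r z))"
          unfolding g[OF \<open>c < d i\<close>] sum_fun_apply vscale_apply sum_distrib_left ..
        then show "(\<Sum>r<d i. g i r c * h i c s * b i r z) = h i c s * std_vec (i, c) z"
          by (simp only: mult.assoc mult.left_commute)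
      qed
      also have "\<dots> = (\<Sum>c<d i. vscale (b i s (i, c)) (std_vec (i, c))) z"
        by (simp only: sum_fun_apply vscale_apply h_def)
      also have "\<dots> = b i s z"
        unfolding component_expansion[OF bK(1)[OF rs(2)], symmetric] bK(2)[OF rs(2)] ..
      also have "(\<Sum>r<d i. if r = s then b i s z else 0) = b i s z" using rs(2) by simp
      finally show "(\<Sum>r<d i. vscale (?e r) (b i r)) z = 0 z" by simp
    qed
    then have "?e r = 0" by (rule indep_onD[OF b]) (use rs in simp)
    then show "(\<Sum>c<d i. g i r c * h i c s) = (if r = s then 1 else 0)" by simp
  qed
  have hstd: "gmap d h (std_vec (i, c)) = b i c" if c: "c < d i" for i c
  proof
    fix z :: "'v \<times> nat"
    obtain j r where z: "z = (j, r)" by (cases z)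
    have "b i c (j, r) = (if j = i \<and> r < d j then b i c (i, r) else 0)"
    proof -
      have "b i c (j, r) = vertex_act i (b i c) (j, r)" unfolding bK(2)[OF c] ..
      then show ?thesis using kspaceD[OF bK(1)[OF c], of i r]
        by (cases "j = i") (auto simp: vertex_act_apply)
    qed
    moreover have "(\<Sum>c'<d j. h j r c' * std_vec (i, c) (j, c')) = (if j = i then b i c (i, r) else 0)"
    proof -
      have "(\<Sum>c'<d j. h j r c' * std_vec (i, c) (j, c')) = (\<Sum>c'<d j. if c' = c then (if j = i then b i c (i, r) else 0) else 0)"
        by (intro sum.cong) (auto simp: std_vec_def h_def)
      then show ?thesis using c by auto
    qed
    ultimately show "gmap d h (std_vec (i, c)) z = b i c z" by (auto simp: z gmap_def)
  qed
  have gb: "gmap d g (b i c) = std_vec (i, c)" if "c < d i" for i c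
    unfolding hstd[OF that, symmetric] by (rule gmap_inverse[OF gh], rule std_vec_kspace, rule that)
  have gspan: "gmap d g ` fvs.span (b i ` {r. r < d i \<and> A i r}) = vertex_act i ` coord_sub d A" for A i
  proof -
    have "gmap d g ` fvs.span (b i ` {r. r < d i \<and> A i r}) = fvs.span (gmap d g ` b i ` {r. r < d i \<and> A i r})"
      by (rule semilinear_on_span[OF gmap_semilinear[of UNIV]]) auto
    also have "gmap d g ` b i ` {r. r < d i \<and> A i r} = (\<lambda>r. std_vec (i, r)) ` {r. r < d i \<and> A i r}"
      unfolding image_image by (rule image_cong[OF refl]) (simp add: gb)
    finally show ?thesis unfolding coord_sub_component .
  qed
  let ?u = "conj_pt Q d g x h"
  have off: "x z = 0" if "z \<notin> rep_coords Q d" for z using xv that unfolding rep_variety_iff by blast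
  have xu: "x = conj_pt Q d h ?u g" by (rule conj_conj[OF hg gh off, symmetric])
  have sm: "scaled_map Q id (\<lambda>\<alpha>. 1) d x d ?u (gmap d g)" by (rule conj_scaled_map[OF hg]) simp
  have bij: "bij_betw (gmap d g) (kspace d) (kspace d)" by (rule gmap_bij[OF hg gh]) simp
  have surj: "gmap d g ` kspace d = kspace d" and inj: "inj_on (gmap d g) (kspace d)" using bij by (auto simp: bij_betw_def)
  have uv: "?u \<in> rep_variety Q L d" by (rule scaled_map_rep_variety[OF sm xv surj conj_pt_off])
  have ul: "?u \<in> rep_layered Q L S"
    unfolding rep_layered_def d using uv scaled_map_invariants(1)[OF sm xv uv bij] layx by simp
  have entry: "?u (\<alpha>, r, c) = gmap d g (arrow_act Q d x \<alpha> (b (tail Q \<alpha>) c)) (head Q \<alpha>, r)"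
    if "(\<alpha>, r, c) \<in> rep_coords Q d" for \<alpha> r c
  proof -
    have c: "c < d (tail Q \<alpha>)" and \<alpha>: "\<alpha> \<in> arcs Q" using that by (auto simp: rep_coords_def)
    have "arrow_act Q d ?u \<alpha> (std_vec (tail Q \<alpha>, c)) = gmap d g (arrow_act Q d x \<alpha> (b (tail Q \<alpha>) c))"
      using conj_arrow[OF hg \<alpha>, of x "b (tail Q \<alpha>) c"] unfolding gb[OF c] by simp
    then show ?thesis unfolding arrow_act_std[OF that, of ?u, symmetric] by simp
  qed
  have ad: "adapted Q d lev ?u" unfolding adapted_def
  proof (intro conjI allI impI)
    fix \<alpha> r c assume nz: "?u (\<alpha>, r, c) \<noteq> 0"
    let ?t = "tail Q \<alpha>" and ?h = "head Q \<alpha>"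
    have co: "(\<alpha>, r, c) \<in> rep_coords Q d" using nz conj_pt_off[of "(\<alpha>, r, c)" Q d g x h] by blast
    then have c: "c < d ?t" and \<alpha>: "\<alpha> \<in> arcs Q" by (auto simp: rep_coords_def)
    let ?n = "arrow_act Q d x \<alpha> (b ?t c)"
    have "b ?t c \<in> rad_sub Q L d x (lev ?t c)" using bF[OF c] unfolding graded_sub_component[OF gr] by blast
    then have "?n \<in> rad_sub Q L d x (Suc (lev ?t c))" by (rule rad_sub_arrow[OF xv \<alpha>])
    moreover have "vertex_act ?h ?n = ?n" by (simp add: arrow_act_head)
    ultimately have "?n \<in> ?F ?h (Suc (lev ?t c))" unfolding graded_sub_component[OF gr] by blast
    then have n: "gmap d g ?n \<in> gmap d g ` ?F ?h (Suc (lev ?t c))" by (rule imageI)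
    have "gmap d g ` ?F ?h (Suc (lev ?t c)) = vertex_act ?h ` level_sub d lev (Suc (lev ?t c))"
      unfolding spanF[symmetric] by (rule gspan)
    then have "gmap d g ?n \<in> vertex_act ?h ` level_sub d lev (Suc (lev ?t c))" using n by (simp only:)
    then have "gmap d g ?n \<in> level_sub d lev (Suc (lev ?t c))"
      unfolding graded_sub_component[OF graded_sub_coord_sub] by blast
    then have "\<not> Suc (lev ?t c) \<le> lev ?h r \<Longrightarrow> gmap d g ?n (?h, r) = 0" unfolding coord_sub_def by blast
    then show "lev ?t c < lev ?h r" using nz unfolding entry[OF co] Suc_le_eq by blast
  qed (rule conj_pt_off)
  have van: "?u (\<alpha>, r, c) = 0" if dc: "d' (tail Q \<alpha>) \<le> c" for \<alpha> r c
  proof (cases "(\<alpha>, r, c) \<in> rep_coords Q d")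
    case True
    then have c: "c < d (tail Q \<alpha>)" and \<alpha>: "\<alpha> \<in> arcs Q" by (auto simp: rep_coords_def)
    have "b (tail Q \<alpha>) c \<in> N" using bN[OF c dc] unfolding graded_sub_component[OF N] by blast
    then have "arrow_act Q d x \<alpha> (b (tail Q \<alpha>) c) = 0" by (rule arr[OF \<alpha>])
    then show ?thesis unfolding entry[OF True] by (simp add: gmap_def)
  next
    case False
    then show ?thesis by (rule conj_pt_off)
  qed
  let ?C = "coord_sub d (\<lambda>i r. d' i \<le> r) :: ('v \<times> nat \<Rightarrow> 'k) set"
  have gN: "graded_sub d (gmap d g ` N)" unfolding graded_sub_def
  proof (intro conjI allI ballI)
    show "fvs.subspace (gmap d g ` N)"
      by (rule semilinear_on_subspace_image[OF gmap_semilinear]) (use N in \<open>simp add: graded_sub_def\<close>)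
    show "gmap d g ` N \<subseteq> kspace d" by (rule image_subsetI) (rule gmap_kspace)
    fix i m assume "m \<in> gmap d g ` N"
    then obtain n where n: "n \<in> N" "m = gmap d g n" by (elim imageE)
    have "vertex_act i n \<in> N" using N n(1) by (simp add: graded_sub_def)
    then show "vertex_act i m \<in> gmap d g ` N" unfolding n(2) gmap_vertex[symmetric] by (rule imageI)
  qed
  have "gmap d g ` N = ?C"
  proof (rule graded_sub_eqI[OF gN graded_sub_coord_sub _ dv])
    have "N \<subseteq> {m. gmap d g m \<in> ?C}"
    proof (rule graded_sub_subsetI[OF N linear_vimage_subspace[OF gmap_semilinear] finite_verts dim_vectorsD[OF dv]])
      show "fvs.subspace ?C" using graded_sub_coord_sub unfolding graded_sub_def by blast
      fix i
      have "gmap d g ` (vertex_act i ` N) = vertex_act i ` ?C" unfolding spanN[symmetric] by (rule gspan)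
      also have "\<dots> \<subseteq> ?C" using graded_sub_coord_sub[of d "\<lambda>i r. d' i \<le> r"] unfolding graded_sub_def by blast
      finally show "vertex_act i ` N \<subseteq> {m. gmap d g m \<in> ?C}" by blast
    qed
    then show "gmap d g ` N \<subseteq> ?C" by blast
    show "dimvec ?C i \<le> dimvec (gmap d g ` N) i" for i
    proof -
      have "dimvec (gmap d g ` N) i = dimvec N i" by (rule scaled_map_dimvec_inj[OF sm N inj])
      moreover have "N \<inter> kspace d = N" using N by (auto simp: graded_sub_def)
      ultimately show ?thesis using dimN[of i 0] unfolding dimvec_coord_sub rad_sub_0[OF xv dv] by simp
    qed
  qed
  then show ?thesis using gh hg xu ad ul van by blast
qed

section \<open>Irreducibility\<close>

lemma line_polyfuns: "(\<lambda>t. (1 - t) * a + t * b) \<in> polyfuns {\<lambda>t :: 'k::field. t}"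
  by (intro polyfuns_closed polyfuns.gen) auto

lemma polyfuns_line_conj:
  fixes \<F> :: "('k::field \<Rightarrow> 'k) set"
  assumes "infinite (UNIV :: 'k set)" "finite \<F>"
    "\<And>F. F \<in> \<F> \<Longrightarrow> F \<in> polyfuns {\<lambda>t. t} \<and> (\<exists>t. F t \<noteq> 0)"
  shows "\<exists>t. \<forall>F\<in>\<F>. F t \<noteq> 0"
proof -
  have "finite (\<Union>F\<in>\<F>. {t. F t = 0})"
  proof (rule finite_UN_I[OF assms(2)])
    fix F assume "F \<in> \<F>"
    from assms(3)[OF this] obtain t where "F \<in> polyfuns {\<lambda>t. t}" "F t \<noteq> 0" by (elim conjE exE)
    then show "finite {t. F t = 0}" by (rule polyfuns_line_finite_zeros)
  qed
  then have "(\<Union>F\<in>\<F>. {t. F t = 0}) \<noteq> UNIV" using assms(1) by (intro notI) simp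
  then obtain t where "t \<notin> (\<Union>F\<in>\<F>. {t. F t = 0})" by (auto simp: set_eq_iff)
  then have "\<forall>F\<in>\<F>. F t \<noteq> 0" by simp
  then show ?thesis by (rule exI)
qed

lemma conj_pt_polyfuns:
  assumes "\<And>i r c. (\<lambda>t. h t i r c) \<in> polyfuns G" "\<And>i r c. (\<lambda>t. k t i r c) \<in> polyfuns G"
    "\<And>z. (\<lambda>t. u t z) \<in> polyfuns G"
  shows "(\<lambda>t. conj_pt Q d (h t) (u t) (k t) z) \<in> polyfuns G"
proof -
  obtain \<alpha> r c where z: "z = (\<alpha>, r, c)" by (metis surj_pair)
  show ?thesis
  proof (cases "z \<in> rep_coords Q d")
    case True
    then show ?thesis unfolding z conj_pt_def using assms by (auto intro!: polyfuns_closed)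
  next
    case False
    then have "(\<lambda>t. conj_pt Q d (h t) (u t) (k t) z) = (\<lambda>_. 0)" by (simp add: conj_pt_off)
    then show ?thesis by (simp only: polyfuns.const)
  qed
qed

lemma polyfuns_point_compose:
  assumes "F \<in> polyfuns coord_funs" "\<And>z. (\<lambda>t. x t z) \<in> polyfuns G"
  shows "(\<lambda>t. F (x t)) \<in> polyfuns G"
  using polyfuns_compose[OF assms(1), of x G] assms(2) by blast

lemma rescale_adapted:
  fixes u :: "('e, 'k::field) point"
  assumes u: "adapted Q d lev u" "u \<in> rep_layered Q L S" and lev: "levels S d lev"
    and S: "semisimple_sequence Q L S" and s: "\<And>\<alpha>. s \<alpha> \<noteq> 0"
  shows "adapted Q d lev (\<lambda>(\<alpha>, r, c). s \<alpha> * u (\<alpha>, r, c)) \<and> (\<lambda>(\<alpha>, r, c). s \<alpha> * u (\<alpha>, r, c)) \<in> rep_layered Q L S"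
proof -
  let ?u = "\<lambda>(\<alpha>, r, c). s \<alpha> * u (\<alpha>, r, c)"
  note d = levels_seq_dim[OF lev S]
  have le: "lev i r \<le> L" if "r < d i" for i r using levels_le[where d = d, OF lev S that] .
  have ad: "adapted Q d lev ?u" using u(1) by (auto simp: adapted_def)
  have uv: "u \<in> rep_variety Q L d" using u(2) d by (auto simp: rep_layered_def)
  have uv': "?u \<in> rep_variety Q L d" by (rule adapted_rep_variety[OF ad le])
  have sm: "scaled_map Q id s d u d ?u (\<lambda>m. m)"
    unfolding scaled_map_def semilinear_on_def using s field_auto_id
    by (auto simp: arrow_act_def fun_eq_iff vscale_apply sum_distrib_left mult.assoc)
  have "rad_layering Q L d ?u = rad_layering Q L d u"
    by (rule scaled_map_invariants(1)[OF sm uv uv']) (simp add: bij_betw_def)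
  then show ?thesis using ad uv' u(2) unfolding rep_layered_def d by simp
qed

lemma rep_layered_adapted_form:
  fixes x :: "('e, 'k::field) point"
  assumes x: "x \<in> rep_layered Q L S" and S: "semisimple_sequence Q L S" and lev: "levels S d lev"
  shows "\<exists>u g h. mat_prod_scalar d g h (\<lambda>_. 1) \<and> mat_prod_scalar d h g (\<lambda>_. 1) \<and>
    x = conj_pt Q d h u g \<and> adapted Q d lev u \<and> u \<in> rep_layered Q L S"
proof -
  have xv: "x \<in> rep_variety Q L d" using x levels_seq_dim[OF lev S] by (auto simp: rep_layered_def)
  have Z: "graded_sub d ({0} :: ('v \<times> nat \<Rightarrow> 'k) set)"
    by (auto simp: graded_sub_def vertex_act_0 kspace_def)
  have "{0} \<inter> rad_sub Q L d x l = {0}" for l using fvs.subspace_0[OF rad_sub_subspace] by blast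
  then have "card {r. r < d i \<and> d i \<le> r \<and> l \<le> lev i r} = dimvec ({0} \<inter> rad_sub Q L d x l) i" for i l
    by (simp only: dimvec_0) simp
  note ad = adapted_form[OF x S lev Z _ this]
  have "\<exists>u g h. mat_prod_scalar d g h (\<lambda>_. 1) \<and> mat_prod_scalar d h g (\<lambda>_. 1) \<and>
    u = conj_pt Q d g x h \<and> x = conj_pt Q d h u g \<and> adapted Q d lev u \<and> u \<in> rep_layered Q L S \<and>
    (\<forall>\<alpha> r c. d (tail Q \<alpha>) \<le> c \<longrightarrow> u (\<alpha>, r, c) = 0) \<and>
    gmap d g ` {0} = coord_sub d (\<lambda>i r. d i \<le> r)"
    by (rule ad) (simp add: arrow_act_0)
  then show ?thesis by (elim exE conjE) (intro exI conjI)
qed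

text \<open>Two points of \<open>Rep S\<close> are joined by a rational curve: the adapted forms and the base changes move along
  straight lines. With the adjugate in place of the inverse the curve becomes polynomial; the determinants
  that this introduces are compensated by rescaling the arrows at the two ends.\<close>

lemma rep_layered_irreducible:
  assumes inf: "infinite (UNIV :: 'k::field set)" and S: "semisimple_sequence Q L S"
    and ne: "(rep_layered Q L S :: ('e, 'k) point set) \<noteq> {}"
  shows "poly_irreducible (rep_layered Q L S :: ('e, 'k) point set)"
  unfolding poly_irreducible_def
proof (intro conjI ballI impI)
  let ?X = "rep_layered Q L S :: ('e, 'k) point set"
  fix F G assume F: "F \<in> polyfuns coord_funs" and G: "G \<in> polyfuns coord_funs"
    and "\<exists>x\<in>?X. F x \<noteq> 0" "\<exists>x\<in>?X. G x \<noteq> 0"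
  then obtain x1 x2 where x1: "x1 \<in> ?X" "F x1 \<noteq> 0" and x2: "x2 \<in> ?X" "G x2 \<noteq> 0" by blast
  define d where "d = seq_dim L S"
  obtain lev where lev: "levels S d lev" using ex_levels[OF S, of S] unfolding d_def by blast
  note form = rep_layered_adapted_form[OF _ S lev]
  from form[OF x1(1)] obtain u1 g1 h1 where 1: "mat_prod_scalar d h1 g1 (\<lambda>_. 1)"
    "x1 = conj_pt Q d h1 u1 g1" "adapted Q d lev u1" "u1 \<in> ?X" by (elim exE conjE)
  from form[OF x2(1)] obtain u2 g2 h2 where 2: "mat_prod_scalar d h2 g2 (\<lambda>_. 1)"
    "x2 = conj_pt Q d h2 u2 g2" "adapted Q d lev u2" "u2 \<in> ?X" by (elim exE conjE)
  define h where "h t i r c = (1 - t) * h1 i r c + t * h2 i r c" for t i r c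
  have hp: "(\<lambda>t. h t i r c) \<in> polyfuns {\<lambda>t. t}" for i r c unfolding h_def by (rule line_polyfuns)
  define P where "P i k\<delta> \<longleftrightarrow> (\<forall>r c. (\<lambda>t. fst k\<delta> t r c) \<in> polyfuns {\<lambda>t. t}) \<and> snd k\<delta> \<in> polyfuns {\<lambda>t. t} \<and>
     (\<forall>t r s. r < d i \<longrightarrow> s < d i \<longrightarrow> (\<Sum>c<d i. h t i r c * fst k\<delta> t c s) = (if r = s then snd k\<delta> t else 0)) \<and>
     (\<forall>t r s. r < d i \<longrightarrow> s < d i \<longrightarrow> (\<Sum>c<d i. fst k\<delta> t r c * h t i c s) = (if r = s then snd k\<delta> t else 0)) \<and>
     (\<forall>t g. (\<forall>r s. r < d i \<longrightarrow> s < d i \<longrightarrow> (\<Sum>c<d i. h t i r c * g c s) = (if r = s then 1 else 0)) \<longrightarrow> snd k\<delta> t \<noteq> 0)"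
    for i k\<delta>
  have "\<forall>i. \<exists>k\<delta>. P i k\<delta>"
  proof
    fix i
    obtain k \<delta> where kd: "\<And>r c. (\<lambda>t. k t r c) \<in> polyfuns {\<lambda>t. t}" "\<delta> \<in> polyfuns {\<lambda>t. t}"
      "\<And>t r s. r < d i \<Longrightarrow> s < d i \<Longrightarrow> (\<Sum>c<d i. h t i r c * k t c s) = (if r = s then \<delta> t else 0)"
      "\<And>t r s. r < d i \<Longrightarrow> s < d i \<Longrightarrow> (\<Sum>c<d i. k t r c * h t i c s) = (if r = s then \<delta> t else 0)"
      "\<And>t g. (\<And>r s. r < d i \<Longrightarrow> s < d i \<Longrightarrow> (\<Sum>c<d i. h t i r c * g c s) = (if r = s then 1 else 0)) \<Longrightarrow> \<delta> t \<noteq> 0"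
      by (rule polyfuns_adjugate[where h = "\<lambda>t. h t i" and n = "d i", OF hp]) blast
    have "P i (k, \<delta>)" unfolding P_def fst_conv snd_conv
    proof (intro conjI allI impI)
      fix t g assume "\<forall>r s. r < d i \<longrightarrow> s < d i \<longrightarrow> (\<Sum>c<d i. h t i r c * g c s) = (if r = s then 1 else 0)"
      then show "\<delta> t \<noteq> 0" by (intro kd(5)[of t g]) blast
    qed (rule kd(1), rule kd(2), erule (1) kd(3), erule (1) kd(4))
    then show "\<exists>k\<delta>. P i k\<delta>" by (rule exI)
  qed
  from choice[OF this] obtain K where "\<forall>i. P i (K i)" by (rule exE)
  note K = this[THEN spec, unfolded P_def]
  define k where "k t i r c = fst (K i) t r c" for t i r c
  define \<delta> where "\<delta> t i = snd (K i) t" for t i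
  have kp: "(\<lambda>t. k t i r c) \<in> polyfuns {\<lambda>t. t}" for i r c
    unfolding k_def by (rule K[THEN conjunct1, THEN spec, THEN spec])
  have dp: "(\<lambda>t. \<delta> t i) \<in> polyfuns {\<lambda>t. t}" for i
  proof -
    have "(\<lambda>t. \<delta> t i) = snd (K i)" by (simp add: \<delta>_def fun_eq_iff)
    then show ?thesis by (simp only: K[THEN conjunct2, THEN conjunct1])
  qed
  have hk: "mat_prod_scalar d (h t) (k t) (\<delta> t)" for t
    unfolding mat_prod_scalar_def k_def \<delta>_def
    by (intro allI impI) (rule K[THEN conjunct2, THEN conjunct2, THEN conjunct1, rule_format])
  have kh: "mat_prod_scalar d (k t) (h t) (\<delta> t)" for t
    unfolding mat_prod_scalar_def k_def \<delta>_def
    by (intro allI impI) (rule K[THEN conjunct2, THEN conjunct2, THEN conjunct2, THEN conjunct1, rule_format])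
  have dnz: "\<delta> t i \<noteq> 0" if "mat_prod_scalar d (h t) g (\<lambda>_. 1)" for t i g
    unfolding \<delta>_def
  proof (rule K[THEN conjunct2, THEN conjunct2, THEN conjunct2, THEN conjunct2, THEN spec, THEN spec, THEN mp])
    show "\<forall>r s. r < d i \<longrightarrow> s < d i \<longrightarrow> (\<Sum>c<d i. h t i r c * g i c s) = (if r = s then 1 else 0)"
      using that unfolding mat_prod_scalar_def by (rule spec)
  qed
  have h01: "h 0 = h1" "h 1 = h2" by (auto simp: h_def fun_eq_iff)
  have d0: "\<delta> 0 i \<noteq> 0" and d1: "\<delta> 1 i \<noteq> 0" for i
    by (rule dnz[of 0 g1], simp only: h01 1(1)) (rule dnz[of 1 g2], simp only: h01 2(1))
  \<comment> \<open>Conjugation by \<open>h\<close> and its adjugate multiplies an arrow starting in \<open>i\<close> by the determinant \<open>\<delta> t i\<close>; dividing the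
    end points by it makes the curve start in \<open>x1\<close> and end in \<open>x2\<close>.\<close>
  define v1 where "v1 = (\<lambda>(\<alpha>, r, c). (1 / \<delta> 0 (tail Q \<alpha>)) * u1 (\<alpha>, r, c))"
  define v2 where "v2 = (\<lambda>(\<alpha>, r, c). (1 / \<delta> 1 (tail Q \<alpha>)) * u2 (\<alpha>, r, c))"
  have v1: "adapted Q d lev v1" "v1 \<in> ?X"
    using rescale_adapted[OF 1(3,4) lev S, of "\<lambda>\<alpha>. 1 / \<delta> 0 (tail Q \<alpha>)"] d0 unfolding v1_def by auto
  have v2: "adapted Q d lev v2" "v2 \<in> ?X"
    using rescale_adapted[OF 2(3,4) lev S, of "\<lambda>\<alpha>. 1 / \<delta> 1 (tail Q \<alpha>)"] d1 unfolding v2_def by auto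
  define u where "u t z = (1 - t) * v1 z + t * v2 z" for t z
  have up: "(\<lambda>t. u t z) \<in> polyfuns {\<lambda>t. t}" for z unfolding u_def by (rule line_polyfuns)
  have ua: "adapted Q d lev (u t)" for t unfolding adapted_def u_def
  proof (intro conjI allI impI)
    show "(1 - t) * v1 z + t * v2 z = 0" if "z \<notin> rep_coords Q d" for z
    proof -
      have "v1 z = 0" "v2 z = 0" using that v1(1) v2(1) unfolding adapted_def by blast+
      then show ?thesis by simp
    qed
    fix \<alpha> r c assume "(1 - t) * v1 (\<alpha>, r, c) + t * v2 (\<alpha>, r, c) \<noteq> 0"
    then have "v1 (\<alpha>, r, c) \<noteq> 0 \<or> v2 (\<alpha>, r, c) \<noteq> 0" by auto
    then show "lev (tail Q \<alpha>) c < lev (head Q \<alpha>) r" using v1(1) v2(1) unfolding adapted_def by blast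
  qed
  have u01: "u 0 = v1" "u 1 = v2" by (auto simp: u_def fun_eq_iff)
  define z where "z t = conj_pt Q d (h t) (u t) (k t)" for t
  have zp: "(\<lambda>t. z t w) \<in> polyfuns {\<lambda>t. t}" for w unfolding z_def by (rule conj_pt_polyfuns[OF hp kp up])
  have adj: "k t i r s = \<delta> t i * g i r s" if "mat_prod_scalar d (h t) g (\<lambda>_. 1)" "r < d i" "s < d i" for t g i r s
  proof -
    have "k t i r s = (\<Sum>c<d i. if c = s then k t i r c else 0)" using that by simp
    also have "\<dots> = (\<Sum>c<d i. k t i r c * (\<Sum>c'<d i. h t i c c' * g i c' s))"
      using that(1,3) unfolding mat_prod_scalar_def by (intro sum.cong refl) simp
    also have "\<dots> = (\<Sum>c<d i. \<Sum>c'<d i. k t i r c * h t i c c' * g i c' s)" by (simp add: sum_distrib_left mult.assoc)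
    also have "\<dots> = (\<Sum>c'<d i. \<Sum>c<d i. k t i r c * h t i c c' * g i c' s)" by (rule sum.swap)
    also have "\<dots> = (\<Sum>c'<d i. (if r = c' then \<delta> t i else 0) * g i c' s)"
      unfolding sum_distrib_right[symmetric] using kh[of t] that(2) unfolding mat_prod_scalar_def by (intro sum.cong refl) simp
    also have "\<dots> = (\<Sum>c'<d i. if c' = r then \<delta> t i * g i r s else 0)" by (intro sum.cong) auto
    also have "\<dots> = \<delta> t i * g i r s" using that(2) by simp
    finally show ?thesis .
  qed
  have z0: "z 0 = x1" unfolding z_def u01 h01 1(2)
  proof
    fix w :: "'e \<times> nat \<times> nat"
    obtain \<alpha> r c where w: "w = (\<alpha>, r, c)" by (metis surj_pair)
    show "conj_pt Q d h1 v1 (k 0) w = conj_pt Q d h1 u1 g1 w"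
      using adj[of 0 g1] 1(1) d0 unfolding w conj_pt_def v1_def h01
      by (auto simp: rep_coords_def intro!: sum.cong)
  qed
  have z1: "z 1 = x2" unfolding z_def u01 h01 2(2)
  proof
    fix w :: "'e \<times> nat \<times> nat"
    obtain \<alpha> r c where w: "w = (\<alpha>, r, c)" by (metis surj_pair)
    show "conj_pt Q d h2 v2 (k 1) w = conj_pt Q d h2 u2 g2 w"
      using adj[of 1 g2] 2(1) d1 unfolding w conj_pt_def v2_def h01
      by (auto simp: rep_coords_def intro!: sum.cong)
  qed
  have "\<exists>H\<in>polyfuns {\<lambda>t. t}. H 0 \<noteq> 0 \<and> (\<forall>t. H t \<noteq> 0 \<longrightarrow> u t \<in> ?X)"
    by (rule adapted_layered_open[OF up ua _ lev S]) (simp only: u01 v1)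
  then obtain H where H: "H \<in> polyfuns {\<lambda>t. t}" "H 0 \<noteq> 0" "\<forall>t. H t \<noteq> 0 \<longrightarrow> u t \<in> ?X" by (elim bexE conjE)
  let ?Fs = "{H, \<lambda>t. F (z t), \<lambda>t. G (z t)} \<union> (\<lambda>i t. \<delta> t i) ` verts Q"
  have "\<exists>t. \<forall>f\<in>?Fs. f t \<noteq> 0"
  proof (rule polyfuns_line_conj[OF inf])
    fix f assume f: "f \<in> ?Fs"
    have Fz: "(\<lambda>t. F (z t)) \<in> polyfuns {\<lambda>t. t}" by (rule polyfuns_point_compose[OF F zp])
    have Gz: "(\<lambda>t. G (z t)) \<in> polyfuns {\<lambda>t. t}" by (rule polyfuns_point_compose[OF G zp])
    have "F (z 0) \<noteq> 0" "G (z 1) \<noteq> 0" using x1 x2 unfolding z0 z1 by blast+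
    from f consider "f = H" | "f = (\<lambda>t. F (z t))" | "f = (\<lambda>t. G (z t))" | i where "f = (\<lambda>t. \<delta> t i)" by auto
    then show "f \<in> polyfuns {\<lambda>t. t} \<and> (\<exists>t. f t \<noteq> 0)"
    proof cases
      case 1 then show ?thesis using H(1,2) by auto
    next
      case 2 show ?thesis unfolding 2 by (intro conjI exI) (rule Fz, rule \<open>F (z 0) \<noteq> 0\<close>)
    next
      case 3 show ?thesis unfolding 3 by (intro conjI exI) (rule Gz, rule \<open>G (z 1) \<noteq> 0\<close>)
    next
      case (4 i) show ?thesis unfolding 4 by (intro conjI exI) (rule dp, rule d0)
    qed
  qed simp
  then obtain t where t0: "\<forall>f\<in>?Fs. f t \<noteq> 0" by (rule exE)
  then have t: "H t \<noteq> 0" "F (z t) \<noteq> 0" "G (z t) \<noteq> 0" "\<And>i. i \<in> verts Q \<Longrightarrow> \<delta> t i \<noteq> 0" by simp_all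
  have dv: "d i = 0" if "i \<notin> verts Q" for i
    using dim_vectorsD[OF seq_dim_dim_vectors[OF S]] that unfolding d_def by blast
  \<comment> \<open>Outside the vertices the matrices have size zero, so any nonzero scalar will do there.\<close>
  define \<delta>' where "\<delta>' i = (if i \<in> verts Q then \<delta> t i else 1)" for i
  have d': "\<delta>' i \<noteq> 0" for i using t(4) by (simp add: \<delta>'_def)
  have hk': "mat_prod_scalar d (h t) (k t) \<delta>'" and kh': "mat_prod_scalar d (k t) (h t) \<delta>'"
    using hk[of t] kh[of t] dv unfolding mat_prod_scalar_def \<delta>'_def by auto
  have utX: "u t \<in> ?X" by (rule H(3)[THEN spec, THEN mp, OF t(1)])
  then have utv: "u t \<in> rep_variety Q L d" and utl: "rad_layering Q L d (u t) = S" by (auto simp: rep_layered_def d_def)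
  have sm: "scaled_map Q id (\<lambda>\<alpha>. \<delta>' (tail Q \<alpha>)) d (u t) d (z t) (gmap d (h t))"
    unfolding z_def by (rule conj_scaled_map[OF kh' d'])
  have bij: "bij_betw (gmap d (h t)) (kspace d) (kspace d)" by (rule gmap_bij[OF kh' hk' d'])
  have zv: "z t \<in> rep_variety Q L d"
  proof (rule scaled_map_rep_variety[OF sm utv])
    show "gmap d (h t) ` kspace d = kspace d" using bij by (simp add: bij_betw_def)
    show "z t w = 0" if "w \<notin> rep_coords Q d" for w unfolding z_def by (rule conj_pt_off[OF that])
  qed
  have "rad_layering Q L d (z t) = S" using scaled_map_invariants(1)[OF sm utv zv bij] utl by simp
  then have "z t \<in> ?X" using zv by (simp add: rep_layered_def d_def)
  then show "\<exists>x\<in>?X. F x \<noteq> 0 \<and> G x \<noteq> 0" using t(2,3) by (intro bexI[of _ "z t"] conjI)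
qed (rule ne)

end

section \<open>A greedy matching\<close>

lemma infinite_alg_closed_field: "infinite (UNIV :: 'k::alg_closed_field set)"
proof
  assume fin: "finite (UNIV :: 'k set)"
  let ?p = "(\<Prod>a\<in>UNIV. [:- a, 1:]) + 1 :: 'k poly"
  have ev: "poly ?p a = 1" for a
  proof -
    have "poly (\<Prod>a\<in>UNIV. [:- a, 1:]) a = (0 :: 'k)"
      unfolding poly_prod by (rule prod_zero[OF fin]) (intro bexI[of _ a], auto)
    then show ?thesis by simp
  qed
  have "degree (\<Prod>a\<in>UNIV. [:- a, 1:] :: 'k poly) = card (UNIV :: 'k set)"
    by (subst degree_prod_eq_sum_degree) auto
  moreover have "card (UNIV :: 'k set) > 0" using fin by (simp add: card_gt_0_iff)
  ultimately have "degree ?p > 0" by (subst degree_add_eq_left) auto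
  then obtain z where "poly ?p z = 0" using alg_closed_imp_poly_has_root by blast
  then show False unfolding ev by simp
qed

text \<open>Sources of weight \<open>\<kappa>\<close> are matched with targets of larger weight \<open>\<tau>\<close>, in order of decreasing \<open>\<kappa>\<close>. When
  weight \<open>L - Suc j\<close> is reached, all targets that are still free and have larger weight are admissible, and they remain so for
  the smaller weights; so as many of them as possible are used. The second component of \<open>p\<close> counts the
  targets left over.\<close>

lemma greedy_matching:
  fixes \<kappa> :: "'a \<Rightarrow> nat" and \<tau> :: "'b \<Rightarrow> nat"
  assumes X: "finite X" and T: "finite T" and \<tau>: "\<And>t. t \<in> T \<Longrightarrow> \<tau> t \<le> L"
    and p0: "p 0 = (0, 0)"
    and pS: "\<And>j. j < L \<Longrightarrow> p (Suc j) =
      (let v = card {t \<in> T. \<tau> t = L - j} + snd (p j); s = min (card {r \<in> X. \<kappa> r = L - Suc j}) v in (s, v - s))"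
  shows "\<exists>X' f. X' \<subseteq> X \<and> inj_on f X' \<and> (\<forall>r\<in>X'. f r \<in> T \<and> \<kappa> r < \<tau> (f r)) \<and>
    (\<forall>l\<le>L. card {r \<in> X'. \<kappa> r = l} = fst (p (L - l)))"
proof -
  have "\<exists>X' f. X' \<subseteq> {r \<in> X. L - m \<le> \<kappa> r} \<and> inj_on f X' \<and> (\<forall>r\<in>X'. f r \<in> T \<and> \<kappa> r < \<tau> (f r)) \<and>
    (\<forall>l. L - m \<le> l \<longrightarrow> l \<le> L \<longrightarrow> card {r \<in> X'. \<kappa> r = l} = fst (p (L - l))) \<and>
    card ({t \<in> T. L - m < \<tau> t} - f ` X') = snd (p m)" if "m \<le> L" for m
    using that
  proof (induction m)
    case 0
    have "{t \<in> T. L < \<tau> t} = {}" using \<tau> by fastforce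
    then have "card {t \<in> T. L < \<tau> t} = 0" by (simp only: card.empty)
    then show ?case by (intro exI[of _ "{}"] exI[of _ "\<lambda>_. undefined"]) (simp add: p0)
  next
    case (Suc m)
    then have mL: "m < L" by simp
    from Suc obtain X' f where X': "X' \<subseteq> {r \<in> X. L - m \<le> \<kappa> r}" and f: "inj_on f X'"
      "\<forall>r\<in>X'. f r \<in> T \<and> \<kappa> r < \<tau> (f r)" and
      c: "\<forall>l. L - m \<le> l \<longrightarrow> l \<le> L \<longrightarrow> card {r \<in> X'. \<kappa> r = l} = fst (p (L - l))"
      and r: "card ({t \<in> T. L - m < \<tau> t} - f ` X') = snd (p m)" by auto
    let ?U = "{t \<in> T. L - Suc m < \<tau> t} - f ` X'"
    let ?Y = "{r \<in> X. \<kappa> r = L - Suc m}"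
    define v where "v = card {t \<in> T. \<tau> t = L - m} + snd (p m)"
    define s where "s = min (card ?Y) v"
    have pm: "p (Suc m) = (s, v - s)" unfolding pS[OF mL] s_def v_def Let_def ..
    have fX: "L - m < \<tau> t" if "t \<in> f ` X'" for t
    proof -
      obtain r where r: "r \<in> X'" "t = f r" using \<open>t \<in> f ` X'\<close> by (rule imageE)
      then show ?thesis using f(2) X' by fastforce
    qed
    have "?U = {t \<in> T. \<tau> t = L - m} \<union> ({t \<in> T. L - m < \<tau> t} - f ` X')"
    proof -
      have "t \<notin> f ` X'" if "\<tau> t = L - m" for t using fX[of t] that by auto
      then show ?thesis using mL by auto
    qed
    then have U: "card ?U = v" unfolding v_def r[symmetric] using T by (simp only:) (intro card_Un_disjoint, auto)
    have "s \<le> card ?Y" by (simp add: s_def)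
    then obtain Y where Y: "Y \<subseteq> ?Y" "card Y = s" by (meson obtain_subset_with_card_n)
    have fY: "finite Y" using Y(1) X by (auto intro: finite_subset)
    have "card Y \<le> card ?U" unfolding U Y by (simp add: s_def)
    moreover have "finite ?U" using T by simp
    ultimately have "\<exists>g. g ` Y \<subseteq> ?U \<and> inj_on g Y" by (intro card_le_inj[OF fY])
    then obtain g where g: "g ` Y \<subseteq> ?U" "inj_on g Y" by (elim exE conjE)
    define f' where "f' r = (if r \<in> Y then g r else f r)" for r
    have XY: "L - m \<le> \<kappa> r" if "r \<in> X'" for r using X' that by blast
    have YY: "\<kappa> r = L - Suc m" "r \<in> X" if "r \<in> Y" for r using Y(1) that by blast+
    have less: "L - Suc m < L - m" using mL by simp
    have dis: "X' \<inter> Y = {}"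
    proof (rule equals0I)
      fix r assume "r \<in> X' \<inter> Y"
      then show False using XY[of r] YY(1)[of r] less by simp
    qed
    have f'X: "f' ` X' = f ` X'" using dis by (intro image_cong) (auto simp: f'_def)
    have f'Y: "f' ` Y = g ` Y" by (intro image_cong) (auto simp: f'_def)
    have inj: "inj_on f' (X' \<union> Y)"
    proof -
      have "inj_on f' X'" using f(1) dis by (subst inj_on_cong[of _ _ f]) (auto simp: f'_def)
      moreover have "inj_on f' Y" using g(2) by (subst inj_on_cong[of _ _ g]) (auto simp: f'_def)
      moreover have "f' ` X' \<inter> f' ` Y = {}" unfolding f'X f'Y using g(1) by blast
      ultimately show ?thesis unfolding inj_on_Un by blast
    qed
    have f'T: "\<forall>r\<in>X' \<union> Y. f' r \<in> T \<and> \<kappa> r < \<tau> (f' r)"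
    proof
      fix r assume r: "r \<in> X' \<union> Y"
      show "f' r \<in> T \<and> \<kappa> r < \<tau> (f' r)"
      proof (cases "r \<in> Y")
        case True
        then have "g r \<in> ?U" "\<kappa> r = L - Suc m" using g(1) Y(1) by blast+
        then show ?thesis using True by (simp add: f'_def)
      next
        case False
        then show ?thesis using r f(2) by (simp add: f'_def)
      qed
    qed
    have cnt: "card {r \<in> X' \<union> Y. \<kappa> r = l} = fst (p (L - l))" if l: "L - Suc m \<le> l" "l \<le> L" for l
    proof (cases "l = L - Suc m")
      case True
      then have "{r \<in> X' \<union> Y. \<kappa> r = l} = Y" using XY YY(1) less by (auto dest: XY)
      moreover have "L - l = Suc m" using True mL by simp
      ultimately show ?thesis using Y(2) pm by simp
    next
      case False
      then have "{r \<in> X' \<union> Y. \<kappa> r = l} = {r \<in> X'. \<kappa> r = l}" using YY(1) by auto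
      moreover have "L - m \<le> l" using False l by linarith
      ultimately show ?thesis using c l(2) by simp
    qed
    have rest: "card ({t \<in> T. L - Suc m < \<tau> t} - f' ` (X' \<union> Y)) = snd (p (Suc m))"
    proof -
      have "{t \<in> T. L - Suc m < \<tau> t} - f' ` (X' \<union> Y) = ?U - g ` Y" unfolding image_Un f'X f'Y by blast
      moreover have "card (?U - g ` Y) = v - s"
        using card_Diff_subset[OF _ g(1)] fY card_image[OF g(2)] U Y(2) by simp
      ultimately show ?thesis unfolding pm by simp
    qed
    have "X' \<union> Y \<subseteq> {r \<in> X. L - Suc m \<le> \<kappa> r}"
    proof
      fix r assume "r \<in> X' \<union> Y"
      then show "r \<in> {r \<in> X. L - Suc m \<le> \<kappa> r}"
      proof
        assume "r \<in> X'" then show ?thesis using X' XY[of r] less by auto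
      next
        assume "r \<in> Y" then show ?thesis using YY[of r] by simp
      qed
    qed
    then show ?case using inj f'T cnt rest by (intro exI[of _ "X' \<union> Y"] exI[of _ f'] conjI allI impI) simp_all
  qed
  from this[OF order_refl] obtain X' f where *: "X' \<subseteq> {r \<in> X. L - L \<le> \<kappa> r}" "inj_on f X'"
    "\<forall>r\<in>X'. f r \<in> T \<and> \<kappa> r < \<tau> (f r)"
    "\<forall>l. L - L \<le> l \<longrightarrow> l \<le> L \<longrightarrow> card {r \<in> X'. \<kappa> r = l} = fst (p (L - l))" by (elim exE conjE)
  show ?thesis by (intro exI[of _ X'] exI[of _ f]) (use * in auto)
qed

section \<open>The generic socle of the radical powers\<close>

text \<open>The entry of the recursion that is subtracted from \<open>S l\<close> to give \<open>C\<^sub>l\<close>. It is the number of basis vectors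
  of level \<open>l\<close> at the vertex \<open>i\<close> that the greedy procedure matches.\<close>

definition matched :: "('v, 'e) pre_digraph \<Rightarrow> nat \<Rightarrow> (nat \<Rightarrow> 'v \<Rightarrow> nat) \<Rightarrow> nat \<Rightarrow> 'v \<Rightarrow> nat" where
  "matched Q L S l i = fst (SD_pair Q L S (L - l)) i"

lemma matched_le: "matched Q L S l i \<le> S l i"
proof (cases "L - l")
  case (Suc j)
  then have "L - Suc j = l" by simp
  then show ?thesis unfolding matched_def Suc by (simp add: Let_def)
qed (simp add: matched_def)

lemma C_mod_matched: "C_mod Q L S k i + matched Q L S k i = S k i"
  using matched_le[of Q L S k i] by (simp add: C_mod_def matched_def)

lemma sum_matched_end: "(\<Sum>k=L..L. matched Q L S k i) = 0"
  by (simp add: matched_def)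

text \<open>The leftover \<open>D\<close> is eliminated: matched and left-over targets together are all targets of level above \<open>l\<close>.\<close>

lemma sum_matched_rec:
  assumes "l < L"
  shows "(\<Sum>k=l..L. matched Q L S k i) =
    min (S l i + (\<Sum>k=Suc l..L. matched Q L S k i)) (\<Sum>k=l..<L. E1 Q (S (k + 1)) i)"
proof -
  have inv: "(\<Sum>k=L-j..L. fst (SD_pair Q L S (L - k)) i) + snd (SD_pair Q L S j) i =
      (\<Sum>k=L-j..<L. E1 Q (S (k + 1)) i)" if "j \<le> L" for j
    using that
  proof (induction j)
    case (Suc j)
    have *: "{L - Suc j..L} = insert (L - Suc j) {L - j..L}" "{L - Suc j..<L} = insert (L - Suc j) {L - j..<L}"
      "L - (L - Suc j) = Suc j" "Suc (L - Suc j) = L - j" using Suc.prems by auto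
    show ?case using Suc.IH Suc.prems unfolding *(1,2) by (simp add: *(3,4) Let_def)
  qed simp
  obtain j where j: "l = L - Suc j" "Suc j \<le> L" using assms by (metis Suc_diff_Suc diff_diff_cancel diff_le_self less_or_eq_imp_le)
  have *: "Suc (L - Suc j) = L - j" "L - (L - Suc j) = Suc j" using j by auto
  have "(\<Sum>k=l..L. matched Q L S k i) = matched Q L S l i + (\<Sum>k=Suc l..L. matched Q L S k i)"
    using assms by (simp add: sum.atLeast_Suc_atMost)
  moreover have "matched Q L S l i = min (S l i) (E1 Q (S (l + 1)) i + snd (SD_pair Q L S j) i)"
    unfolding matched_def j by (simp add: * Let_def inf_min)
  moreover have "(\<Sum>k=l..<L. E1 Q (S (k + 1)) i) = E1 Q (S (l + 1)) i + (\<Sum>k=Suc l..<L. E1 Q (S (k + 1)) i)"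
    using assms by (simp add: sum.atLeast_Suc_lessThan)
  moreover have "(\<Sum>k=Suc l..L. matched Q L S k i) + snd (SD_pair Q L S j) i = (\<Sum>k=Suc l..<L. E1 Q (S (k + 1)) i)"
    using inv[of j] j unfolding matched_def by (simp add: *)
  ultimately show ?thesis by linarith
qed

text \<open>Write \<open>c\<^sub>l\<close> for the dimension of \<open>C\<^sub>l \<oplus> \<dots> \<oplus> C\<^sub>L\<close> and \<open>\<delta>\<^sub>l\<close> for the sum of \<open>S\<^sub>k - E\<^sub>1(S\<^sub>k\<^sub>+\<^sub>1)\<close> over \<open>k \<ge> l\<close>. The minimum in the
  recursion becomes \<open>c\<^sub>l = max c\<^sub>l\<^sub>+\<^sub>1 \<delta>\<^sub>l\<close>, so \<open>c\<^sub>l\<close> is the maximum of the \<open>\<delta>\<^sub>k\<close> with \<open>k \<ge> l\<close>.\<close>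

lemma socle_sup_C_mod:
  assumes S: "semisimple_sequence Q L S" and "m \<le> L"
  shows "(\<lambda>i. int (\<Sum>k=L-m..L. C_mod Q L S k i)) = socle_sup Q L S m"
  using \<open>m \<le> L\<close>
proof (induction m)
  case 0
  have "E1 Q (S (Suc L)) i = 0" for i using S by (simp add: semisimple_sequence_def E1_def)
  then show ?case by (simp add: socle_sup_def C_mod_def fun_eq_iff)
next
  case (Suc m)
  let ?l = "L - Suc m"
  let ?\<delta> = "\<lambda>j i. \<Sum>l = L - j..L. int (S l i) - int (E1 Q (S (l + 1)) i)"
  have l: "?l < L" "Suc ?l = L - m" using Suc.prems by auto
  have split: "(\<Sum>k=l..L. C_mod Q L S k i) + (\<Sum>k=l..L. matched Q L S k i) = (\<Sum>k=l..L. S k i)" for l :: nat and i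
    unfolding sum.distrib[symmetric] C_mod_matched ..
  have E0: "E1 Q (S (Suc L)) i = 0" for i using S by (simp add: semisimple_sequence_def E1_def)
  have "{0..Suc m} = insert (Suc m) {0..m}" by auto
  then have "socle_sup Q L S (Suc m) = sup (?\<delta> (Suc m)) (socle_sup Q L S m)"
    unfolding socle_sup_def by (simp only: image_insert) (rule Sup_fin.insert; simp)
  also have "\<dots> = (\<lambda>i. int (\<Sum>k=?l..L. C_mod Q L S k i))"
  proof
    fix i
    have "?\<delta> (Suc m) i = int (\<Sum>k=?l..L. S k i) - int (\<Sum>k=?l..<L. E1 Q (S (k + 1)) i)"
      using l(1) E0[of i] by (simp add: sum_subtractf sum.last_plus)
    moreover have "socle_sup Q L S m i = int (\<Sum>k=L-m..L. C_mod Q L S k i)"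
      using Suc.IH Suc.prems by (simp add: fun_eq_iff)
    moreover have "(\<Sum>k=?l..L. S k i) = S ?l i + (\<Sum>k=L-m..L. S k i)"
      using l by (simp add: sum.atLeast_Suc_atMost)
    moreover note sum_matched_rec[OF l(1), where Q = Q and S = S and i = i]
    moreover note split[where l = ?l and i = i] split[where l = "L - m" and i = i]
    ultimately show "sup (?\<delta> (Suc m)) (socle_sup Q L S m) i = int (\<Sum>k=?l..L. C_mod Q L S k i)"
      unfolding l(2) sup_fun_def sup_max by linarith
  qed
  finally show ?case ..
qed

text \<open>The coordinates of the direct sum of the spaces at the ends of all arrows starting in \<open>j\<close>.\<close>

definition targets :: "('v, 'e) pre_digraph \<Rightarrow> ('v \<Rightarrow> nat) \<Rightarrow> 'v \<Rightarrow> ('e \<times> nat) set" where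
  "targets Q d j = (SIGMA \<alpha> : {\<alpha> \<in> arcs Q. tail Q \<alpha> = j}. {..<d (head Q \<alpha>)})"

context quiver
begin

lemma card_targets:
  assumes "levels S d lev" "semisimple_sequence Q L S"
  shows "card {t \<in> targets Q d j. lev (head Q (fst t)) (snd t) = k} = E1 Q (S k) j"
proof -
  let ?A = "{\<alpha> \<in> arcs Q. tail Q \<alpha> = j}"
  have "{t \<in> targets Q d j. lev (head Q (fst t)) (snd t) = k} =
      (SIGMA \<alpha> : ?A. {r. r < d (head Q \<alpha>) \<and> lev (head Q \<alpha>) r = k})"
    by (auto simp: targets_def)
  then have "card {t \<in> targets Q d j. lev (head Q (fst t)) (snd t) = k} = (\<Sum>\<alpha>\<in>?A. S k (head Q \<alpha>))"
    using assms(1) by (simp add: levels_def)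
  also have "\<dots> = (\<Sum>i\<in>verts Q. \<Sum>\<alpha> | \<alpha> \<in> ?A \<and> head Q \<alpha> = i. S k (head Q \<alpha>))"
    by (rule sum.group[symmetric]) auto
  also have "\<dots> = (\<Sum>i\<in>verts Q. S k i * adjT Q i j)"
  proof (rule sum.cong[OF refl])
    fix i
    have "{\<alpha>. \<alpha> \<in> ?A \<and> head Q \<alpha> = i} = {\<alpha> \<in> arcs Q. tail Q \<alpha> = j \<and> head Q \<alpha> = i}" by auto
    then show "(\<Sum>\<alpha> | \<alpha> \<in> ?A \<and> head Q \<alpha> = i. S k (head Q \<alpha>)) = S k i * adjT Q i j"
      by (simp add: adjT_def adjacency_def)
  qed
  finally show ?thesis by (simp add: E1_def)
qed

lemma finite_targets: "finite (targets Q d j)"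
  by (auto simp: targets_def)

text \<open>The arrows map an element of the radical power \<open>l\<close> into the levels above \<open>l\<close>, so the rank is bounded by the number
  of targets of these levels.\<close>

lemma path_rank_le_E1:
  fixes u :: "('e, 'k::field) point"
  assumes u: "adapted Q d lev u" "u \<in> rep_layered Q L S" and lev: "levels S d lev"
    and S: "semisimple_sequence Q L S"
  shows "path_rank L d u l 1 j \<le> (\<Sum>k=l..<L. E1 Q (S (k + 1)) j)"
proof -
  have le: "lev i r \<le> L" if "r < d i" for i r using levels_le[where d = d, OF lev S that] .
  let ?A = "{t \<in> targets Q d j. l < lev (head Q (fst t)) (snd t)}"
  let ?z = "\<lambda>t :: 'e \<times> nat. ((j, [fst t]), (head Q (fst t), snd t))"
  let ?B = "(\<lambda>t. std_vec (?z t)) ` ?A :: (('v, 'e) path \<times> 'v \<times> nat \<Rightarrow> 'k) set"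
  have fA: "finite ?A" using finite_targets by simp
  have "path_eval Q d u 1 n \<in> fvs.span ?B" if n: "n \<in> vertex_act j ` rad_sub Q L d u l" for n
  proof -
    have nj: "n = vertex_act j n" using n by (auto simp: vertex_act_idem)
    have nl: "n \<in> level_sub d lev l"
      using n graded_sub_coord_sub[of d "\<lambda>i r. l \<le> lev i r"]
      unfolding adapted_layered_rad_sub[OF u lev S] graded_sub_def by blast
    have "path_eval Q d u 1 n = (\<Sum>t\<in>?A. vscale (path_eval Q d u 1 n (?z t)) (std_vec (?z t)))"
    proof
      fix y :: "('v, 'e) path \<times> 'v \<times> nat"
      have inj: "?z t = ?z t' \<longleftrightarrow> t = t'" for t t' by (auto simp: prod_eq_iff)
      have R: "(\<Sum>t\<in>?A. vscale (path_eval Q d u 1 n (?z t)) (std_vec (?z t))) y =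
          (\<Sum>t\<in>?A. if y = ?z t then path_eval Q d u 1 n y else 0)"
        unfolding sum_fun_apply vscale_apply by (intro sum.cong) (auto simp: std_vec_def)
      show "path_eval Q d u 1 n y = (\<Sum>t\<in>?A. vscale (path_eval Q d u 1 n (?z t)) (std_vec (?z t))) y"
      proof (cases "\<exists>t\<in>?A. y = ?z t")
        case True
        then obtain t where t: "t \<in> ?A" "y = ?z t" by blast
        have "(\<Sum>t'\<in>?A. if y = ?z t' then path_eval Q d u 1 n y else 0) =
            (\<Sum>t'\<in>?A. if t' = t then path_eval Q d u 1 n y else 0)"
          unfolding t(2) inj by (intro sum.cong) auto
        then show ?thesis unfolding R using t(1) fA by simp
      next
        case False
        have "path_eval Q d u 1 n y = 0"
        proof (rule ccontr)
          assume nz: "path_eval Q d u 1 n y \<noteq> 0"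
          obtain v p h r where y: "y = ((v, p), (h, r))" by (metis surj_pair)
          have p: "(v, p) \<in> paths Q" "length p = 1" and nz': "path_act Q d u (v, p) n (h, r) \<noteq> 0"
            using nz by (auto simp: y path_eval_def split: if_splits)
          then obtain \<alpha> where \<alpha>: "p = [\<alpha>]" by (metis One_nat_def length_0_conv length_Suc_conv)
          have a: "\<alpha> \<in> arcs Q" "v = tail Q \<alpha>" using p path_snoc[of v "[]" \<alpha>] by (auto simp: \<alpha>)
          have nz2: "arrow_act Q d u \<alpha> n (h, r) \<noteq> 0" using nz' unfolding \<alpha> a(2) path_act_arrow .
          have tj: "tail Q \<alpha> = j"
          proof (rule ccontr)
            assume "tail Q \<alpha> \<noteq> j"
            then have "arrow_act Q d u \<alpha> (vertex_act j n) = 0" by (simp add: arrow_act_tail)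
            then show False using nz2 nj by simp
          qed
          have hd: "h = head Q \<alpha>" "r < d h" using nz2 by (auto simp: arrow_act_def split: if_splits)
          have "arrow_act Q d u \<alpha> n \<in> level_sub d lev (Suc l)" by (rule adapted_arrow[OF u(1) nl])
          then have "Suc l \<le> lev h r" using nz2 unfolding coord_sub_def by blast
          then have "(\<alpha>, r) \<in> ?A" using a tj hd by (auto simp: targets_def)
          moreover have "y = ?z (\<alpha>, r)" using y \<alpha> a tj hd by simp
          ultimately show False using False by blast
        qed
        moreover have "(\<Sum>t'\<in>?A. if y = ?z t' then path_eval Q d u 1 n y else 0) = 0"
          using False by (intro sum.neutral) auto
        ultimately show ?thesis unfolding R by simp
      qed
    qed
    moreover have "(\<Sum>t\<in>?A. vscale (path_eval Q d u 1 n (?z t)) (std_vec (?z t))) \<in> fvs.span ?B"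
      by (intro fvs.span_sum fvs.span_scale fvs.span_base imageI)
    ultimately show ?thesis by simp
  qed
  then have sub: "path_eval Q d u 1 ` vertex_act j ` rad_sub Q L d u l \<subseteq> fvs.span ?B" by blast
  have "path_rank L d u l 1 j \<le> card ?B"
    unfolding path_rank_def using sub fA by (intro fvs.dim_le_card) auto
  also have "\<dots> \<le> card ?A" by (rule card_image_le[OF fA])
  also have "?A = (\<Union>k\<in>{l..<L}. {t \<in> targets Q d j. lev (head Q (fst t)) (snd t) = k + 1})"
  proof (intro equalityI subsetI)
    fix t assume t: "t \<in> ?A"
    then have "lev (head Q (fst t)) (snd t) \<le> L" by (intro le) (auto simp: targets_def)
    then show "t \<in> (\<Union>k\<in>{l..<L}. {t \<in> targets Q d j. lev (head Q (fst t)) (snd t) = k + 1})"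
      using t by (intro UN_I[of "lev (head Q (fst t)) (snd t) - 1"]) auto
  qed auto
  also have "card \<dots> = (\<Sum>k=l..<L. E1 Q (S (k + 1)) j)"
    unfolding card_targets[OF lev S, symmetric] using finite_targets by (intro card_UN_disjoint) auto
  finally show ?thesis .
qed

text \<open>The socles of the radical powers decrease with the powers.\<close>

lemma path_rank_step:
  fixes x :: "('e, 'k::field) point"
  assumes x: "x \<in> rep_layered Q L S" and S: "semisimple_sequence Q L S" and "l \<le> L"
  shows "path_rank L (seq_dim L S) x l 1 j \<le> S l j + path_rank L (seq_dim L S) x (Suc l) 1 j"
proof -
  let ?d = "seq_dim L S"
  have xv: "x \<in> rep_variety Q L ?d" using x by (simp add: rep_layered_def)
  let ?R = "rad_sub Q L ?d x"
  note gr = graded_sub_rad_sub[OF xv]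
  have "socle Q L ?d x (?R (Suc l)) \<subseteq> socle Q L ?d x (?R l)"
    unfolding socle_arrows[OF xv rad_sub_kspace[OF xv]] using rad_sub_antimono[OF xv, of l "Suc l"] by auto
  then have "dimvec (socle Q L ?d x (?R (Suc l))) j \<le> dimvec (socle Q L ?d x (?R l)) j"
    by (rule dimvec_mono[OF graded_sub_ann_sub[OF xv gr]])
  moreover have "dimvec (?R l) j = S l j + dimvec (?R (Suc l)) j"
    unfolding dimvec_rad_sub[OF x S] using \<open>l \<le> L\<close> by (simp add: sum.atLeast_Suc_atMost)
  ultimately show ?thesis using path_rank_nullity[OF xv, of l j 1] path_rank_nullity[OF xv, of "Suc l" j 1] by linarith
qed

lemma path_rank_le_matched:
  fixes u :: "('e, 'k::field) point"
  assumes u: "adapted Q d lev u" "u \<in> rep_layered Q L S" and lev: "levels S d lev"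
    and S: "semisimple_sequence Q L S" and "l \<le> L"
  shows "path_rank L d u l 1 j \<le> (\<Sum>k=l..L. matched Q L S k j)"
  using \<open>l \<le> L\<close>
proof (induction l rule: inc_induct)
  case base
  then show ?case using path_rank_le_E1[OF u lev S, of L j] by (simp add: sum_matched_end)
next
  case (step l)
  show ?case unfolding sum_matched_rec[OF \<open>l < L\<close>] min.bounded_iff
    using path_rank_le_E1[OF u lev S, of l j] path_rank_step[OF u(2) S, of l j] step
    unfolding levels_seq_dim[OF lev S] by simp
qed

text \<open>The greedy matching, read as a representation, has maximal rank, but it may fail to lie in
  \<open>Rep S\<close>. On the line to an adapted point of \<open>Rep S\<close> both conditions hold generically.\<close>

lemma greedy_point:
  assumes inf: "infinite (UNIV :: 'k::field set)" and S: "semisimple_sequence Q L S"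
    and ne: "(rep_layered Q L S :: ('e, 'k) point set) \<noteq> {}" and lev: "levels S d lev"
  shows "\<exists>u :: ('e, 'k) point. adapted Q d lev u \<and> u \<in> rep_layered Q L S \<and>
    (\<forall>l\<le>L. \<forall>j\<in>verts Q. path_rank L d u l 1 j = (\<Sum>k=l..L. matched Q L S k j))"
proof -
  have le: "lev i r \<le> L" if "r < d i" for i r using levels_le[where d = d, OF lev S that] .
  obtain x :: "('e, 'k) point" where "x \<in> rep_layered Q L S" using ne by blast
  from rep_layered_adapted_form[OF this S lev] obtain u0 :: "('e, 'k) point"
    where u0: "adapted Q d lev u0" "u0 \<in> rep_layered Q L S" by (elim exE conjE)
  let ?\<tau> = "\<lambda>t. lev (head Q (fst t)) (snd t)"
  have "\<exists>Xf :: nat set \<times> (nat \<Rightarrow> 'e \<times> nat). fst Xf \<subseteq> {..<d j} \<and> inj_on (snd Xf) (fst Xf) \<and>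
      (\<forall>r\<in>fst Xf. snd Xf r \<in> targets Q d j \<and> lev j r < ?\<tau> (snd Xf r)) \<and>
      (\<forall>l\<le>L. card {r \<in> fst Xf. lev j r = l} = matched Q L S l j)" for j
  proof -
    have "\<exists>X' f. X' \<subseteq> {..<d j} \<and> inj_on f X' \<and> (\<forall>r\<in>X'. f r \<in> targets Q d j \<and> lev j r < ?\<tau> (f r)) \<and>
      (\<forall>l\<le>L. card {r \<in> X'. lev j r = l} = fst ((\<lambda>m. (fst (SD_pair Q L S m) j, snd (SD_pair Q L S m) j)) (L - l)))"
    proof (rule greedy_matching[OF finite_lessThan finite_targets])
      show "?\<tau> t \<le> L" if "t \<in> targets Q d j" for t using that by (intro le) (auto simp: targets_def)
      fix m assume "m < L"
      have c: "card {r \<in> {..<d j}. lev j r = l} = S l j" for l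
        using lev by (simp add: levels_def)
      show "(fst (SD_pair Q L S (Suc m)) j, snd (SD_pair Q L S (Suc m)) j) =
        (let v = card {t \<in> targets Q d j. ?\<tau> t = L - m} + snd (fst (SD_pair Q L S m) j, snd (SD_pair Q L S m) j);
           s = min (card {r \<in> {..<d j}. lev j r = L - Suc m}) v in (s, v - s))"
        unfolding card_targets[OF lev S] c by (simp add: Let_def inf_min)
    qed simp
    then obtain X' f where "X' \<subseteq> {..<d j}" "inj_on f X'" "\<forall>r\<in>X'. f r \<in> targets Q d j \<and> lev j r < ?\<tau> (f r)"
      "\<forall>l\<le>L. card {r \<in> X'. lev j r = l} = fst ((\<lambda>m. (fst (SD_pair Q L S m) j, snd (SD_pair Q L S m) j)) (L - l))"
      by (elim exE conjE)
    then show ?thesis by (intro exI[of _ "(X', f)"]) (simp add: matched_def)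
  qed
  then have "\<forall>j. \<exists>Xf :: nat set \<times> (nat \<Rightarrow> 'e \<times> nat). fst Xf \<subseteq> {..<d j} \<and> inj_on (snd Xf) (fst Xf) \<and>
      (\<forall>r\<in>fst Xf. snd Xf r \<in> targets Q d j \<and> lev j r < ?\<tau> (snd Xf r)) \<and>
      (\<forall>l\<le>L. card {r \<in> fst Xf. lev j r = l} = matched Q L S l j)" by (rule allI)
  from choice[OF this] obtain Xf :: "'v \<Rightarrow> nat set \<times> (nat \<Rightarrow> 'e \<times> nat)" where
    "\<forall>j. fst (Xf j) \<subseteq> {..<d j} \<and> inj_on (snd (Xf j)) (fst (Xf j)) \<and>
      (\<forall>r\<in>fst (Xf j). snd (Xf j) r \<in> targets Q d j \<and> lev j r < ?\<tau> (snd (Xf j) r)) \<and>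
      (\<forall>l\<le>L. card {r \<in> fst (Xf j). lev j r = l} = matched Q L S l j)" by (rule exE)
  note Xf = this[THEN spec]
  define X where "X j = fst (Xf j)" for j
  define f where "f j = snd (Xf j)" for j
  have X: "X j \<subseteq> {..<d j}" and f: "inj_on (f j) (X j)"
    and fT: "r \<in> X j \<Longrightarrow> f j r \<in> targets Q d j" and flev: "r \<in> X j \<Longrightarrow> lev j r < ?\<tau> (f j r)"
    and cX: "l \<le> L \<Longrightarrow> card {r \<in> X j. lev j r = l} = matched Q L S l j" for j l r
    using Xf[of j] unfolding X_def f_def by simp_all
  have fX: "finite (X j)" for j using X by (rule finite_subset) simp
  \<comment> \<open>The matching as a representation: \<open>\<alpha>\<close> maps a basis vector to the one at its end that it is matched with
    through \<open>\<alpha>\<close>, and to zero if there is none.\<close>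
  define x1 :: "('e, 'k) point" where
    "x1 = (\<lambda>(\<alpha>, r', r). if \<alpha> \<in> arcs Q \<and> r \<in> X (tail Q \<alpha>) \<and> f (tail Q \<alpha>) r = (\<alpha>, r') then 1 else 0)"
  have x1: "adapted Q d lev x1" unfolding adapted_def
  proof (intro conjI allI impI)
    fix z assume z: "z \<notin> rep_coords Q d"
    obtain \<alpha> r' r where zz: "z = (\<alpha>, r', r)" by (metis surj_pair)
    show "x1 z = 0"
    proof (rule ccontr)
      assume "x1 z \<noteq> 0"
      then have *: "\<alpha> \<in> arcs Q" "r \<in> X (tail Q \<alpha>)" "f (tail Q \<alpha>) r = (\<alpha>, r')" by (auto simp: zz x1_def split: if_splits)
      then have "z \<in> rep_coords Q d" using fT[OF *(2)] X[of "tail Q \<alpha>"] by (auto simp: zz rep_coords_def targets_def)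
      then show False using z by simp
    qed
  next
    fix \<alpha> r' r assume "x1 (\<alpha>, r', r) \<noteq> 0"
    then have *: "r \<in> X (tail Q \<alpha>)" "f (tail Q \<alpha>) r = (\<alpha>, r')" by (auto simp: x1_def split: if_splits)
    then show "lev (tail Q \<alpha>) r < lev (head Q \<alpha>) r'" using flev[OF *(1)] by simp
  qed
  define u where "u t z = (1 - t) * u0 z + t * x1 z" for t z
  have up: "(\<lambda>t. u t z) \<in> polyfuns {\<lambda>t. t}" for z unfolding u_def by (rule line_polyfuns)
  have ua: "adapted Q d lev (u t)" for t unfolding adapted_def u_def
  proof (intro conjI allI impI)
    show "(1 - t) * u0 z + t * x1 z = 0" if "z \<notin> rep_coords Q d" for z
    proof -
      have "u0 z = 0" "x1 z = 0" using that u0(1) x1 unfolding adapted_def by blast+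
      then show ?thesis by simp
    qed
    fix \<alpha> r c assume "(1 - t) * u0 (\<alpha>, r, c) + t * x1 (\<alpha>, r, c) \<noteq> 0"
    then have "u0 (\<alpha>, r, c) \<noteq> 0 \<or> x1 (\<alpha>, r, c) \<noteq> 0" by auto
    then show "lev (tail Q \<alpha>) c < lev (head Q \<alpha>) r" using u0(1) x1 unfolding adapted_def by blast
  qed
  have u01: "u 0 = u0" "u 1 = x1" by (auto simp: u_def fun_eq_iff)
  define w where "w j t r = path_eval Q d (u t) 1 (std_vec (j, r))" for j t r
  have wp: "(\<lambda>t. w j t r b) \<in> polyfuns {\<lambda>t. t}" for j r b
  proof -
    obtain v p z where b: "b = ((v, p), z)" by (metis surj_pair)
    show ?thesis
    proof (cases "(v, p) \<in> paths Q \<and> length p = 1")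
      case True
      then show ?thesis unfolding w_def b path_eval_def by (simp add: path_act_polyfuns[OF up polyfuns.const])
    next
      case False
      then have "(\<lambda>t. w j t r b) = (\<lambda>_. 0)" unfolding w_def b path_eval_def by auto
      then show ?thesis by (simp only: polyfuns.const)
    qed
  qed
  have w1: "indep_on (X j) (w j 1)" for j unfolding indep_on_def
  proof (intro allI impI ballI)
    fix c r assume 0: "(\<Sum>r\<in>X j. vscale (c r) (w j 1 r)) = 0" and r: "r \<in> X j"
    obtain \<alpha> r' where fr: "f j r = (\<alpha>, r')" by (cases "f j r")
    have \<alpha>: "\<alpha> \<in> arcs Q" "tail Q \<alpha> = j" "r' < d (head Q \<alpha>)" using fT[OF r] by (auto simp: fr targets_def)
    have "w j 1 s ((j, [\<alpha>]), (head Q \<alpha>, r')) = (if s = r then 1 else 0)" if s: "s \<in> X j" for s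
    proof -
      have sd: "s < d j" using X s by blast
      then have co: "(\<alpha>, r', s) \<in> rep_coords Q d" using \<alpha> by (auto simp: rep_coords_def)
      have "w j 1 s ((j, [\<alpha>]), (head Q \<alpha>, r')) = path_act Q d x1 (tail Q \<alpha>, [\<alpha>]) (std_vec (tail Q \<alpha>, s)) (head Q \<alpha>, r')"
        unfolding w_def u01 path_eval_def using arc_path[OF \<alpha>(1)] \<alpha>(2) by simp
      also have "\<dots> = x1 (\<alpha>, r', s)" unfolding path_act_arrow by (rule arrow_act_std[OF co])
      also have "\<dots> = (if f j s = (\<alpha>, r') then 1 else 0)" using \<alpha> s by (simp add: x1_def)
      also have "f j s = (\<alpha>, r') \<longleftrightarrow> s = r" unfolding fr[symmetric] using f r s by (auto simp: inj_on_def)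
      finally show ?thesis .
    qed
    then have "(\<Sum>s\<in>X j. vscale (c s) (w j 1 s)) ((j, [\<alpha>]), (head Q \<alpha>, r')) = (\<Sum>s\<in>X j. if s = r then c r else 0)"
      unfolding sum_fun_apply vscale_apply by (intro sum.cong) auto
    then show "c r = 0" unfolding 0 using r fX by simp
  qed
  have "\<exists>F. F \<in> polyfuns {\<lambda>t. t} \<and> F 1 \<noteq> 0 \<and> (\<forall>t. F t \<noteq> 0 \<longrightarrow> indep_on (X j) (w j t))" for j
    by (rule indep_on_open[of "X j" "w j" "{\<lambda>t. t}" 1, OF fX wp w1]) blast
  then have "\<forall>j. \<exists>F. F \<in> polyfuns {\<lambda>t. t} \<and> F 1 \<noteq> 0 \<and> (\<forall>t. F t \<noteq> 0 \<longrightarrow> indep_on (X j) (w j t))" by (rule allI)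
  from choice[OF this] obtain F where
    "\<forall>j. F j \<in> polyfuns {\<lambda>t. t} \<and> F j 1 \<noteq> 0 \<and> (\<forall>t. F j t \<noteq> 0 \<longrightarrow> indep_on (X j) (w j t))" by (rule exE)
  note F = this[THEN spec]
  have "\<exists>H\<in>polyfuns {\<lambda>t. t}. H 0 \<noteq> 0 \<and> (\<forall>t. H t \<noteq> 0 \<longrightarrow> u t \<in> rep_layered Q L S)"
    by (rule adapted_layered_open[OF up ua _ lev S]) (simp only: u01 u0)
  then obtain H where H: "H \<in> polyfuns {\<lambda>t. t}" "H 0 \<noteq> 0" "\<forall>t. H t \<noteq> 0 \<longrightarrow> u t \<in> rep_layered Q L S" by (elim bexE conjE)
  have "\<exists>t. \<forall>g\<in>insert H (F ` verts Q). g t \<noteq> 0"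
  proof (rule polyfuns_line_conj[OF inf])
    fix g assume "g \<in> insert H (F ` verts Q)"
    then consider "g = H" | j where "g = F j" by blast
    then show "g \<in> polyfuns {\<lambda>t. t} \<and> (\<exists>t. g t \<noteq> 0)"
    proof cases
      case 1 then show ?thesis using H(1,2) by auto
    next
      case (2 j) show ?thesis unfolding 2
        by (intro conjI exI) (rule F[THEN conjunct1], rule F[THEN conjunct2, THEN conjunct1])
    qed
  qed simp
  then obtain t where t: "\<forall>g\<in>insert H (F ` verts Q). g t \<noteq> 0" by (rule exE)
  have ut: "u t \<in> rep_layered Q L S" using t H(3) by simp
  then have utv: "u t \<in> rep_variety Q L d" using levels_seq_dim[OF lev S] by (auto simp: rep_layered_def)
  have rank: "path_rank L d (u t) l 1 j = (\<Sum>k=l..L. matched Q L S k j)" if l: "l \<le> L" and j: "j \<in> verts Q" for l j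
  proof (rule antisym)
    show "path_rank L d (u t) l 1 j \<le> (\<Sum>k=l..L. matched Q L S k j)"
      by (rule path_rank_le_matched[OF ua ut lev S l])
    have ind: "indep_on (X j) (w j t)" using t j F[of j] by simp
    let ?Y = "{r \<in> X j. l \<le> lev j r}"
    have "lev j r \<le> L" if "r \<in> X j" for r using le X that by blast
    then have "?Y = (\<Union>k\<in>{l..L}. {r \<in> X j. lev j r = k})" by auto
    then have "card ?Y = card (\<Union>k\<in>{l..L}. {r \<in> X j. lev j r = k})" by simp
    also have "\<dots> = (\<Sum>k=l..L. card {r \<in> X j. lev j r = k})" using fX by (intro card_UN_disjoint) auto
    finally have cY: "card ?Y = (\<Sum>k=l..L. matched Q L S k j)" using cX by simp
    have "card ?Y \<le> path_rank L d (u t) l 1 j" unfolding path_rank_def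
    proof (rule indep_on_card_le)
      show "indep_on ?Y (w j t)" by (rule indep_on_mono[OF ind _ fX]) auto
      show "finite ?Y" using fX by simp
      show "w j t ` ?Y \<subseteq> path_eval Q d (u t) 1 ` vertex_act j ` rad_sub Q L d (u t) l"
      proof
        fix y assume "y \<in> w j t ` ?Y"
        then obtain r where r: "r \<in> X j" "l \<le> lev j r" "y = w j t r" by blast
        have sj: "std_vec (j, r) = (vertex_act j (std_vec (j, r)) :: 'v \<times> nat \<Rightarrow> 'k)"
          by (auto simp: fun_eq_iff vertex_act_apply std_vec_def)
        have rd: "r < d j" using X r(1) by blast
        have "(std_vec (j, r) :: 'v \<times> nat \<Rightarrow> 'k) \<in> kspace d" by (rule std_vec_kspace, rule rd)
        then have "(std_vec (j, r) :: 'v \<times> nat \<Rightarrow> 'k) \<in> rad_sub Q L d (u t) l"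
          unfolding adapted_layered_rad_sub[OF ua ut lev S] coord_sub_def using r(2) by (auto simp: std_vec_def)
        with sj have "(std_vec (j, r) :: 'v \<times> nat \<Rightarrow> 'k) \<in> vertex_act j ` rad_sub Q L d (u t) l" by (rule image_eqI)
        then show "y \<in> path_eval Q d (u t) 1 ` vertex_act j ` rad_sub Q L d (u t) l"
          unfolding r(3) w_def by (rule imageI)
      qed
      show "fin_dim (path_eval Q d (u t) 1 ` vertex_act j ` rad_sub Q L d (u t) l)"
        by (rule fin_dim_image[OF path_eval_semilinear graded_sub_component_subspace[OF graded_sub_rad_sub[OF utv]]
          graded_sub_fin_dim[OF graded_sub_rad_sub[OF utv]]])
    qed
    then show "(\<Sum>k=l..L. matched Q L S k j) \<le> path_rank L d (u t) l 1 j" unfolding cY .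
  qed
  show ?thesis by (intro exI[of _ "u t"] conjI allI impI ballI) (rule ua, rule ut, erule (1) rank)
qed

lemma poly_generic_path_rank:
  assumes x0: "x0 \<in> (rep_layered Q L S :: ('e, 'k::field) point set)"
  shows "poly_generic (rep_layered Q L S :: ('e, 'k) point set)
    (\<lambda>x. path_rank L (seq_dim L S) x0 l k i \<le> path_rank L (seq_dim L S) x l k i)"
proof -
  have v: "x \<in> rep_variety Q L (seq_dim L S)" if "x \<in> rep_layered Q L S" for x :: "('e, 'k) point"
    using that by (simp add: rep_layered_def)
  have "\<exists>F\<in>polyfuns coord_funs. F x0 \<noteq> 0 \<and> (\<forall>x :: ('e, 'k) point. F x \<noteq> 0 \<longrightarrow> x \<in> rep_variety Q L (seq_dim L S) \<longrightarrow>
      path_rank L (seq_dim L S) x0 l k i \<le> path_rank L (seq_dim L S) x l k i)"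
    by (rule path_rank_open[where x = "\<lambda>x. x", OF polyfuns.gen v[OF x0]]) simp
  then obtain F where F: "F \<in> polyfuns coord_funs" "F x0 \<noteq> 0" "\<forall>x :: ('e, 'k) point. F x \<noteq> 0 \<longrightarrow>
      x \<in> rep_variety Q L (seq_dim L S) \<longrightarrow> path_rank L (seq_dim L S) x0 l k i \<le> path_rank L (seq_dim L S) x l k i"
    by (elim bexE conjE)
  show ?thesis unfolding poly_generic_def
    by (rule bexI[OF _ F(1)]) (use F(2,3) x0 v in auto)
qed

end

text \<open>These values are lower bounds for all points of \<open>Rep S\<close>, since the rank of the arrows is bounded above by
  the sum of the entries \<open>matched\<close>.\<close>

definition socles_minimal :: "('v, 'e) pre_digraph \<Rightarrow> nat \<Rightarrow> (nat \<Rightarrow> 'v \<Rightarrow> nat) \<Rightarrow> ('e, 'k::field) point \<Rightarrow> bool" where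
  "socles_minimal Q L S x \<longleftrightarrow> (\<forall>l\<le>L. \<forall>i.
     dimvec (socle Q L (seq_dim L S) x (rad_sub Q L (seq_dim L S) x l)) i = (\<Sum>k=l..L. C_mod Q L S k i))"

context quiver
begin

lemma dimvec_off: "graded_sub d N \<Longrightarrow> d i = 0 \<Longrightarrow> dimvec N i = 0"
  using dimvec_mono[OF graded_sub_kspace, of N d i] unfolding dimvec_kspace by (simp add: graded_sub_def)

lemma conj_layered:
  fixes u :: "('e, 'k::field) point"
  assumes u: "u \<in> rep_layered Q L S" and d: "d = seq_dim L S"
    and gh: "mat_prod_scalar d g h (\<lambda>_. 1)" and hg: "mat_prod_scalar d h g (\<lambda>_. 1)"
  shows "conj_pt Q d h u g \<in> rep_layered Q L S"
    and "soc_layering Q L d (conj_pt Q d h u g) = soc_layering Q L d u"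
    and "socles_minimal Q L S (conj_pt Q d h u g) = socles_minimal Q L S u"
    and "path_rank L d (conj_pt Q d h u g) l 1 i = path_rank L d u l 1 i"
proof -
  let ?x = "conj_pt Q d h u g"
  have uv: "u \<in> rep_variety Q L d" and ul: "rad_layering Q L d u = S" using u by (auto simp: rep_layered_def d)
  have sm: "scaled_map Q id (\<lambda>\<alpha>. 1) d u d ?x (gmap d h)" by (rule conj_scaled_map[OF gh]) simp
  have bij: "bij_betw (gmap d h) (kspace d) (kspace d)" by (rule gmap_bij[OF gh hg]) simp
  then have surj: "gmap d h ` kspace d = kspace d" by (simp add: bij_betw_def)
  have xv: "?x \<in> rep_variety Q L d" by (rule scaled_map_rep_variety[OF sm uv surj conj_pt_off])
  show x: "?x \<in> rep_layered Q L S"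
    using xv scaled_map_invariants(1)[OF sm uv xv bij] ul by (simp add: rep_layered_def d)
  show "soc_layering Q L d ?x = soc_layering Q L d u" by (rule scaled_map_invariants(2)[OF sm uv xv bij])
  note soc = scaled_map_invariants(3)[OF sm uv xv bij]
  show "socles_minimal Q L S ?x = socles_minimal Q L S u"
    unfolding socles_minimal_def d[symmetric] soc ..
  have "dimvec (rad_sub Q L d ?x l) i = dimvec (rad_sub Q L d u l) i"
    unfolding scaled_map_rad_sub[OF sm uv xv surj, symmetric] using bij
    by (intro scaled_map_dimvec_inj[OF sm graded_sub_rad_sub[OF uv]]) (simp add: bij_betw_def)
  then show "path_rank L d ?x l 1 i = path_rank L d u l 1 i"
    using path_rank_nullity[OF uv, of l i 1] path_rank_nullity[OF xv, of l i 1] soc[of l i] by linarith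
qed

lemma poly_generic_socles_minimal:
  assumes inf: "infinite (UNIV :: 'k::field set)" and S: "semisimple_sequence Q L S"
    and ne: "(rep_layered Q L S :: ('e, 'k) point set) \<noteq> {}"
  shows "poly_generic (rep_layered Q L S :: ('e, 'k) point set) (socles_minimal Q L S)"
proof -
  let ?X = "rep_layered Q L S :: ('e, 'k) point set"
  define d where d: "d = seq_dim L S"
  note irr = rep_layered_irreducible[OF inf S ne]
  from ex_levels[OF S, of S] obtain lev where lev: "levels S d lev" unfolding d by auto
  from greedy_point[OF inf S ne lev] obtain u :: "('e, 'k) point" where u: "u \<in> ?X"
    "\<forall>l\<le>L. \<forall>j\<in>verts Q. path_rank L d u l 1 j = (\<Sum>k=l..L. matched Q L S k j)" by (elim exE conjE)
  have "poly_generic ?X (\<lambda>x. \<forall>q\<in>{..L} \<times> verts Q.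
      path_rank L d u (fst q) 1 (snd q) \<le> path_rank L d x (fst q) 1 (snd q))"
  proof (rule poly_generic_ball[OF irr])
    fix q :: "nat \<times> 'v"
    show "poly_generic ?X (\<lambda>x. path_rank L d u (fst q) 1 (snd q) \<le> path_rank L d x (fst q) 1 (snd q))"
      unfolding d by (rule poly_generic_path_rank[OF u(1)])
  qed simp
  then show ?thesis
  proof (rule poly_generic_mono)
    fix x :: "('e, 'k) point"
    assume x: "x \<in> ?X" and r: "\<forall>q\<in>{..L} \<times> verts Q.
      path_rank L d u (fst q) 1 (snd q) \<le> path_rank L d x (fst q) 1 (snd q)"
    have xv: "x \<in> rep_variety Q L d" using x by (simp add: rep_layered_def d)
    show "socles_minimal Q L S x" unfolding socles_minimal_def d[symmetric]
    proof (intro allI impI)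
      fix l i assume l: "l \<le> L"
      show "dimvec (socle Q L d x (rad_sub Q L d x l)) i = (\<Sum>k=l..L. C_mod Q L S k i)"
      proof (cases "i \<in> verts Q")
        case True
        have "path_rank L d u l 1 i \<le> path_rank L d x l 1 i" using r l True by auto
        then have "(\<Sum>k=l..L. matched Q L S k i) \<le> path_rank L d x l 1 i" using u(2) l True by simp
        moreover have "path_rank L d x l 1 i \<le> (\<Sum>k=l..L. matched Q L S k i)"
        proof -
          from rep_layered_adapted_form[OF x S lev] obtain v g h where *:
            "mat_prod_scalar d g h (\<lambda>_. 1)" "mat_prod_scalar d h g (\<lambda>_. 1)" "x = conj_pt Q d h v g"
            "adapted Q d lev v" "v \<in> ?X" by (elim exE conjE)
          show ?thesis unfolding *(3) conj_layered(4)[OF *(5) d *(1,2)]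
            by (rule path_rank_le_matched[OF *(4,5) lev S l])
        qed
        moreover have "(\<Sum>k=l..L. S k i) = dimvec (socle Q L d x (rad_sub Q L d x l)) i + path_rank L d x l 1 i"
          using path_rank_nullity[OF xv, of l i 1] dimvec_rad_sub[OF x S, of l i] unfolding d by simp
        moreover have "(\<Sum>k=l..L. C_mod Q L S k i) + (\<Sum>k=l..L. matched Q L S k i) = (\<Sum>k=l..L. S k i)"
          unfolding sum.distrib[symmetric] C_mod_matched ..
        ultimately show ?thesis by linarith
      next
        case False
        have "S k i = 0" for k using S False by (auto simp: semisimple_sequence_def dim_vectors_def)
        then have "C_mod Q L S k i = 0" "d i = 0" for k by (simp_all add: C_mod_def d seq_dim_def)
        then show ?thesis using dimvec_off[OF graded_sub_ann_sub[OF xv graded_sub_rad_sub[OF xv]]] by simp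
      qed
    qed
  qed
qed

text \<open>The dimensions of the annihilators are upper semicontinuous, so each of them has its minimal value on a
  nonempty open set. By irreducibility these sets have a common point.\<close>

lemma generic_ann_dims:
  assumes inf: "infinite (UNIV :: 'k::field set)" and S: "semisimple_sequence Q L S"
    and ne: "(rep_layered Q L S :: ('e, 'k) point set) \<noteq> {}"
  shows "\<exists>A. poly_generic (rep_layered Q L S :: ('e, 'k) point set)
    (\<lambda>x. \<forall>k i. dimvec (ann_sub Q L (seq_dim L S) x (kspace (seq_dim L S)) k) i = A k i)"
proof -
  let ?X = "rep_layered Q L S :: ('e, 'k) point set"
  define d where d: "d = seq_dim L S"
  have dv: "d \<in> dim_vectors Q" unfolding d by (rule seq_dim_dim_vectors[OF S])
  note irr = rep_layered_irreducible[OF inf S ne]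
  have v: "x \<in> rep_variety Q L d" if "x \<in> ?X" for x using that by (simp add: rep_layered_def d)
  let ?a = "\<lambda>x :: ('e, 'k) point. \<lambda>k i. dimvec (ann_sub Q L d x (kspace d) k) i"
  have rn: "d i = ?a x k i + path_rank L d x 0 k i" if "x \<in> ?X" for x k i
    using path_rank_nullity[OF v[OF that], of 0 i k] unfolding rad_sub_0[OF v[OF that] dv] dimvec_kspace .
  obtain z where z: "z \<in> ?X" using ne by blast
  define A where "A k i = (LEAST n. \<exists>x\<in>?X. ?a x k i = n)" for k i
  have A: "\<exists>x\<in>?X. ?a x k i = A k i" for k i
    unfolding A_def by (rule LeastI_ex) (rule exI, rule bexI[OF refl z])
  have Ale: "A k i \<le> ?a x k i" if "x \<in> ?X" for x k i
    unfolding A_def by (rule Least_le) (rule bexI[OF refl that])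
  have "poly_generic ?X (\<lambda>x. \<forall>q\<in>{..L} \<times> verts Q. ?a x (fst q) (snd q) = A (fst q) (snd q))"
  proof (rule poly_generic_ball[OF irr])
    fix q :: "nat \<times> 'v"
    obtain x0 where x0: "x0 \<in> ?X" "?a x0 (fst q) (snd q) = A (fst q) (snd q)" using A by blast
    have "poly_generic ?X (\<lambda>x. path_rank L d x0 0 (fst q) (snd q) \<le> path_rank L d x 0 (fst q) (snd q))"
      unfolding d by (rule poly_generic_path_rank[OF x0(1)])
    then show "poly_generic ?X (\<lambda>x. ?a x (fst q) (snd q) = A (fst q) (snd q))"
    proof (rule poly_generic_mono)
      fix x assume x: "x \<in> ?X" "path_rank L d x0 0 (fst q) (snd q) \<le> path_rank L d x 0 (fst q) (snd q)"
      show "?a x (fst q) (snd q) = A (fst q) (snd q)"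
        using rn[OF x(1), of "snd q" "fst q"] rn[OF x0(1), of "snd q" "fst q"] Ale[OF x(1), of "fst q" "snd q"] x(2) x0(2)
        by linarith
    qed
  qed simp
  then have "poly_generic ?X (\<lambda>x. \<forall>k i. ?a x k i = (if i \<notin> verts Q then 0 else if L < k then d i else A k i))"
  proof (rule poly_generic_mono)
    fix x assume x: "x \<in> ?X" and q: "\<forall>q\<in>{..L} \<times> verts Q. ?a x (fst q) (snd q) = A (fst q) (snd q)"
    show "\<forall>k i. ?a x k i = (if i \<notin> verts Q then 0 else if L < k then d i else A k i)"
    proof (intro allI)
      fix k i
      show "?a x k i = (if i \<notin> verts Q then 0 else if L < k then d i else A k i)"
      proof (cases "i \<in> verts Q")
        case False
        then have "d i = 0" using dim_vectorsD[OF dv] by blast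
        then show ?thesis using False dimvec_off[OF graded_sub_ann_sub[OF v[OF x] graded_sub_kspace]] by simp
      next
        case True
        show ?thesis
        proof (cases "L < k")
          case k: True
          then show ?thesis unfolding ann_sub_end[OF v[OF x] order_refl k] dimvec_kspace using True by simp
        next
          case False
          then have "(k, i) \<in> {..L} \<times> verts Q" using True by simp
          from bspec[OF q this] show ?thesis using True False by simp
        qed
      qed
    qed
  qed
  then show ?thesis unfolding d[symmetric]
    by (rule exI[of _ "\<lambda>k i. if i \<notin> verts Q then 0 else if L < k then d i else A k i"])
qed

lemma ex_generic_soc_layering:
  assumes inf: "infinite (UNIV :: 'k::field set)" and S: "semisimple_sequence Q L S"
    and ne: "(rep_layered Q L S :: ('e, 'k) point set) \<noteq> {}"
  shows "\<exists>T. poly_generic (rep_layered Q L S :: ('e, 'k) point set) (\<lambda>x. soc_layering Q L (seq_dim L S) x = T)"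
proof -
  from generic_ann_dims[OF inf S ne] obtain A where A: "poly_generic (rep_layered Q L S :: ('e, 'k) point set)
    (\<lambda>x. \<forall>k i. dimvec (ann_sub Q L (seq_dim L S) x (kspace (seq_dim L S)) k) i = A k i)" by (rule exE)
  have "poly_generic (rep_layered Q L S :: ('e, 'k) point set)
    (\<lambda>x. soc_layering Q L (seq_dim L S) x = (\<lambda>l i. A (l + 1) i - A l i))"
    by (rule poly_generic_mono[OF A]) (simp add: soc_layering_def fun_eq_iff)
  then show ?thesis by (rule exI[of _ "\<lambda>l i. A (l + 1) i - A l i"])
qed

lemma socles_minimal_socle_sup:
  fixes x :: "('e, 'k::field) point"
  assumes S: "semisimple_sequence Q L S" and "socles_minimal Q L S x" "m \<le> L"
  shows "(\<lambda>i. int (dimvec (socle Q L (seq_dim L S) x (rad_sub Q L (seq_dim L S) x (L - m))) i)) = socle_sup Q L S m"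
  unfolding socle_sup_C_mod[OF S \<open>m \<le> L\<close>, symmetric] using assms(2) by (simp add: socles_minimal_def)

lemma soc_layering_0:
  fixes x :: "('e, 'k::field) point"
  assumes S: "semisimple_sequence Q L S" and x: "x \<in> rep_layered Q L S" and m: "socles_minimal Q L S x"
  shows "(\<lambda>i. int (soc_layering Q L (seq_dim L S) x 0 i)) = socle_sup Q L S L"
proof -
  let ?d = "seq_dim L S"
  have dv: "?d \<in> dim_vectors Q" by (rule seq_dim_dim_vectors[OF S])
  have xv: "x \<in> rep_variety Q L ?d" using x by (simp add: rep_layered_def)
  have "soc_layering Q L ?d x 0 i = dimvec (socle Q L ?d x (rad_sub Q L ?d x (L - L))) i" for i
    unfolding soc_layering_def diff_self_eq_0 rad_sub_0[OF xv dv] ann_sub_0[OF xv graded_sub_kspace dv] dimvec_0 by simp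
  then show ?thesis using socles_minimal_socle_sup[OF S m order_refl] by simp
qed

text \<open>The dimensions of the socles of the radical powers are invariant under isomorphisms onto Galois twists, so
  their generic values are values at every generic module.\<close>

lemma generic_module_socles:
  fixes x :: "('e, 'k::field) point"
  assumes inf: "infinite (UNIV :: 'k::field set)" and S: "semisimple_sequence Q L S"
    and x: "generic_module Q L S x"
  shows "socles_minimal Q L S x"
proof -
  have ne: "(rep_layered Q L S :: ('e, 'k) point set) \<noteq> {}" using x by (auto simp: generic_module_def)
  define P :: "('v \<Rightarrow> nat) \<Rightarrow> ('e, 'k) point \<Rightarrow> bool" where
    "P d y \<longleftrightarrow> (\<forall>l\<le>L. \<forall>i. dimvec (socle Q L d y (rad_sub Q L d y l)) i = (\<Sum>k=l..L. C_mod Q L S k i))" for d y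
  have stable: "stable_under Q L \<phi> P" if \<phi>: "field_auto \<phi>" for \<phi> unfolding stable_under_def
  proof (intro ballI impI, elim conjE)
    fix d d' and y z :: "('e, 'k) point"
    assume dv: "d \<in> dim_vectors Q" "d' \<in> dim_vectors Q" and v: "y \<in> rep_variety Q L d" "z \<in> rep_variety Q L d'"
      and iso: "twisted_iso Q L \<phi> d y d' z" and P: "P d y"
    from iso obtain f where f: "twisted_hom Q L \<phi> d y d' z f" "bij_betw f (kspace d) (kspace d')"
      unfolding twisted_iso_def by (elim exE conjE)
    show "P d' z"
      using P unfolding P_def scaled_map_invariants(3)[OF twisted_hom_scaled_map[OF f(1) \<phi> v dv] v f(2)] .
  qed
  have "module_property Q L P" unfolding module_property_def by (rule stable[OF field_auto_id(1)])
  moreover have "galois_stable Q L P" unfolding galois_stable_def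
    by (intro ballI stable) (auto simp: galois_group_def field_auto_def)
  moreover have "generically Q L S (P (seq_dim L S))"
    unfolding generically_iff_poly_generic[OF rep_layered_irreducible[OF inf S ne]]
    by (rule poly_generic_mono[OF poly_generic_socles_minimal[OF inf S ne]]) (simp add: P_def socles_minimal_def)
  ultimately have "P (seq_dim L S) x" using x unfolding generic_module_def by blast
  then show ?thesis by (simp add: P_def socles_minimal_def)
qed

end

section \<open>Passing to the quotient by the socle\<close>

definition restrict_pt :: "('v, 'e) pre_digraph \<Rightarrow> ('v \<Rightarrow> nat) \<Rightarrow> ('e, 'k::field) point \<Rightarrow> ('e, 'k) point" where
  "restrict_pt Q d u = (\<lambda>z. if z \<in> rep_coords Q d then u z else 0)"

definition forget_coords :: "('v \<Rightarrow> nat) \<Rightarrow> ('v \<times> nat \<Rightarrow> 'k::field) \<Rightarrow> ('v \<times> nat \<Rightarrow> 'k)" where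
  "forget_coords d m = (\<lambda>(i, r). if r < d i then m (i, r) else 0)"

lemma forget_coords_semilinear: "semilinear_on id V (forget_coords d)"
  unfolding semilinear_on_def using field_auto_id by (auto simp: forget_coords_def fun_eq_iff vscale_apply)

lemma forget_coords_surj:
  fixes d d' :: "'v \<Rightarrow> nat"
  assumes "\<And>i. d' i \<le> d i"
  shows "forget_coords d' ` kspace d = (kspace d' :: ('v \<times> nat \<Rightarrow> 'k::field) set)"
proof (intro equalityI subsetI)
  fix m :: "'v \<times> nat \<Rightarrow> 'k" assume m: "m \<in> kspace d'"
  have "m = forget_coords d' m" using m by (auto simp: forget_coords_def kspace_def fun_eq_iff)
  moreover have "m \<in> kspace d" unfolding kspace_def
  proof (intro CollectI allI impI)
    fix i r assume "d i \<le> r"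
    then have "d' i \<le> r" using assms[of i] by simp
    then show "m (i, r) = 0" using m by (simp add: kspace_def)
  qed
  ultimately show "m \<in> forget_coords d' ` kspace d" by (rule image_eqI)
qed (auto simp: forget_coords_def kspace_def)

lemma forget_coords_kernel: "{m \<in> kspace d. forget_coords d' m = 0} = coord_sub d (\<lambda>i r. d' i \<le> r)"
  unfolding coord_sub_def forget_coords_def fun_eq_iff by (auto simp: not_le split: if_splits)

lemma forget_coords_scaled_map:
  fixes u :: "('e, 'k::field) point" and Q :: "('v, 'e) pre_digraph"
  assumes le: "\<And>i. d' i \<le> d i" and u: "\<And>\<alpha> r c. d' (tail Q \<alpha>) \<le> c \<Longrightarrow> u (\<alpha>, r, c) = 0"
  shows "scaled_map Q id (\<lambda>_. 1) d u d' (restrict_pt Q d' u) (forget_coords d')"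
  unfolding scaled_map_def
proof (intro conjI allI ballI)
  show "semilinear_on id (kspace d) (forget_coords d')" by (rule forget_coords_semilinear)
  show "forget_coords d' ` kspace d \<subseteq> kspace d'" unfolding forget_coords_surj[OF le] ..
  show "forget_coords d' (vertex_act i m) = vertex_act i (forget_coords d' m)" for i and m :: "'v \<times> nat \<Rightarrow> 'k"
    by (auto simp: forget_coords_def vertex_act_apply fun_eq_iff)
  show "1 \<noteq> (0 :: 'k)" by simp
  fix \<alpha> and m :: "'v \<times> nat \<Rightarrow> 'k" assume \<alpha>: "\<alpha> \<in> arcs Q"
  let ?y = "restrict_pt Q d' u" and ?t = "tail Q \<alpha>" and ?h = "head Q \<alpha>"
  have sum: "(\<Sum>c<d ?t. u (\<alpha>, r, c) * m (?t, c)) = (\<Sum>c<d' ?t. ?y (\<alpha>, r, c) * forget_coords d' m (?t, c))" if "r < d' ?h" for r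
  proof -
    have "(\<Sum>c<d' ?t. ?y (\<alpha>, r, c) * forget_coords d' m (?t, c)) = (\<Sum>c<d' ?t. u (\<alpha>, r, c) * m (?t, c))"
      using \<alpha> that by (intro sum.cong) (auto simp: restrict_pt_def forget_coords_def rep_coords_def)
    also have "\<dots> = (\<Sum>c<d ?t. u (\<alpha>, r, c) * m (?t, c))"
      using le[of ?t] u by (intro sum.mono_neutral_left) auto
    finally show ?thesis by simp
  qed
  show "arrow_act Q d' ?y \<alpha> (forget_coords d' m) = vscale 1 (forget_coords d' (arrow_act Q d u \<alpha> m))"
  proof
    fix z :: "'v \<times> nat"
    obtain j r where z: "z = (j, r)" by (cases z)
    show "arrow_act Q d' ?y \<alpha> (forget_coords d' m) z = vscale 1 (forget_coords d' (arrow_act Q d u \<alpha> m)) z"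
    proof (cases "j = ?h \<and> r < d' j")
      case True
      have "r < d j" using conjunct2[OF True] le[of j] by (rule order_less_le_trans)
      then show ?thesis using True sum[of r] by (simp add: z vscale_apply arrow_act_def forget_coords_def)
    next
      case False
      then show ?thesis by (auto simp: z vscale_apply arrow_act_def forget_coords_def)
    qed
  qed
qed

lemma scaled_map_comp:
  fixes x y z :: "('e, 'k::field) point" and Q :: "('v, 'e) pre_digraph"
  assumes f: "scaled_map Q id (\<lambda>_. 1) d x d' y f" and g: "scaled_map Q id (\<lambda>_. 1) d' y d'' z g"
  shows "scaled_map Q id (\<lambda>_. 1) d x d'' z (\<lambda>m. g (f m))"
proof -
  have fk: "f m \<in> kspace d'" if "m \<in> kspace d" for m using f that unfolding scaled_map_def by blast
  have one: "vscale 1 m = m" for m :: "'v \<times> nat \<Rightarrow> 'k" by (simp add: vscale_def)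
  show ?thesis unfolding scaled_map_def semilinear_on_def
  proof (intro conjI allI ballI)
    show "field_auto (id :: 'k \<Rightarrow> 'k)" by (rule field_auto_id)
    show "(\<lambda>m. g (f m)) ` kspace d \<subseteq> kspace d''" using fk g unfolding scaled_map_def by blast
    show "1 \<noteq> (0 :: 'k)" by simp
    fix m :: "'v \<times> nat \<Rightarrow> 'k" assume m: "m \<in> kspace d"
    show "g (f (vertex_act i m)) = vertex_act i (g (f m))" for i
      using f g m fk[OF m] by (simp add: scaled_map_def)
    show "g (f (vscale c m)) = vscale (id c) (g (f m))" for c
      using f g m fk[OF m] by (simp add: scaled_map_def semilinear_on_def)
    show "g (f (m + n)) = g (f m) + g (f n)" if n: "n \<in> kspace d" for n
      using f g m n fk[OF m] fk[OF n] by (simp add: scaled_map_def semilinear_on_def)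
    show "arrow_act Q d'' z \<alpha> (g (f m)) = vscale 1 (g (f (arrow_act Q d x \<alpha> m)))" if "\<alpha> \<in> arcs Q" for \<alpha>
      using f g m fk[OF m] fk[OF arrow_act_kspace] arrow_act_kspace[of Q d x \<alpha> m] that
      unfolding scaled_map_def one by simp
  qed
qed

lemma quot_seq_C_mod: "quot_seq Q L S k i + C_mod Q L S k i = S k i"
  by (simp add: quot_seq_def C_mod_def)

lemma quot_seq_semisimple:
  assumes S: "semisimple_sequence Q L S"
  shows "semisimple_sequence Q L (quot_seq Q L S)"
proof -
  have "quot_seq Q L S k i \<le> S k i" for k i using quot_seq_C_mod[of Q L S k i] by simp
  moreover have "S k i = 0" if "i \<notin> verts Q \<or> L < k" for k i
    using S that by (auto simp: semisimple_sequence_def dim_vectors_def)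
  ultimately have "quot_seq Q L S k i = 0" if "i \<notin> verts Q \<or> L < k" for k i using that by (metis le_zero_eq)
  then show ?thesis by (auto simp: semisimple_sequence_def dim_vectors_def fun_eq_iff)
qed

context quiver
begin

text \<open>The elements killed by \<open>f\<close> are those annihilated by all arrows. Hence \<open>f m\<close> is annihilated by the paths of
  length \<open>l\<close> if and only if \<open>m\<close> is annihilated by those of length \<open>l + 1\<close>.\<close>

lemma socle_quotient_ann:
  fixes x y :: "('e, 'k::field) point"
  assumes f: "scaled_map Q id (\<lambda>_. 1) d x d' y f" and x: "x \<in> rep_variety Q L d" and y: "y \<in> rep_variety Q L d'"
    and surj: "f ` kspace d = kspace d'" and ker: "{m \<in> kspace d. f m = 0} = socle Q L d x (kspace d)"
  shows "dimvec (ann_sub Q L d x (kspace d) (Suc l)) i =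
    dimvec (socle Q L d x (kspace d)) i + dimvec (ann_sub Q L d' y (kspace d') l) i"
proof -
  have iff: "f m \<in> ann_sub Q L d' y (kspace d') l \<longleftrightarrow> m \<in> ann_sub Q L d x (kspace d) (Suc l)" if m: "m \<in> kspace d" for m
  proof -
    have fm: "f m \<in> kspace d'" using f m unfolding scaled_map_def by blast
    have one: "path_act Q d' y w (f m) = 0 \<longleftrightarrow> (\<forall>\<alpha>\<in>arcs Q. arrow_act Q d x \<alpha> (path_act Q d x w m) = 0)"
      if w: "w \<in> paths Q" for w
    proof -
      obtain u p where up: "w = (u, p)" by (cases w)
      obtain c where c: "c \<noteq> 0" "\<forall>m\<in>kspace d. path_act Q d' y (u, p) (f m) = vscale c (f (path_act Q d x (u, p) m))"
        using scaled_map_path[OF f w[unfolded up]] by (elim exE conjE)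
      have pm: "path_act Q d x w m \<in> kspace d" by (rule path_act_kspace[OF m])
      have "path_act Q d' y w (f m) = vscale c (f (path_act Q d x w m))" using c(2) m unfolding up by blast
      then have "path_act Q d' y w (f m) = 0 \<longleftrightarrow> f (path_act Q d x w m) = 0"
        using c(1) by (simp add: fun_eq_iff vscale_apply)
      also have "\<dots> \<longleftrightarrow> path_act Q d x w m \<in> socle Q L d x (kspace d)" unfolding ker[symmetric] using pm by simp
      finally show ?thesis unfolding socle_arrows[OF x order_refl] using pm by simp
    qed
    have "f m \<in> ann_sub Q L d' y (kspace d') l \<longleftrightarrow>
        (\<forall>w\<in>paths Q. length (snd w) = l \<longrightarrow> (\<forall>\<alpha>\<in>arcs Q. arrow_act Q d x \<alpha> (path_act Q d x w m) = 0))"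
      unfolding ann_sub_paths[OF y order_refl] using fm one by simp
    also have "\<dots> \<longleftrightarrow> (\<forall>w\<in>paths Q. length (snd w) = Suc l \<longrightarrow> path_act Q d x w m = 0)"
    proof (intro iffI ballI impI)
      fix w assume *: "\<forall>w\<in>paths Q. length (snd w) = l \<longrightarrow> (\<forall>\<alpha>\<in>arcs Q. arrow_act Q d x \<alpha> (path_act Q d x w m) = 0)"
        and w: "w \<in> paths Q" "length (snd w) = Suc l"
      obtain u p where up: "w = (u, p)" by (cases w)
      then obtain q \<alpha> where q: "p = q @ [\<alpha>]" using w(2) by (cases p rule: rev_cases) auto
      have qp: "(u, q) \<in> paths Q" "\<alpha> \<in> arcs Q" "length q = l" using w path_snoc[of u q \<alpha>] by (auto simp: up q)
      have "arrow_act Q d x \<alpha> (path_act Q d x (u, q) m) = 0" using * qp by simp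
      then show "path_act Q d x w m = 0" unfolding up q path_act_snoc .
    next
      fix w \<alpha> assume *: "\<forall>w\<in>paths Q. length (snd w) = Suc l \<longrightarrow> path_act Q d x w m = 0"
        and w: "w \<in> paths Q" "length (snd w) = l" and \<alpha>: "\<alpha> \<in> arcs Q"
      obtain u p where up: "w = (u, p)" by (cases w)
      show "arrow_act Q d x \<alpha> (path_act Q d x w m) = 0"
      proof (cases "awlast u p = tail Q \<alpha>")
        case True
        then have "(u, p @ [\<alpha>]) \<in> paths Q" using w \<alpha> path_snoc[of u p \<alpha>] by (simp add: up)
        then have "path_act Q d x (u, p @ [\<alpha>]) m = 0" using * w(2) by (simp add: up)
        then show ?thesis unfolding up path_act_snoc .
      next
        case False
        have "vertex_act (tail Q \<alpha>) (path_act Q d x (u, p) m) = 0" using False by (simp add: path_act_end)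
        then have "arrow_act Q d x \<alpha> (vertex_act (tail Q \<alpha>) (path_act Q d x (u, p) m)) = 0" by (simp only: arrow_act_0)
        then show ?thesis unfolding up arrow_act_tail by simp
      qed
    qed
    also have "\<dots> \<longleftrightarrow> m \<in> ann_sub Q L d x (kspace d) (Suc l)"
      unfolding ann_sub_paths[OF x order_refl] using m by simp
    finally show ?thesis .
  qed
  let ?A = "ann_sub Q L d x (kspace d) (Suc l)"
  have Ak: "?A \<subseteq> kspace d" by (auto simp: ann_sub_def)
  have im: "f ` ?A = ann_sub Q L d' y (kspace d') l"
  proof (intro equalityI subsetI)
    fix n assume "n \<in> f ` ?A"
    then show "n \<in> ann_sub Q L d' y (kspace d') l" using iff Ak by blast
  next
    fix n assume n: "n \<in> ann_sub Q L d' y (kspace d') l"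
    then have "n \<in> f ` kspace d" unfolding surj by (simp add: ann_sub_def)
    then obtain m where m: "m \<in> kspace d" "n = f m" by (rule imageE)
    then show "n \<in> f ` ?A" using n iff by blast
  qed
  have "socle Q L d x (kspace d) \<subseteq> ?A" by (rule ann_sub_mono[OF x order_refl]) simp
  then have "{n \<in> ?A. f n = 0} = socle Q L d x (kspace d)" unfolding ker[symmetric] using Ak by blast
  then show ?thesis
    using scaled_map_dimvec[OF f graded_sub_ann_sub[OF x graded_sub_kspace], of "Suc l" i] unfolding im by simp
qed

text \<open>Passing to the quotient by the socle lowers the index in the socle filtration by one, and all dimensions
  drop by the same amount.\<close>

lemma socle_quotient_soc_layering:
  fixes x y :: "('e, 'k::field) point"
  assumes f: "scaled_map Q id (\<lambda>_. 1) d x d' y f" and x: "x \<in> rep_variety Q L d" and y: "y \<in> rep_variety Q L d'"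
    and surj: "f ` kspace d = kspace d'" and ker: "{m \<in> kspace d. f m = 0} = socle Q L d x (kspace d)"
  shows "soc_layering Q L d' y = (\<lambda>l. if l < L then soc_layering Q L d x (l + 1) else (\<lambda>_. 0))"
proof (intro ext)
  fix l i
  note q = socle_quotient_ann[OF f x y surj ker]
  have "soc_layering Q L d' y l i = soc_layering Q L d x (l + 1) i"
    unfolding soc_layering_def using q[of l i] q[of "Suc l" i] by simp
  moreover have "soc_layering Q L d x (l + 1) i = 0" if "\<not> l < L"
    unfolding soc_layering_def using that ann_sub_end[OF x order_refl, of "l + 1"] ann_sub_end[OF x order_refl, of "l + 1 + 1"] by simp
  ultimately show "soc_layering Q L d' y l i = (if l < L then soc_layering Q L d x (l + 1) else (\<lambda>_. 0)) i" by auto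
qed

lemma socle_quotient_rad_layering:
  fixes x y :: "('e, 'k::field) point"
  assumes S: "semisimple_sequence Q L S" and x: "x \<in> rep_layered Q L S" and m: "socles_minimal Q L S x"
    and d: "d = seq_dim L S" and d': "d' = seq_dim L (quot_seq Q L S)"
    and f: "scaled_map Q id (\<lambda>_. 1) d x d' y f" and y: "y \<in> rep_variety Q L d'"
    and surj: "f ` kspace d = kspace d'" and ker: "{m \<in> kspace d. f m = 0} = socle Q L d x (kspace d)"
  shows "y \<in> rep_layered Q L (quot_seq Q L S)"
proof -
  let ?S = "quot_seq Q L S"
  have xv: "x \<in> rep_variety Q L d" using x by (simp add: rep_layered_def d)
  have rk: "rad_sub Q L d x l \<subseteq> kspace d" for l by (rule rad_sub_kspace[OF xv])
  have rad: "dimvec (rad_sub Q L d' y l) i = (\<Sum>k=l..L. ?S k i)" for l i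
  proof (cases "l \<le> L")
    case True
    have "{n \<in> rad_sub Q L d x l. f n = 0} = rad_sub Q L d x l \<inter> {m \<in> kspace d. f m = 0}" using rk by blast
    also have "\<dots> = socle Q L d x (rad_sub Q L d x l)" unfolding ker ann_sub_inter[OF xv rk] ..
    finally have "dimvec (rad_sub Q L d x l) i = dimvec (socle Q L d x (rad_sub Q L d x l)) i + dimvec (rad_sub Q L d' y l) i"
      using scaled_map_dimvec[OF f graded_sub_rad_sub[OF xv], of l i] unfolding scaled_map_rad_sub[OF f xv y surj] by simp
    moreover have "dimvec (rad_sub Q L d x l) i = (\<Sum>k=l..L. S k i)" unfolding d by (rule dimvec_rad_sub[OF x S])
    moreover have "dimvec (socle Q L d x (rad_sub Q L d x l)) i = (\<Sum>k=l..L. C_mod Q L S k i)"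
      using m True unfolding socles_minimal_def d by blast
    moreover have "(\<Sum>k=l..L. ?S k i) + (\<Sum>k=l..L. C_mod Q L S k i) = (\<Sum>k=l..L. S k i)"
      unfolding sum.distrib[symmetric] quot_seq_C_mod ..
    ultimately show ?thesis by linarith
  next
    case False
    then have "rad_sub Q L d' y l = {0}" by (intro rad_sub_end[OF y]) simp
    then show ?thesis using False by (simp add: dimvec_0)
  qed
  have "rad_layering Q L d' y l i = ?S l i" for l i
  proof (cases "l \<le> L")
    case True
    then show ?thesis unfolding rad_layering_def rad by (simp add: sum.atLeast_Suc_atMost)
  next
    case False
    then show ?thesis unfolding rad_layering_def rad by (simp add: quot_seq_def)
  qed
  then show ?thesis using y unfolding rep_layered_def d'[symmetric] by (simp add: fun_eq_iff)
qed

text \<open>The cardinalities required by the adapted form are sums of entries of \<open>C\<close>, and so are the dimensions of the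
  intersections of the socle with the radical powers.\<close>

lemma socle_adapted_form:
  fixes x :: "('e, 'k::field) point"
  assumes S: "semisimple_sequence Q L S" and x: "x \<in> rep_layered Q L S" and m: "socles_minimal Q L S x"
    and lev: "levels S d lev" "levels (quot_seq Q L S) d' lev"
  shows "\<exists>u g h. mat_prod_scalar d g h (\<lambda>_. 1) \<and> mat_prod_scalar d h g (\<lambda>_. 1) \<and>
    x = conj_pt Q d h u g \<and> adapted Q d lev u \<and> u \<in> rep_layered Q L S \<and>
    (\<forall>\<alpha> r c. d' (tail Q \<alpha>) \<le> c \<longrightarrow> u (\<alpha>, r, c) = 0)"
proof -
  note d = levels_seq_dim[OF lev(1) S] and d' = levels_seq_dim[OF lev(2) quot_seq_semisimple[OF S]]
  have xv: "x \<in> rep_variety Q L d" using x by (simp add: rep_layered_def d)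
  let ?N = "socle Q L d x (kspace d)"
  have le: "d' i \<le> d i" for i
    unfolding d[symmetric] d'[symmetric] seq_dim_def
    by (rule sum_mono) (use quot_seq_C_mod in \<open>metis le_add1\<close>)
  have lL: "lev i r \<le> L" if "r < d i" for i r using levels_le[where d = d, OF lev(1) S that] .
  have card: "card {r. r < d i \<and> d' i \<le> r \<and> l \<le> lev i r} = dimvec (?N \<inter> rad_sub Q L d x l) i" for i l
  proof -
    have N: "?N \<inter> rad_sub Q L d x l = socle Q L d x (rad_sub Q L d x l)"
      unfolding ann_sub_inter[OF xv rad_sub_kspace[OF xv]] by blast
    have "{r. r < d i \<and> l \<le> lev i r} = {r. r < d' i \<and> l \<le> lev i r} \<union> {r. r < d i \<and> d' i \<le> r \<and> l \<le> lev i r}"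
      using le[of i] by auto
    then have "card {r. r < d i \<and> l \<le> lev i r} =
        card ({r. r < d' i \<and> l \<le> lev i r} \<union> {r. r < d i \<and> d' i \<le> r \<and> l \<le> lev i r})" by (simp only:)
    also have "\<dots> = card {r. r < d' i \<and> l \<le> lev i r} + card {r. r < d i \<and> d' i \<le> r \<and> l \<le> lev i r}"
      by (rule card_Un_disjoint) auto
    finally have c: "(\<Sum>k=l..L. S k i) = (\<Sum>k=l..L. quot_seq Q L S k i) + card {r. r < d i \<and> d' i \<le> r \<and> l \<le> lev i r}"
      unfolding card_levels_ge[OF lev(1) S] card_levels_ge[OF lev(2) quot_seq_semisimple[OF S]] .
    show ?thesis
    proof (cases "l \<le> L")
      case True
      have "(\<Sum>k=l..L. quot_seq Q L S k i) + (\<Sum>k=l..L. C_mod Q L S k i) = (\<Sum>k=l..L. S k i)"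
        unfolding sum.distrib[symmetric] quot_seq_C_mod ..
      then show ?thesis unfolding N using c m True unfolding socles_minimal_def d by simp
    next
      case False
      then have z: "rad_sub Q L d x l = {0}" by (intro rad_sub_end[OF xv]) simp
      have "{r. r < d i \<and> d' i \<le> r \<and> l \<le> lev i r} = {}"
      proof (rule equals0I)
        fix r assume "r \<in> {r. r < d i \<and> d' i \<le> r \<and> l \<le> lev i r}"
        then show False using lL[of r i] False by simp
      qed
      moreover have "socle Q L d x {0} = {0}"
        using fvs.subspace_0 graded_sub_ann_sub[OF xv graded_sub_rad_sub[OF xv, of l], of 1] unfolding z graded_sub_def
        by (auto simp: ann_sub_def)
      ultimately show ?thesis unfolding N unfolding z by (simp only: dimvec_0 card.empty)
    qed
  qed
  have arr: "arrow_act Q d x \<alpha> n = 0" if "\<alpha> \<in> arcs Q" "n \<in> ?N" for \<alpha> n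
    using that unfolding socle_arrows[OF xv order_refl] by blast
  have "\<exists>u g h. mat_prod_scalar d g h (\<lambda>_. 1) \<and> mat_prod_scalar d h g (\<lambda>_. 1) \<and>
    u = conj_pt Q d g x h \<and> x = conj_pt Q d h u g \<and> adapted Q d lev u \<and> u \<in> rep_layered Q L S \<and>
    (\<forall>\<alpha> r c. d' (tail Q \<alpha>) \<le> c \<longrightarrow> u (\<alpha>, r, c) = 0) \<and>
    gmap d g ` ?N = coord_sub d (\<lambda>i r. d' i \<le> r)"
    by (rule adapted_form[OF x S lev(1) graded_sub_ann_sub[OF xv graded_sub_kspace] _ card]) (rule arr)
  then show ?thesis by (elim exE conjE) (intro exI conjI)
qed

text \<open>The last coordinates are annihilated by all arrows, and the dimensions agree.\<close>

lemma socle_coords: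
  fixes u :: "('e, 'k::field) point"
  assumes S: "semisimple_sequence Q L S" and u: "u \<in> rep_layered Q L S" and m: "socles_minimal Q L S u"
    and d: "d = seq_dim L S" and d': "d' = seq_dim L (quot_seq Q L S)"
    and van: "\<And>\<alpha> r c. d' (tail Q \<alpha>) \<le> c \<Longrightarrow> u (\<alpha>, r, c) = 0"
  shows "socle Q L d u (kspace d) = coord_sub d (\<lambda>i r. d' i \<le> r)"
proof (rule sym, rule graded_sub_eqI)
  let ?C = "coord_sub d (\<lambda>i r. d' i \<le> r) :: ('v \<times> nat \<Rightarrow> 'k) set"
  show dv: "d \<in> dim_vectors Q" unfolding d by (rule seq_dim_dim_vectors[OF S])
  have uv: "u \<in> rep_variety Q L d" using u by (simp add: rep_layered_def d)
  show "graded_sub d ?C" by (rule graded_sub_coord_sub)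
  show "graded_sub d (socle Q L d u (kspace d))" by (rule graded_sub_ann_sub[OF uv graded_sub_kspace])
  show "?C \<subseteq> socle Q L d u (kspace d)"
  proof
    fix n assume n: "n \<in> ?C"
    have "arrow_act Q d u \<alpha> n = 0" for \<alpha>
    proof
      fix z :: "'v \<times> nat"
      have "u (\<alpha>, r, c) * n (tail Q \<alpha>, c) = 0" for r c
        using n van[of \<alpha> c r] by (cases "d' (tail Q \<alpha>) \<le> c") (auto simp: coord_sub_def)
      then have "(\<Sum>c<d (tail Q \<alpha>). u (\<alpha>, r, c) * n (tail Q \<alpha>, c)) = 0" for r by (intro sum.neutral ballI)
      then show "arrow_act Q d u \<alpha> n z = 0 z" by (cases z) (simp add: arrow_act_def)
    qed
    then show "n \<in> socle Q L d u (kspace d)"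
      unfolding socle_arrows[OF uv order_refl] using n by (simp add: coord_sub_def)
  qed
  fix i
  have "dimvec (socle Q L d u (kspace d)) i = (\<Sum>k=0..L. C_mod Q L S k i)"
    using m unfolding socles_minimal_def d[symmetric] using rad_sub_0[OF uv dv] by fastforce
  moreover have "(\<Sum>k=0..L. quot_seq Q L S k i) + (\<Sum>k=0..L. C_mod Q L S k i) = (\<Sum>k=0..L. S k i)"
    unfolding sum.distrib[symmetric] quot_seq_C_mod ..
  moreover have "{r. r < d i \<and> d' i \<le> r} = {d' i..<d i}" by auto
  then have "dimvec ?C i = d i - d' i" unfolding dimvec_coord_sub by simp
  moreover have "d i = (\<Sum>k=0..L. S k i)" "d' i = (\<Sum>k=0..L. quot_seq Q L S k i)"
    unfolding d d' seq_dim_def atLeast0AtMost by simp_all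
  ultimately show "dimvec (socle Q L d u (kspace d)) i \<le> dimvec ?C i" by linarith
qed


lemma quot_seq_levels:
  assumes S: "semisimple_sequence Q L S"
  shows "\<exists>lev. levels S (seq_dim L S) lev \<and> levels (quot_seq Q L S) (seq_dim L (quot_seq Q L S)) lev"
proof (rule ex_levels[OF S])
  show "quot_seq Q L S l i \<le> S l i" for l i using quot_seq_C_mod[of Q L S l i] by simp
qed

lemma seq_dim_quot_seq_le:
  assumes S: "semisimple_sequence Q L S"
  shows "seq_dim L (quot_seq Q L S) i \<le> seq_dim L S i"
  unfolding seq_dim_def by (rule sum_mono) (use quot_seq_C_mod in \<open>metis le_add1\<close>)

lemma socle_quotient_exists:
  fixes x :: "('e, 'k::field) point"
  assumes S: "semisimple_sequence Q L S" and x: "x \<in> rep_layered Q L S" and m: "socles_minimal Q L S x"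
  shows "\<exists>y\<in>rep_layered Q L (quot_seq Q L S).
    is_quotient Q L (seq_dim L S) x (socle Q L (seq_dim L S) x (kspace (seq_dim L S))) (seq_dim L (quot_seq Q L S)) y"
proof -
  define d where d: "d = seq_dim L S"
  define d' where d': "d' = seq_dim L (quot_seq Q L S)"
  from quot_seq_levels[OF S] obtain lev where lev: "levels S d lev" "levels (quot_seq Q L S) d' lev"
    unfolding d d' by (elim exE conjE)
  have le: "d' i \<le> d i" for i unfolding d d' by (rule seq_dim_quot_seq_le[OF S])
  from socle_adapted_form[OF S x m lev] obtain u g h where gh: "mat_prod_scalar d g h (\<lambda>_. 1)"
    and hg: "mat_prod_scalar d h g (\<lambda>_. 1)" and xu: "x = conj_pt Q d h u g"
    and ad: "adapted Q d lev u" and u: "u \<in> rep_layered Q L S"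
    and van: "\<forall>\<alpha> r c. d' (tail Q \<alpha>) \<le> c \<longrightarrow> u (\<alpha>, r, c) = 0" by (elim exE conjE)
  have van': "u (\<alpha>, r, c) = 0" if "d' (tail Q \<alpha>) \<le> c" for \<alpha> r c using van that by simp
  have off: "u z = 0" if "z \<notin> rep_coords Q d" for z using ad that unfolding adapted_def by blast
  have ux: "u = conj_pt Q d g x h" unfolding xu by (rule conj_conj[OF gh hg off, symmetric])
  have xv: "x \<in> rep_variety Q L d" and uv: "u \<in> rep_variety Q L d" using x u by (simp_all add: rep_layered_def d)
  have um: "socles_minimal Q L S u" using m unfolding xu conj_layered(3)[OF u d gh hg] .
  have sm: "scaled_map Q id (\<lambda>_. 1) d x d u (gmap d g)"
    using conj_scaled_map[OF hg, of Q x] unfolding ux[symmetric] by simp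
  have bij: "bij_betw (gmap d g) (kspace d) (kspace d)" by (rule gmap_bij[OF hg gh]) simp
  then have gs: "gmap d g ` kspace d = kspace d" and gi: "inj_on (gmap d g) (kspace d)" by (simp_all add: bij_betw_def)
  let ?y = "restrict_pt Q d' u"
  have tm: "scaled_map Q id (\<lambda>_. 1) d u d' ?y (forget_coords d')" by (rule forget_coords_scaled_map[OF le]) (rule van')
  have yv: "?y \<in> rep_variety Q L d'"
    by (rule scaled_map_rep_variety[OF tm uv forget_coords_surj[OF le]]) (simp add: restrict_pt_def)
  let ?f = "\<lambda>m. forget_coords d' (gmap d g m)"
  have fm: "scaled_map Q id (\<lambda>_. 1) d x d' ?y ?f" by (rule scaled_map_comp[OF sm tm])
  have surj: "?f ` kspace d = kspace d'"
    unfolding image_image[symmetric] gs by (rule forget_coords_surj[OF le])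
  have soc: "gmap d g ` socle Q L d x (kspace d) = coord_sub d (\<lambda>i r. d' i \<le> r)"
    unfolding scaled_map_ann_sub[OF sm xv uv gi order_refl] gs by (rule socle_coords[OF S u um d d' van'])
  have ker: "{m \<in> kspace d. ?f m = 0} = socle Q L d x (kspace d)"
  proof (intro equalityI subsetI)
    fix n assume "n \<in> {m \<in> kspace d. ?f m = 0}"
    then have n: "n \<in> kspace d" "?f n = 0" by simp_all
    have "gmap d g n \<in> gmap d g ` socle Q L d x (kspace d)"
      unfolding soc forget_coords_kernel[symmetric] using n gmap_kspace by simp
    then obtain k where k: "gmap d g n = gmap d g k" "k \<in> socle Q L d x (kspace d)" by (rule imageE)
    have "k \<in> kspace d" using k(2) by (simp add: ann_sub_def)
    then have "n = k" by (rule inj_onD[OF gi k(1) n(1)])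
    then show "n \<in> socle Q L d x (kspace d)" using k(2) by simp
  next
    fix n assume n: "n \<in> socle Q L d x (kspace d)"
    then have "gmap d g n \<in> coord_sub d (\<lambda>i r. d' i \<le> r)" unfolding soc[symmetric] by (rule imageI)
    then show "n \<in> {m \<in> kspace d. ?f m = 0}" unfolding forget_coords_kernel[symmetric] using n by (simp add: ann_sub_def)
  qed
  have "?y \<in> rep_layered Q L (quot_seq Q L S)"
    by (rule socle_quotient_rad_layering[OF S x m d d' fm yv surj ker])
  moreover have "is_quotient Q L d x (socle Q L d x (kspace d)) d' ?y"
    unfolding is_quotient_def by (intro exI[of _ ?f] conjI) (rule scaled_map_lam_hom[OF fm xv yv], rule surj, rule ker)
  ultimately show ?thesis unfolding d[symmetric] d'[symmetric] by (intro bexI[of _ ?y])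
qed

text \<open>A single point of \<open>Rep S\<close> is generic for \<open>T\<close> but its quotient may fail to be generic in \<open>Rep S'\<close>. Both are
  achieved on the line from an adapted point \<open>u\<close> of \<open>Rep S\<close> whose last coordinates span the socle to an adapted point \<open>v\<close> of
  \<open>Rep S'\<close>, extended by zero. All points of the line vanish on the last coordinates, so forgetting them is a
  homomorphism; where the socle has its generic dimension, it is the kernel.\<close>

lemma generic_soc_layering_quotient:
  assumes inf: "infinite (UNIV :: 'k::field set)" and S: "semisimple_sequence Q L S"
    and ne: "(rep_layered Q L S :: ('e, 'k) point set) \<noteq> {}"
    and T: "poly_generic (rep_layered Q L S :: ('e, 'k) point set) (\<lambda>x. soc_layering Q L (seq_dim L S) x = T)"
    and T': "poly_generic (rep_layered Q L (quot_seq Q L S) :: ('e, 'k) point set)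
      (\<lambda>y. soc_layering Q L (seq_dim L (quot_seq Q L S)) y = T')"
  shows "T' = (\<lambda>l. if l < L then T (l + 1) else (\<lambda>_. 0))"
proof -
  let ?S' = "quot_seq Q L S"
  let ?X = "rep_layered Q L S :: ('e, 'k) point set" and ?X' = "rep_layered Q L ?S' :: ('e, 'k) point set"
  define d where d: "d = seq_dim L S"
  define d' where d': "d' = seq_dim L ?S'"
  note S' = quot_seq_semisimple[OF S]
  from quot_seq_levels[OF S] obtain lev where lev: "levels S d lev" "levels ?S' d' lev"
    unfolding d d' by (elim exE conjE)
  have le: "d' i \<le> d i" for i unfolding d d' by (rule seq_dim_quot_seq_le[OF S])
  have co: "z \<in> rep_coords Q d" if "z \<in> rep_coords Q d'" for z
    using that le by (auto simp: rep_coords_def intro: order_less_le_trans)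
  have "poly_generic ?X (\<lambda>x. soc_layering Q L d x = T \<and> socles_minimal Q L S x)"
    unfolding d by (rule poly_generic_conj[OF rep_layered_irreducible[OF inf S ne] T poly_generic_socles_minimal[OF inf S ne]])
  then obtain F where "F \<in> polyfuns coord_funs" and "(\<exists>x\<in>?X. F x \<noteq> 0) \<and>
    (\<forall>x\<in>?X. F x \<noteq> 0 \<longrightarrow> soc_layering Q L d x = T \<and> socles_minimal Q L S x)"
    unfolding poly_generic_def by (rule bexE)
  note F = this(1) this(2)[THEN conjunct1] this(2)[THEN conjunct2]
  from F(2) obtain x where x: "x \<in> ?X" "F x \<noteq> 0" by (elim bexE)
  from T'[folded d'] obtain G where "G \<in> polyfuns coord_funs" and "(\<exists>y\<in>?X'. G y \<noteq> 0) \<and>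
    (\<forall>y\<in>?X'. G y \<noteq> 0 \<longrightarrow> soc_layering Q L d' y = T')"
    unfolding poly_generic_def by (rule bexE)
  note G = this(1) this(2)[THEN conjunct1] this(2)[THEN conjunct2]
  from G(2) obtain y where y: "y \<in> ?X'" "G y \<noteq> 0" by (elim bexE)
  have xm: "socles_minimal Q L S x" using F(3) x by simp
  from socle_adapted_form[OF S x(1) xm lev] obtain u g h where gh: "mat_prod_scalar d g h (\<lambda>_. 1)"
    and hg: "mat_prod_scalar d h g (\<lambda>_. 1)" and xu: "x = conj_pt Q d h u g"
    and ua: "adapted Q d lev u" and u: "u \<in> ?X"
    and van: "\<forall>\<alpha> r c. d' (tail Q \<alpha>) \<le> c \<longrightarrow> u (\<alpha>, r, c) = 0" by (elim exE conjE)
  from rep_layered_adapted_form[OF y(1) S' lev(2)] obtain v g' h' where gh': "mat_prod_scalar d' g' h' (\<lambda>_. 1)"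
    and hg': "mat_prod_scalar d' h' g' (\<lambda>_. 1)" and yv: "y = conj_pt Q d' h' v g'"
    and va: "adapted Q d' lev v" and v: "v \<in> ?X'" by (elim exE conjE)
  have voff: "v z = 0" if "z \<notin> rep_coords Q d'" for z using va that unfolding adapted_def by blast
  define U where "U t z = (1 - t) * u z + t * v z" for t z
  define V where "V t = restrict_pt Q d' (U t)" for t
  have Up: "(\<lambda>t. U t z) \<in> polyfuns {\<lambda>t. t}" for z unfolding U_def by (rule line_polyfuns)
  have Vp: "(\<lambda>t. V t z) \<in> polyfuns {\<lambda>t. t}" for z
  proof (cases "z \<in> rep_coords Q d'")
    case True
    then have "(\<lambda>t. V t z) = (\<lambda>t. U t z)" by (simp add: V_def restrict_pt_def)
    then show ?thesis using Up[of z] by (simp only:)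
  next
    case False
    then have "(\<lambda>t. V t z) = (\<lambda>t. 0)" by (simp add: V_def restrict_pt_def)
    then show ?thesis by (simp only: polyfuns.const)
  qed
  have Unz: "lev (tail Q \<alpha>) c < lev (head Q \<alpha>) r" if "U t (\<alpha>, r, c) \<noteq> 0" for t \<alpha> r c
  proof -
    have "u (\<alpha>, r, c) \<noteq> 0 \<or> v (\<alpha>, r, c) \<noteq> 0" using that unfolding U_def by auto
    then show ?thesis using ua va unfolding adapted_def by blast
  qed
  have Ua: "adapted Q d lev (U t)" for t unfolding adapted_def
  proof (intro conjI allI impI)
    fix z assume z: "z \<notin> rep_coords Q d"
    have "u z = 0" using ua z unfolding adapted_def by blast
    moreover have "v z = 0" using voff co z by blast
    ultimately show "U t z = 0" by (simp add: U_def)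
  qed (rule Unz)
  have Va: "adapted Q d' lev (V t)" for t unfolding adapted_def
  proof (intro conjI allI impI)
    fix \<alpha> r c assume "V t (\<alpha>, r, c) \<noteq> 0"
    then have "U t (\<alpha>, r, c) \<noteq> 0" by (auto simp: V_def restrict_pt_def split: if_splits)
    then show "lev (tail Q \<alpha>) c < lev (head Q \<alpha>) r" by (rule Unz)
  qed (simp add: V_def restrict_pt_def)
  have Uvan: "U t (\<alpha>, r, c) = 0" if "d' (tail Q \<alpha>) \<le> c" for t \<alpha> r c
  proof -
    have "(\<alpha>, r, c) \<notin> rep_coords Q d'" using that by (simp add: rep_coords_def)
    then show ?thesis using van voff that by (simp add: U_def)
  qed
  have U0: "U 0 = u" by (simp add: U_def fun_eq_iff)
  have V1: "V 1 = v" using voff by (auto simp: V_def U_def restrict_pt_def fun_eq_iff)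
  have "\<exists>H\<in>polyfuns {\<lambda>t. t}. H 0 \<noteq> 0 \<and> (\<forall>t. H t \<noteq> 0 \<longrightarrow> U t \<in> ?X)"
    by (rule adapted_layered_open[OF Up Ua _ lev(1) S]) (simp only: U0 u)
  then obtain H where H: "H \<in> polyfuns {\<lambda>t. t}" "H 0 \<noteq> 0" "\<forall>t. H t \<noteq> 0 \<longrightarrow> U t \<in> ?X" by (elim bexE conjE)
  have "\<exists>H\<in>polyfuns {\<lambda>t. t}. H 1 \<noteq> 0 \<and> (\<forall>t. H t \<noteq> 0 \<longrightarrow> V t \<in> ?X')"
    by (rule adapted_layered_open[OF Vp Va _ lev(2) S']) (simp only: V1 v)
  then obtain H' where H': "H' \<in> polyfuns {\<lambda>t. t}" "H' 1 \<noteq> 0" "\<forall>t. H' t \<noteq> 0 \<longrightarrow> V t \<in> ?X'" by (elim bexE conjE)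
  \<comment> \<open>The polynomials \<open>F\<close> and \<open>G\<close> are known to be nonzero at \<open>x\<close> and \<open>y\<close>, not at their adapted forms; so the line is
    conjugated back.\<close>
  define x' where "x' t = conj_pt Q d h (U t) g" for t
  define y' where "y' t = conj_pt Q d' h' (V t) g'" for t
  have xp: "(\<lambda>t. x' t z) \<in> polyfuns {\<lambda>t. t}" for z
    unfolding x'_def by (rule conj_pt_polyfuns[OF polyfuns.const polyfuns.const Up])
  have yp: "(\<lambda>t. y' t z) \<in> polyfuns {\<lambda>t. t}" for z
    unfolding y'_def by (rule conj_pt_polyfuns[OF polyfuns.const polyfuns.const Vp])
  have x0: "x' 0 = x" unfolding x'_def U0 xu ..
  have y1: "y' 1 = y" unfolding y'_def V1 yv ..
  have "\<exists>t. \<forall>f\<in>{H, H', \<lambda>t. F (x' t), \<lambda>t. G (y' t)}. f t \<noteq> 0"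
  proof (rule polyfuns_line_conj[OF inf])
    fix f assume "f \<in> {H, H', \<lambda>t. F (x' t), \<lambda>t. G (y' t)}"
    then consider "f = H" | "f = H'" | "f = (\<lambda>t. F (x' t))" | "f = (\<lambda>t. G (y' t))" by blast
    then show "f \<in> polyfuns {\<lambda>t. t} \<and> (\<exists>t. f t \<noteq> 0)"
    proof cases
      case 1 then show ?thesis using H(1,2) by auto
    next
      case 2 then show ?thesis using H'(1,2) by auto
    next
      case 3
      have "F (x' 0) \<noteq> 0" unfolding x0 by (rule x(2))
      then show ?thesis unfolding 3 by (intro conjI exI) (rule polyfuns_point_compose[OF F(1) xp])
    next
      case 4
      have "G (y' 1) \<noteq> 0" unfolding y1 by (rule y(2))
      then show ?thesis unfolding 4 by (intro conjI exI) (rule polyfuns_point_compose[OF G(1) yp])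
    qed
  qed simp
  then obtain t where "\<forall>f\<in>{H, H', \<lambda>t. F (x' t), \<lambda>t. G (y' t)}. f t \<noteq> 0" by (rule exE)
  then have t: "H t \<noteq> 0" "H' t \<noteq> 0" "F (x' t) \<noteq> 0" "G (y' t) \<noteq> 0" by simp_all
  have UX: "U t \<in> ?X" and VX: "V t \<in> ?X'" using H(3) H'(3) t by simp_all
  then have Uv: "U t \<in> rep_variety Q L d" and Vv: "V t \<in> rep_variety Q L d'" by (simp_all add: rep_layered_def d d')
  note cU = conj_layered[OF UX d gh hg] and cV = conj_layered[OF VX d' gh' hg']
  have xX: "x' t \<in> ?X" unfolding x'_def by (rule cU(1))
  have socU: "soc_layering Q L d (U t) = T" "socles_minimal Q L S (U t)"
    using F(3) xX t(3) cU(2,3) unfolding x'_def by simp_all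
  have "y' t \<in> ?X'" unfolding y'_def by (rule cV(1))
  then have socV: "soc_layering Q L d' (V t) = T'" using G(3) t(4) cV(2) unfolding y'_def by simp
  have tm: "scaled_map Q id (\<lambda>_. 1) d (U t) d' (V t) (forget_coords d')"
    unfolding V_def by (rule forget_coords_scaled_map[OF le]) (rule Uvan)
  have "{m \<in> kspace d. forget_coords d' m = 0} = socle Q L d (U t) (kspace d)"
    unfolding forget_coords_kernel by (rule socle_coords[OF S UX socU(2) d d' Uvan, symmetric])
  from socle_quotient_soc_layering[OF tm Uv Vv forget_coords_surj[OF le] this]
  show ?thesis unfolding socU socV .
qed

end

section \<open>Generic socles and generic socle layerings\<close>

text \<open>The entries of the radical layering of a module add up to its dimension vector.\<close>

lemma realizable_rep_layered:
  assumes "fin_digraph Q" "semisimple_sequence Q L S" "realizable TYPE('k::field) Q L S"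
  shows "(rep_layered Q L S :: ('e, 'k) point set) \<noteq> {}"
proof -
  interpret quiver Q using assms(1) by (simp add: quiver_def)
  obtain d and x :: "('e, 'k) point" where dv: "d \<in> dim_vectors Q" and x: "x \<in> rep_variety Q L d"
    and lay: "rad_layering Q L d x = S" using assms(3) unfolding realizable_def by (elim bexE)
  let ?D = "\<lambda>l i. dimvec (rad_sub Q L d x l) i"
  have "seq_dim L S i = d i" for i
  proof -
    have "(\<Sum>l<n. S l i) + ?D n i = ?D 0 i" for n
    proof (induction n)
      case (Suc n)
      have "?D (Suc n) i \<le> ?D n i"
        by (intro dimvec_mono[OF graded_sub_rad_sub[OF x]] rad_sub_antimono[OF x]) simp
      moreover have "S n i = ?D n i - ?D (Suc n) i" unfolding lay[symmetric] rad_layering_def by simp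
      ultimately show ?case using Suc by simp
    qed simp
    from this[of "Suc L"] show ?thesis
      unfolding seq_dim_def rad_sub_0[OF x dv] rad_sub_end[OF x lessI] dimvec_0 dimvec_kspace lessThan_Suc_atMost by simp
  qed
  then have "seq_dim L S = d" by (rule ext)
  then have "x \<in> rep_layered Q L S" using x lay by (simp add: rep_layered_def)
  then show ?thesis by blast
qed

theorem theorem3p8:
  fixes Q :: "('v, 'e) pre_digraph" and L :: nat and S :: "nat \<Rightarrow> 'v \<Rightarrow> nat"
  assumes "fin_digraph Q" and "L \<ge> 1"
    and "semisimple_sequence Q L S"
    and "realizable TYPE('k::alg_closed_field) Q L S"
  shows
    "(infinite_trdeg_over (prime_field :: 'k set) \<longrightarrow>
        (\<forall>x :: ('e, 'k) point. generic_module Q L S x \<longrightarrow>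
           (\<forall>m\<le>L.
              (\<lambda>i. int (dimvec (socle Q L (seq_dim L S) x
                                 (rad_sub Q L (seq_dim L S) x (L - m))) i))
              = socle_sup Q L S m))) \<and>
     (\<exists>!T. generic_soc_layering TYPE('k) Q L S T) \<and>
     (\<forall>T. generic_soc_layering TYPE('k) Q L S T \<longrightarrow>
        (\<lambda>i. int (T 0 i)) = socle_sup Q L S L) \<and>
     generically Q L S (\<lambda>x :: ('e, 'k) point.
        \<exists>d'\<in>dim_vectors Q. \<exists>y\<in>rep_variety Q L d'.
          is_quotient Q L (seq_dim L S) x
            (socle Q L (seq_dim L S) x (kspace (seq_dim L S))) d' y \<and>
          rad_layering Q L d' y = quot_seq Q L S) \<and>
     (\<forall>T. generic_soc_layering TYPE('k) Q L S T \<longrightarrow>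
        generic_soc_layering TYPE('k) Q L (quot_seq Q L S)
          (\<lambda>l. if l < L then T (l + 1) else (\<lambda>_. 0)))"
proof -
  note S = assms(3)
  interpret quiver Q using assms(1) by (simp add: quiver_def)
  let ?d = "seq_dim L S" and ?S' = "quot_seq Q L S"
  let ?X = "rep_layered Q L S :: ('e, 'k) point set" and ?X' = "rep_layered Q L ?S' :: ('e, 'k) point set"
  note inf = infinite_alg_closed_field[where 'k = 'k]
  have ne: "?X \<noteq> {}" by (rule realizable_rep_layered[OF assms(1,3,4)])
  note irr = rep_layered_irreducible[OF inf S ne]
  note pm = poly_generic_socles_minimal[OF inf S ne]
  have gsl: "generic_soc_layering TYPE('k) Q L S T \<longleftrightarrow> poly_generic ?X (\<lambda>x. soc_layering Q L ?d x = T)" for T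
    unfolding generic_soc_layering_def by (rule generically_iff_poly_generic[OF irr])
  from poly_generic_ex[OF pm] obtain x0 where x0: "x0 \<in> ?X" "socles_minimal Q L S x0" by (elim bexE)
  from socle_quotient_exists[OF S x0] have ne': "?X' \<noteq> {}" by blast
  note S' = quot_seq_semisimple[OF S]
  have gsl': "generic_soc_layering TYPE('k) Q L ?S' T \<longleftrightarrow>
      poly_generic ?X' (\<lambda>x. soc_layering Q L (seq_dim L ?S') x = T)" for T
    unfolding generic_soc_layering_def by (rule generically_iff_poly_generic[OF rep_layered_irreducible[OF inf S' ne']])
  from ex_generic_soc_layering[OF inf S ne] obtain T0 where
    T0: "poly_generic ?X (\<lambda>x. soc_layering Q L ?d x = T0)" by (rule exE)
  from ex_generic_soc_layering[OF inf S' ne'] obtain T1 where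
    T1: "poly_generic ?X' (\<lambda>x. soc_layering Q L (seq_dim L ?S') x = T1)" by (rule exE)
  have uniq: "T = T0" if T: "poly_generic ?X (\<lambda>x. soc_layering Q L ?d x = T)" for T
    using poly_generic_ex[OF poly_generic_conj[OF irr T T0]] by auto
  show ?thesis
  proof (intro conjI impI allI)
    fix x :: "('e, 'k) point" and m assume x: "generic_module Q L S x" and m: "m \<le> L"
    show "(\<lambda>i. int (dimvec (socle Q L ?d x (rad_sub Q L ?d x (L - m))) i)) = socle_sup Q L S m"
      by (rule socles_minimal_socle_sup[OF S generic_module_socles[OF inf S x] m])
  next
    show "\<exists>!T. generic_soc_layering TYPE('k) Q L S T"
      unfolding gsl by (rule ex1I[of _ T0]) (rule T0, erule uniq)
  next
    fix T assume "generic_soc_layering TYPE('k) Q L S T"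
    then have T: "poly_generic ?X (\<lambda>x. soc_layering Q L ?d x = T)" unfolding gsl .
    from poly_generic_ex[OF poly_generic_conj[OF irr T pm]]
    obtain x where "x \<in> ?X" "soc_layering Q L ?d x = T" "socles_minimal Q L S x" by (elim bexE conjE)
    then show "(\<lambda>i. int (T 0 i)) = socle_sup Q L S L" using soc_layering_0[OF S] by blast
  next
    show "generically Q L S (\<lambda>x :: ('e, 'k) point. \<exists>d'\<in>dim_vectors Q. \<exists>y\<in>rep_variety Q L d'.
          is_quotient Q L ?d x (socle Q L ?d x (kspace ?d)) d' y \<and> rad_layering Q L d' y = ?S')"
      unfolding generically_iff_poly_generic[OF irr]
    proof (rule poly_generic_mono[OF pm])
      fix x assume "x \<in> ?X" "socles_minimal Q L S x"
      from socle_quotient_exists[OF S this] obtain y :: "('e, 'k) point" where y: "y \<in> ?X'"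
        "is_quotient Q L ?d x (socle Q L ?d x (kspace ?d)) (seq_dim L ?S') y" by (elim bexE)
      have "seq_dim L ?S' \<in> dim_vectors Q" by (rule seq_dim_dim_vectors[OF S'])
      moreover have "y \<in> rep_variety Q L (seq_dim L ?S')" "rad_layering Q L (seq_dim L ?S') y = ?S'"
        using y(1) by (simp_all add: rep_layered_def)
      ultimately show "\<exists>d'\<in>dim_vectors Q. \<exists>y\<in>rep_variety Q L d'.
          is_quotient Q L ?d x (socle Q L ?d x (kspace ?d)) d' y \<and> rad_layering Q L d' y = ?S'"
        using y(2) by (intro bexI[of _ "seq_dim L ?S'"] bexI[of _ y] conjI)
    qed
  next
    fix T assume "generic_soc_layering TYPE('k) Q L S T"
    then have "poly_generic ?X (\<lambda>x. soc_layering Q L ?d x = T)" unfolding gsl .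
    from generic_soc_layering_quotient[OF inf S ne this T1]
    show "generic_soc_layering TYPE('k) Q L ?S' (\<lambda>l. if l < L then T (l + 1) else (\<lambda>_. 0))"
      unfolding gsl' using T1 by simp
  qed
qed

end
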